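(* Fix $1\le p<\infty$. There is a radially symmetric function $f\in\mathscr{H}^p(\mathbb{R}^2)$ which has uncountably many $2p$-energy minimisers, modulo rotations.
   Context: $\mathscr{H}^p(\mathbb{R}^2)$ is the real Hardy space, which equals $L^p(\mathbb{R}^2)$ for $p>1$. A function $f$ on $\mathbb{R}^2$ is radially symmetric if $f(x)$ depends only on $|x|$. Write $\mathrm{J}u=\det\mathrm{D}u$ and $|A|=\mathrm{tr}(AA^{T})^{1/2}$. $\dot W^{1,2p}(\mathbb{R}^2,\mathbb{R}^2)$ is the homogeneous Sobolev space of maps with weak gradient in $L^{2p}$, whose elements are identified when they differ by an additive constant. A map $u\in\dot W^{1,2p}(\mathbb{R}^2,\mathbb{R}^2)$ is a $2p$-energy minimiser for $f$ if $\mathrm{J}u=f$ a.e. and $$\int_{\mathbb{R}^2}|\mathrm{D}u|^{2p}dx=\inf\left\{\int_{\mathbb{R}^2}|\mathrm{D}v|^{2p}dx: v\in\dot W^{1,2p}(\mathbb{R}^2,\mathbb{R}^2),\ \mathrm{J}v=f\text{ a.e.}\right\}<\infty.$$ "Modulo rotations" means that minimisers $u$ and $v$ are identified when $u=Qv$ in $\dot W^{1,2p}$ for some $Q\in\mathrm{SO}(2)$. *)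

theory Defs
  imports "HOL-Analysis.Analysis"
begin

definition partial_deriv :: "2 \<Rightarrow> (real^2 \<Rightarrow> real) \<Rightarrow> real^2 \<Rightarrow> real" where
  "partial_deriv j \<phi> x = frechet_derivative \<phi> (at x) (axis j 1)"

definition iterated_partial :: "2 list \<Rightarrow> (real^2 \<Rightarrow> real) \<Rightarrow> real^2 \<Rightarrow> real" where
  "iterated_partial js \<phi> = foldr partial_deriv js \<phi>"

text \<open>Differentiability (hence continuity) of all iterated partial derivatives is
  equivalent to being of class \<open>C\<^sup>\<infinity>\<close>.\<close>

definition smooth_fun :: "(real^2 \<Rightarrow> real) \<Rightarrow> bool" where
  "smooth_fun \<phi> \<longleftrightarrow> (\<forall>js x. iterated_partial js \<phi> differentiable (at x))"

definition test_function :: "(real^2 \<Rightarrow> real) \<Rightarrow> bool" where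
  "test_function \<phi> \<longleftrightarrow> smooth_fun \<phi> \<and> compact (closure {x. \<phi> x \<noteq> 0})"

definition schwartz_function :: "(real^2 \<Rightarrow> real) \<Rightarrow> bool" where
  "schwartz_function \<phi> \<longleftrightarrow>
     smooth_fun \<phi> \<and> (\<forall>k js. \<exists>C. \<forall>x. norm x ^ k * \<bar>iterated_partial js \<phi> x\<bar> \<le> C)"

definition in_Lp :: "real \<Rightarrow> (real^2 \<Rightarrow> 'b::euclidean_space) \<Rightarrow> bool" where
  "in_Lp q g \<longleftrightarrow>
     g \<in> borel_measurable lebesgue \<and> integrable lebesgue (\<lambda>x. norm (g x) powr q)"

definition locally_integrable :: "(real^2 \<Rightarrow> 'b::euclidean_space) \<Rightarrow> bool" where
  "locally_integrable g \<longleftrightarrow> (\<forall>K. compact K \<longrightarrow> g absolutely_integrable_on K)"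

text \<open>\<open>dilated_conv \<Phi> t f\<close> is \<open>f * \<Phi>\<^sub>t\<close> with \<open>\<Phi>\<^sub>t(x) = t\<^sup>-\<^sup>2 \<Phi>(x/t)\<close>.\<close>

definition dilated_conv :: "(real^2 \<Rightarrow> real) \<Rightarrow> real \<Rightarrow> (real^2 \<Rightarrow> real) \<Rightarrow> real^2 \<Rightarrow> real" where
  "dilated_conv \<Phi> t f x = (\<integral>y. \<Phi> ((x - y) /\<^sub>R t) / t\<^sup>2 * f y \<partial>lebesgue)"

text \<open>The real Hardy space for exponents \<open>p \<ge> 1\<close>: the maximal function
  \<open>sup\<^bsub>t>0\<^esub> |f * \<Phi>\<^sub>t|\<close> lies in \<open>L\<^sup>p\<close> for some Schwartz function \<open>\<Phi>\<close> of nonzero mean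
  (the choice of \<open>\<Phi>\<close> is immaterial by Fefferman--Stein). In this range of exponents every
  tempered distribution with this property is an \<open>L\<^sup>p\<close> function, so the space is
  a set of functions. The power \<open>p\<close> is taken inside the supremum because the maximal
  function may be infinite.\<close>

definition hardy_space :: "real \<Rightarrow> (real^2 \<Rightarrow> real) set" where
  "hardy_space p = {f. in_Lp p f \<and>
     (\<exists>\<Phi>. schwartz_function \<Phi> \<and> (\<integral>x. \<Phi> x \<partial>lebesgue) \<noteq> 0 \<and>
        (\<integral>\<^sup>+x. (SUP t\<in>{0<..}. ennreal (\<bar>dilated_conv \<Phi> t f x\<bar> powr p)) \<partial>lebesgue) < \<infinity>)}"

definition radially_symmetric :: "(real^2 \<Rightarrow> real) \<Rightarrow> bool" where
  "radially_symmetric f \<longleftrightarrow> (\<forall>x y. norm x = norm y \<longrightarrow> f x = f y)"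

text \<open>\<open>G x $ i $ j\<close> is the weak partial derivative of the component \<open>u\<^sub>i\<close> in the direction
  \<open>x\<^sub>j\<close>. It is determined by \<open>u\<close> up to null sets.\<close>

definition has_weak_gradient :: "(real^2 \<Rightarrow> real^2) \<Rightarrow> (real^2 \<Rightarrow> real^2^2) \<Rightarrow> bool" where
  "has_weak_gradient u G \<longleftrightarrow> locally_integrable u \<and> locally_integrable G \<and>
     (\<forall>\<phi> i j. test_function \<phi> \<longrightarrow>
        (\<integral>x. u x $ i * partial_deriv j \<phi> x \<partial>lebesgue) = - (\<integral>x. G x $ i $ j * \<phi> x \<partial>lebesgue))"

text \<open>The norm that the library puts on \<open>real^2^2\<close> is the Frobenius norm.\<close>

lemma norm_matrix_eq_sqrt_trace:
  fixes A :: "real^2^2"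
  shows "norm A = sqrt (trace (A ** transpose A))"
  by (simp add: norm_vec_def L2_set_def trace_def matrix_matrix_mult_def transpose_def
      sum_nonneg power2_eq_square)

definition energy :: "real \<Rightarrow> (real^2 \<Rightarrow> real^2^2) \<Rightarrow> ennreal" where
  "energy q G = (\<integral>\<^sup>+x. ennreal (norm (G x) powr q) \<partial>lebesgue)"

text \<open>\<open>u\<close> lies in the homogeneous Sobolev space of order \<open>(1, 2p)\<close>, its weak gradient is \<open>G\<close>,
  and its Jacobian is \<open>f\<close> almost everywhere.\<close>

definition admissible ::
    "real \<Rightarrow> (real^2 \<Rightarrow> real) \<Rightarrow> (real^2 \<Rightarrow> real^2) \<Rightarrow> (real^2 \<Rightarrow> real^2^2) \<Rightarrow> bool" where
  "admissible p f u G \<longleftrightarrow>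
     has_weak_gradient u G \<and> in_Lp (2 * p) G \<and> (AE x in lebesgue. det (G x) = f x)"

definition energy_minimiser :: "real \<Rightarrow> (real^2 \<Rightarrow> real) \<Rightarrow> (real^2 \<Rightarrow> real^2) \<Rightarrow> bool" where
  "energy_minimiser p f u \<longleftrightarrow>
     (\<exists>G. admissible p f u G \<and>
          energy (2 * p) G = Inf {energy (2 * p) H |v H. admissible p f v H} \<and>
          energy (2 * p) G < \<infinity>)"

text \<open>Equality \<open>u = Q v\<close> in the homogeneous Sobolev space means equality almost everywhere
  up to an additive constant.\<close>

definition rotation_rel :: "((real^2 \<Rightarrow> real^2) \<times> (real^2 \<Rightarrow> real^2)) set" where
  "rotation_rel = {(u, v). \<exists>Q c. rotation_matrix Q \<and>
     (AE x in lebesgue. u x = Q *v v x + c)}"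

lemma equiv_rotation_rel: "equiv UNIV rotation_rel"
proof (rule equivI)
  show "rotation_rel \<subseteq> UNIV \<times> UNIV" by simp
  show "refl_on UNIV rotation_rel"
  proof (rule refl_onI)
    fix u :: "real^2 \<Rightarrow> real^2"
    have "rotation_matrix (mat 1 :: real^2^2)"
      by (simp add: rotation_matrix_def orthogonal_matrix_id)
    moreover have "AE x in lebesgue. u x = mat 1 *v u x + 0" by simp
    ultimately show "(u, u) \<in> rotation_rel" unfolding rotation_rel_def by blast
  qed
  show "sym rotation_rel"
  proof (rule symI)
    fix u v assume "(u, v) \<in> rotation_rel"
    then obtain Q c where Q: "rotation_matrix Q" and uv: "AE x in lebesgue. u x = Q *v v x + c"
      unfolding rotation_rel_def by blast
    have QQ: "transpose Q ** Q = mat 1"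
      using Q by (simp add: rotation_matrix_def orthogonal_matrix_def)
    have "rotation_matrix (transpose Q)"
      using Q by (simp add: rotation_matrix_def orthogonal_matrix_transpose det_transpose)
    moreover have "AE x in lebesgue. v x = transpose Q *v u x + - (transpose Q *v c)"
      using uv
    proof eventually_elim
      case (elim x)
      have "transpose Q *v (Q *v v x + c) = v x + transpose Q *v c"
        by (simp only: matrix_vector_right_distrib matrix_vector_mul_assoc QQ
            matrix_vector_mul_lid)
      then show ?case by (simp add: elim)
    qed
    ultimately show "(v, u) \<in> rotation_rel" unfolding rotation_rel_def by blast
  qed
  show "trans rotation_rel"
  proof (rule transI)
    fix u v w assume "(u, v) \<in> rotation_rel" "(v, w) \<in> rotation_rel"
    then obtain Q c R d where Q: "rotation_matrix Q" and uv: "AE x in lebesgue. u x = Q *v v x + c"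
      and R: "rotation_matrix R" and vw: "AE x in lebesgue. v x = R *v w x + d"
      unfolding rotation_rel_def by blast
    have "rotation_matrix (Q ** R)"
      using Q R by (simp add: rotation_matrix_def orthogonal_matrix_mul det_mul)
    moreover have "AE x in lebesgue. u x = (Q ** R) *v w x + (Q *v d + c)"
      using uv vw
      by eventually_elim
        (simp only: matrix_vector_right_distrib matrix_vector_mul_assoc add.assoc)
    ultimately show "(u, w) \<in> rotation_rel" unfolding rotation_rel_def by blast
  qed
qed

end

theory Submission
  imports Defs "HOL-Complex_Analysis.Great_Picard"
begin

text \<open>The datum \<open>f\<close>, the Jacobian of \<open>w + C * cnj (w\<^sup>2)\<close>, where \<open>w\<close> is a compactly supported radial
  stretching, is radial although this map is not, and its integrals against the radial cutoffs
  \<open>rbump 1 R\<close> take both signs. The direct method gives a minimiser \<open>u\<close>, the Jacobian constraint being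
  closed by weak continuity of the determinant. Since \<open>f\<close> is radial, all \<open>u \<circ> rot \<alpha>\<close> are minimisers.

  If these fell into countably many classes, then two of them with arbitrarily close angles would
  be equivalent, so \<open>u \<circ> rot \<alpha>\<^sub>k = Q\<^sub>k u + c\<^sub>k\<close> for some \<open>\<alpha>\<^sub>k \<rightarrow> 0\<close>. Differentiating, the
  angular derivative of \<open>u\<close> is \<open>\<kappa>\<close> times the quarter turn of \<open>u - m\<close>. Integrating the Jacobian
  by parts, the integral of \<open>f\<close> against a radial cutoff becomes \<open>\<kappa>\<close> times a nonnegative number, contradicting the change of sign.\<close>

section \<open>Smooth functions and test functions\<close>

text \<open>A rotationally equivariant map is equivalent to all its own rotations, so the datum has
  to rule such maps out. For them the integrals of the Jacobian against radial cutoffs all have the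
  sign of the winding speed; the two signs of the datum come from mixing the speeds 1 and -2, and
  the mixed map keeps the admissible class nonempty.

  The exponent p = 1 shapes the existence proof. Determinants of gradients bounded in L^2 are then
  bounded only in L^1, and the constraint on the determinant is not convex, so averaging maps
  destroys it. In divergence form, however, the determinant is bilinear in the first component of
  the map and the gradient of the second. With the first component frozen at its strong local L^2
  limit, the constraint becomes an affine condition on the gradient. That condition passes to
  averages, and uniform convexity makes suitable averages converge strongly.

  A minimiser has no more regularity than a weak gradient, so every rotation of its argument is
  moved to a test function before anything is differentiated.\<close>

lemma smooth_fun_coinduct:
  assumes "P f" "\<And>g x. P g \<Longrightarrow> g differentiable (at x)" "\<And>g j. P g \<Longrightarrow> P (partial_deriv j g)"
  shows "smooth_fun f"
proof -
  have "P (iterated_partial js f)" for js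
    by (induction js) (auto simp: iterated_partial_def assms)
  then show ?thesis by (auto simp: smooth_fun_def assms)
qed

lemma smooth_fun_differentiable: "smooth_fun f \<Longrightarrow> f differentiable (at x)"
  unfolding smooth_fun_def by (metis iterated_partial_def foldr.simps(1) id_apply)

lemma smooth_fun_partial: "smooth_fun f \<Longrightarrow> smooth_fun (partial_deriv j f)"
proof -
  assume *: "smooth_fun f"
  \<comment> \<open>\<open>foldr\<close> applies the last direction of the list first, so a
    derivative taken beforehand is an entry appended at the end.\<close>
  have "iterated_partial js (partial_deriv j f) = iterated_partial (js @ [j]) f" for js
    by (simp add: iterated_partial_def)
  then show ?thesis using * by (simp add: smooth_fun_def)
qed

lemma vec2_eq_axis: "(v :: real^2) = v $ 1 *\<^sub>R axis 1 1 + v $ 2 *\<^sub>R axis 2 1"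
  by (simp add: vec_eq_iff axis_def forall_2)

lemma frechet_derivative_partial:
  assumes "f differentiable (at x)"
  shows "frechet_derivative f (at x) v = v $ 1 * partial_deriv 1 f x + v $ 2 * partial_deriv 2 f x"
proof -
  have l: "linear (frechet_derivative f (at x))"
    using assms linear_frechet_derivative by blast
  show ?thesis
    by (subst vec2_eq_axis[of v]) (simp add: linear_add[OF l] linear_cmul[OF l] partial_deriv_def)
qed

lemma has_derivative_partial:
  assumes "f differentiable (at x)"
  shows "(f has_derivative (\<lambda>v. v $ 1 * partial_deriv 1 f x + v $ 2 * partial_deriv 2 f x)) (at x)"
  using assms frechet_derivative_works frechet_derivative_partial[OF assms]
  by (metis (no_types, lifting) ext)

lemma partial_deriv_eqI:
  assumes "(f has_derivative D) (at x)" shows "partial_deriv j f x = D (axis j 1)"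
  using frechet_derivative_at[OF assms] by (simp add: partial_deriv_def)

lemma axis_nth_2: "axis j (1::real) $ (1::2) = (if j = 1 then 1 else 0)"
   "axis j (1::real) $ (2::2) = (if j = 2 then 1 else 0)"
  by (auto simp: axis_def)

text \<open>The functions \<open>flat q\<close> form a class that contains \<open>exp (-1/x)\<close> extended by zero and is closed
  under differentiation.\<close>

definition flat :: "real poly \<Rightarrow> real \<Rightarrow> real" where
  "flat q x = (if x > 0 then poly q (1/x) * exp (- (1/x)) else 0)"

text \<open>The derivative of q(1/x) exp(-1/x) is x^-2 (q - q')(1/x) exp(-1/x); the polynomial
  \<open>[:0, 0, 1:]\<close> is the factor x^-2 in the variable 1/x.\<close>

definition flat_deriv :: "real poly \<Rightarrow> real poly" where
  "flat_deriv q = [:0, 0, 1:] * (q - pderiv q)"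

text \<open>The free power of y carries the induction: splitting off the constant coefficient of the
  polynomial leaves its tail with the exponent raised by one.\<close>

lemma power_poly_exp_tendsto_0: "((\<lambda>y::real. y ^ k * poly p y * exp (- y)) \<longlongrightarrow> 0) at_top"
proof (induction p arbitrary: k)
  case 0
  show ?case by simp
next
  case (pCons a p)
  have "((\<lambda>y::real. a * (y ^ k / exp y) + y ^ Suc k * poly p y * exp (- y)) \<longlongrightarrow> a * 0 + 0) at_top"
    by (intro tendsto_intros tendsto_power_div_exp_0 pCons.IH)
  moreover have "(\<lambda>y::real. a * (y ^ k / exp y) + y ^ Suc k * poly p y * exp (- y))
      = (\<lambda>y. y ^ k * poly (pCons a p) y * exp (- y))"
    by (rule ext) (simp add: exp_minus field_simps)
  ultimately show ?case by simp
qed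

lemma has_real_derivative_flat:
  "(flat q has_real_derivative flat (flat_deriv q) x) (at x)"
proof -
  consider "x > 0" | "x < 0" | "x = 0" by linarith
  then show ?thesis
  proof cases
    case 1
    have "((\<lambda>x. poly q (1/x) * exp (- (1/x))) has_real_derivative flat (flat_deriv q) x) (at x)"
      using 1 by (auto intro!: derivative_eq_intros DERIV_chain2[OF poly_DERIV]
          simp: flat_def flat_deriv_def field_simps power2_eq_square)
    then show ?thesis
      by (rule has_field_derivative_transform_within_open[where S="{0<..}"])
        (use 1 in \<open>auto simp: flat_def\<close>)
  next
    case 2
    have "((\<lambda>x. 0) has_real_derivative flat (flat_deriv q) x) (at x)"
      using 2 by (simp add: flat_def)
    then show ?thesis
      by (rule has_field_derivative_transform_within_open[where S="{..<0}"])
        (use 2 in \<open>auto simp: flat_def\<close>)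
  next
    case 3
    \<comment> \<open>The power 1 is the division by h in the difference quotient at zero, after the
      substitution y = 1/h.\<close>
    have "((\<lambda>h::real. (inverse h) ^ 1 * poly q (inverse h) * exp (- inverse h)) \<longlongrightarrow> 0) (at_right 0)"
      by (rule filterlim_compose[OF power_poly_exp_tendsto_0 filterlim_inverse_at_top_right])
    then have r: "((\<lambda>h. flat q h / h) \<longlongrightarrow> 0) (at_right 0)"
      by (rule Lim_transform_eventually)
        (auto simp: eventually_at_right_field flat_def field_simps intro!: exI[of _ 1])
    have l: "((\<lambda>h. flat q h / h) \<longlongrightarrow> 0) (at_left 0)"
      by (rule Lim_transform_eventually[OF tendsto_const])
        (auto simp: eventually_at_left_field flat_def intro!: exI[of _ "-1"])
    have "((\<lambda>h. flat q h / h) \<longlongrightarrow> 0) (at 0)"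
      using l r by (simp add: filterlim_at_split)
    then show ?thesis
      using 3 by (simp add: DERIV_def flat_def)
  qed
qed

lemma flat_one: "flat 1 x = (if x > 0 then exp (- (1/x)) else 0)"
  by (simp add: flat_def)

text \<open>The clauses \<open>flat\<close> and \<open>affine\<close> start from smooth functions
  rather than from members. The chain rule then yields products whose factors are again covered by
  these clauses or by \<open>base\<close>, so the class is stable under partial derivatives.\<close>

inductive smooth_closure :: "(real^2 \<Rightarrow> real) \<Rightarrow> bool" where
  base: "smooth_fun f \<Longrightarrow> smooth_closure f"
| const: "smooth_closure (\<lambda>x. c)"
| coord: "smooth_closure (\<lambda>x. x $ i)"
| flat: "smooth_fun f \<Longrightarrow> smooth_closure (\<lambda>x. flat q (f x))"
| affine: "smooth_fun f \<Longrightarrow> linear A \<Longrightarrow> smooth_closure (\<lambda>x. f (A x + b))"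
| add: "smooth_closure f \<Longrightarrow> smooth_closure g \<Longrightarrow> smooth_closure (\<lambda>x. f x + g x)"
| mult: "smooth_closure f \<Longrightarrow> smooth_closure g \<Longrightarrow> smooth_closure (\<lambda>x. f x * g x)"

lemma has_derivative_flat_comp:
  assumes "f differentiable (at x)"
  shows "((\<lambda>x. flat q (f x)) has_derivative
    (\<lambda>v. flat (flat_deriv q) (f x) * (v $ 1 * partial_deriv 1 f x + v $ 2 * partial_deriv 2 f x))) (at x)"
  using has_derivative_compose[OF has_derivative_partial[OF assms]
      has_real_derivative_flat[of q "f x", unfolded has_field_derivative_def]] .

lemma has_derivative_affine_comp:
  fixes f :: "real^2 \<Rightarrow> real" and A :: "real^2 \<Rightarrow> real^2"
  assumes "f differentiable (at (A x + b))" "linear A"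
  shows "((\<lambda>x. f (A x + b)) has_derivative
    (\<lambda>v. A v $ 1 * partial_deriv 1 f (A x + b) + A v $ 2 * partial_deriv 2 f (A x + b))) (at x)"
proof -
  have "((\<lambda>x. A x + b) has_derivative A) (at x)"
    using linear_imp_has_derivative[OF assms(2)] has_derivative_add_const by blast
  from has_derivative_compose[OF this has_derivative_partial[OF assms(1)]]
  show ?thesis .
qed

lemma partial_deriv_affine_comp:
  fixes f :: "real^2 \<Rightarrow> real" and A :: "real^2 \<Rightarrow> real^2"
  assumes "f differentiable (at (A x + b))" "linear A"
  shows "partial_deriv j (\<lambda>x. f (A x + b)) x =
    A (axis j 1) $ 1 * partial_deriv 1 f (A x + b) + A (axis j 1) $ 2 * partial_deriv 2 f (A x + b)"
  using partial_deriv_eqI[OF has_derivative_affine_comp[OF assms]] .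

lemma partial_deriv_flat_comp:
  assumes "f differentiable (at x)"
  shows "partial_deriv j (\<lambda>x. flat q (f x)) x = flat (flat_deriv q) (f x) * partial_deriv j f x"
  using exhaust_2[of j]
  by (auto simp: partial_deriv_eqI[OF has_derivative_flat_comp[OF assms]] axis_nth_2)

lemma partial_deriv_add:
  assumes "f differentiable (at x)" "g differentiable (at x)"
  shows "partial_deriv j (\<lambda>x. f x + g x) x = partial_deriv j f x + partial_deriv j g x"
proof -
  have "((\<lambda>x. f x + g x) has_derivative
     (\<lambda>h. frechet_derivative f (at x) h + frechet_derivative g (at x) h)) (at x)"
    using assms by (intro has_derivative_add) (auto simp: frechet_derivative_works[symmetric])
  from partial_deriv_eqI[OF this] show ?thesis by (simp add: partial_deriv_def)
qed

lemma partial_deriv_mult: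
  assumes "f differentiable (at x)" "g differentiable (at x)"
  shows "partial_deriv j (\<lambda>x. f x * g x) x = partial_deriv j f x * g x + f x * partial_deriv j g x"
proof -
  have "((\<lambda>x. f x * g x) has_derivative
     (\<lambda>h. f x * frechet_derivative g (at x) h + frechet_derivative f (at x) h * g x)) (at x)"
    using assms by (intro has_derivative_mult) (auto simp: frechet_derivative_works[symmetric])
  from partial_deriv_eqI[OF this] show ?thesis by (simp add: partial_deriv_def)
qed

lemma partial_deriv_const [simp]: "partial_deriv j (\<lambda>x. c) x = 0"
  by (rule partial_deriv_eqI[of _ "\<lambda>_. 0", OF has_derivative_const, simplified])

lemma has_derivative_coord: "((\<lambda>x::real^2. x $ i) has_derivative (\<lambda>v. v $ i)) (at x)"
  by (rule bounded_linear_imp_has_derivative[OF bounded_linear_vec_nth])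

lemma partial_deriv_coord [simp]: "partial_deriv j (\<lambda>x. x $ i) x = axis j 1 $ i"
  by (rule partial_deriv_eqI[OF has_derivative_coord])

lemma smooth_closure_differentiable: "smooth_closure f \<Longrightarrow> f differentiable (at x)"
proof (induction rule: smooth_closure.induct)
  case (coord i)
  then show ?case using has_derivative_coord differentiable_def by blast
next
  case (flat f q)
  then show ?case using has_derivative_flat_comp smooth_fun_differentiable differentiable_def by blast
next
  case (affine f A b)
  then show ?case using has_derivative_affine_comp smooth_fun_differentiable differentiable_def by blast
qed (auto intro: smooth_fun_differentiable differentiable_mult)

lemma smooth_closure_partial: "smooth_closure f \<Longrightarrow> smooth_closure (partial_deriv j f)"
proof (induction rule: smooth_closure.induct)
  case (base f)
  then show ?case by (intro smooth_closure.base smooth_fun_partial)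
next
  case (const c)
  have "partial_deriv j (\<lambda>x. c) = (\<lambda>x. 0)" by (rule ext) simp
  then show ?case by (simp add: smooth_closure.const)
next
  case (coord i)
  have "partial_deriv j (\<lambda>x. x $ i) = (\<lambda>x. axis j 1 $ i)" by (rule ext) simp
  then show ?case by (simp add: smooth_closure.const)
next
  case (flat f q)
  have "partial_deriv j (\<lambda>x. flat q (f x)) = (\<lambda>x. flat (flat_deriv q) (f x) * partial_deriv j f x)"
    using partial_deriv_flat_comp smooth_fun_differentiable[OF flat] by blast
  then show ?case using flat by (simp add: smooth_closure.intros smooth_fun_partial)
next
  case (affine f A b)
  have "partial_deriv j (\<lambda>x. f (A x + b)) = (\<lambda>x. A (axis j 1) $ 1 * partial_deriv 1 f (A x + b)
      + A (axis j 1) $ 2 * partial_deriv 2 f (A x + b))"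
    using partial_deriv_affine_comp smooth_fun_differentiable[OF affine(1)] affine(2) by blast
  moreover have "smooth_closure (\<lambda>x. partial_deriv i f (A x + b))" for i
    using affine by (intro smooth_closure.affine smooth_fun_partial)
  ultimately show ?case by (simp add: smooth_closure.add smooth_closure.mult smooth_closure.const)
next
  case (add f g)
  have "partial_deriv j (\<lambda>x. f x + g x) = (\<lambda>x. partial_deriv j f x + partial_deriv j g x)"
    using partial_deriv_add smooth_closure_differentiable add by blast
  then show ?case using add by (simp add: smooth_closure.add)
next
  case (mult f g)
  have "partial_deriv j (\<lambda>x. f x * g x) = (\<lambda>x. partial_deriv j f x * g x + f x * partial_deriv j g x)"
    using partial_deriv_mult smooth_closure_differentiable mult by blast
  then show ?case using mult by (simp add: smooth_closure.add smooth_closure.mult)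
qed

text \<open>By coinduction every member is smooth, and \<open>base\<close> gives the converse.
  Unfolding this equivalence turns each clause of the inductive definition into a closure property
  of \<open>smooth_fun\<close>.\<close>

lemma smooth_closure_iff: "smooth_closure f \<longleftrightarrow> smooth_fun f"
  using smooth_fun_coinduct[of smooth_closure] smooth_closure_differentiable
    smooth_closure_partial smooth_closure.base by blast

lemmas smooth_const [intro, simp] = smooth_closure.const[unfolded smooth_closure_iff]
lemmas smooth_coord [intro, simp] = smooth_closure.coord[unfolded smooth_closure_iff]
lemmas smooth_flat [intro] = smooth_closure.flat[unfolded smooth_closure_iff]
lemmas smooth_affine = smooth_closure.affine[unfolded smooth_closure_iff]
lemmas smooth_add [intro] = smooth_closure.add[unfolded smooth_closure_iff]
lemmas smooth_mult [intro] = smooth_closure.mult[unfolded smooth_closure_iff]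

lemma smooth_diff [intro]: "smooth_fun f \<Longrightarrow> smooth_fun g \<Longrightarrow> smooth_fun (\<lambda>x. f x - g x)"
  using smooth_add[OF _ smooth_mult[OF smooth_const[of "-1"]], of f g] by simp

lemma smooth_power [intro]: "smooth_fun f \<Longrightarrow> smooth_fun (\<lambda>x. f x ^ n)"
  by (induction n) auto

lemma smooth_shift: "smooth_fun f \<Longrightarrow> smooth_fun (\<lambda>x. f (x + b))"
  using smooth_affine[of f "\<lambda>x. x" b] by (simp add: linear_id[unfolded id_def])

lemma smooth_continuous: "smooth_fun f \<Longrightarrow> continuous_on S f"
  using smooth_fun_differentiable differentiable_imp_continuous_within
  by (metis continuous_at_imp_continuous_on)

lemma test_functionI:
  assumes "smooth_fun f" "\<And>x. R < norm x \<Longrightarrow> f x = 0"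
  shows "test_function f"
proof -
  have "{x. f x \<noteq> 0} \<subseteq> cball 0 R" using assms(2) by (force simp: not_less)
  then have "bounded {x. f x \<noteq> 0}" using bounded_cball bounded_subset by blast
  then have "compact (closure {x. f x \<noteq> 0})" by (simp add: compact_closure)
  then show ?thesis using assms(1) by (simp add: test_function_def)
qed

lemma test_function_smooth: "test_function f \<Longrightarrow> smooth_fun f"
  by (simp add: test_function_def)

lemma test_function_support:
  assumes "test_function f"
  obtains R where "R > 0" "\<And>x. R < norm x \<Longrightarrow> f x = 0"
proof -
  have "bounded {x. f x \<noteq> 0}"
    using assms bounded_subset[OF compact_imp_bounded closure_subset] by (simp add: test_function_def)
  then obtain R where "R > 0" "\<And>x. f x \<noteq> 0 \<Longrightarrow> norm x \<le> R"
    by (auto simp: bounded_pos)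
  then show ?thesis using that[of R] by force
qed

lemma partial_deriv_eq_0_open:
  assumes "open S" "x \<in> S" "\<And>y. y \<in> S \<Longrightarrow> f y = 0"
  shows "partial_deriv j f x = 0"
proof -
  have "((\<lambda>x. 0) has_derivative (\<lambda>_. 0)) (at x)" by simp
  then have "(f has_derivative (\<lambda>_. 0)) (at x)"
    using has_derivative_transform_within_open[of "\<lambda>x. 0" "\<lambda>_. 0" x UNIV S f] assms by simp
  from partial_deriv_eqI[OF this] show ?thesis .
qed

lemma partial_deriv_support:
  assumes "\<And>x. R < norm x \<Longrightarrow> f x = 0" "R < norm x"
  shows "partial_deriv j f x = 0"
  by (rule partial_deriv_eq_0_open[where S="- cball 0 R"]) (use assms in auto)

lemma test_function_partial:
  assumes "test_function f" shows "test_function (partial_deriv j f)"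
proof -
  obtain R where "\<And>x. R < norm x \<Longrightarrow> f x = 0" using test_function_support[OF assms] by blast
  then show ?thesis
    using test_functionI[of "partial_deriv j f" R] partial_deriv_support[of R f]
      smooth_fun_partial[OF test_function_smooth[OF assms]] by blast
qed

lemma test_function_mult: "test_function f \<Longrightarrow> smooth_fun g \<Longrightarrow> test_function (\<lambda>x. f x * g x)"
  by (metis (no_types, lifting) mult_zero_left smooth_mult test_functionI test_function_smooth
      test_function_support)

lemma test_function_add:
  assumes "test_function f" "test_function g" shows "test_function (\<lambda>x. f x + g x)"
proof -
  obtain R S where "\<And>x. R < norm x \<Longrightarrow> f x = 0" "\<And>x. S < norm x \<Longrightarrow> g x = 0"
    using test_function_support assms by metis
  then show ?thesis using assms
    by (intro test_functionI[of _ "max R S"]) (auto dest: test_function_smooth)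
qed

lemma test_function_bounded:
  assumes "test_function f"
  obtains B where "B > 0" "\<And>x. \<bar>f x\<bar> \<le> B"
proof -
  obtain R where R: "R > 0" "\<And>x. R < norm x \<Longrightarrow> f x = 0" using test_function_support[OF assms] by blast
  have "compact (f ` cball 0 R)"
    using smooth_continuous[OF test_function_smooth[OF assms]] by (intro compact_continuous_image) auto
  then obtain B where "B > 0" "\<And>x. x \<in> cball 0 R \<Longrightarrow> \<bar>f x\<bar> \<le> B"
    using compact_imp_bounded bounded_pos by (metis image_eqI real_norm_def)
  then have "\<bar>f x\<bar> \<le> B" for x using R by (cases "norm x \<le> R") auto
  then show ?thesis using that \<open>B > 0\<close> by blast
qed

lemma test_function_affine:
  fixes A :: "real^2 \<Rightarrow> real^2"
  assumes "test_function f" "linear A" "\<And>x. norm (A x) = norm x"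
  shows "test_function (\<lambda>x. f (A x + b))"
proof -
  obtain R where R: "R > 0" "\<And>x. R < norm x \<Longrightarrow> f x = 0" using test_function_support[OF assms(1)] by blast
  show ?thesis
  proof (rule test_functionI[of _ "R + norm b"])
    show "smooth_fun (\<lambda>x. f (A x + b))" using smooth_affine assms test_function_smooth by blast
    fix x :: "real^2" assume "R + norm b < norm x"
    then have "R < norm (A x + b)" using assms(3)[of x] norm_triangle_ineq4[of "A x + b" b] by simp
    then show "f (A x + b) = 0" using R by blast
  qed
qed

lemma test_function_shift: "test_function f \<Longrightarrow> test_function (\<lambda>x. f (x + b))"
  using test_function_affine[of f "\<lambda>x. x" b] by (simp add: linear_id[unfolded id_def])

lemma test_function_reflect: "test_function f \<Longrightarrow> test_function (\<lambda>x. f (b - x))"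
  using test_function_affine[of f "\<lambda>x. - x" b] by (simp add: linear_uminus)

lemma partial_deriv_shift:
  "smooth_fun f \<Longrightarrow> partial_deriv j (\<lambda>x. f (x + b)) x = partial_deriv j f (x + b)"
  using partial_deriv_affine_comp[of f "\<lambda>x. x" x b j] exhaust_2[of j]
  by (auto simp: linear_id[unfolded id_def] axis_nth_2 smooth_fun_differentiable)

lemma partial_deriv_reflect:
  "smooth_fun f \<Longrightarrow> partial_deriv j (\<lambda>x. f (b - x)) x = - partial_deriv j f (b - x)"
  using partial_deriv_affine_comp[of f "\<lambda>x. - x" x b j] exhaust_2[of j]
  by (auto simp: linear_uminus axis_nth_2 smooth_fun_differentiable)

lemma smooth_DERIV_line:
  assumes "smooth_fun f"
  shows "((\<lambda>t. f (x + (t * c) *\<^sub>R axis j 1)) has_real_derivative c * partial_deriv j f (x + (t * c) *\<^sub>R axis j 1)) (at t)"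
proof -
  have *: "((\<lambda>t. x + (t * c) *\<^sub>R axis j 1) has_derivative (\<lambda>h. (h * c) *\<^sub>R axis j 1)) (at t)"
    by (auto intro!: derivative_eq_intros)
  have **: "(f has_derivative frechet_derivative f (at y)) (at y)" for y
    using smooth_fun_differentiable[OF assms] frechet_derivative_works by blast
  have l: "linear (frechet_derivative f (at y))" for y
    using smooth_fun_differentiable[OF assms] linear_frechet_derivative by blast
  have "frechet_derivative f (at y) ((h * c) *\<^sub>R axis j 1) = c * partial_deriv j f y * h" for y h
    by (simp add: linear_cmul[OF l] partial_deriv_def)
  then show ?thesis using has_derivative_compose[OF * **] by (simp add: has_field_derivative_def)
qed

section \<open>Locally integrable functions\<close>

lemma cball_borel [measurable]: "cball a r \<in> sets borel"
  by simp

lemma nn_integral_shift: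
  fixes f :: "'a::euclidean_space \<Rightarrow> ennreal"
  assumes [measurable]: "f \<in> borel_measurable borel"
  shows "(\<integral>\<^sup>+x. f (x + c) \<partial>lborel) = (\<integral>\<^sup>+x. f x \<partial>lborel)"
proof -
  have "(\<integral>\<^sup>+x. f x \<partial>distr lborel borel ((+) c)) = (\<integral>\<^sup>+x. f (c + x) \<partial>lborel)"
    by (subst nn_integral_distr) auto
  then show ?thesis by (simp add: lborel_distr_plus add.commute)
qed

lemma
  fixes f :: "'a::euclidean_space \<Rightarrow> real"
  assumes [measurable]: "f \<in> borel_measurable borel"
  shows integrable_shift: "integrable lborel (\<lambda>x. f (x + c)) \<longleftrightarrow> integrable lborel f"
    and integral_shift: "(\<integral>x. f (x + c) \<partial>lborel) = (\<integral>x. f x \<partial>lborel)"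
proof -
  have "integrable (distr lborel borel ((+) c)) f \<longleftrightarrow> integrable lborel (\<lambda>x. f (c + x))"
    by (subst integrable_distr_eq) auto
  then show "integrable lborel (\<lambda>x. f (x + c)) \<longleftrightarrow> integrable lborel f"
    by (simp add: lborel_distr_plus add.commute)
  have "(\<integral>x. f x \<partial>distr lborel borel ((+) c)) = (\<integral>x. f (c + x) \<partial>lborel)"
    by (subst integral_distr) auto
  then show "(\<integral>x. f (x + c) \<partial>lborel) = (\<integral>x. f x \<partial>lborel)"
    by (simp add: lborel_distr_plus add.commute)
qed

lemma lborel_product_integrableI:
  fixes f :: "'a::euclidean_space \<Rightarrow> 'b::euclidean_space \<Rightarrow> real"
  assumes [measurable]: "(\<lambda>z. f (fst z) (snd z)) \<in> borel_measurable (lborel \<Otimes>\<^sub>M lborel)"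
    and "(\<integral>\<^sup>+x. \<integral>\<^sup>+y. ennreal \<bar>f x y\<bar> \<partial>lborel \<partial>lborel) < \<infinity>"
  shows "integrable (lborel \<Otimes>\<^sub>M lborel) (\<lambda>(x, y). f x y)"
proof (rule integrableI_bounded)
  show "(\<lambda>(x, y). f x y) \<in> borel_measurable (lborel \<Otimes>\<^sub>M lborel)"
    by (simp add: case_prod_beta')
  have "(\<integral>\<^sup>+x. \<integral>\<^sup>+y. ennreal \<bar>f x y\<bar> \<partial>lborel \<partial>lborel) =
      (\<integral>\<^sup>+z. ennreal \<bar>f (fst z) (snd z)\<bar> \<partial>(lborel \<Otimes>\<^sub>M lborel))"
    by (subst lborel.nn_integral_fst[symmetric]) auto
  then show "(\<integral>\<^sup>+z. ennreal (norm (case z of (x, y) \<Rightarrow> f x y)) \<partial>(lborel \<Otimes>\<^sub>M lborel)) < \<infinity>"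
    using assms(2) by (simp add: case_prod_beta')
qed

text \<open>Borel functions and \<open>lborel\<close> instead of the completed measure: Fubini's
  theorem and the product measurability arguments are carried out there. The way to and from
  \<open>lebesgue\<close> is made once, for whole maps, in \<open>sob_admissible\<close> and
  \<open>admissible_sob\<close>.\<close>

definition locL1 :: "(real^2 \<Rightarrow> real) \<Rightarrow> bool" where
  "locL1 g \<longleftrightarrow> g \<in> borel_measurable borel \<and> (\<forall>R. integrable lborel (\<lambda>x. indicator (cball 0 R) x * g x))"

definition locL2 :: "(real^2 \<Rightarrow> real) \<Rightarrow> bool" where
  "locL2 g \<longleftrightarrow> g \<in> borel_measurable borel \<and> (\<forall>R. integrable lborel (\<lambda>x. indicator (cball 0 R) x * (g x)\<^sup>2))"

lemma locL1_measurable [measurable_dest]: "locL1 g \<Longrightarrow> g \<in> borel_measurable borel"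
  by (simp add: locL1_def)

lemma locL2_measurable [measurable_dest]: "locL2 g \<Longrightarrow> g \<in> borel_measurable borel"
  by (simp add: locL2_def)

lemma locL1_integrable: "locL1 g \<Longrightarrow> integrable lborel (\<lambda>x. indicator (cball 0 R) x * g x)"
  by (simp add: locL1_def)

lemma locL2_iff: "locL2 g \<longleftrightarrow> g \<in> borel_measurable borel \<and> locL1 (\<lambda>x. (g x)\<^sup>2)"
  by (auto simp: locL1_def locL2_def)

lemma locL1_dominated:
  assumes [measurable]: "g \<in> borel_measurable borel"
    and dom: "\<And>R. \<exists>h. locL1 h \<and> (\<forall>x. norm x \<le> R \<longrightarrow> \<bar>g x\<bar> \<le> \<bar>h x\<bar>)"
  shows "locL1 g"
  unfolding locL1_def
proof (intro conjI allI)
  fix R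
  obtain h where h: "locL1 h" "\<And>x. norm x \<le> R \<Longrightarrow> \<bar>g x\<bar> \<le> \<bar>h x\<bar>" using dom by blast
  show "integrable lborel (\<lambda>x. indicator (cball 0 R) x * g x)"
    by (rule Bochner_Integration.integrable_bound[OF locL1_integrable[OF h(1), of R]])
      (auto simp: indicator_def h)
qed simp

lemma locL1_add [intro]: "locL1 f \<Longrightarrow> locL1 g \<Longrightarrow> locL1 (\<lambda>x. f x + g x)"
  by (auto simp: locL1_def distrib_left)

lemma locL1_cmult [intro]: "locL1 f \<Longrightarrow> locL1 (\<lambda>x. c * f x)"
  by (auto simp: locL1_def mult.left_commute)

lemma locL1_diff [intro]: "locL1 f \<Longrightarrow> locL1 g \<Longrightarrow> locL1 (\<lambda>x. f x - g x)"
  by (auto simp: locL1_def right_diff_distrib)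

lemma locL1_abs [intro]: "locL1 f \<Longrightarrow> locL1 (\<lambda>x. \<bar>f x\<bar>)"
  by (rule locL1_dominated) (auto simp: locL1_measurable)

lemma integrable_indicator_cball: "integrable lborel (indicator (cball (a::'a::euclidean_space) R) :: _ \<Rightarrow> real)"
  by (intro integrable_real_indicator) (simp_all add: emeasure_bounded_finite[OF bounded_cball, unfolded infinity_ennreal_def])

lemma locL1_const [intro, simp]: "locL1 (\<lambda>x. c)"
  using integrable_indicator_cball by (auto simp: locL1_def)

lemma continuous_bounded_cball:
  assumes "continuous_on UNIV f"
  obtains B where "B > 0" "\<And>x::real^2. norm x \<le> R \<Longrightarrow> \<bar>f x :: real\<bar> \<le> B"
proof -
  have "compact (f ` cball 0 R)"
    using assms by (intro compact_continuous_image) (auto intro: continuous_on_subset)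
  then obtain B where "B > 0" "\<And>y. y \<in> f ` cball 0 R \<Longrightarrow> norm y \<le> B"
    using compact_imp_bounded bounded_pos by metis
  then show ?thesis using that[of B] by auto
qed

lemma locL1_mult_continuous [intro]:
  assumes g: "locL1 g" and f: "continuous_on UNIV f"
  shows "locL1 (\<lambda>x. g x * f x)"
proof (rule locL1_dominated)
  show "(\<lambda>x. g x * f x) \<in> borel_measurable borel"
    using g borel_measurable_continuous_onI[OF f] by measurable
  fix R
  obtain B where "B > 0" "\<And>x. norm x \<le> R \<Longrightarrow> \<bar>f x\<bar> \<le> B"
    using continuous_bounded_cball[OF f] by blast
  then show "\<exists>h. locL1 h \<and> (\<forall>x. norm x \<le> R \<longrightarrow> \<bar>g x * f x\<bar> \<le> \<bar>h x\<bar>)"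
    using g by (intro exI[of _ "\<lambda>x. B * g x"]) (auto simp: abs_mult mult.commute[of "\<bar>g _\<bar>"] intro: mult_right_mono)
qed

lemma locL1_continuous [intro]: "continuous_on UNIV f \<Longrightarrow> locL1 f"
  using locL1_mult_continuous[of "\<lambda>_. 1" f] by simp

lemma locL2_continuous [intro]: "continuous_on UNIV f \<Longrightarrow> locL2 f"
  by (auto simp: locL2_iff intro!: borel_measurable_continuous_onI continuous_intros)

lemma locL1_mult_L2 [intro]:
  assumes "locL2 f" "locL2 g" shows "locL1 (\<lambda>x. f x * g x)"
proof (rule locL1_dominated)
  show "(\<lambda>x. f x * g x) \<in> borel_measurable borel" using assms by measurable
  fix R
  have "\<bar>f x * g x\<bar> \<le> \<bar>(f x)\<^sup>2 + (g x)\<^sup>2\<bar>" for x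
    using sum_squares_bound[of "\<bar>f x\<bar>" "\<bar>g x\<bar>"] mult_nonneg_nonneg[of "\<bar>f x\<bar>" "\<bar>g x\<bar>"]
    by (simp add: abs_mult del: mult_nonneg_nonneg zero_le_mult_iff)
  then show "\<exists>h. locL1 h \<and> (\<forall>x. norm x \<le> R \<longrightarrow> \<bar>f x * g x\<bar> \<le> \<bar>h x\<bar>)"
    using assms by (intro exI[of _ "\<lambda>x. (f x)\<^sup>2 + (g x)\<^sup>2"]) (auto simp: locL2_iff)
qed

lemma locL2_const [simp, intro]: "locL2 (\<lambda>x. c)"
  by auto

lemma locL2_imp_locL1: "locL2 f \<Longrightarrow> locL1 f"
  using locL1_mult_L2[of f "\<lambda>_. 1"] by simp

lemma locL2_add [intro]:
  assumes "locL2 f" "locL2 g" shows "locL2 (\<lambda>x. f x + g x)"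
  using assms locL1_mult_L2[OF assms] by (auto simp: locL2_iff power2_sum mult.assoc)

lemma locL2_cmult [intro]: "locL2 f \<Longrightarrow> locL2 (\<lambda>x. c * f x)"
  by (auto simp: locL2_iff power_mult_distrib)

lemma locL2_diff [intro]: "locL2 f \<Longrightarrow> locL2 g \<Longrightarrow> locL2 (\<lambda>x. f x - g x)"
  using locL2_add[OF _ locL2_cmult[of g "-1"]] by simp

lemma locL2_mult_continuous [intro]:
  assumes g: "locL2 g" and f: "continuous_on UNIV f" shows "locL2 (\<lambda>x. g x * f x)"
proof -
  have "(\<lambda>x. g x * f x) \<in> borel_measurable borel"
    using g borel_measurable_continuous_onI[OF f] by measurable
  moreover have "continuous_on UNIV (\<lambda>x. (f x)\<^sup>2)" using f by (intro continuous_intros)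
  ultimately show ?thesis using g by (auto simp: locL2_iff power_mult_distrib)
qed

lemma test_function_continuous: "test_function \<phi> \<Longrightarrow> continuous_on S \<phi>"
  by (simp add: smooth_continuous test_function_smooth)

lemma test_function_measurable [measurable_dest]: "test_function \<phi> \<Longrightarrow> \<phi> \<in> borel_measurable borel"
  by (simp add: test_function_continuous borel_measurable_continuous_onI)

lemma locL1_support_integrable:
  assumes "locL1 g" "\<And>x. R < norm x \<Longrightarrow> g x = 0"
  shows "integrable lborel g"
proof -
  have "(\<lambda>x. indicator (cball 0 R) x * g x) = g"
    using assms(2) by (auto simp: indicator_def fun_eq_iff)
  then show ?thesis using locL1_integrable[OF assms(1), of R] by simp
qed

lemma integrable_locL1_test:
  assumes "locL1 g" "test_function \<phi>"
  shows "integrable lborel (\<lambda>x. g x * \<phi> x)"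
proof -
  obtain R where "\<And>x. R < norm x \<Longrightarrow> \<phi> x = 0" using test_function_support[OF assms(2)] by blast
  then show ?thesis using assms
    by (intro locL1_support_integrable[of _ R] locL1_mult_continuous test_function_continuous) auto
qed

lemma integrable_test: "test_function \<phi> \<Longrightarrow> integrable lborel \<phi>"
  using integrable_locL1_test[of "\<lambda>_. 1" \<phi>] by simp

lemma locL1_shift:
  assumes "locL1 g" shows "locL1 (\<lambda>x. g (x + c))"
  unfolding locL1_def
proof (intro conjI allI)
  have [measurable]: "g \<in> borel_measurable borel" using assms by measurable
  show m: "(\<lambda>x. g (x + c)) \<in> borel_measurable borel" by measurable
  fix R
  have "integrable lborel (\<lambda>x. indicator (cball 0 (R + norm c)) (x + c) * g (x + c))"
    using integrable_shift[of "\<lambda>x. indicator (cball 0 (R + norm c)) x * g x" c]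
      locL1_integrable[OF assms] by simp
  then show "integrable lborel (\<lambda>x. indicator (cball 0 R) x * g (x + c))"
  proof (rule Bochner_Integration.integrable_bound)
    have [measurable]: "cball (0::real^2) R \<in> sets borel" by simp
    show "(\<lambda>x. indicator (cball 0 R) x * g (x + c)) \<in> borel_measurable lborel"
      using m by (intro borel_measurable_times borel_measurable_indicator) auto
    have "norm (x + c) \<le> R + norm c" if "norm x \<le> R" for x
      using norm_triangle_ineq[of x c] that by linarith
    then show "AE x in lborel. norm (indicator (cball 0 R) x * g (x + c))
        \<le> norm (indicator (cball 0 (R + norm c)) (x + c) * g (x + c))"
      by (auto simp: indicator_def)
  qed
qed

text \<open>Integrating a translation difference of \<open>\<phi>\<close> gives zero and, by the fundamental theorem
  of calculus, also the integral of the partial derivative.\<close>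

lemma test_function_difference:
  assumes \<phi>: "test_function \<phi>"
  shows "\<phi> (x + c *\<^sub>R axis j 1) - \<phi> x
    = (\<integral>t. indicator {0..1} t * (c * partial_deriv j \<phi> (x + (t * c) *\<^sub>R axis j 1)) \<partial>lborel)"
proof -
  have s: "smooth_fun \<phi>" using test_function_smooth[OF \<phi>] .
  have "(\<integral>t. indicator {0..1::real} t *\<^sub>R (c * partial_deriv j \<phi> (x + (t * c) *\<^sub>R axis j 1)) \<partial>lborel)
     = \<phi> (x + (1 * c) *\<^sub>R axis j 1) - \<phi> (x + (0 * c) *\<^sub>R axis j 1)"
  proof (rule integral_FTC_atLeastAtMost)
    show "((\<lambda>t. \<phi> (x + (t * c) *\<^sub>R axis j 1)) has_vector_derivative
        c * partial_deriv j \<phi> (x + (t * c) *\<^sub>R axis j 1)) (at t within {0..1})" for t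
      using smooth_DERIV_line[OF s, of x c j t]
      by (simp add: has_real_derivative_iff_has_vector_derivative has_vector_derivative_at_within)
    show "continuous_on {0..1} (\<lambda>t. c * partial_deriv j \<phi> (x + (t * c) *\<^sub>R axis j 1))"
      by (intro continuous_intros continuous_on_compose2[OF smooth_continuous[OF smooth_fun_partial[OF s], of UNIV]]) auto
  qed simp
  then show ?thesis by simp
qed

text \<open>Licenses Fubini in the next lemma. For t in the unit interval the translate of \<phi>
  moves by at most \<open>\<bar>c\<bar>\<close>, so everything happens in a ball of radius
  \<open>R + \<bar>c\<bar>\<close>, where h is integrable.\<close>

lemma segment_mult_test_integrable:
  fixes h :: "real^2 \<Rightarrow> real"
  assumes h: "locL1 h" and \<phi>: "test_function \<phi>"
  shows "integrable (lborel \<Otimes>\<^sub>M lborel)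
     (\<lambda>(t::real, x::real^2). indicator {0..1} t * (h x * \<phi> (x + (t * c) *\<^sub>R axis j 1)))"
proof (rule lborel_product_integrableI)
  have [measurable]: "h \<in> borel_measurable borel" "\<phi> \<in> borel_measurable borel"
    using h \<phi> by measurable
  show "(\<lambda>z. indicator {0..1} (fst z) * (h (snd z) * \<phi> (snd z + (fst z * c) *\<^sub>R axis j 1)))
    \<in> borel_measurable (lborel \<Otimes>\<^sub>M lborel)" for c :: real
    by measurable
  obtain R where R: "\<And>x. R < norm x \<Longrightarrow> \<phi> x = 0" using test_function_support[OF \<phi>] by blast
  obtain B where B: "B > 0" "\<And>x. \<bar>\<phi> x\<bar> \<le> B" using test_function_bounded[OF \<phi>] by blast
  define I where "I = (\<integral>\<^sup>+x. ennreal \<bar>B * (indicator (cball 0 (R + \<bar>c\<bar>)) x * h x)\<bar> \<partial>lborel)"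
  have "integrable lborel (\<lambda>x. B * (indicator (cball 0 (R + \<bar>c\<bar>)) x * h x))"
    using locL1_integrable[OF h] by auto
  then have I: "I < \<infinity>"
    unfolding I_def integrable_iff_bounded real_norm_def by blast
  have le: "\<bar>indicator {0..1} t * (h x * \<phi> (x + (t * c) *\<^sub>R axis j 1))\<bar>
      \<le> indicator {0..1} t * \<bar>B * (indicator (cball 0 (R + \<bar>c\<bar>)) x * h x)\<bar>" for t x
  proof (cases "t \<in> {0..1} \<and> norm x > R + \<bar>c\<bar>")
    case True
    have "\<bar>t * c\<bar> \<le> \<bar>c\<bar>" using True by (auto simp: abs_mult intro: mult_left_le_one_le)
    then have "norm ((t * c) *\<^sub>R axis j (1::real) :: real^2) \<le> \<bar>c\<bar>" by simp
    then have "R < norm (x + (t * c) *\<^sub>R axis j 1)"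
      using norm_triangle_ineq4[of "x + (t * c) *\<^sub>R axis j 1" "(t * c) *\<^sub>R axis j 1"] True by simp
    then show ?thesis using R by simp
  next
    case False
    then show ?thesis
      using mult_left_mono[OF B(2), of "\<bar>h x\<bar>" "x + (t * c) *\<^sub>R axis j 1"] B(1)
      by (auto simp: indicator_def abs_mult mult.commute)
  qed
  have "(\<integral>\<^sup>+t. \<integral>\<^sup>+x. ennreal \<bar>indicator {0..1} t * (h x * \<phi> (x + (t * c) *\<^sub>R axis j 1))\<bar> \<partial>lborel \<partial>lborel)
     \<le> (\<integral>\<^sup>+t. \<integral>\<^sup>+x. ennreal (indicator {0..1} t * \<bar>B * (indicator (cball 0 (R + \<bar>c\<bar>)) x * h x)\<bar>) \<partial>lborel \<partial>(lborel::real measure))"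
    by (intro nn_integral_mono ennreal_leI le)
  also have "\<dots> = (\<integral>\<^sup>+t. indicator {0..1::real} t * I \<partial>lborel)"
    unfolding I_def
    by (subst nn_integral_cmult[symmetric]) (auto simp: ennreal_mult' ennreal_indicator)
  also have "\<dots> = I"
    by (simp add: nn_integral_multc)
  finally show "(\<integral>\<^sup>+t. \<integral>\<^sup>+x. ennreal \<bar>indicator {0..1} t * (h x * \<phi> (x + (t * c) *\<^sub>R axis j 1))\<bar> \<partial>lborel \<partial>lborel) < \<infinity>"
    using I by auto
qed

text \<open>The fundamental theorem along segments, integrated against h. Only \<phi> is
  differentiated, so h may be a function for which merely a weak derivative is known.\<close>

lemma integral_difference_test:
  assumes h: "locL1 h" and \<phi>: "test_function \<phi>"
  shows "(\<integral>x. h x * (\<phi> (x + c *\<^sub>R axis j 1) - \<phi> x) \<partial>lborel)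
    = c * (\<integral>t. indicator {0..1} t * (\<integral>x. h x * partial_deriv j \<phi> (x + (t * c) *\<^sub>R axis j 1) \<partial>lborel) \<partial>lborel)"
proof -
  note * = segment_mult_test_integrable[OF h test_function_partial[OF \<phi>, of j], of c j]
  have "(\<integral>x. h x * (\<phi> (x + c *\<^sub>R axis j 1) - \<phi> x) \<partial>lborel) =
    (\<integral>x. c * (\<integral>t. indicator {0..1} t * (h x * partial_deriv j \<phi> (x + (t * c) *\<^sub>R axis j 1)) \<partial>lborel) \<partial>lborel)"
    by (subst test_function_difference[OF \<phi>])
       (simp add: integral_mult_right_zero[symmetric] mult_ac del: integral_mult_right_zero)
  also have "\<dots> = c * (\<integral>x. \<integral>t. indicator {0..1} t * (h x * partial_deriv j \<phi> (x + (t * c) *\<^sub>R axis j 1)) \<partial>lborel \<partial>lborel)"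
    by simp
  also have "\<dots> = c * (\<integral>t. \<integral>x. indicator {0..1} t * (h x * partial_deriv j \<phi> (x + (t * c) *\<^sub>R axis j 1)) \<partial>lborel \<partial>lborel)"
    using lborel_pair.Fubini_integral[OF *] by simp
  finally show ?thesis by simp
qed

lemma integral_partial_test:
  assumes \<phi>: "test_function \<phi>"
  shows "(\<integral>x. partial_deriv j \<phi> x \<partial>lborel) = 0"
proof -
  have [measurable]: "\<phi> \<in> borel_measurable borel" "partial_deriv j \<phi> \<in> borel_measurable borel"
    using \<phi> test_function_partial[OF \<phi>] by measurable
  have "(\<integral>x. \<phi> (x + 1 *\<^sub>R axis j 1) - \<phi> x \<partial>lborel) = 0"
    using integrable_test[OF \<phi>] integrable_test[OF test_function_shift[OF \<phi>]]
    by (subst Bochner_Integration.integral_diff) (auto simp: integral_shift)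
  then show ?thesis
    using integral_difference_test[of "\<lambda>_. 1" \<phi> 1 j] \<phi> by (simp add: integral_shift)
qed

lemma test_integration_by_parts:
  assumes "test_function \<phi>" "smooth_fun g"
  shows "(\<integral>x. g x * partial_deriv j \<phi> x \<partial>lborel) = - (\<integral>x. partial_deriv j g x * \<phi> x \<partial>lborel)"
proof -
  have eq: "partial_deriv j (\<lambda>x. \<phi> x * g x) x = g x * partial_deriv j \<phi> x + partial_deriv j g x * \<phi> x" for x
    using assms by (simp add: partial_deriv_mult smooth_fun_differentiable test_function_smooth)
  have "(\<integral>x. g x * partial_deriv j \<phi> x + partial_deriv j g x * \<phi> x \<partial>lborel) = 0"
    using integral_partial_test[OF test_function_mult[OF assms], of j] by (simp add: eq)
  moreover have "integrable lborel (\<lambda>x. g x * partial_deriv j \<phi> x)" "integrable lborel (\<lambda>x. partial_deriv j g x * \<phi> x)"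
    using assms by (auto intro!: integrable_locL1_test test_function_partial smooth_continuous smooth_fun_partial)
  ultimately show ?thesis by simp
qed

section \<open>The fundamental lemma of the calculus of variations\<close>

definition box_bump :: "real^2 \<Rightarrow> real^2 \<Rightarrow> nat \<Rightarrow> real^2 \<Rightarrow> real" where
  "box_bump a b n x = flat 1 (real n * (x $ 1 - a $ 1)) * flat 1 (real n * (b $ 1 - x $ 1))
     * (flat 1 (real n * (x $ 2 - a $ 2)) * flat 1 (real n * (b $ 2 - x $ 2)))"

lemma flat_one_bounds: "0 \<le> flat 1 x" "flat 1 x \<le> 1" "x \<le> 0 \<Longrightarrow> flat 1 x = 0"
  by (auto simp: flat_one)

text \<open>exp(-1/x) tends to 1 at infinity and its extension vanishes on the left half-line, so
  dilation by n sharpens it to an indicator. One such factor for each side of a box gives test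
  functions converging boundedly to the indicator of the box.\<close>

lemma flat_one_tendsto: "(\<lambda>n. flat 1 (real n * y)) \<longlonglongrightarrow> indicat_real {0<..} y"
proof (cases "y > 0")
  case True
  have "(\<lambda>n. exp (- (1 / y * (1 / real n)))) \<longlonglongrightarrow> exp (- (1 / y * 0))"
    by (intro tendsto_intros lim_1_over_n)
  then have "(\<lambda>n. exp (- (1 / y * (1 / real n)))) \<longlonglongrightarrow> 1" by simp
  moreover have "eventually (\<lambda>n. exp (- (1 / y * (1 / real n))) = flat 1 (real n * y)) sequentially"
    using eventually_gt_at_top[of 0] by eventually_elim (use True in \<open>auto simp: flat_one field_simps\<close>)
  ultimately show ?thesis using True by (auto intro: Lim_transform_eventually)
next
  case False
  then have "flat 1 (real n * y) = 0" for n by (auto simp: flat_one zero_less_mult_iff)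
  then show ?thesis using False by simp
qed

lemma mem_box_2: "(x::real^2) \<in> box a b \<longleftrightarrow> a $ 1 < x $ 1 \<and> x $ 1 < b $ 1 \<and> a $ 2 < x $ 2 \<and> x $ (2::2) < b $ (2::2)"
  by (auto simp: mem_box_cart forall_2)

lemma box_bump_tendsto: "(\<lambda>n. box_bump a b n x) \<longlonglongrightarrow> indicat_real (box a b) x"
proof -
  have "(\<lambda>n. box_bump a b n x) \<longlonglongrightarrow> indicat_real {0<..} (x $ 1 - a $ 1) * indicator {0<..} (b $ 1 - x $ 1)
      * (indicator {0<..} (x $ 2 - a $ 2) * indicator {0<..} (b $ 2 - x $ 2))"
    unfolding box_bump_def by (intro tendsto_mult flat_one_tendsto)
  moreover have "indicat_real {0<..} (x $ 1 - a $ 1) * indicator {0<..} (b $ 1 - x $ 1)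
      * (indicator {0<..} (x $ 2 - a $ 2) * indicator {0<..} (b $ 2 - x $ 2)) = indicator (box a b) x"
    by (auto simp: indicator_def mem_box_2)
  ultimately show ?thesis by simp
qed

lemma box_bump_bounds: "0 \<le> box_bump a b n x" "box_bump a b n x \<le> 1" "x \<notin> box a b \<Longrightarrow> box_bump a b n x = 0"
proof -
  show "0 \<le> box_bump a b n x" "box_bump a b n x \<le> 1"
    unfolding box_bump_def by (auto intro!: mult_nonneg_nonneg mult_le_one flat_one_bounds)
  assume "x \<notin> box a b"
  then have "x $ 1 - a $ 1 \<le> 0 \<or> b $ 1 - x $ 1 \<le> 0 \<or> x $ 2 - a $ 2 \<le> 0 \<or> b $ 2 - x $ 2 \<le> 0"
    by (auto simp: mem_box_2)
  moreover have "flat 1 (real n * y) = 0" if "y \<le> 0" for y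
    using that by (intro flat_one_bounds) (simp add: mult_le_0_iff)
  ultimately show "box_bump a b n x = 0"
    unfolding box_bump_def by auto
qed

lemma box_subset_cball: obtains R where "R > 0" "box a b \<subseteq> cball (0::real^2) R"
  using bounded_box[of a b] by (auto simp: bounded_pos subset_iff)

lemma test_function_box_bump: "test_function (box_bump a b n)"
proof -
  obtain R where R: "box a b \<subseteq> cball (0::real^2) R" using box_subset_cball by blast
  show ?thesis
  proof (rule test_functionI[of _ R])
    show "smooth_fun (box_bump a b n)"
      unfolding box_bump_def by (intro smooth_mult smooth_flat smooth_diff smooth_const smooth_coord)
    show "box_bump a b n x = 0" if "R < norm x" for x
      using that R by (intro box_bump_bounds) auto
  qed
qed

lemma integral_box_eq_0:
  assumes g: "locL1 g" and 0: "\<And>\<phi>. test_function \<phi> \<Longrightarrow> (\<integral>x. g x * \<phi> x \<partial>lborel) = 0"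
  shows "(\<integral>x. g x * indicator (box a b) x \<partial>lborel) = 0"
proof -
  have [measurable]: "g \<in> borel_measurable borel" using g by measurable
  have [measurable]: "box_bump a b n \<in> borel_measurable borel" for n
    using test_function_box_bump by measurable
  obtain R where R: "box a b \<subseteq> cball (0::real^2) R" using box_subset_cball by blast
  have "(\<lambda>n. \<integral>x. g x * box_bump a b n x \<partial>lborel) \<longlonglongrightarrow> (\<integral>x. g x * indicator (box a b) x \<partial>lborel)"
  proof (rule integral_dominated_convergence)
    show "integrable lborel (\<lambda>x. \<bar>indicator (cball 0 R) x * g x\<bar>)"
      using locL1_integrable[OF g] by auto
    have "\<bar>box_bump a b n x\<bar> \<le> indicator (cball 0 R) x" for x n
      using R[THEN subsetD, of x] box_bump_bounds(1,2)[of a b n x] box_bump_bounds(3)[of x a b n] by (auto simp: indicator_def)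
    from mult_left_mono[OF this, of "\<bar>g y\<bar>" _ y for y]
    show "AE x in lborel. norm (g x * box_bump a b n x) \<le> \<bar>indicator (cball 0 R) x * g x\<bar>" for n
      by (auto simp: abs_mult mult.commute)
  qed (auto intro!: tendsto_intros box_bump_tendsto)
  then show ?thesis
    using 0[OF test_function_box_bump] by (simp add: LIMSEQ_const_iff)
qed

text \<open>Dynkin's argument: open boxes are stable under intersection and generate the Borel sets,
  and the sets of vanishing integral are closed under disjoint unions and, by the hypothesis on the
  total integral, under complements. A function whose integral over every Borel set vanishes is zero
  almost everywhere.\<close>

lemma AE_0_of_boxes:
  fixes k :: "real^2 \<Rightarrow> real"
  assumes k: "integrable lborel k" and box: "\<And>a b. (\<integral>x. k x * indicator (box a b) x \<partial>lborel) = 0"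
    and tot: "(\<integral>x. k x \<partial>lborel) = 0"
  shows "AE x in lborel. k x = 0"
proof (rule sigma_finite_measure.density_zero[OF sigma_finite_lborel k])
  have km: "k \<in> borel_measurable borel" using borel_measurable_integrable[OF k] by simp
  have I: "set_integrable lborel A k" if "A \<in> sets borel" for A
    using k that unfolding set_integrable_def by (intro integrable_mult_indicator) auto
  fix A :: "(real^2) set" assume "A \<in> sets lborel"
  then have A: "A \<in> sigma_sets UNIV (range (\<lambda>(a, b). box a b :: (real^2) set))"
    by (simp add: borel_eq_box)
  have sb: "sigma_sets UNIV (range (\<lambda>(a, b). box a b :: (real^2) set)) = sets borel"
    by (simp add: borel_eq_box)
  have ist: "Int_stable (range (\<lambda>(a, b). box a b :: (real^2) set))"
    by (auto simp: Int_stable_def box_Int_box)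
  show "set_lebesgue_integral lborel A k = 0"
  proof (rule sigma_sets_induct_disjoint[OF ist _ A, of "\<lambda>A. set_lebesgue_integral lborel A k = 0"])
    show "set_lebesgue_integral lborel A k = 0" if "A \<in> range (\<lambda>(a, b). box a b)" for A
      using box that by (auto simp: set_lebesgue_integral_def mult.commute)
    show "set_lebesgue_integral lborel {} k = 0" by (simp add: set_lebesgue_integral_def)
  next
    fix A assume A: "A \<in> sigma_sets UNIV (range (\<lambda>(a, b). box a b :: (real^2) set))"
      "set_lebesgue_integral lborel A k = 0"
    then have [measurable]: "A \<in> sets borel" using sb by simp
    have eq: "indicator (UNIV - A) x * k x = k x - indicator A x * k x" for x
      by (auto simp: indicator_def)
    show "set_lebesgue_integral lborel (UNIV - A) k = 0"
      using A I[of A] k tot by (simp add: set_lebesgue_integral_def set_integrable_def eq del: Diff_iff)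
  next
    fix A :: "nat \<Rightarrow> (real^2) set"
    assume A: "disjoint_family A" "range A \<subseteq> sigma_sets UNIV (range (\<lambda>(a, b). box a b :: (real^2) set))"
      "\<And>i. set_lebesgue_integral lborel (A i) k = 0"
    have A': "A i \<in> sets borel" for i using sb A(2) by blast
    have "set_lebesgue_integral lborel (\<Union>i. A i) k = (\<Sum>i. set_lebesgue_integral lborel (A i) k)"
      using A' A(1) by (intro lebesgue_integral_countable_add I) (auto simp: disjoint_family_on_def)
    then show "set_lebesgue_integral lborel (\<Union>i. A i) k = 0" using A(3) by simp
  qed auto
qed

lemma locL1_AE_0:
  assumes g: "locL1 g" and 0: "\<And>\<phi>. test_function \<phi> \<Longrightarrow> (\<integral>x. g x * \<phi> x \<partial>lborel) = 0"
  shows "AE x in lborel. g x = 0"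
proof -
  have [measurable]: "g \<in> borel_measurable borel" using g by measurable
  define C where "C n = (box (- (real n *\<^sub>R One)) (real n *\<^sub>R One) :: (real^2) set)" for n :: nat
  \<comment> \<open>Local integrability gives an integrable function only after cutting to the cube
    \<open>C n\<close>. The cut is harmless because a box intersected with the cube is again a
    box.\<close>
  have "AE x in lborel. g x * indicator (C n) x = 0" for n
  proof (rule AE_0_of_boxes)
    obtain R where R: "C n \<subseteq> cball (0::real^2) R" unfolding C_def using box_subset_cball by blast
    show "integrable lborel (\<lambda>x. g x * indicator (C n) x)"
      by (rule Bochner_Integration.integrable_bound[OF locL1_integrable[OF g, of R]])
         (use R in \<open>auto simp: indicator_def C_def intro!: AE_I2\<close>)
    show "(\<integral>x. g x * indicator (C n) x * indicator (box a b) x \<partial>lborel) = 0" for a b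
      using integral_box_eq_0[OF g 0] unfolding C_def
      by (simp add: mult.assoc indicator_inter_arith[symmetric] box_Int_box)
    show "(\<integral>x. g x * indicator (C n) x \<partial>lborel) = 0"
      using integral_box_eq_0[OF g 0] unfolding C_def .
  qed
  then have "AE x in lborel. \<forall>n. g x * indicator (C n) x = 0"
    by (subst AE_all_countable) blast
  then show ?thesis
  proof eventually_elim
    case (elim x)
    have "x \<in> (\<Union>n. C n)" unfolding C_def UN_box_eq_UNIV by simp
    then obtain n where "x \<in> C n" by blast
    then show ?case using elim[rule_format, of n] by simp
  qed
qed

section \<open>Weak partial derivatives\<close>

definition wpd :: "2 \<Rightarrow> (real^2 \<Rightarrow> real) \<Rightarrow> (real^2 \<Rightarrow> real) \<Rightarrow> bool" where
  "wpd j g h \<longleftrightarrow> locL1 g \<and> locL1 h \<and>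
     (\<forall>\<phi>. test_function \<phi> \<longrightarrow>
        (\<integral>x. g x * partial_deriv j \<phi> x \<partial>lborel) = - (\<integral>x. h x * \<phi> x \<partial>lborel))"

lemma wpdD:
  assumes "wpd j g h"
  shows "locL1 g" "locL1 h"
    "test_function \<phi> \<Longrightarrow> (\<integral>x. g x * partial_deriv j \<phi> x \<partial>lborel) = - (\<integral>x. h x * \<phi> x \<partial>lborel)"
  using assms by (auto simp: wpd_def)

lemma wpd_linear:
  assumes "wpd j g h" "wpd j g' h'"
  shows "wpd j (\<lambda>x. a * g x + b * g' x) (\<lambda>x. a * h x + b * h' x)"
  unfolding wpd_def
proof (intro conjI allI impI)
  fix \<phi> assume t: "test_function \<phi>"
  note I = integrable_locL1_test[OF wpdD(1)[OF assms(1)] test_function_partial[OF t, of j]]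
    integrable_locL1_test[OF wpdD(1)[OF assms(2)] test_function_partial[OF t, of j]]
    integrable_locL1_test[OF wpdD(2)[OF assms(1)] t] integrable_locL1_test[OF wpdD(2)[OF assms(2)] t]
  show "(\<integral>x. (a * g x + b * g' x) * partial_deriv j \<phi> x \<partial>lborel) =
        - (\<integral>x. (a * h x + b * h' x) * \<phi> x \<partial>lborel)"
    using I wpdD(3)[OF assms(1) t] wpdD(3)[OF assms(2) t]
    by (simp add: distrib_right mult.assoc)
qed (use assms in \<open>auto dest: wpdD intro!: locL1_add locL1_cmult\<close>)

lemma wpd_smooth:
  assumes "smooth_fun g" shows "wpd j g (partial_deriv j g)"
  using assms by (auto simp: wpd_def smooth_continuous smooth_fun_partial locL1_continuous test_integration_by_parts)

lemma wpd_const: "wpd j (\<lambda>x. c) (\<lambda>x. 0)"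
proof -
  have "partial_deriv j (\<lambda>x. c) = (\<lambda>x. 0)" by (rule ext) simp
  then show ?thesis using wpd_smooth[of "\<lambda>x. c" j] by simp
qed

section \<open>Difference quotients of weakly differentiable functions and the Poincare
  inequality\<close>

text \<open>The shift now falls on the rough factor h. The factor k is merely bounded with bounded
  support, so that it can be an indicator as well as a test function in the next proof.\<close>

lemma segment_shift_integrable:
  fixes h k :: "real^2 \<Rightarrow> real"
  assumes h: "locL1 h" and [measurable]: "k \<in> borel_measurable borel"
    and B: "\<And>x. \<bar>k x\<bar> \<le> B" and R: "\<And>x. R < norm x \<Longrightarrow> k x = 0"
  shows "integrable (lborel \<Otimes>\<^sub>M lborel)
     (\<lambda>(t::real, x::real^2). indicator {0..1} t * (h (x + (t * c) *\<^sub>R axis j 1) * k x))"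
proof (rule lborel_product_integrableI)
  have [measurable]: "h \<in> borel_measurable borel" using h by measurable
  show "(\<lambda>z. indicator {0..1} (fst z) * (h (snd z + (fst z * c) *\<^sub>R axis j 1) * k (snd z)))
    \<in> borel_measurable (lborel \<Otimes>\<^sub>M lborel)"
    by measurable
  define I where "I = (\<integral>\<^sup>+x. ennreal \<bar>B * (indicator (cball 0 (R + \<bar>c\<bar>)) x * h x)\<bar> \<partial>lborel)"
  have "integrable lborel (\<lambda>x. B * (indicator (cball 0 (R + \<bar>c\<bar>)) x * h x))"
    using locL1_integrable[OF h] by auto
  then have I: "I < \<infinity>"
    unfolding I_def integrable_iff_bounded real_norm_def by blast
  have B0: "B \<ge> 0" using B[of 0] by linarith
  have le: "\<bar>indicator {0..1} t * (h (x + (t * c) *\<^sub>R axis j 1) * k x)\<bar>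
      \<le> indicator {0..1} t * \<bar>B * (indicator (cball 0 (R + \<bar>c\<bar>)) (x + (t * c) *\<^sub>R axis j 1) * h (x + (t * c) *\<^sub>R axis j 1))\<bar>" for t x
  proof (cases "t \<in> {0..1} \<and> norm x \<le> R")
    case True
    have "\<bar>t * c\<bar> \<le> \<bar>c\<bar>" using True by (auto simp: abs_mult intro: mult_left_le_one_le)
    then have "norm ((t * c) *\<^sub>R axis j (1::real) :: real^2) \<le> \<bar>c\<bar>" by simp
    then have "norm (x + (t * c) *\<^sub>R axis j 1) \<le> R + \<bar>c\<bar>"
      using norm_triangle_ineq[of x "(t * c) *\<^sub>R axis j 1"] True by linarith
    then show ?thesis
      using mult_left_mono[OF B, of "\<bar>h (x + (t * c) *\<^sub>R axis j 1)\<bar>" x] B0 True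
      by (auto simp: abs_mult mult.commute)
  next
    case False
    then show ?thesis using R by (auto simp: indicator_def)
  qed
  have "(\<integral>\<^sup>+t. \<integral>\<^sup>+x. ennreal \<bar>indicator {0..1} t * (h (x + (t * c) *\<^sub>R axis j 1) * k x)\<bar> \<partial>lborel \<partial>lborel)
     \<le> (\<integral>\<^sup>+t. \<integral>\<^sup>+x. ennreal (indicator {0..1} t * \<bar>B * (indicator (cball 0 (R + \<bar>c\<bar>)) (x + (t * c) *\<^sub>R axis j 1) * h (x + (t * c) *\<^sub>R axis j 1))\<bar>) \<partial>lborel \<partial>(lborel::real measure))"
    by (intro nn_integral_mono ennreal_leI le)
  also have "\<dots> = (\<integral>\<^sup>+t. indicator {0..1::real} t * (\<integral>\<^sup>+x. ennreal \<bar>B * (indicator (cball 0 (R + \<bar>c\<bar>)) (x + (t * c) *\<^sub>R axis j 1) * h (x + (t * c) *\<^sub>R axis j 1))\<bar> \<partial>lborel) \<partial>lborel)"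
    by (subst nn_integral_cmult[symmetric]) (auto simp: ennreal_mult' ennreal_indicator)
  also have "\<dots> = (\<integral>\<^sup>+t. indicator {0..1::real} t * I \<partial>lborel)"
    unfolding I_def
    by (subst nn_integral_shift[of "\<lambda>x. ennreal \<bar>B * (indicator (cball 0 (R + \<bar>c\<bar>)) x * h x)\<bar>"]) auto
  also have "\<dots> = I"
    by (simp add: nn_integral_multc)
  finally show "(\<integral>\<^sup>+t. \<integral>\<^sup>+x. ennreal \<bar>indicator {0..1} t * (h (x + (t * c) *\<^sub>R axis j 1) * k x)\<bar> \<partial>lborel \<partial>lborel) < \<infinity>"
    using I by auto
qed

text \<open>The fundamental theorem of calculus along segments holds almost everywhere for a weak
  derivative: both sides have the same integral against each test function, so the fundamental lemma
  applies.\<close>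

lemma wpd_difference:
  assumes w: "wpd j g h"
  shows "AE x in lborel. g (x + c *\<^sub>R axis j 1) - g x =
    c * (\<integral>t. indicator {0..1} t * h (x + (t * c) *\<^sub>R axis j 1) \<partial>lborel)"
proof -
  note [simp del] = scaleR_minus_left
  define e where "e = (axis j 1 :: real^2)"
  have g: "locL1 g" and h: "locL1 h" using wpdD[OF w] by auto
  have [measurable]: "g \<in> borel_measurable borel" "h \<in> borel_measurable borel"
    using g h by measurable
  define H where "H x = (\<integral>t. indicator {0..1} t * h (x + (t * c) *\<^sub>R e) \<partial>lborel)" for x
  have [measurable]: "H \<in> borel_measurable borel" unfolding H_def by measurable
  have H: "locL1 H"
    unfolding locL1_def
  proof (intro conjI allI)
    fix R
    have "integrable lborel (\<lambda>x. \<integral>t. indicator {0..1} t * (h (x + (t * c) *\<^sub>R e) * indicator (cball 0 R) x) \<partial>lborel)"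
      unfolding e_def
      by (intro lborel_pair.integrable_snd[OF segment_shift_integrable[where B=1 and R=R]] h)
        (auto simp: indicator_def)
    moreover have "(\<integral>t. indicator {0..1} t * (h (x + (t * c) *\<^sub>R e) * indicator (cball 0 R) x) \<partial>lborel)
       = H x * indicator (cball 0 R) x" for x
      unfolding H_def mult.assoc[symmetric] by (rule integral_mult_left_zero)
    ultimately show "integrable lborel (\<lambda>x. indicator (cball 0 R) x * H x)"
      by (simp only: mult.commute)
  qed measurable
  have "AE x in lborel. g (x + c *\<^sub>R e) - g x - c * H x = 0"
  proof (rule locL1_AE_0)
    show "locL1 (\<lambda>x. g (x + c *\<^sub>R e) - g x - c * H x)"
      by (intro locL1_diff locL1_cmult locL1_shift g H)
    fix \<phi> assume t: "test_function \<phi>"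
    have [measurable]: "\<phi> \<in> borel_measurable borel" using t by measurable
    obtain B where B: "\<And>x. \<bar>\<phi> x\<bar> \<le> B" using test_function_bounded[OF t] by blast
    obtain R where R: "\<And>x. R < norm x \<Longrightarrow> \<phi> x = 0" using test_function_support[OF t] by blast
    note t' = test_function_shift[OF t]
    have shift: "(\<integral>x. f x * \<phi> (x + - b) \<partial>lborel) = (\<integral>x. f (x + b) * \<phi> x \<partial>lborel)"
      if [measurable]: "f \<in> borel_measurable borel" for f b
      using integral_shift[of "\<lambda>x. f x * \<phi> (x + - b)" b] by simp
    \<comment> \<open>The shift of g by c becomes a shift of \<phi> by -c, so the difference formula
      is used with -c. Its sign cancels against the minus sign of the weak derivative, and
      translating back puts the shift on h.\<close>
    have "(\<integral>x. g (x + c *\<^sub>R e) * \<phi> x \<partial>lborel) - (\<integral>x. g x * \<phi> x \<partial>lborel)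
       = (\<integral>x. g x * \<phi> (x + - (c *\<^sub>R e)) \<partial>lborel) - (\<integral>x. g x * \<phi> x \<partial>lborel)"
      by (subst shift) auto
    also have "\<dots> = (\<integral>x. g x * (\<phi> (x + (- c) *\<^sub>R e) - \<phi> x) \<partial>lborel)"
      using integrable_locL1_test[OF g t] integrable_locL1_test[OF g t'[of "- (c *\<^sub>R e)"]]
      by (simp add: right_diff_distrib scaleR_minus_left)
    also have "\<dots> = - c * (\<integral>s. indicator {0..1} s * (\<integral>x. g x * partial_deriv j \<phi> (x + (s * - c) *\<^sub>R e) \<partial>lborel) \<partial>lborel)"
      unfolding e_def by (rule integral_difference_test[OF g t])
    also have "(\<lambda>s. \<integral>x. g x * partial_deriv j \<phi> (x + (s * - c) *\<^sub>R e) \<partial>lborel) =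
       (\<lambda>s. - (\<integral>x. h x * \<phi> (x + (s * - c) *\<^sub>R e) \<partial>lborel))"
      using wpdD(3)[OF w t'] test_function_smooth[OF t]
      by (auto simp: fun_eq_iff partial_deriv_shift)
    also have "(\<lambda>s. - (\<integral>x. h x * \<phi> (x + (s * - c) *\<^sub>R e) \<partial>lborel))
        = (\<lambda>s. - (\<integral>x. h (x + (s * c) *\<^sub>R e) * \<phi> x \<partial>lborel))"
      using shift[of h] by (auto simp: fun_eq_iff scaleR_minus_left)
    also have "- c * (\<integral>s. indicator {0..1} s * - (\<integral>x. h (x + (s * c) *\<^sub>R e) * \<phi> x \<partial>lborel) \<partial>lborel)
       = c * (\<integral>s. \<integral>x. indicator {0..1} s * (h (x + (s * c) *\<^sub>R e) * \<phi> x) \<partial>lborel \<partial>lborel)"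
      by simp
    also have "(\<integral>s. \<integral>x. indicator {0..1} s * (h (x + (s * c) *\<^sub>R e) * \<phi> x) \<partial>lborel \<partial>lborel)
       = (\<integral>x. \<integral>s. indicator {0..1} s * (h (x + (s * c) *\<^sub>R e) * \<phi> x) \<partial>lborel \<partial>lborel)"
      using lborel_pair.Fubini_integral[OF segment_shift_integrable[OF h _ B R, where c=c and j=j]]
      unfolding e_def by simp
    also have "\<dots> = (\<integral>x. H x * \<phi> x \<partial>lborel)"
      unfolding H_def mult.assoc[symmetric] by (simp only: integral_mult_left_zero)
    finally show "(\<integral>x. (g (x + c *\<^sub>R e) - g x - c * H x) * \<phi> x \<partial>lborel) = 0"
      using integrable_locL1_test[OF g t] integrable_locL1_test[OF H t]
        integrable_locL1_test[OF locL1_shift[OF g] t]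
      by (simp add: left_diff_distrib mult.assoc)
  qed
  then show ?thesis unfolding H_def e_def by simp
qed

text \<open>Expanding the nonnegative integral over S of the squared deviation of f from its mean.
  If the square of f is not integrable on S, the right-hand side is infinite.\<close>

lemma set_jensen:
  fixes f :: "'a::euclidean_space \<Rightarrow> real"
  assumes [measurable]: "f \<in> borel_measurable borel" "S \<in> sets borel" and fin: "emeasure lborel S < \<infinity>"
  shows "ennreal ((\<integral>t. indicator S t * f t \<partial>lborel)\<^sup>2)
    \<le> emeasure lborel S * (\<integral>\<^sup>+t. indicator S t * ennreal ((f t)\<^sup>2) \<partial>lborel)"
\<comment> \<open>A null set is treated apart: there the right-hand side is a product with 0, which
  is 0 in \<open>ennreal\<close> even against an infinite integral.\<close>
proof (cases "emeasure lborel S = 0")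
  case True
  then have "AE t in lborel. t \<notin> S" by (intro AE_not_in) auto
  then have "(\<integral>t. indicator S t * f t \<partial>lborel) = 0" by (intro integral_eq_zero_AE) auto
  then show ?thesis by simp
next
  case pos: False
  show ?thesis
  proof (cases "(\<integral>\<^sup>+t. indicator S t * ennreal ((f t)\<^sup>2) \<partial>lborel) = \<infinity>")
    case True
    then show ?thesis using pos by (simp add: ennreal_mult_top)
  next
    case False
    let ?I = "indicat_real S"
    define \<mu> where "\<mu> = measure lborel S"
    have em: "emeasure lborel S = ennreal \<mu>" unfolding \<mu>_def
      using fin by (intro emeasure_eq_ennreal_measure) auto
    have \<mu>: "\<mu> > 0" using pos em by (simp add: zero_less_measure_iff \<mu>_def)
    have eq: "indicator S t * ennreal ((f t)\<^sup>2) = ennreal (?I t * (f t)\<^sup>2)" for t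
      by (auto simp: indicator_def)
    have i2: "integrable lborel (\<lambda>t. ?I t * (f t)\<^sup>2)"
      using False by (intro integrableI_nonneg) (auto simp: eq top.not_eq_extremum)
    have i0: "integrable lborel ?I" using fin by (intro integrable_real_indicator) auto
    have I0: "(\<integral>t. ?I t \<partial>lborel) = \<mu>" by (simp add: \<mu>_def)
    have i1: "integrable lborel (\<lambda>t. ?I t * f t)"
    proof (rule Bochner_Integration.integrable_bound[OF Bochner_Integration.integrable_add[OF i0 i2]])
      have "\<bar>f t\<bar> \<le> 1 + (f t)\<^sup>2" for t
        using sum_squares_bound[of 1 "\<bar>f t\<bar>"] by (simp add: power2_eq_square)
      then show "AE t in lborel. norm (?I t * f t) \<le> norm (?I t + ?I t * (f t)\<^sup>2)"
        by (auto simp: indicator_def)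
    qed measurable
    define M where "M = (\<integral>t. ?I t * f t \<partial>lborel)"
    have "0 \<le> (\<integral>t. ?I t * (f t - M / \<mu>)\<^sup>2 \<partial>lborel)"
      by (intro Bochner_Integration.integral_nonneg) auto
    also have "\<dots> = (\<integral>t. ?I t * (f t)\<^sup>2 - 2 * (M / \<mu>) * (?I t * f t) + (M / \<mu>)\<^sup>2 * ?I t \<partial>lborel)"
      by (intro Bochner_Integration.integral_cong) (auto simp: power2_eq_square algebra_simps)
    also have "\<dots> = (\<integral>t. ?I t * (f t)\<^sup>2 \<partial>lborel) - 2 * (M / \<mu>) * M + (M / \<mu>)\<^sup>2 * \<mu>"
      using i0 i1 i2 I0 by (simp add: M_def)
    also have "\<dots> = (\<integral>t. ?I t * (f t)\<^sup>2 \<partial>lborel) - M\<^sup>2 / \<mu>"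
      using \<mu> by (simp add: power2_eq_square)
    finally have "M\<^sup>2 \<le> \<mu> * (\<integral>t. ?I t * (f t)\<^sup>2 \<partial>lborel)" using \<mu> by (simp add: field_simps)
    then have "ennreal (M\<^sup>2) \<le> ennreal \<mu> * ennreal (\<integral>t. ?I t * (f t)\<^sup>2 \<partial>lborel)"
      using \<mu> by (simp add: ennreal_mult'[symmetric] ennreal_leI)
    then show ?thesis
      unfolding M_def[symmetric] eq em
      by (subst nn_integral_eq_integral[OF i2]) auto
  qed
qed

lemma unit_interval_jensen:
  fixes f :: "real \<Rightarrow> real"
  assumes "f \<in> borel_measurable borel"
  shows "ennreal ((\<integral>t. indicator {0..1} t * f t \<partial>lborel)\<^sup>2) \<le> (\<integral>\<^sup>+t. indicator {0..1} t * ennreal ((f t)\<^sup>2) \<partial>lborel)"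
  using set_jensen[OF assms, of "{0..1}"] by simp

text \<open>The increment is an average of h over a segment, so Jensen's inequality bounds its
  square by the average of the square of h. Fubini and translation invariance then remove the
  average, all segments staying in Q.\<close>

lemma wpd_shift_L2:
  assumes w: "wpd j g h" and [measurable]: "S \<in> sets borel" "Q \<in> sets borel"
    and SQ: "\<And>x t. x \<in> S \<Longrightarrow> 0 \<le> t \<Longrightarrow> t \<le> 1 \<Longrightarrow> x + (t * c) *\<^sub>R axis j 1 \<in> Q"
  shows "(\<integral>\<^sup>+x. indicator S x * ennreal ((g (x + c *\<^sub>R axis j 1) - g x)\<^sup>2) \<partial>lborel)
     \<le> ennreal (c\<^sup>2) * (\<integral>\<^sup>+x. indicator Q x * ennreal ((h x)\<^sup>2) \<partial>lborel)"
proof -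
  define e where "e = (axis j 1 :: real^2)"
  have [measurable]: "g \<in> borel_measurable borel" "h \<in> borel_measurable borel"
    using wpdD(1,2)[OF w] by measurable
  define D where "D = (\<integral>\<^sup>+x. indicator Q x * ennreal ((h x)\<^sup>2) \<partial>lborel)"
  have "(\<integral>\<^sup>+x. indicator S x * ennreal ((g (x + c *\<^sub>R e) - g x)\<^sup>2) \<partial>lborel)
    \<le> (\<integral>\<^sup>+x. ennreal (c\<^sup>2) * (\<integral>\<^sup>+t. indicator {0..1::real} t * (indicator Q (x + (t * c) *\<^sub>R e) * ennreal ((h (x + (t * c) *\<^sub>R e))\<^sup>2)) \<partial>lborel) \<partial>lborel)"
  proof (rule nn_integral_mono_AE)
    show "AE x in lborel. indicator S x * ennreal ((g (x + c *\<^sub>R e) - g x)\<^sup>2)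
      \<le> ennreal (c\<^sup>2) * (\<integral>\<^sup>+t. indicator {0..1::real} t * (indicator Q (x + (t * c) *\<^sub>R e) * ennreal ((h (x + (t * c) *\<^sub>R e))\<^sup>2)) \<partial>lborel)"
      using wpd_difference[OF w, of c] unfolding e_def[symmetric]
    proof eventually_elim
      case (elim x)
      show ?case
      proof (cases "x \<in> S")
        case True
        have "indicator S x * ennreal ((g (x + c *\<^sub>R e) - g x)\<^sup>2) =
           ennreal (c\<^sup>2) * ennreal ((\<integral>t. indicator {0..1} t * h (x + (t * c) *\<^sub>R e) \<partial>lborel)\<^sup>2)"
          unfolding elim using True by (simp add: power_mult_distrib ennreal_mult')
        also have "\<dots> \<le> ennreal (c\<^sup>2) * (\<integral>\<^sup>+t. indicator {0..1} t * ennreal ((h (x + (t * c) *\<^sub>R e))\<^sup>2) \<partial>lborel)"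
          by (intro mult_left_mono unit_interval_jensen) auto
        also have "(\<integral>\<^sup>+t. indicator {0..1} t * ennreal ((h (x + (t * c) *\<^sub>R e))\<^sup>2) \<partial>lborel) =
          (\<integral>\<^sup>+t. indicator {0..1::real} t * (indicator Q (x + (t * c) *\<^sub>R e) * ennreal ((h (x + (t * c) *\<^sub>R e))\<^sup>2)) \<partial>lborel)"
          using SQ[OF True] by (intro nn_integral_cong) (auto simp: indicator_def e_def)
        finally show ?thesis .
      qed simp
    qed
  qed
  also have "\<dots> = ennreal (c\<^sup>2) * (\<integral>\<^sup>+x. \<integral>\<^sup>+t. indicator {0..1::real} t * (indicator Q (x + (t * c) *\<^sub>R e) * ennreal ((h (x + (t * c) *\<^sub>R e))\<^sup>2)) \<partial>lborel \<partial>lborel)"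
    by (subst nn_integral_cmult) measurable
  also have "(\<integral>\<^sup>+x. \<integral>\<^sup>+t. indicator {0..1::real} t * (indicator Q (x + (t * c) *\<^sub>R e) * ennreal ((h (x + (t * c) *\<^sub>R e))\<^sup>2)) \<partial>lborel \<partial>lborel)
    = (\<integral>\<^sup>+t. \<integral>\<^sup>+x. indicator {0..1::real} t * (indicator Q (x + (t * c) *\<^sub>R e) * ennreal ((h (x + (t * c) *\<^sub>R e))\<^sup>2)) \<partial>lborel \<partial>lborel)"
    by (rule lborel_pair.Fubini') measurable
  also have "\<dots> = (\<integral>\<^sup>+t. indicator {0..1::real} t * D \<partial>lborel)"
    unfolding D_def
    by (intro nn_integral_cong)
      (simp add: nn_integral_cmult nn_integral_shift[of "\<lambda>x. indicator Q x * ennreal ((h x)\<^sup>2)"])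
  also have "\<dots> = D" by (simp add: nn_integral_multc)
  finally show ?thesis unfolding D_def e_def .
qed

text \<open>Half-open, so that translates by multiples of the side tile the plane without
  overlap.\<close>

definition sq :: "real \<Rightarrow> real \<Rightarrow> real \<Rightarrow> (real^2) set" where
  "sq a b L = {x. a \<le> x $ 1 \<and> x $ 1 < a + L \<and> b \<le> x $ 2 \<and> x $ 2 < b + L}"

lemma sq_borel [measurable]: "sq a b L \<in> sets borel"
  unfolding sq_def by measurable

lemma emeasure_sq:
  assumes "L \<ge> 0" shows "emeasure lborel (sq a b L) = ennreal (L\<^sup>2)"
proof -
  define u v where "u = (vector [a, b] :: real^2)" and "v = (vector [a + L, b + L] :: real^2)"
  have le: "\<forall>i. u $ i \<le> v $ i" using assms by (auto simp: forall_2 u_def v_def)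
  have B: "(Basis :: (real^2) set) = {axis 1 1, axis 2 1}"
    by (auto simp: Basis_vec_def exhaust_2) (metis exhaust_2)+
  have ne: "(axis 1 1 :: real^2) \<noteq> axis 2 1" by (simp add: axis_eq_axis)
  have P: "(\<Prod>i\<in>Basis. (v - u) \<bullet> i) = L\<^sup>2"
    unfolding B using ne by (simp add: inner_axis u_def v_def power2_eq_square)
  have le': "\<And>i. i \<in> Basis \<Longrightarrow> u \<bullet> i \<le> v \<bullet> i"
    unfolding B using le by (auto simp: inner_axis)
  have "box u v \<subseteq> sq a b L" "sq a b L \<subseteq> cbox u v"
    by (auto simp: sq_def mem_box_cart forall_2 u_def v_def)
  then have "emeasure lborel (box u v) \<le> emeasure lborel (sq a b L)"
    "emeasure lborel (sq a b L) \<le> emeasure lborel (cbox u v)"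
    by (auto intro!: emeasure_mono)
  moreover have "emeasure lborel (box u v) = ennreal (L\<^sup>2)" "emeasure lborel (cbox u v) = ennreal (L\<^sup>2)"
    using emeasure_lborel_box[of u v] emeasure_lborel_cbox[of u v] le' P by auto
  ultimately show ?thesis by simp
qed

text \<open>The increment by z is split at the corner \<open>x + z $ 1 *\<^sub>R e1\<close>; both
  axis-parallel segments stay in the square because a square is a product of intervals. The
  indicator on the right records that two points of the square differ by less than its side in each
  coordinate.\<close>

lemma wpd_increment_L2:
  assumes w1: "wpd 1 g h1" and w2: "wpd 2 g h2" and L: "L > 0"
  shows "(\<integral>\<^sup>+x. indicator (sq a b L) x * indicator (sq a b L) (x + z) * ennreal ((g (x + z) - g x)\<^sup>2) \<partial>lborel)
    \<le> indicator (sq (-L) (-L) (2 * L)) z * ennreal (2 * L\<^sup>2)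
       * (\<integral>\<^sup>+x. indicator (sq a b L) x * ennreal ((h1 x)\<^sup>2 + (h2 x)\<^sup>2) \<partial>lborel)"
proof (cases "z \<in> sq (-L) (-L) (2 * L)")
  case False
  then have "indicator (sq a b L) x * indicator (sq a b L) (x + z) * ennreal ((g (x + z) - g x)\<^sup>2) = 0" for x
    by (auto simp: sq_def indicator_def)
  then show ?thesis by (simp only: nn_integral_const mult_zero_left) simp
next
  case True
  define Q where "Q = sq a b L"
  have [measurable]: "Q \<in> sets borel" unfolding Q_def by measurable
  have [measurable]: "g \<in> borel_measurable borel" "h1 \<in> borel_measurable borel" "h2 \<in> borel_measurable borel"
    using wpdD(1,2)[OF w1] wpdD(1,2)[OF w2] by measurable
  define e1 e2 where "e1 = (axis 1 1 :: real^2)" and "e2 = (axis 2 1 :: real^2)"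
  have e [simp]: "e1 $ 1 = 1" "e1 $ 2 = 0" "e2 $ 1 = 0" "e2 $ 2 = 1"
    by (auto simp: e1_def e2_def axis_def)
  have z: "z = z $ 1 *\<^sub>R e1 + z $ 2 *\<^sub>R e2" unfolding e1_def e2_def by (rule vec2_eq_axis)
  define S where "S = {x \<in> Q. x + z \<in> Q}"
  \<comment> \<open>The second segment starts at the corner, so its base points form the translate
    of S by the first component of z.\<close>
  define S' where "S' = {y. y + (- z $ 1) *\<^sub>R e1 \<in> S}"
  have [measurable]: "S \<in> sets borel" "S' \<in> sets borel" unfolding S_def S'_def by measurable
  define D1 where "D1 = (\<integral>\<^sup>+x. indicator Q x * ennreal ((h1 x)\<^sup>2) \<partial>lborel)"
  define D2 where "D2 = (\<integral>\<^sup>+x. indicator Q x * ennreal ((h2 x)\<^sup>2) \<partial>lborel)"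
  have mid: "u \<le> r + t * s \<and> r + t * s < v" if "u \<le> r" "r < v" "u \<le> r + s" "r + s < v" "0 \<le> t" "t \<le> 1"
    for u v r s t :: real
  proof (cases "s \<ge> 0")
    case True
    have "0 \<le> t * s" "t * s \<le> s" using True that by (auto simp: mult_left_le_one_le)
    then show ?thesis using that by linarith
  next
    case False
    then have "t * s \<le> 0" "s \<le> t * s" using that by (auto simp: mult_le_0_iff mult_le_cancel_right1)
    then show ?thesis using that by linarith
  qed
  have zL: "(z $ 1)\<^sup>2 \<le> L\<^sup>2" "(z $ 2)\<^sup>2 \<le> L\<^sup>2"
    using True L by (auto simp: sq_def abs_le_square_iff[symmetric] abs_if)
  have A: "(\<integral>\<^sup>+x. indicator S x * ennreal ((g (x + z $ 1 *\<^sub>R e1) - g x)\<^sup>2) \<partial>lborel) \<le> ennreal (L\<^sup>2) * D1"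
  proof -
    have "(\<integral>\<^sup>+x. indicator S x * ennreal ((g (x + z $ 1 *\<^sub>R e1) - g x)\<^sup>2) \<partial>lborel) \<le> ennreal ((z $ 1)\<^sup>2) * D1"
      unfolding D1_def e1_def
    proof (rule wpd_shift_L2[OF w1])
      show "x + (t * z $ 1) *\<^sub>R axis 1 1 \<in> Q" if "x \<in> S" "0 \<le> t" "t \<le> 1" for x t
        using that mid[of a "x $ 1" "a + L" "z $ 1" t] e unfolding S_def Q_def sq_def e1_def[symmetric] by auto
    qed measurable
    also have "\<dots> \<le> ennreal (L\<^sup>2) * D1" using zL by (intro mult_right_mono ennreal_leI) auto
    finally show ?thesis .
  qed
  have B: "(\<integral>\<^sup>+x. indicator S x * ennreal ((g (x + z) - g (x + z $ 1 *\<^sub>R e1))\<^sup>2) \<partial>lborel) \<le> ennreal (L\<^sup>2) * D2"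
  proof -
    have "(\<integral>\<^sup>+x. indicator S x * ennreal ((g (x + z) - g (x + z $ 1 *\<^sub>R e1))\<^sup>2) \<partial>lborel)
      = (\<integral>\<^sup>+x. indicator S' (x + z $ 1 *\<^sub>R e1) * ennreal ((g (x + z $ 1 *\<^sub>R e1 + z $ 2 *\<^sub>R e2) - g (x + z $ 1 *\<^sub>R e1))\<^sup>2) \<partial>lborel)"
      by (intro nn_integral_cong) (auto simp: S'_def indicator_def add.assoc z[symmetric])
    also have "\<dots> = (\<integral>\<^sup>+x. indicator S' x * ennreal ((g (x + z $ 2 *\<^sub>R e2) - g x)\<^sup>2) \<partial>lborel)"
      by (rule nn_integral_shift[where f="\<lambda>x. indicator S' x * ennreal ((g (x + z $ 2 *\<^sub>R e2) - g x)\<^sup>2)"]) measurable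
    also have "\<dots> \<le> ennreal ((z $ 2)\<^sup>2) * D2"
      unfolding D2_def e2_def
    proof (rule wpd_shift_L2[OF w2])
      show "x + (t * z $ 2) *\<^sub>R axis 2 1 \<in> Q" if "x \<in> S'" "0 \<le> t" "t \<le> 1" for x t
        using that mid[of b "x $ 2" "b + L" "z $ 2" t] e
        unfolding S_def S'_def Q_def sq_def e2_def[symmetric] by auto
    qed measurable
    also have "\<dots> \<le> ennreal (L\<^sup>2) * D2" using zL by (intro mult_right_mono ennreal_leI) auto
    finally show ?thesis .
  qed
  have pw: "indicator Q x * indicator Q (x + z) * ennreal ((g (x + z) - g x)\<^sup>2)
     \<le> 2 * (indicator S x * ennreal ((g (x + z $ 1 *\<^sub>R e1) - g x)\<^sup>2))
       + 2 * (indicator S x * ennreal ((g (x + z) - g (x + z $ 1 *\<^sub>R e1))\<^sup>2))" for x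
  proof (cases "x \<in> S")
    case True
    have "(g (x + z) - g x)\<^sup>2 \<le> 2 * (g (x + z $ 1 *\<^sub>R e1) - g x)\<^sup>2 + 2 * (g (x + z) - g (x + z $ 1 *\<^sub>R e1))\<^sup>2"
      using sum_squares_bound[of "g (x + z $ 1 *\<^sub>R e1) - g x" "g (x + z) - g (x + z $ 1 *\<^sub>R e1)"]
      by (simp add: power2_eq_square algebra_simps)
    then have "ennreal ((g (x + z) - g x)\<^sup>2) \<le> ennreal (2 * (g (x + z $ 1 *\<^sub>R e1) - g x)\<^sup>2 + 2 * (g (x + z) - g (x + z $ 1 *\<^sub>R e1))\<^sup>2)"
      by (rule ennreal_leI)
    then show ?thesis using True by (simp add: S_def ennreal_plus ennreal_mult')
  next
    case False
    then show ?thesis by (auto simp: S_def indicator_def)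
  qed
  have "(\<integral>\<^sup>+x. indicator Q x * indicator Q (x + z) * ennreal ((g (x + z) - g x)\<^sup>2) \<partial>lborel)
     \<le> (\<integral>\<^sup>+x. 2 * (indicator S x * ennreal ((g (x + z $ 1 *\<^sub>R e1) - g x)\<^sup>2))
       + 2 * (indicator S x * ennreal ((g (x + z) - g (x + z $ 1 *\<^sub>R e1))\<^sup>2)) \<partial>lborel)"
    by (intro nn_integral_mono pw)
  also have "\<dots> = 2 * (\<integral>\<^sup>+x. indicator S x * ennreal ((g (x + z $ 1 *\<^sub>R e1) - g x)\<^sup>2) \<partial>lborel)
       + 2 * (\<integral>\<^sup>+x. indicator S x * ennreal ((g (x + z) - g (x + z $ 1 *\<^sub>R e1))\<^sup>2) \<partial>lborel)"
    by (subst nn_integral_add) (auto simp: nn_integral_cmult)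
  also have "\<dots> \<le> 2 * (ennreal (L\<^sup>2) * D1) + 2 * (ennreal (L\<^sup>2) * D2)"
    by (intro add_mono mult_left_mono A B) auto
  also have "\<dots> = ennreal (2 * L\<^sup>2) * (D1 + D2)"
    by (simp add: ennreal_mult' distrib_left mult.assoc)
  also have "D1 + D2 = (\<integral>\<^sup>+x. indicator Q x * ennreal ((h1 x)\<^sup>2 + (h2 x)\<^sup>2) \<partial>lborel)"
    unfolding D1_def D2_def by (subst nn_integral_add[symmetric]) (auto simp: ennreal_plus distrib_left)
  finally show ?thesis using True unfolding Q_def by simp
qed

text \<open>Poincare's inequality without mean values. Substituting y = x + z and integrating the
  increment bound over the admissible z multiplies 2 L^2 by the area (2 L)^2, which gives the
  constant 8 L^4.\<close>

lemma poincare_sq: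
  assumes w1: "wpd 1 g h1" and w2: "wpd 2 g h2" and L: "L > 0"
  shows "(\<integral>\<^sup>+x. \<integral>\<^sup>+y. indicator (sq a b L) x * indicator (sq a b L) y * ennreal ((g y - g x)\<^sup>2) \<partial>lborel \<partial>lborel)
    \<le> ennreal (8 * L ^ 4) * (\<integral>\<^sup>+x. indicator (sq a b L) x * ennreal ((h1 x)\<^sup>2 + (h2 x)\<^sup>2) \<partial>lborel)"
proof -
  define Q where "Q = sq a b L"
  have [measurable]: "Q \<in> sets borel" unfolding Q_def by measurable
  have [measurable]: "g \<in> borel_measurable borel"
    using wpdD(1,2)[OF w1] wpdD(1,2)[OF w2] by measurable
  define D where "D = (\<integral>\<^sup>+x. indicator Q x * ennreal ((h1 x)\<^sup>2 + (h2 x)\<^sup>2) \<partial>lborel)"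
  have "(\<integral>\<^sup>+x. \<integral>\<^sup>+y. indicator Q x * indicator Q y * ennreal ((g y - g x)\<^sup>2) \<partial>lborel \<partial>lborel)
    = (\<integral>\<^sup>+x. \<integral>\<^sup>+z. indicator Q x * indicator Q (x + z) * ennreal ((g (x + z) - g x)\<^sup>2) \<partial>lborel \<partial>lborel)"
    using nn_integral_shift[of "\<lambda>y. indicator Q x * indicator Q y * ennreal ((g y - g x)\<^sup>2)" x for x]
    by (simp add: add.commute)
  also have "\<dots> = (\<integral>\<^sup>+z. \<integral>\<^sup>+x. indicator Q x * indicator Q (x + z) * ennreal ((g (x + z) - g x)\<^sup>2) \<partial>lborel \<partial>lborel)"
    by (rule lborel_pair.Fubini') measurable
  also have "\<dots> \<le> (\<integral>\<^sup>+z. indicator (sq (-L) (-L) (2 * L)) z * ennreal (2 * L\<^sup>2) * D \<partial>lborel)"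
    unfolding D_def Q_def by (intro nn_integral_mono wpd_increment_L2[OF assms])
  also have "\<dots> = ennreal ((2 * L)\<^sup>2) * (ennreal (2 * L\<^sup>2) * D)"
    using L by (simp add: mult.assoc nn_integral_multc emeasure_sq)
  also have "\<dots> = ennreal (8 * L ^ 4) * D"
    by (simp add: mult.assoc[symmetric] ennreal_mult'[symmetric] power2_eq_square eval_nat_numeral)
  finally show ?thesis unfolding Q_def D_def .
qed

lemma sq_subset_cball: "sq a b L \<subseteq> cball 0 (\<bar>a\<bar> + \<bar>b\<bar> + 2 * \<bar>L\<bar>)"
proof
  fix x assume x: "x \<in> sq a b L"
  have "norm x \<le> \<bar>x $ 1\<bar> + \<bar>x $ 2\<bar>"
    using norm_le_l1_cart[of x] by (simp add: sum_2)
  also have "\<dots> \<le> \<bar>a\<bar> + \<bar>b\<bar> + 2 * \<bar>L\<bar>" using x by (auto simp: sq_def)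
  finally show "x \<in> cball 0 (\<bar>a\<bar> + \<bar>b\<bar> + 2 * \<bar>L\<bar>)" by simp
qed

lemma cball_subset_sq: "r < R \<Longrightarrow> cball 0 r \<subseteq> sq (-R) (-R) (2 * R)"
proof
  fix x :: "real^2" assume "r < R" "x \<in> cball 0 r"
  then have "\<bar>x $ 1\<bar> < R" "\<bar>x $ 2\<bar> < R"
    using component_le_norm_cart[of x 1] component_le_norm_cart[of x 2] by auto
  then show "x \<in> sq (-R) (-R) (2 * R)" by (auto simp: sq_def)
qed

lemma locL2_sq_finite:
  assumes "locL2 g"
  shows "(\<integral>\<^sup>+x. indicator (sq a b L) x * ennreal ((g x)\<^sup>2) \<partial>lborel) < \<infinity>"
proof -
  define R where "R = \<bar>a\<bar> + \<bar>b\<bar> + 2 * \<bar>L\<bar>"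
  have "(\<integral>\<^sup>+x. indicator (sq a b L) x * ennreal ((g x)\<^sup>2) \<partial>lborel)
     \<le> (\<integral>\<^sup>+x. ennreal (norm (indicator (cball 0 R) x * (g x)\<^sup>2)) \<partial>lborel)"
    using sq_subset_cball[of a b L] unfolding R_def by (intro nn_integral_mono) (auto simp: indicator_def)
  also have "\<dots> < \<infinity>"
    using assms unfolding locL2_def integrable_iff_bounded by blast
  finally show ?thesis .
qed

text \<open>The double integral of squared increments is finite, so for almost every base point the
  inner integral is finite. The square has positive measure and therefore contains such a base
  point; comparing g with its value there proves square integrability from local integrability
  alone.\<close>

lemma wpd_locL2:
  assumes w1: "wpd 1 g h1" and w2: "wpd 2 g h2" and h1: "locL2 h1" and h2: "locL2 h2"
  shows "locL2 g"
  unfolding locL2_def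
proof (intro conjI allI)
  show [measurable]: "g \<in> borel_measurable borel" using wpdD(1)[OF w1] by measurable
  have [measurable]: "h1 \<in> borel_measurable borel" "h2 \<in> borel_measurable borel" using h1 h2 by measurable
  fix r :: real
  define R where "R = \<bar>r\<bar> + 1"
  define Q where "Q = sq (-R) (-R) (2 * R)"
  have R: "R > 0" "r < R" unfolding R_def by auto
  have Q: "cball 0 r \<subseteq> Q" unfolding Q_def by (rule cball_subset_sq[OF R(2)])
  have [measurable]: "Q \<in> sets borel" unfolding Q_def by measurable
  have emQ: "emeasure lborel Q = ennreal ((2 * R)\<^sup>2)" unfolding Q_def using R by (simp add: emeasure_sq)
  have "(\<integral>\<^sup>+x. indicator Q x * ennreal ((h1 x)\<^sup>2 + (h2 x)\<^sup>2) \<partial>lborel) =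
     (\<integral>\<^sup>+x. indicator Q x * ennreal ((h1 x)\<^sup>2) \<partial>lborel) + (\<integral>\<^sup>+x. indicator Q x * ennreal ((h2 x)\<^sup>2) \<partial>lborel)"
    by (subst nn_integral_add[symmetric]) (auto simp: ennreal_plus distrib_left)
  also have "\<dots> < \<infinity>" using locL2_sq_finite[OF h1] locL2_sq_finite[OF h2] unfolding Q_def by simp
  finally have D: "ennreal (8 * (2 * R) ^ 4) * (\<integral>\<^sup>+x. indicator Q x * ennreal ((h1 x)\<^sup>2 + (h2 x)\<^sup>2) \<partial>lborel) < \<infinity>"
    by (simp add: ennreal_mult_less_top)
  have "(\<integral>\<^sup>+x. \<integral>\<^sup>+y. indicator Q x * indicator Q y * ennreal ((g y - g x)\<^sup>2) \<partial>lborel \<partial>lborel) < \<infinity>"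
    unfolding Q_def by (rule le_less_trans[OF poincare_sq[OF w1 w2] D[unfolded Q_def]]) (use R in auto)
  then have ae: "AE x in lborel. (\<integral>\<^sup>+y. indicator Q x * indicator Q y * ennreal ((g y - g x)\<^sup>2) \<partial>lborel) \<noteq> \<infinity>"
    by (intro nn_integral_noteq_infinite) auto
  have "\<exists>x\<in>Q. (\<integral>\<^sup>+y. indicator Q x * indicator Q y * ennreal ((g y - g x)\<^sup>2) \<partial>lborel) \<noteq> \<infinity>"
  proof (rule ccontr)
    assume "\<not> ?thesis"
    with ae have "AE x in lborel. x \<notin> Q" by (auto elim: eventually_mono)
    then have "emeasure lborel Q = 0" by (subst (asm) AE_iff_measurable[of Q]) auto
    then show False using emQ R by simp
  qed
  then obtain x0 where x0: "x0 \<in> Q" "(\<integral>\<^sup>+y. indicator Q y * ennreal ((g y - g x0)\<^sup>2) \<partial>lborel) < \<infinity>"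
    by (auto simp: top.not_eq_extremum)
  have pw: "indicator (cball 0 r) y * ennreal ((g y)\<^sup>2)
     \<le> 2 * (indicator Q y * ennreal ((g y - g x0)\<^sup>2)) + ennreal (2 * (g x0)\<^sup>2) * indicator Q y" for y
  proof (cases "y \<in> cball 0 r")
    case True
    then have "y \<in> Q" using Q by blast
    have "(g y)\<^sup>2 \<le> 2 * (g y - g x0)\<^sup>2 + 2 * (g x0)\<^sup>2"
      using zero_le_power2[of "g y - 2 * g x0"] by (simp add: power2_eq_square algebra_simps)
    then have "ennreal ((g y)\<^sup>2) \<le> ennreal (2 * (g y - g x0)\<^sup>2 + 2 * (g x0)\<^sup>2)" by (rule ennreal_leI)
    then show ?thesis using True \<open>y \<in> Q\<close> by (simp add: ennreal_plus ennreal_mult')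
  qed simp
  have "(\<integral>\<^sup>+y. indicator (cball 0 r) y * ennreal ((g y)\<^sup>2) \<partial>lborel) \<le>
    (\<integral>\<^sup>+y. 2 * (indicator Q y * ennreal ((g y - g x0)\<^sup>2)) + ennreal (2 * (g x0)\<^sup>2) * indicator Q y \<partial>lborel)"
    by (intro nn_integral_mono pw)
  also have "\<dots> = 2 * (\<integral>\<^sup>+y. indicator Q y * ennreal ((g y - g x0)\<^sup>2) \<partial>lborel) + ennreal (2 * (g x0)\<^sup>2) * emeasure lborel Q"
    by (subst nn_integral_add) (auto simp: nn_integral_cmult)
  also have "\<dots> < \<infinity>" using x0(2) emQ by (simp add: ennreal_mult_less_top)
  finally have fin: "(\<integral>\<^sup>+y. indicator (cball 0 r) y * ennreal ((g y)\<^sup>2) \<partial>lborel) < \<infinity>" .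
  show "integrable lborel (\<lambda>x. indicator (cball 0 r) x * (g x)\<^sup>2)"
  proof (rule integrableI_nonneg)
    show "(\<integral>\<^sup>+x. ennreal (indicator (cball 0 r) x * (g x)\<^sup>2) \<partial>lborel) < \<infinity>"
      using fin by (simp add: ennreal_mult' ennreal_indicator)
  qed auto
qed

section \<open>Mollification and the weak Jacobian\<close>

text \<open>The parameter r is the square of the radius of the support. Working with the squared
  norm keeps the argument polynomial, hence smooth at the origin, and makes each partial derivative
  a coordinate times another radial bump.\<close>

definition rbump :: "real poly \<Rightarrow> real \<Rightarrow> real^2 \<Rightarrow> real" where
  "rbump q r x = flat q (r - ((x $ 1)\<^sup>2 + (x $ 2)\<^sup>2))"

lemma norm_sq_2: "(norm x)\<^sup>2 = (x $ 1)\<^sup>2 + (x $ (2::2))\<^sup>2" for x :: "real^2"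
  by (simp add: norm_vec_def L2_set_def sum_2)

lemma smooth_rbump [intro]: "smooth_fun (rbump q r)"
  unfolding rbump_def by (intro smooth_flat smooth_diff smooth_const smooth_add smooth_power smooth_coord)

lemma rbump_support:
  assumes "r \<le> R\<^sup>2" "R \<le> norm x" "0 \<le> R" shows "rbump q r x = 0"
proof -
  have "R\<^sup>2 \<le> (norm x)\<^sup>2" using assms by (intro power_mono) auto
  then show ?thesis using assms by (auto simp: rbump_def flat_def norm_sq_2)
qed

lemma test_function_rbump [intro]: "test_function (rbump q r)"
proof (rule test_functionI[of _ "\<bar>r\<bar> + 1"])
  have "(\<bar>r\<bar> + 1)\<^sup>2 = r\<^sup>2 + 2 * \<bar>r\<bar> + 1" by (simp add: power2_sum)
  then have "r \<le> (\<bar>r\<bar> + 1)\<^sup>2" using zero_le_power2[of r] abs_ge_self[of r] abs_ge_zero[of r] by linarith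
  then show "rbump q r x = 0" if "\<bar>r\<bar> + 1 < norm x" for x
    using that by (intro rbump_support[of r "\<bar>r\<bar> + 1"]) auto
qed auto

lemma partial_deriv_rbump: "partial_deriv j (rbump q r) = (\<lambda>x. - 2 * x $ j * rbump (flat_deriv q) r x)"
proof
  fix x :: "real^2"
  have s: "smooth_fun (\<lambda>x::real^2. r - ((x $ 1)\<^sup>2 + (x $ 2)\<^sup>2))"
    by (intro smooth_diff smooth_const smooth_add smooth_power smooth_coord)
  have "((\<lambda>x::real^2. r - ((x $ 1)\<^sup>2 + (x $ 2)\<^sup>2)) has_derivative
     (\<lambda>v. - (2 * x $ 1 * v $ 1 + 2 * x $ 2 * v $ 2))) (at x)"
    by (auto intro!: derivative_eq_intros has_derivative_coord simp: fun_eq_iff)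
  from partial_deriv_eqI[OF this, of j]
  have "partial_deriv j (\<lambda>x::real^2. r - ((x $ 1)\<^sup>2 + (x $ 2)\<^sup>2)) x = - 2 * x $ j"
    using exhaust_2[of j] by (auto simp: axis_nth_2)
  then show "partial_deriv j (rbump q r) x = - 2 * x $ j * rbump (flat_deriv q) r x"
    using partial_deriv_flat_comp[OF smooth_fun_differentiable[OF s], where j=j and q=q]
    by (simp add: rbump_def[abs_def])
qed

text \<open>Second derivatives commute here because the mixed ones are explicit: off the diagonal
  they equal 4 \<open>x $ i * x $ j\<close> times one and the same radial bump. Through the
  mollifiers this supplies the symmetry on which the Jacobian identity rests.\<close>

lemma partial_deriv_rbump_commute:
  "partial_deriv i (partial_deriv j (rbump q r)) = partial_deriv j (partial_deriv i (rbump q r))"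
proof (cases "i = j")
  case False
  have "partial_deriv i (partial_deriv j (rbump q r)) x = 4 * x $ i * x $ j * rbump (flat_deriv (flat_deriv q)) r x"
    if "i \<noteq> j" for i j x
  proof -
    have d: "(\<lambda>x::real^2. -2 * x $ j) differentiable (at x)"
      by (intro smooth_fun_differentiable smooth_mult smooth_const smooth_coord)
    have "partial_deriv i (\<lambda>x::real^2. -2 * x $ j) x = 0"
      using partial_deriv_mult[of "\<lambda>x::real^2. -2" x "\<lambda>x. x $ j" i] that
      by (simp add: smooth_fun_differentiable axis_def)
    then show ?thesis
      using partial_deriv_mult[OF d smooth_fun_differentiable[OF smooth_rbump], of i "flat_deriv q" r]
      by (simp add: partial_deriv_rbump)
  qed
  from this[OF False] this[OF False[symmetric]] show ?thesis by (auto simp: fun_eq_iff)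
qed simp

lemma rbump_nonneg: "0 \<le> rbump 1 r x"
  by (simp add: rbump_def flat_one_bounds)

lemma integral_pos_ball:
  fixes h :: "real^2 \<Rightarrow> real"
  assumes i: "integrable lborel h" and nn: "\<And>x. 0 \<le> h x" and r: "r > 0" and pos: "\<And>x. x \<in> ball c r \<Longrightarrow> 0 < h x"
  shows "0 < (\<integral>x. h x \<partial>lborel)"
proof -
  have "(\<integral>x. h x \<partial>lborel) \<noteq> 0"
  proof
    assume "(\<integral>x. h x \<partial>lborel) = 0"
    then have ae: "AE x in lborel. h x = 0"
      using integral_nonneg_eq_0_iff_AE[OF i] nn by auto
    have "AE x in lborel. x \<notin> ball c r" using ae
      by eventually_elim (use pos in force)
    then have "emeasure lborel (ball c r) = 0"
      by (subst (asm) AE_iff_measurable[of "ball c r"]) auto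
    then have "measure lborel (ball c r) = 0" by (simp add: measure_def)
    moreover have "measure lborel (ball c r) > 0"
      using content_ball_pos[OF r, of c] by simp
    ultimately show False by simp
  qed
  moreover have "(\<integral>x. h x \<partial>lborel) \<ge> 0" by (intro Bochner_Integration.integral_nonneg nn)
  ultimately show ?thesis by simp
qed

lemma rbump_integral_pos:
  assumes "r > 0" shows "0 < (\<integral>x. rbump 1 r x \<partial>lborel)"
proof (rule integral_pos_ball)
  show "integrable lborel (rbump 1 r)" by (intro integrable_test test_function_rbump)
  show "0 < rbump 1 r x" if "x \<in> ball 0 (sqrt r)" for x
  proof -
    have "(norm x)\<^sup>2 < (sqrt r)\<^sup>2" using that assms by (intro power_strict_mono) auto
    then show ?thesis using assms by (simp add: rbump_def flat_one norm_sq_2)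
  qed
qed (use assms rbump_nonneg in auto)

text \<open>Each radius has its own normalised bump instead of a dilate of a fixed kernel; mass one,
  evenness and support in radius r are what the limit uses.\<close>

definition mollifier :: "real \<Rightarrow> real^2 \<Rightarrow> real" where
  "mollifier r x = inverse (\<integral>x. rbump 1 (r\<^sup>2) x \<partial>lborel) * rbump 1 (r\<^sup>2) x"

lemma partial_deriv_cmult: "smooth_fun f \<Longrightarrow> partial_deriv j (\<lambda>x. c * f x) = (\<lambda>x. c * partial_deriv j f x)"
  using partial_deriv_mult[of "\<lambda>x. c" _ f j] by (simp add: smooth_fun_differentiable fun_eq_iff)

lemma mollifier:
  assumes "r > 0"
  shows "test_function (mollifier r)" "0 \<le> mollifier r x" "(\<integral>x. mollifier r x \<partial>lborel) = 1"
    "r \<le> norm x \<Longrightarrow> mollifier r x = 0"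
    "partial_deriv 1 (partial_deriv 2 (mollifier r)) = partial_deriv 2 (partial_deriv 1 (mollifier r))"
proof -
  have p: "(\<integral>x. rbump 1 (r\<^sup>2) x \<partial>lborel) > 0" using assms by (intro rbump_integral_pos) auto
  show "test_function (mollifier r)"
    using test_function_mult[OF test_function_rbump smooth_const]
    unfolding mollifier_def[abs_def] by (subst mult.commute)
  show "0 \<le> mollifier r x" unfolding mollifier_def using p rbump_nonneg by simp
  show "(\<integral>x. mollifier r x \<partial>lborel) = 1" unfolding mollifier_def using p by simp
  show "r \<le> norm x \<Longrightarrow> mollifier r x = 0" using assms by (simp add: mollifier_def rbump_support[of "r\<^sup>2" r])
  show "partial_deriv 1 (partial_deriv 2 (mollifier r)) = partial_deriv 2 (partial_deriv 1 (mollifier r))"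
    unfolding mollifier_def[abs_def]
    by (simp add: partial_deriv_cmult smooth_rbump smooth_fun_partial partial_deriv_rbump_commute[of 1 2])
qed

section \<open>Continuity of translations in L^1\<close>

definition translation_continuous :: "(real^2 \<Rightarrow> real) \<Rightarrow> bool" where
  "translation_continuous f \<longleftrightarrow> (\<forall>z. z \<longlonglongrightarrow> 0 \<longrightarrow> (\<lambda>n. \<integral>x. \<bar>f (x + z n) - f x\<bar> \<partial>lborel) \<longlonglongrightarrow> 0)"

lemma integral_abs_shift_le:
  assumes f: "integrable lborel f" and g: "integrable lborel (g :: real^2 \<Rightarrow> real)"
  shows "(\<integral>x. \<bar>f (x + z) - f x\<bar> \<partial>lborel) \<le> (\<integral>x. \<bar>g (x + z) - g x\<bar> \<partial>lborel) + 2 * (\<integral>x. \<bar>f x - g x\<bar> \<partial>lborel)"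
proof -
  have [measurable]: "f \<in> borel_measurable borel" "g \<in> borel_measurable borel"
    using f g by (auto dest: borel_measurable_integrable)
  have fz: "integrable lborel (\<lambda>x. f (x + z))" and gz: "integrable lborel (\<lambda>x. g (x + z))"
    using f g by (auto simp: integrable_shift)
  have "(\<integral>x. \<bar>f (x + z) - f x\<bar> \<partial>lborel) \<le>
     (\<integral>x. \<bar>g (x + z) - g x\<bar> + (\<bar>f (x + z) - g (x + z)\<bar> + \<bar>f x - g x\<bar>) \<partial>lborel)"
    by (intro integral_mono) (use f g fz gz in \<open>auto\<close>)
  also have "\<dots> = (\<integral>x. \<bar>g (x + z) - g x\<bar> \<partial>lborel) + ((\<integral>x. \<bar>f (x + z) - g (x + z)\<bar> \<partial>lborel) + (\<integral>x. \<bar>f x - g x\<bar> \<partial>lborel))"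
    using f g fz gz by (subst Bochner_Integration.integral_add) auto
  also have "(\<integral>x. \<bar>f (x + z) - g (x + z)\<bar> \<partial>lborel) = (\<integral>x. \<bar>f x - g x\<bar> \<partial>lborel)"
    by (rule integral_shift[of "\<lambda>x. \<bar>f x - g x\<bar>"]) auto
  finally show ?thesis by simp
qed

lemma translation_continuous_approx:
  assumes f: "integrable lborel f"
    and approx: "\<And>e. e > 0 \<Longrightarrow> \<exists>g. integrable lborel g \<and> translation_continuous g \<and> (\<integral>x. \<bar>f x - g x\<bar> \<partial>lborel) \<le> e"
  shows "translation_continuous f"
  unfolding translation_continuous_def
proof (intro allI impI LIMSEQ_I)
  fix z :: "nat \<Rightarrow> real^2" and e :: real assume z: "z \<longlonglongrightarrow> 0" and e: "0 < e"
  obtain g where g: "integrable lborel g" "translation_continuous g" "(\<integral>x. \<bar>f x - g x\<bar> \<partial>lborel) \<le> e / 4"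
    using approx[of "e / 4"] e by auto
  have "(\<lambda>n. \<integral>x. \<bar>g (x + z n) - g x\<bar> \<partial>lborel) \<longlonglongrightarrow> 0"
    using g(2) z by (simp add: translation_continuous_def)
  from LIMSEQ_D[OF this, of "e / 2"] e
  obtain N where N: "\<And>n. n \<ge> N \<Longrightarrow> norm ((\<integral>x. \<bar>g (x + z n) - g x\<bar> \<partial>lborel) - 0) < e / 2"
    by auto
  show "\<exists>N. \<forall>n\<ge>N. norm ((\<integral>x. \<bar>f (x + z n) - f x\<bar> \<partial>lborel) - 0) < e"
  proof (intro exI allI impI)
    fix n assume "N \<le> n"
    then have "(\<integral>x. \<bar>g (x + z n) - g x\<bar> \<partial>lborel) < e / 2" using N by fastforce
    moreover have "0 \<le> (\<integral>x. \<bar>f (x + z n) - f x\<bar> \<partial>lborel)" by simp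
    ultimately show "norm ((\<integral>x. \<bar>f (x + z n) - f x\<bar> \<partial>lborel) - 0) < e"
      using integral_abs_shift_le[OF f g(1), of "z n"] g(3) by simp
  qed
qed

text \<open>A translation preserves measure, so only the points that leave the open set count,
  and dominated convergence applies to these.\<close>

lemma translation_continuous_open:
  assumes "open U" "emeasure lborel U < \<infinity>"
  shows "translation_continuous (indicator U)"
  unfolding translation_continuous_def
proof (intro allI impI)
  fix z :: "nat \<Rightarrow> real^2" assume z: "z \<longlonglongrightarrow> 0"
  have [measurable]: "U \<in> sets borel" using assms by simp
  have i: "integrable lborel (indicat_real U)" using assms by (intro integrable_real_indicator) auto
  have iz: "integrable lborel (\<lambda>x. indicat_real U (x + z n))" for n
    using i by (subst integrable_shift) auto
  have "(\<lambda>n. \<integral>x. 2 * max 0 (indicat_real U x - indicator U (x + z n)) \<partial>lborel) \<longlonglongrightarrow> (\<integral>x. 0 \<partial>(lborel :: (real^2) measure))"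
  proof (rule integral_dominated_convergence)
    show "integrable lborel (\<lambda>x. 2 * indicat_real U x)" using i by auto
    show "AE x in lborel. (\<lambda>n. 2 * max 0 (indicat_real U x - indicator U (x + z n))) \<longlonglongrightarrow> 0"
    proof (rule AE_I2)
      fix x
      have "eventually (\<lambda>n. 0 = 2 * max 0 (indicat_real U x - indicator U (x + z n))) sequentially"
      proof (cases "x \<in> U")
        case True
        have "(\<lambda>n. x + z n) \<longlonglongrightarrow> x + 0" by (intro tendsto_intros z)
        then have "eventually (\<lambda>n. x + z n \<in> U) sequentially"
          using assms(1) True by (simp add: topological_tendstoD)
        then show ?thesis by eventually_elim (use True in simp)
      qed (simp add: max_def indicator_def)
      then show "(\<lambda>n. 2 * max 0 (indicat_real U x - indicator U (x + z n))) \<longlonglongrightarrow> 0"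
        by (rule Lim_transform_eventually[OF tendsto_const])
    qed
  qed (auto simp: max_def indicator_def)
  moreover have "(\<integral>x. 2 * max 0 (indicat_real U x - indicator U (x + z n)) \<partial>lborel) =
     (\<integral>x. \<bar>indicat_real U (x + z n) - indicator U x\<bar> \<partial>lborel)" for n
  proof -
    have "2 * max 0 (indicat_real U x - indicator U (x + z n)) =
      \<bar>indicat_real U (x + z n) - indicator U x\<bar> - indicator U (x + z n) + indicator U x" for x
      by (auto simp: max_def indicator_def)
    then show ?thesis using i iz[of n] integral_shift[of "indicat_real U" "z n"] by simp
  qed
  ultimately show "(\<lambda>n. \<integral>x. \<bar>indicat_real U (x + z n) - indicator U x\<bar> \<partial>lborel) \<longlonglongrightarrow> 0"
    by (simp only: Bochner_Integration.integral_zero)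
qed

lemma translation_continuous_add:
  assumes "integrable lborel f" "translation_continuous f" "integrable lborel g" "translation_continuous g"
  shows "translation_continuous (\<lambda>x. f x + g x)"
  unfolding translation_continuous_def
proof (intro allI impI)
  fix z :: "nat \<Rightarrow> real^2" assume z: "z \<longlonglongrightarrow> 0"
  have [measurable]: "f \<in> borel_measurable borel" "g \<in> borel_measurable borel"
    using assms by (auto dest: borel_measurable_integrable)
  have i: "integrable lborel (\<lambda>x. f (x + z n))" "integrable lborel (\<lambda>x. g (x + z n))" for n
    using assms by (auto simp: integrable_shift)
  have "(\<lambda>n. (\<integral>x. \<bar>f (x + z n) - f x\<bar> \<partial>lborel) + (\<integral>x. \<bar>g (x + z n) - g x\<bar> \<partial>lborel)) \<longlonglongrightarrow> 0 + 0"
    using assms(2,4) z unfolding translation_continuous_def by (intro tendsto_add) auto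
  then have lim: "(\<lambda>n. (\<integral>x. \<bar>f (x + z n) - f x\<bar> \<partial>lborel) + (\<integral>x. \<bar>g (x + z n) - g x\<bar> \<partial>lborel)) \<longlonglongrightarrow> 0" by simp
  have le: "(\<integral>x. \<bar>f (x + z n) + g (x + z n) - (f x + g x)\<bar> \<partial>lborel)
     \<le> (\<integral>x. \<bar>f (x + z n) - f x\<bar> \<partial>lborel) + (\<integral>x. \<bar>g (x + z n) - g x\<bar> \<partial>lborel)" for n
  proof -
    have "(\<integral>x. \<bar>f (x + z n) + g (x + z n) - (f x + g x)\<bar> \<partial>lborel)
      \<le> (\<integral>x. \<bar>f (x + z n) - f x\<bar> + \<bar>g (x + z n) - g x\<bar> \<partial>lborel)"
      using assms i by (intro integral_mono) auto
    then show ?thesis using assms i by simp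
  qed
  show "(\<lambda>n. \<integral>x. \<bar>f (x + z n) + g (x + z n) - (f x + g x)\<bar> \<partial>lborel) \<longlonglongrightarrow> 0"
    by (rule tendsto_sandwich[OF _ _ tendsto_const lim]) (auto simp: le)
qed

lemma translation_continuous_cmult:
  assumes "translation_continuous f" shows "translation_continuous (\<lambda>x. f x * c)"
  unfolding translation_continuous_def
proof (intro allI impI)
  fix z :: "nat \<Rightarrow> real^2" assume "z \<longlonglongrightarrow> 0"
  then have "(\<lambda>n. (\<integral>x. \<bar>f (x + z n) - f x\<bar> \<partial>lborel) * \<bar>c\<bar>) \<longlonglongrightarrow> 0 * \<bar>c\<bar>"
    using assms unfolding translation_continuous_def by (intro tendsto_intros) auto
  then show "(\<lambda>n. \<integral>x. \<bar>f (x + z n) * c - f x * c\<bar> \<partial>lborel) \<longlonglongrightarrow> 0"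
    by (simp add: left_diff_distrib[symmetric] abs_mult)
qed

text \<open>Indicators of open sets are handled directly, those of Borel sets by outer regularity,
  sums by the triangle inequality, and dominated limits by L^1 approximation, in step with the
  induction rule for integrable functions.\<close>

lemma translation_continuous_integrable:
  assumes "integrable lborel f" shows "translation_continuous f"
  using assms
proof (induction rule: integrable_induct)
  case (base A c)
  have A: "A \<in> sets borel" "emeasure lborel A < \<infinity>" using base by auto
  have [measurable]: "A \<in> sets borel" by fact
  have iA: "integrable lborel (indicat_real A)" using A by (intro integrable_real_indicator) auto
  have "translation_continuous (indicat_real A)"
  proof (rule translation_continuous_approx[OF iA])
    fix e :: real assume e: "e > 0"
    obtain U where U: "open U" "A \<subseteq> U" "emeasure lborel (U - A) < e"
      using outer_regular_lborel[OF A(1) e] by blast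
    have "emeasure lborel U \<le> emeasure lborel A + emeasure lborel (U - A)"
      using U A by (subst plus_emeasure) (auto simp: Un_absorb1)
    also have "\<dots> < \<infinity>" using A(2) U(3) by (simp add: less_top order_less_trans[OF U(3)])
    finally have fU: "emeasure lborel U < \<infinity>" .
    have iU: "integrable lborel (indicat_real U)" using U fU by (intro integrable_real_indicator) auto
    have "(\<integral>x. \<bar>indicat_real A x - indicator U x\<bar> \<partial>lborel) = (\<integral>x. indicat_real (U - A) x \<partial>lborel)"
      using U(2) by (intro Bochner_Integration.integral_cong) (auto simp: indicator_def)
    also have "\<dots> \<le> e" using U(3) e by (simp add: measure_def enn2real_leI)
    finally show "\<exists>g. integrable lborel g \<and> translation_continuous g \<and> (\<integral>x. \<bar>indicat_real A x - g x\<bar> \<partial>lborel) \<le> e"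
      using iU translation_continuous_open[OF U(1) fU] by blast
  qed
  from translation_continuous_cmult[OF this, of c] show ?case by simp
next
  case (add f g)
  then show ?case by (intro translation_continuous_add)
next
  case (lim f s)
  have [measurable]: "f \<in> borel_measurable borel" "\<And>i. s i \<in> borel_measurable borel"
    using lim by (auto dest: borel_measurable_integrable)
  show ?case
  proof (rule translation_continuous_approx[OF lim(4)])
    fix e :: real assume e: "e > 0"
    have "(\<lambda>i. \<integral>x. \<bar>f x - s i x\<bar> \<partial>lborel) \<longlonglongrightarrow> (\<integral>x. 0 \<partial>(lborel :: (real^2) measure))"
    proof (rule integral_dominated_convergence)
      \<comment> \<open>The induction rule provides simple functions bounded by twice the absolute
        value of f; the factor 3 adds f itself.\<close>
      show "integrable lborel (\<lambda>x. 3 * \<bar>f x\<bar>)" using lim(4) by auto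
      show "AE x in lborel. (\<lambda>i. \<bar>f x - s i x\<bar>) \<longlonglongrightarrow> 0"
      proof (rule AE_I2)
        fix x
        have "(\<lambda>i. \<bar>f x - s i x\<bar>) \<longlonglongrightarrow> \<bar>f x - f x\<bar>" using lim(2)[of x] by (intro tendsto_intros) auto
        then show "(\<lambda>i. \<bar>f x - s i x\<bar>) \<longlonglongrightarrow> 0" by simp
      qed
      show "AE x in lborel. norm \<bar>f x - s i x\<bar> \<le> 3 * \<bar>f x\<bar>" for i
        using lim(3)[of _ i] by (intro AE_I2) (smt (verit) space_lborel UNIV_I real_norm_def)
    qed auto
    from LIMSEQ_D[OF this e] obtain i where "(\<integral>x. \<bar>f x - s i x\<bar> \<partial>lborel) < e"
      by auto
    then show "\<exists>g. integrable lborel g \<and> translation_continuous g \<and> (\<integral>x. \<bar>f x - g x\<bar> \<partial>lborel) \<le> e"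
      using lim(1) lim(5) by (intro exI[of _ "s i"]) auto
  qed
qed

section \<open>Convolution and integration of the Jacobian by parts\<close>

definition conv :: "(real^2 \<Rightarrow> real) \<Rightarrow> (real^2 \<Rightarrow> real) \<Rightarrow> real^2 \<Rightarrow> real" where
  "conv \<eta> g x = (\<integral>y. g y * \<eta> (x - y) \<partial>lborel)"

lemma conv_integrable:
  assumes k: "integrable lborel k" "\<And>x. R < norm x \<Longrightarrow> k x = 0" and g: "locL1 g" and \<eta>: "test_function \<eta>"
  shows "integrable (lborel \<Otimes>\<^sub>M lborel) (\<lambda>(x, y). k x * (g y * \<eta> (x - y)))"
proof (rule lborel_product_integrableI)
  have [measurable]: "k \<in> borel_measurable borel" "g \<in> borel_measurable borel" "\<eta> \<in> borel_measurable borel"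
    using k(1) g \<eta> by (auto dest: borel_measurable_integrable)
  show "(\<lambda>z. k (fst z) * (g (snd z) * \<eta> (fst z - snd z))) \<in> borel_measurable (lborel \<Otimes>\<^sub>M lborel)"
    by measurable
  obtain S where S: "\<And>x. S < norm x \<Longrightarrow> \<eta> x = 0" using test_function_support[OF \<eta>] by blast
  obtain B where B: "B > 0" "\<And>x. \<bar>\<eta> x\<bar> \<le> B" using test_function_bounded[OF \<eta>] by blast
  define I where "I = (\<integral>\<^sup>+x. ennreal \<bar>B * (indicator (cball 0 (R + S)) x * g x)\<bar> \<partial>lborel)"
  have "integrable lborel (\<lambda>x. B * (indicator (cball 0 (R + S)) x * g x))"
    using locL1_integrable[OF g] by auto
  then have I: "I < \<infinity>"
    unfolding I_def integrable_iff_bounded real_norm_def by blast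
  have le: "\<bar>k x * (g y * \<eta> (x - y))\<bar> \<le> \<bar>k x\<bar> * \<bar>B * (indicator (cball 0 (R + S)) y * g y)\<bar>" for x y
  proof (cases "norm x \<le> R \<and> norm (x - y) \<le> S")
    case True
    then have "norm y \<le> R + S" using norm_triangle_ineq4[of x "x - y"] by simp
    then show ?thesis using mult_left_mono[OF B(2), of "\<bar>k x\<bar> * \<bar>g y\<bar>" "x - y"] B(1)
      by (simp add: abs_mult mult_ac)
  next
    case False
    then show ?thesis using k(2) S by (auto simp: not_le)
  qed
  have "(\<integral>\<^sup>+x. \<integral>\<^sup>+y. ennreal \<bar>k x * (g y * \<eta> (x - y))\<bar> \<partial>lborel \<partial>lborel)
    \<le> (\<integral>\<^sup>+x. \<integral>\<^sup>+y. ennreal (\<bar>k x\<bar> * \<bar>B * (indicator (cball 0 (R + S)) y * g y)\<bar>) \<partial>lborel \<partial>lborel)"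
    by (intro nn_integral_mono ennreal_leI le)
  also have "\<dots> = (\<integral>\<^sup>+x. ennreal \<bar>k x\<bar> * I \<partial>lborel)"
    unfolding I_def by (subst nn_integral_cmult[symmetric]) (auto simp: ennreal_mult')
  also have "\<dots> = (\<integral>\<^sup>+x. ennreal \<bar>k x\<bar> \<partial>lborel) * I"
    by (rule nn_integral_multc) measurable
  also have "\<dots> < \<infinity>"
    using k(1) I by (simp add: integrable_iff_bounded ennreal_mult_less_top)
  finally show "(\<integral>\<^sup>+x. \<integral>\<^sup>+y. ennreal \<bar>k x * (g y * \<eta> (x - y))\<bar> \<partial>lborel \<partial>lborel) < \<infinity>" .
qed

lemma
  assumes k: "integrable lborel k" "\<And>x. R < norm x \<Longrightarrow> k x = 0" and g: "locL1 g" and \<eta>: "test_function \<eta>"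
  shows conv_mult_integrable: "integrable lborel (\<lambda>x. k x * conv \<eta> g x)"
    and conv_mult_integrable': "integrable lborel (\<lambda>y. g y * (\<integral>x. k x * \<eta> (x - y) \<partial>lborel))"
    and conv_Fubini: "(\<integral>x. k x * conv \<eta> g x \<partial>lborel) = (\<integral>y. g y * (\<integral>x. k x * \<eta> (x - y) \<partial>lborel) \<partial>lborel)"
proof -
  note * = conv_integrable[OF assms]
  have 1: "(\<integral>y. k x * (g y * \<eta> (x - y)) \<partial>lborel) = k x * conv \<eta> g x" for x
    unfolding conv_def by simp
  have "(\<integral>x. k x * (g y * \<eta> (x - y)) \<partial>lborel) = (\<integral>x. g y * (k x * \<eta> (x - y)) \<partial>lborel)" for y
    by (simp only: mult.left_commute)
  then have 2: "(\<integral>x. k x * (g y * \<eta> (x - y)) \<partial>lborel) = g y * (\<integral>x. k x * \<eta> (x - y) \<partial>lborel)" for y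
    by simp
  show "integrable lborel (\<lambda>x. k x * conv \<eta> g x)"
    using lborel_pair.integrable_fst[OF *] by (simp only: prod.case 1)
  show "integrable lborel (\<lambda>y. g y * (\<integral>x. k x * \<eta> (x - y) \<partial>lborel))"
    using lborel_pair.integrable_snd[OF *] by (simp only: 2)
  show "(\<integral>x. k x * conv \<eta> g x \<partial>lborel) = (\<integral>y. g y * (\<integral>x. k x * \<eta> (x - y) \<partial>lborel) \<partial>lborel)"
    using lborel_pair.Fubini_integral[OF *] by (simp only: 1 2)
qed

text \<open>The function y to \<open>\<eta> (x - y)\<close> is itself a test function. Its
  reflection contributes a sign that cancels the one in the weak derivative.\<close>

lemma conv_partial:
  assumes w: "wpd j v b" and \<eta>: "test_function \<eta>"
  shows "conv (partial_deriv j \<eta>) v = conv \<eta> b"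
proof
  fix x
  have "(\<integral>y. v y * partial_deriv j (\<lambda>y. \<eta> (x - y)) y \<partial>lborel) = - (\<integral>y. b y * \<eta> (x - y) \<partial>lborel)"
    by (rule wpdD(3)[OF w test_function_reflect[OF \<eta>]])
  then show "conv (partial_deriv j \<eta>) v x = conv \<eta> b x"
    by (simp add: partial_deriv_reflect[OF test_function_smooth[OF \<eta>]] conv_def)
qed

lemma wpd_mult_test:
  assumes w: "wpd j u a" and \<psi>: "test_function \<psi>" and \<theta>: "smooth_fun \<theta>"
  shows "(\<integral>x. (\<psi> x * a x) * \<theta> x \<partial>lborel) =
    - (\<integral>x. (u x * partial_deriv j \<psi> x) * \<theta> x \<partial>lborel) - (\<integral>x. (u x * \<psi> x) * partial_deriv j \<theta> x \<partial>lborel)"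
proof -
  have t: "test_function (\<lambda>x. \<psi> x * \<theta> x)" by (rule test_function_mult[OF \<psi> \<theta>])
  have pd: "partial_deriv j (\<lambda>x. \<psi> x * \<theta> x) x = partial_deriv j \<psi> x * \<theta> x + \<psi> x * partial_deriv j \<theta> x" for x
    by (intro partial_deriv_mult smooth_fun_differentiable \<theta> test_function_smooth[OF \<psi>])
  have I: "integrable lborel (\<lambda>x. u x * (partial_deriv j \<psi> x * \<theta> x))"
    "integrable lborel (\<lambda>x. u x * (\<psi> x * partial_deriv j \<theta> x))"
    by (intro integrable_locL1_test wpdD(1)[OF w] test_function_mult test_function_partial \<psi> \<theta> smooth_fun_partial)+
  have "(\<integral>x. a x * (\<psi> x * \<theta> x) \<partial>lborel) = - (\<integral>x. u x * partial_deriv j (\<lambda>x. \<psi> x * \<theta> x) x \<partial>lborel)"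
    using wpdD(3)[OF w t] by simp
  also have "\<dots> = - ((\<integral>x. u x * (partial_deriv j \<psi> x * \<theta> x) \<partial>lborel) + (\<integral>x. u x * (\<psi> x * partial_deriv j \<theta> x) \<partial>lborel))"
    unfolding pd distrib_left using I by simp
  finally show ?thesis by (simp add: mult_ac)
qed

text \<open>Only v is mollified. Its derivatives are moved to the kernel, after which v appears
  undifferentiated under the y-integral and the inner x-integral can be integrated by parts for each
  fixed y.\<close>

lemma jacobian_conv:
  assumes u: "wpd 1 u a1" "wpd 2 u a2" and v: "wpd 1 v b1" "wpd 2 v b2"
    and \<psi>: "test_function \<psi>" and \<eta>: "test_function \<eta>"
    and sym: "partial_deriv 1 (partial_deriv 2 \<eta>) = partial_deriv 2 (partial_deriv 1 \<eta>)"
  shows "(\<integral>x. (\<psi> x * a1 x) * conv \<eta> b2 x \<partial>lborel) - (\<integral>x. (\<psi> x * a2 x) * conv \<eta> b1 x \<partial>lborel)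
    = - ((\<integral>x. (u x * partial_deriv 1 \<psi> x) * conv \<eta> b2 x \<partial>lborel)
        - (\<integral>x. (u x * partial_deriv 2 \<psi> x) * conv \<eta> b1 x \<partial>lborel))"
proof -
  note v1 = wpdD(1)[OF v(1)]
  obtain R where R: "\<And>x. R < norm x \<Longrightarrow> \<psi> x = 0" using test_function_support[OF \<psi>] by blast
  note R' = partial_deriv_support[OF R]
  define p where "p j = partial_deriv j \<eta>" for j
  have tp: "test_function (p j)" for j unfolding p_def by (rule test_function_partial[OF \<eta>])
  have K: "integrable lborel (\<lambda>x. \<psi> x * a1 x)" "integrable lborel (\<lambda>x. \<psi> x * a2 x)"
    "integrable lborel (\<lambda>x. u x * partial_deriv 1 \<psi> x)" "integrable lborel (\<lambda>x. u x * partial_deriv 2 \<psi> x)"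
    using integrable_locL1_test[OF wpdD(2)[OF u(1)] \<psi>] integrable_locL1_test[OF wpdD(2)[OF u(2)] \<psi>]
      integrable_locL1_test[OF wpdD(1)[OF u(1)] test_function_partial[OF \<psi>]]
    by (simp_all add: mult.commute)
  have S: "R < norm x \<Longrightarrow> \<psi> x * a1 x = 0" "R < norm x \<Longrightarrow> \<psi> x * a2 x = 0"
    "R < norm x \<Longrightarrow> u x * partial_deriv 1 \<psi> x = 0" "R < norm x \<Longrightarrow> u x * partial_deriv 2 \<psi> x = 0" for x
    using R R' by auto
  have sm: "smooth_fun (\<lambda>x. p j (x - y))" for j y
    using smooth_shift[OF test_function_smooth[OF tp], of j "- y"] by simp
  have pd: "partial_deriv i (\<lambda>x. p j (x - y)) x = partial_deriv i (p j) (x - y)" for i j x y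
    using partial_deriv_shift[OF test_function_smooth[OF tp], of i j "- y" x] by simp
  \<comment> \<open>Both integrations by parts produce the integral of u \<psi> against a mixed
    second derivative of \<eta>; the symmetry hypothesis makes these two terms cancel in the
    difference.\<close>
  have inner: "(\<integral>x. (\<psi> x * a1 x) * p 2 (x - y) \<partial>lborel) - (\<integral>x. (\<psi> x * a2 x) * p 1 (x - y) \<partial>lborel)
     = - ((\<integral>x. (u x * partial_deriv 1 \<psi> x) * p 2 (x - y) \<partial>lborel) - (\<integral>x. (u x * partial_deriv 2 \<psi> x) * p 1 (x - y) \<partial>lborel))" for y
    using wpd_mult_test[OF u(1) \<psi> sm[of 2 y]] wpd_mult_test[OF u(2) \<psi> sm[of 1 y]]
    by (simp add: pd) (simp add: p_def sym)
  have F: "(\<integral>x. k x * conv (p j) v x \<partial>lborel) = (\<integral>y. v y * (\<integral>x. k x * p j (x - y) \<partial>lborel) \<partial>lborel)"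
      and I: "integrable lborel (\<lambda>y. v y * (\<integral>x. k x * p j (x - y) \<partial>lborel))"
    if "integrable lborel k" "\<And>x. R < norm x \<Longrightarrow> k x = 0" for k j
    using conv_Fubini[OF that v1 tp] conv_mult_integrable'[OF that v1 tp] by auto
  have "(\<integral>x. (\<psi> x * a1 x) * conv (p 2) v x \<partial>lborel) - (\<integral>x. (\<psi> x * a2 x) * conv (p 1) v x \<partial>lborel)
     = (\<integral>y. v y * (\<integral>x. (\<psi> x * a1 x) * p 2 (x - y) \<partial>lborel) - v y * (\<integral>x. (\<psi> x * a2 x) * p 1 (x - y) \<partial>lborel) \<partial>lborel)"
    by (subst F, fact K, fact S)+ (intro Bochner_Integration.integral_diff[symmetric] I K S)
  also have "\<dots> = (\<integral>y. - (v y * (\<integral>x. (u x * partial_deriv 1 \<psi> x) * p 2 (x - y) \<partial>lborel) - v y * (\<integral>x. (u x * partial_deriv 2 \<psi> x) * p 1 (x - y) \<partial>lborel)) \<partial>lborel)"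
    unfolding right_diff_distrib[symmetric] inner by (simp only: mult_minus_right)
  also have "\<dots> = - ((\<integral>x. (u x * partial_deriv 1 \<psi> x) * conv (p 2) v x \<partial>lborel) - (\<integral>x. (u x * partial_deriv 2 \<psi> x) * conv (p 1) v x \<partial>lborel))"
    unfolding Bochner_Integration.integral_minus
    by (subst F, fact K, fact S)+ (intro arg_cong[where f=uminus] Bochner_Integration.integral_diff I K S)
  finally show ?thesis
    unfolding p_def conv_partial[OF v(1) \<eta>] conv_partial[OF v(2) \<eta>] .
qed

text \<open>Continuity of translations is known in L^1, while k is only square integrable. So k is
  cut at a level m: the bounded part pairs with the L^1 statement, and the excess over m is small in
  L^2 and is absorbed by Young's inequality against a uniform local bound for g.\<close>

lemma correlation_tendsto:
  assumes k: "locL2 k" "\<And>x. R < norm x \<Longrightarrow> k x = 0" and g: "locL2 g" and z: "z \<longlonglongrightarrow> 0"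
  shows "(\<lambda>n. \<integral>x. \<bar>k x\<bar> * \<bar>g (x + z n) - g x\<bar> \<partial>lborel) \<longlonglongrightarrow> 0"
proof (rule LIMSEQ_I)
  fix e :: real assume e: "e > 0"
  have [measurable]: "k \<in> borel_measurable borel" "g \<in> borel_measurable borel" using k g by measurable
  define B where "B = cball (0::real^2) R"
  define B1 where "B1 = cball (0::real^2) (R + 1)"
  have [measurable]: "B \<in> sets borel" "B1 \<in> sets borel" unfolding B_def B1_def by auto
  define G where "G = (\<integral>x. indicator B1 x * (g x)\<^sup>2 \<partial>lborel)"
  have iG: "integrable lborel (\<lambda>x. indicator B1 x * (g x)\<^sup>2)" using g unfolding locL2_def B1_def by blast
  have G0: "G \<ge> 0" unfolding G_def by (intro Bochner_Integration.integral_nonneg) auto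
  \<comment> \<open>The Young weight is fixed first, to make the contribution
    \<open>2 * G / l\<close> of g less than \<open>e / 3\<close>. The level m is chosen for this
    weight, and the index bounds for the shift come last. The summand 1 covers G = 0.\<close>
  define l where "l = 6 * (G + 1) / e"
  have l: "l > 0" "2 * G / l < e / 3" using e G0 by (auto simp: l_def field_simps)
  have ik: "integrable lborel (\<lambda>x. (k x)\<^sup>2)"
    using k by (intro locL1_support_integrable[of _ R]) (auto simp: locL2_iff)
  have "(\<lambda>m. \<integral>x. (max 0 (\<bar>k x\<bar> - real m))\<^sup>2 \<partial>lborel) \<longlonglongrightarrow> (\<integral>x. 0 \<partial>(lborel :: (real^2) measure))"
  proof (rule integral_dominated_convergence[where w="\<lambda>x. (k x)\<^sup>2"])
    show "AE x in lborel. (\<lambda>m. (max 0 (\<bar>k x\<bar> - real m))\<^sup>2) \<longlonglongrightarrow> 0"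
    proof (rule AE_I2)
      fix x
      obtain N :: nat where "\<bar>k x\<bar> \<le> real N" using real_arch_simple by blast
      then have "eventually (\<lambda>m. 0 = (max 0 (\<bar>k x\<bar> - real m))\<^sup>2) sequentially"
        unfolding eventually_sequentially by (intro exI[of _ N]) auto
      then show "(\<lambda>m. (max 0 (\<bar>k x\<bar> - real m))\<^sup>2) \<longlonglongrightarrow> 0"
        by (rule Lim_transform_eventually[OF tendsto_const])
    qed
    have "(max 0 (\<bar>k x\<bar> - real m))\<^sup>2 \<le> \<bar>k x\<bar>\<^sup>2" for x m by (intro power_mono) auto
    then show "AE x in lborel. norm ((max 0 (\<bar>k x\<bar> - real m))\<^sup>2) \<le> (k x)\<^sup>2" for m by simp
  qed (use ik in auto)
  then have "(\<lambda>m. l / 2 * (\<integral>x. (max 0 (\<bar>k x\<bar> - real m))\<^sup>2 \<partial>lborel)) \<longlonglongrightarrow> l / 2 * 0"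
    by (intro tendsto_intros) simp
  from LIMSEQ_D[OF this, of "e / 3"] e
  obtain m where "norm (l / 2 * (\<integral>x. (max 0 (\<bar>k x\<bar> - real m))\<^sup>2 \<partial>lborel) - l / 2 * 0) < e / 3"
    by auto
  then have m: "l / 2 * (\<integral>x. (max 0 (\<bar>k x\<bar> - real m))\<^sup>2 \<partial>lborel) < e / 3"
    by (simp add: abs_less_iff)
  \<comment> \<open>The cut is made on a ball larger by 1 than the support of k, so that shifts of
    length less than 1 do not see it.\<close>
  define f where "f x = indicator B1 x * g x" for x
  have f: "integrable lborel f"
    using locL1_integrable[OF locL2_imp_locL1[OF g], of "R + 1"] unfolding f_def B1_def .
  have "(\<lambda>n. real m * (\<integral>x. \<bar>f (x + z n) - f x\<bar> \<partial>lborel)) \<longlonglongrightarrow> real m * 0"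
    using translation_continuous_integrable[OF f] z unfolding translation_continuous_def
    by (intro tendsto_intros) auto
  from LIMSEQ_D[OF this, of "e / 3"] e
  obtain N1 where N1: "\<And>n. n \<ge> N1 \<Longrightarrow> \<bar>real m * (\<integral>x. \<bar>f (x + z n) - f x\<bar> \<partial>lborel)\<bar> < e / 3"
    by auto
  obtain N2 where N2: "\<And>n. n \<ge> N2 \<Longrightarrow> norm (z n) < 1" using LIMSEQ_D[OF z, of 1] by auto
  show "\<exists>N. \<forall>n\<ge>N. norm ((\<integral>x. \<bar>k x\<bar> * \<bar>g (x + z n) - g x\<bar> \<partial>lborel) - 0) < e"
  proof (intro exI allI impI)
    fix n assume n: "max N1 N2 \<le> n"
    have zn: "norm (z n) < 1" using N2 n by auto
    have B1: "x + z n \<in> B1" "x \<in> B1" if "x \<in> B" for x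
      using that norm_triangle_ineq[of x "z n"] zn unfolding B_def B1_def by auto
    have ifz: "integrable lborel (\<lambda>x. \<bar>f (x + z n) - f x\<bar>)"
      using f by (auto simp: integrable_shift borel_measurable_integrable)
    have iGz: "integrable lborel (\<lambda>x. indicator B1 (x + z n) * (g (x + z n))\<^sup>2)"
      using iG integrable_shift[of "\<lambda>x. indicator B1 x * (g x)\<^sup>2" "z n"] by simp
    have Gz: "(\<integral>x. indicator B1 (x + z n) * (g (x + z n))\<^sup>2 \<partial>lborel) = G"
      using integral_shift[of "\<lambda>x. indicator B1 x * (g x)\<^sup>2" "z n"] unfolding G_def by simp
    have ikm: "integrable lborel (\<lambda>x. (max 0 (\<bar>k x\<bar> - real m))\<^sup>2)"
    proof (rule Bochner_Integration.integrable_bound[OF ik])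
      have "(max 0 (\<bar>k x\<bar> - real m))\<^sup>2 \<le> \<bar>k x\<bar>\<^sup>2" for x by (intro power_mono) auto
      then show "AE x in lborel. norm ((max 0 (\<bar>k x\<bar> - real m))\<^sup>2) \<le> norm ((k x)\<^sup>2)" by simp
    qed measurable
    have pw: "\<bar>k x\<bar> * \<bar>g (x + z n) - g x\<bar> \<le> real m * \<bar>f (x + z n) - f x\<bar>
      + (l / 2 * (max 0 (\<bar>k x\<bar> - real m))\<^sup>2
      + (1 / l * (indicator B1 (x + z n) * (g (x + z n))\<^sup>2) + 1 / l * (indicator B1 x * (g x)\<^sup>2)))" for x
    proof (cases "x \<in> B")
      case True
      define D where "D = \<bar>g (x + z n) - g x\<bar>"
      define K where "K = max 0 (\<bar>k x\<bar> - real m)"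
      have D: "\<bar>f (x + z n) - f x\<bar> = D" unfolding f_def D_def using B1[OF True] by simp
      have "D\<^sup>2 \<le> 2 * (g (x + z n))\<^sup>2 + 2 * (g x)\<^sup>2"
        unfolding D_def using zero_le_power2[of "g (x + z n) + g x"] by (simp add: power2_eq_square algebra_simps)
      then have D2: "1 / (2 * l) * D\<^sup>2 \<le> 1 / (2 * l) * (2 * (g (x + z n))\<^sup>2 + 2 * (g x)\<^sup>2)"
        using l by (intro mult_left_mono) auto
      have "0 \<le> (l * K - D)\<^sup>2 / (2 * l)" using l by simp
      then have KD: "K * D \<le> l / 2 * K\<^sup>2 + 1 / (2 * l) * D\<^sup>2"
        using l by (simp add: power2_eq_square field_simps)
      have "\<bar>k x\<bar> * D \<le> (real m + K) * D" unfolding K_def D_def by (intro mult_right_mono) auto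
      also have "\<dots> = real m * D + K * D" by (simp add: distrib_right)
      finally have 1: "\<bar>k x\<bar> * D \<le> real m * D + K * D" .
      have 2: "1 / (2 * l) * (2 * (g (x + z n))\<^sup>2 + 2 * (g x)\<^sup>2) = 1 / l * (g (x + z n))\<^sup>2 + 1 / l * (g x)\<^sup>2"
        using l by (simp add: field_simps)
      have "\<bar>k x\<bar> * D \<le> real m * D + (l / 2 * K\<^sup>2 + (1 / l * (g (x + z n))\<^sup>2 + 1 / l * (g x)\<^sup>2))"
        using KD D2 1 unfolding 2 by linarith
      then show ?thesis using B1[OF True] unfolding D K_def[symmetric] D_def[symmetric] by simp
    next
      case False
      then have "k x = 0" using k(2) by (auto simp: B_def)
      then show ?thesis using l by simp
    qed
    have "(\<integral>x. \<bar>k x\<bar> * \<bar>g (x + z n) - g x\<bar> \<partial>lborel) \<le> (\<integral>x. real m * \<bar>f (x + z n) - f x\<bar>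
      + (l / 2 * (max 0 (\<bar>k x\<bar> - real m))\<^sup>2
      + (1 / l * (indicator B1 (x + z n) * (g (x + z n))\<^sup>2) + 1 / l * (indicator B1 x * (g x)\<^sup>2))) \<partial>lborel)"
    proof (rule integral_mono_AE')
      show "AE x in lborel. \<bar>k x\<bar> * \<bar>g (x + z n) - g x\<bar> \<le> real m * \<bar>f (x + z n) - f x\<bar>
        + (l / 2 * (max 0 (\<bar>k x\<bar> - real m))\<^sup>2
        + (1 / l * (indicator B1 (x + z n) * (g (x + z n))\<^sup>2) + 1 / l * (indicator B1 x * (g x)\<^sup>2)))"
        using pw by (intro AE_I2)
      show "AE x in lborel. 0 \<le> real m * \<bar>f (x + z n) - f x\<bar>
        + (l / 2 * (max 0 (\<bar>k x\<bar> - real m))\<^sup>2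
        + (1 / l * (indicator B1 (x + z n) * (g (x + z n))\<^sup>2) + 1 / l * (indicator B1 x * (g x)\<^sup>2)))"
        using l by (intro AE_I2 add_nonneg_nonneg mult_nonneg_nonneg) auto
    qed (use ifz iG iGz ikm in \<open>auto intro!: Bochner_Integration.integrable_add\<close>)
    also have "\<dots> = real m * (\<integral>x. \<bar>f (x + z n) - f x\<bar> \<partial>lborel)
      + (l / 2 * (\<integral>x. (max 0 (\<bar>k x\<bar> - real m))\<^sup>2 \<partial>lborel) + (1 / l * G + 1 / l * G))"
      unfolding G_def using ifz iG iGz ikm Gz[unfolded G_def]
      by (subst Bochner_Integration.integral_add, simp, simp)+ simp
    also have "\<dots> < e" using m N1[of n] n l(2) by (simp add: field_simps)
    finally show "norm ((\<integral>x. \<bar>k x\<bar> * \<bar>g (x + z n) - g x\<bar> \<partial>lborel) - 0) < e" by simp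
  qed
qed

text \<open>Convolution minus identity is an average of translation differences with weight
  \<open>\<eta>\<close>, so the error is at most the supremum of the correlations over shifts
  shorter than the mollification radius.\<close>

lemma conv_tendsto:
  assumes k: "locL2 k" "\<And>x. R < norm x \<Longrightarrow> k x = 0" and g: "locL2 g"
  shows "(\<lambda>n. \<integral>x. k x * conv (mollifier (1 / real (Suc n))) g x \<partial>lborel) \<longlonglongrightarrow> (\<integral>x. k x * g x \<partial>lborel)"
proof (rule LIMSEQ_I)
  fix e :: real assume e: "e > 0"
  have [measurable]: "k \<in> borel_measurable borel" "g \<in> borel_measurable borel" using k g by measurable
  define d where "d z = (\<integral>x. \<bar>k x\<bar> * \<bar>g (x + z) - g x\<bar> \<partial>lborel)" for z
  have "d \<midarrow>0\<rightarrow> 0"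
    unfolding LIMSEQ_SEQ_conv[symmetric] d_def using correlation_tendsto[OF k g] by auto
  from LIM_D[OF this, of "e / 2"] e obtain s where s: "s > 0" "\<And>z. z \<noteq> 0 \<Longrightarrow> norm z < s \<Longrightarrow> \<bar>d z\<bar> < e / 2"
    by auto
  have d0: "d 0 = 0" unfolding d_def by simp
  have s': "d z \<le> e / 2" if "norm z < s" for z using s(2)[of z] that e d0 by (cases "z = 0") auto
  obtain N where N: "1 / real (Suc N) < s" using s(1) nat_approx_posE by blast
  have id: "integrable lborel (\<lambda>x. \<bar>k x\<bar> * \<bar>g (x + z) - g x\<bar>)" for z
  proof -
    have gz: "locL2 (\<lambda>x. g (x + z))"
      using g locL1_shift[of "\<lambda>x. (g x)\<^sup>2" z] by (simp add: locL2_iff)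
    have "integrable lborel (\<lambda>x. \<bar>k x * (g (x + z) - g x)\<bar>)"
      by (intro locL1_support_integrable[of _ R] locL1_abs locL1_mult_L2 locL2_diff gz g k(1)) (simp add: k(2))
    then show ?thesis by (simp add: abs_mult)
  qed
  show "\<exists>N. \<forall>n\<ge>N. norm ((\<integral>x. k x * conv (mollifier (1 / real (Suc n))) g x \<partial>lborel) - (\<integral>x. k x * g x \<partial>lborel)) < e"
  proof (intro exI allI impI)
    fix n assume n: "N \<le> n"
    define \<eta> where "\<eta> = mollifier (1 / real (Suc n))"
    have r: "1 / real (Suc n) > 0" by simp
    note m = mollifier[OF r, folded \<eta>_def]
    have [measurable]: "\<eta> \<in> borel_measurable borel" using m(1) by measurable
    have "1 / real (Suc n) \<le> 1 / real (Suc N)" using n by (intro divide_left_mono) auto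
    then have supp: "norm z < s" if "\<eta> z \<noteq> 0" for z using m(4)[of z] N that by linarith
    have ik: "integrable lborel k" by (rule locL1_support_integrable[OF locL2_imp_locL1[OF k(1)] k(2)])
    have ikg: "integrable lborel (\<lambda>x. k x * g x)"
      by (intro locL1_support_integrable[of _ R] locL1_mult_L2 k(1) g) (simp add: k(2))
    note ikc = conv_mult_integrable[OF ik k(2) locL2_imp_locL1[OF g] m(1)]
    \<comment> \<open>Evenness replaces the reflected shift in the definition of convolution by a
      shift in the direction used by the correlation.\<close>
    have even: "\<eta> (- z) = \<eta> z" for z unfolding \<eta>_def by (simp add: mollifier_def rbump_def)
    have pw: "ennreal \<bar>k x * conv \<eta> g x - k x * g x\<bar> \<le> (\<integral>\<^sup>+z. ennreal (\<eta> z) * ennreal (\<bar>k x\<bar> * \<bar>g (x + z) - g x\<bar>) \<partial>lborel)" for x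
    proof -
      have I: "integrable lborel (\<lambda>z. g (z + x) * \<eta> z)"
        by (rule integrable_locL1_test[OF locL1_shift[OF locL2_imp_locL1[OF g]] m(1)])
      have "conv \<eta> g x = (\<integral>z. g (z + x) * \<eta> z \<partial>lborel)"
        unfolding conv_def using integral_shift[of "\<lambda>y. g y * \<eta> (x - y)" x] by (simp add: even)
      then have "conv \<eta> g x - g x = (\<integral>z. g (z + x) * \<eta> z \<partial>lborel) - (\<integral>z. g x * \<eta> z \<partial>lborel)"
        using m(3) by simp
      also have "\<dots> = (\<integral>z. g (z + x) * \<eta> z - g x * \<eta> z \<partial>lborel)"
        by (intro Bochner_Integration.integral_diff[symmetric] I) (use integrable_test[OF m(1)] in auto)
      finally have "k x * conv \<eta> g x - k x * g x = (\<integral>z. k x * (g (z + x) * \<eta> z - g x * \<eta> z) \<partial>lborel)"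
        by (simp add: right_diff_distrib[symmetric])
      then have "ennreal \<bar>k x * conv \<eta> g x - k x * g x\<bar> = ennreal (norm (\<integral>z. k x * (g (z + x) * \<eta> z - g x * \<eta> z) \<partial>lborel))"
        by simp
      also have "\<dots> \<le> (\<integral>\<^sup>+z. ennreal (norm (k x * (g (z + x) * \<eta> z - g x * \<eta> z))) \<partial>lborel)"
        by (intro integral_norm_bound_ennreal Bochner_Integration.integrable_mult_right Bochner_Integration.integrable_diff I)
          (use integrable_test[OF m(1)] in auto)
      also have "\<dots> = (\<integral>\<^sup>+z. ennreal (\<eta> z) * ennreal (\<bar>k x\<bar> * \<bar>g (x + z) - g x\<bar>) \<partial>lborel)"
      proof (intro nn_integral_cong)
        fix z
        have "k x * (g (z + x) * \<eta> z - g x * \<eta> z) = \<eta> z * (k x * (g (x + z) - g x))"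
          by (simp add: algebra_simps)
        then have "norm (k x * (g (z + x) * \<eta> z - g x * \<eta> z)) = \<eta> z * (\<bar>k x\<bar> * \<bar>g (x + z) - g x\<bar>)"
          using m(2)[of z] by (simp only: real_norm_def abs_mult abs_of_nonneg)
        then show "ennreal (norm (k x * (g (z + x) * \<eta> z - g x * \<eta> z))) = ennreal (\<eta> z) * ennreal (\<bar>k x\<bar> * \<bar>g (x + z) - g x\<bar>)"
          using m(2)[of z] by (simp only: ennreal_mult')
      qed
      finally show ?thesis .
    qed
    have "ennreal (norm (\<integral>x. k x * conv \<eta> g x - k x * g x \<partial>lborel)) \<le> (\<integral>\<^sup>+x. ennreal (norm (k x * conv \<eta> g x - k x * g x)) \<partial>lborel)"
      by (intro integral_norm_bound_ennreal Bochner_Integration.integrable_diff ikc ikg)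
    also have "\<dots> \<le> (\<integral>\<^sup>+x. \<integral>\<^sup>+z. ennreal (\<eta> z) * ennreal (\<bar>k x\<bar> * \<bar>g (x + z) - g x\<bar>) \<partial>lborel \<partial>lborel)"
      using pw by (intro nn_integral_mono) auto
    also have "\<dots> = (\<integral>\<^sup>+z. \<integral>\<^sup>+x. ennreal (\<eta> z) * ennreal (\<bar>k x\<bar> * \<bar>g (x + z) - g x\<bar>) \<partial>lborel \<partial>lborel)"
      by (rule lborel_pair.Fubini') measurable
    also have "\<dots> = (\<integral>\<^sup>+z. ennreal (\<eta> z) * ennreal (d z) \<partial>lborel)"
      unfolding d_def
      by (intro nn_integral_cong) (subst nn_integral_cmult, measurable, subst nn_integral_eq_integral[OF id], auto)
    also have "\<dots> \<le> (\<integral>\<^sup>+z. ennreal (\<eta> z) * ennreal (e / 2) \<partial>lborel)"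
    proof (intro nn_integral_mono)
      fix z show "ennreal (\<eta> z) * ennreal (d z) \<le> ennreal (\<eta> z) * ennreal (e / 2)"
        using supp[of z] s'[of z] by (cases "\<eta> z = 0") (auto intro!: mult_left_mono ennreal_leI)
    qed
    also have "\<dots> = ennreal (e / 2)"
      using nn_integral_eq_integral[OF integrable_test[OF m(1)]] m(2,3) by (subst nn_integral_multc) auto
    finally have "norm (\<integral>x. k x * conv \<eta> g x - k x * g x \<partial>lborel) \<le> e / 2" using e by (simp add: ennreal_le_iff)
    then show "norm ((\<integral>x. k x * conv (mollifier (1 / real (Suc n))) g x \<partial>lborel) - (\<integral>x. k x * g x \<partial>lborel)) < e"
      using ikc ikg e unfolding \<eta>_def by simp
  qed
qed

text \<open>The limit of the mollified identity. Gradients that are locally square integrable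
  suffice, since u is then locally square integrable and every product is locally integrable. On the
  right u enters without derivatives, which lets strong convergence of u meet mere boundedness of
  the gradient of v.\<close>

theorem weak_jacobian:
  assumes u: "wpd 1 u a1" "wpd 2 u a2" and v: "wpd 1 v b1" "wpd 2 v b2"
    and a: "locL2 a1" "locL2 a2" and b: "locL2 b1" "locL2 b2" and \<psi>: "test_function \<psi>"
  shows "(\<integral>x. (a1 x * b2 x - a2 x * b1 x) * \<psi> x \<partial>lborel)
    = - (\<integral>x. u x * (partial_deriv 1 \<psi> x * b2 x - partial_deriv 2 \<psi> x * b1 x) \<partial>lborel)"
proof -
  have lu: "locL2 u" by (rule wpd_locL2[OF u a])
  obtain R where R: "\<And>x. R < norm x \<Longrightarrow> \<psi> x = 0" using test_function_support[OF \<psi>] by blast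
  note R' = partial_deriv_support[OF R]
  note c = test_function_continuous[OF \<psi>] test_function_continuous[OF test_function_partial[OF \<psi>]]
  have L: "locL2 (\<lambda>x. \<psi> x * a1 x)" "locL2 (\<lambda>x. \<psi> x * a2 x)" "locL2 (\<lambda>x. u x * partial_deriv j \<psi> x)" for j
    using locL2_mult_continuous[OF a(1) c(1)] locL2_mult_continuous[OF a(2) c(1)] locL2_mult_continuous[OF lu c(2)]
    by (simp_all add: mult.commute)
  have C: "(\<lambda>n. \<integral>x. k x * conv (mollifier (1 / real (Suc n))) g x \<partial>lborel) \<longlonglongrightarrow> (\<integral>x. k x * g x \<partial>lborel)"
    if "locL2 k" "locL2 g" "\<And>x. R < norm x \<Longrightarrow> k x = 0" for k g
    by (rule conv_tendsto[OF that(1) that(3) that(2)])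
  have I: "integrable lborel (\<lambda>x. k x * g x)" if "locL2 k" "locL2 g" "\<And>x. R < norm x \<Longrightarrow> k x = 0" for k g
    by (intro locL1_support_integrable[of _ R] locL1_mult_L2 that(1,2)) (simp add: that(3))
  define X where "X n = (\<integral>x. (\<psi> x * a1 x) * conv (mollifier (1 / real (Suc n))) b2 x \<partial>lborel)
      - (\<integral>x. (\<psi> x * a2 x) * conv (mollifier (1 / real (Suc n))) b1 x \<partial>lborel)" for n
  have "X \<longlonglongrightarrow> (\<integral>x. (\<psi> x * a1 x) * b2 x \<partial>lborel) - (\<integral>x. (\<psi> x * a2 x) * b1 x \<partial>lborel)"
    unfolding X_def by (intro tendsto_intros C L b) (auto simp: R)
  moreover have "X = (\<lambda>n. - ((\<integral>x. (u x * partial_deriv 1 \<psi> x) * conv (mollifier (1 / real (Suc n))) b2 x \<partial>lborel)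
        - (\<integral>x. (u x * partial_deriv 2 \<psi> x) * conv (mollifier (1 / real (Suc n))) b1 x \<partial>lborel)))"
    unfolding X_def using mollifier by (intro ext jacobian_conv[OF u v \<psi>]) auto
  then have "X \<longlonglongrightarrow> - ((\<integral>x. (u x * partial_deriv 1 \<psi> x) * b2 x \<partial>lborel) - (\<integral>x. (u x * partial_deriv 2 \<psi> x) * b1 x \<partial>lborel))"
    by (simp only:) (intro tendsto_intros C L b, auto simp: R')
  ultimately have "(\<integral>x. (\<psi> x * a1 x) * b2 x \<partial>lborel) - (\<integral>x. (\<psi> x * a2 x) * b1 x \<partial>lborel) =
     - ((\<integral>x. (u x * partial_deriv 1 \<psi> x) * b2 x \<partial>lborel) - (\<integral>x. (u x * partial_deriv 2 \<psi> x) * b1 x \<partial>lborel))"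
    by (rule LIMSEQ_unique)
  moreover have "(\<integral>x. (\<psi> x * a1 x) * b2 x \<partial>lborel) - (\<integral>x. (\<psi> x * a2 x) * b1 x \<partial>lborel)
     = (\<integral>x. (\<psi> x * a1 x) * b2 x - (\<psi> x * a2 x) * b1 x \<partial>lborel)"
    using I[OF L(1) b(2)] I[OF L(2) b(1)] by (simp add: R)
  moreover have "(\<integral>x. (u x * partial_deriv 1 \<psi> x) * b2 x \<partial>lborel) - (\<integral>x. (u x * partial_deriv 2 \<psi> x) * b1 x \<partial>lborel)
     = (\<integral>x. (u x * partial_deriv 1 \<psi> x) * b2 x - (u x * partial_deriv 2 \<psi> x) * b1 x \<partial>lborel)"
    using I[OF L(3) b(2)] I[OF L(3) b(1)] by (simp add: R')
  ultimately show ?thesis by (simp add: algebra_simps)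
qed

section \<open>Compactness in \<open>L\<^sup>2\<close>\<close>

text \<open>For x in the square, L^2 g(x) is the integral of g minus the integral of the increments
  from x. Squaring costs a factor 2, Jensen bounds the increments, and \<open>poincare_sq\<close>
  turns 2 / L^2 times 8 L^4 into 16 L^2.\<close>

lemma cell_estimate:
  assumes w1: "wpd 1 g h1" and w2: "wpd 2 g h2" and L: "L > 0"
  shows "(\<integral>\<^sup>+x. indicator (sq a b L) x * ennreal ((g x)\<^sup>2) \<partial>lborel)
    \<le> ennreal (16 * L\<^sup>2) * (\<integral>\<^sup>+x. indicator (sq a b L) x * ennreal ((h1 x)\<^sup>2 + (h2 x)\<^sup>2) \<partial>lborel)
      + ennreal (2 * (\<integral>x. indicator (sq a b L) x * g x \<partial>lborel)\<^sup>2 / L\<^sup>2)"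
proof -
  define Q where "Q = sq a b L"
  have [measurable]: "Q \<in> sets borel" unfolding Q_def by measurable
  have [measurable]: "g \<in> borel_measurable borel"
    using wpdD(1,2)[OF w1] by measurable
  have emQ: "emeasure lborel Q = ennreal (L\<^sup>2)" unfolding Q_def using L by (simp add: emeasure_sq)
  define D where "D = (\<integral>\<^sup>+x. indicator Q x * ennreal ((h1 x)\<^sup>2 + (h2 x)\<^sup>2) \<partial>lborel)"
  define m where "m = (\<integral>x. indicator Q x * g x \<partial>lborel)"
  have iQ: "integrable lborel (indicat_real Q)" using emQ by (intro integrable_real_indicator) auto
  have mQ: "(\<integral>x. indicat_real Q x \<partial>lborel) = L\<^sup>2" using emQ by (simp add: measure_def)
  have ig: "integrable lborel (\<lambda>x. indicator Q x * g x)"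
    using sq_subset_cball[of a b L] unfolding Q_def[symmetric]
    by (intro Bochner_Integration.integrable_bound[OF locL1_integrable[OF wpdD(1)[OF w1], of "\<bar>a\<bar> + \<bar>b\<bar> + 2 * \<bar>L\<bar>"]])
      (auto simp: indicator_def intro!: AE_I2)
  have pw: "indicator Q x * ennreal ((g x)\<^sup>2) \<le>
     ennreal (2 / L\<^sup>2) * (\<integral>\<^sup>+y. indicator Q x * indicator Q y * ennreal ((g y - g x)\<^sup>2) \<partial>lborel)
     + indicator Q x * ennreal (2 * m\<^sup>2 / L ^ 4)" for x
  proof (cases "x \<in> Q")
    case True
    define t where "t = (\<integral>y. indicator Q y * (g y - g x) \<partial>lborel)"
    have "t = (\<integral>y. indicator Q y * g y - g x * indicator Q y \<partial>lborel)"
      unfolding t_def by (intro Bochner_Integration.integral_cong) (auto simp: algebra_simps)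
    also have "\<dots> = m - g x * L\<^sup>2" using ig iQ mQ unfolding m_def by simp
    finally have "g x = m / L\<^sup>2 - t / L\<^sup>2" using L by (simp add: field_simps)
    moreover have "(c - d)\<^sup>2 \<le> 2 * c\<^sup>2 + 2 * d\<^sup>2" for c d :: real
      using zero_le_power2[of "c + d"] by (simp add: power2_eq_square algebra_simps)
    ultimately have "(g x)\<^sup>2 \<le> 2 * (m / L\<^sup>2)\<^sup>2 + 2 * (t / L\<^sup>2)\<^sup>2" by simp
    also have "\<dots> = 2 / L ^ 4 * t\<^sup>2 + 2 * m\<^sup>2 / L ^ 4" by (simp add: power_divide)
    finally have "ennreal ((g x)\<^sup>2) \<le> ennreal (2 / L ^ 4) * ennreal (t\<^sup>2) + ennreal (2 * m\<^sup>2 / L ^ 4)"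
      using L by (simp add: ennreal_leI flip: ennreal_mult' ennreal_plus)
    also have "ennreal (t\<^sup>2) \<le> ennreal (L\<^sup>2) * (\<integral>\<^sup>+y. indicator Q y * ennreal ((g y - g x)\<^sup>2) \<partial>lborel)"
      unfolding t_def using set_jensen[of "\<lambda>y. g y - g x" Q] emQ by simp
    finally have "ennreal ((g x)\<^sup>2) \<le> ennreal (2 / L ^ 4) * (ennreal (L\<^sup>2) * (\<integral>\<^sup>+y. indicator Q y * ennreal ((g y - g x)\<^sup>2) \<partial>lborel)) + ennreal (2 * m\<^sup>2 / L ^ 4)"
      by (simp add: add_mono mult_left_mono)
    also have "ennreal (2 / L ^ 4) * (ennreal (L\<^sup>2) * (\<integral>\<^sup>+y. indicator Q y * ennreal ((g y - g x)\<^sup>2) \<partial>lborel))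
      = ennreal (2 / L\<^sup>2) * (\<integral>\<^sup>+y. indicator Q y * ennreal ((g y - g x)\<^sup>2) \<partial>lborel)"
      using L by (simp add: mult.assoc[symmetric] ennreal_mult'[symmetric] eval_nat_numeral)
    finally show ?thesis using True by simp
  qed simp
  have "(\<integral>\<^sup>+x. indicator Q x * ennreal ((g x)\<^sup>2) \<partial>lborel) \<le>
     (\<integral>\<^sup>+x. ennreal (2 / L\<^sup>2) * (\<integral>\<^sup>+y. indicator Q x * indicator Q y * ennreal ((g y - g x)\<^sup>2) \<partial>lborel)
     + indicator Q x * ennreal (2 * m\<^sup>2 / L ^ 4) \<partial>lborel)"
    by (intro nn_integral_mono pw)
  also have "\<dots> = ennreal (2 / L\<^sup>2) * (\<integral>\<^sup>+x. \<integral>\<^sup>+y. indicator Q x * indicator Q y * ennreal ((g y - g x)\<^sup>2) \<partial>lborel \<partial>lborel)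
      + ennreal (L\<^sup>2) * ennreal (2 * m\<^sup>2 / L ^ 4)"
    using emQ by (subst nn_integral_add) (auto simp: nn_integral_cmult nn_integral_multc)
  also have "\<dots> \<le> ennreal (2 / L\<^sup>2) * (ennreal (8 * L ^ 4) * D) + ennreal (L\<^sup>2) * ennreal (2 * m\<^sup>2 / L ^ 4)"
    unfolding D_def Q_def by (intro add_mono mult_left_mono poincare_sq[OF assms]) auto
  also have "\<dots> = ennreal (16 * L\<^sup>2) * D + ennreal (2 * m\<^sup>2 / L\<^sup>2)"
    using L by (simp add: mult.assoc[symmetric] ennreal_mult'[symmetric] eval_nat_numeral)
  finally show ?thesis unfolding D_def Q_def m_def .
qed

lemma wpd_add_const: "wpd j g h \<Longrightarrow> wpd j (\<lambda>x. g x - c) h"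
  using wpd_linear[OF _ wpd_const, of j g h 1 "-1" c] by simp

lemma locL1_sq_integrable:
  assumes "locL1 g" shows "integrable lborel (\<lambda>x. indicator (sq a b L) x * g x)"
  using sq_subset_cball[of a b L] assms
  by (intro Bochner_Integration.integrable_bound[OF locL1_integrable[OF assms, of "\<bar>a\<bar> + \<bar>b\<bar> + 2 * \<bar>L\<bar>"]])
    (auto simp: indicator_def intro!: AE_I2)

lemma integral_indicator_sq: "L \<ge> 0 \<Longrightarrow> (\<integral>x. indicat_real (sq a b L) x \<partial>lborel) = L\<^sup>2"
  by (simp add: measure_def emeasure_sq)

lemma integrable_indicator_sq: "L \<ge> 0 \<Longrightarrow> integrable lborel (indicat_real (sq a b L))"
  by (intro integrable_real_indicator) (auto simp: emeasure_sq)

text \<open>The normalisation lives on one fixed unit square, so that it does not change as R grows.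
  With m the mean over the large square, \<open>cell_estimate\<close> controls g - m, and Jensen on
  the unit square, where g has mean zero, controls m itself. The constant is 2 * 64 R^2 plus the
  area 4 R^2 times 2 * 64 R^2.\<close>

lemma mean_zero_estimate:
  assumes w1: "wpd 1 g h1" and w2: "wpd 2 g h2" and R: "R \<ge> 1"
    and mean: "(\<integral>x. indicator (sq 0 0 1) x * g x \<partial>lborel) = 0"
  shows "(\<integral>\<^sup>+x. indicator (sq (-R) (-R) (2 * R)) x * ennreal ((g x)\<^sup>2) \<partial>lborel)
    \<le> ennreal (128 * R\<^sup>2 + 512 * R ^ 4) * (\<integral>\<^sup>+x. indicator (sq (-R) (-R) (2 * R)) x * ennreal ((h1 x)\<^sup>2 + (h2 x)\<^sup>2) \<partial>lborel)"
proof -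
  define B where "B = sq (-R) (-R) (2 * R)"
  define Q where "Q = sq 0 0 1"
  have QB: "Q \<subseteq> B" unfolding B_def Q_def sq_def using R by auto
  have [measurable]: "B \<in> sets borel" "Q \<in> sets borel" unfolding B_def Q_def by measurable
  have [measurable]: "g \<in> borel_measurable borel" using wpdD(1,2)[OF w1] by measurable
  define D where "D = (\<integral>\<^sup>+x. indicator B x * ennreal ((h1 x)\<^sup>2 + (h2 x)\<^sup>2) \<partial>lborel)"
  define m where "m = (\<integral>x. indicator B x * g x \<partial>lborel) / (2 * R)\<^sup>2"
  have iB: "integrable lborel (indicat_real B)" unfolding B_def using R by (intro integrable_indicator_sq) auto
  have IB: "(\<integral>x. indicat_real B x \<partial>lborel) = (2 * R)\<^sup>2"
    unfolding B_def using R by (subst integral_indicator_sq) auto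
  have iQ: "integrable lborel (indicat_real Q)" unfolding Q_def by (intro integrable_indicator_sq) auto
  have IQ: "(\<integral>x. indicat_real Q x \<partial>lborel) = 1" unfolding Q_def by (subst integral_indicator_sq) auto
  have ig: "integrable lborel (\<lambda>x. indicator B x * g x)" "integrable lborel (\<lambda>x. indicator Q x * g x)"
    unfolding B_def Q_def by (intro locL1_sq_integrable wpdD(1)[OF w1])+
  have z: "(\<integral>x. indicator B x * (g x - m) \<partial>lborel) = 0"
    using ig iB IB R unfolding right_diff_distrib by (simp add: m_def)
  have E: "(\<integral>\<^sup>+x. indicator B x * ennreal ((g x - m)\<^sup>2) \<partial>lborel) \<le> ennreal (64 * R\<^sup>2) * D"
    using cell_estimate[OF wpd_add_const[OF w1, of m] wpd_add_const[OF w2, of m], of "2 * R" "-R" "-R"] R z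
    unfolding B_def D_def by (simp add: power_mult_distrib)
  have "(\<integral>x. indicator Q x * (g x - m) \<partial>lborel) = - m"
    using ig iQ IQ mean unfolding right_diff_distrib by (simp add: Q_def)
  then have "ennreal (m\<^sup>2) \<le> (\<integral>\<^sup>+x. indicator Q x * ennreal ((g x - m)\<^sup>2) \<partial>lborel)"
    using set_jensen[of "\<lambda>x. g x - m" Q] by (simp add: Q_def emeasure_sq)
  also have "\<dots> \<le> (\<integral>\<^sup>+x. indicator B x * ennreal ((g x - m)\<^sup>2) \<partial>lborel)"
    using QB by (intro nn_integral_mono) (auto simp: indicator_def)
  finally have m: "ennreal (m\<^sup>2) \<le> ennreal (64 * R\<^sup>2) * D" using E by (rule order_trans)
  have pw: "indicator B x * ennreal ((g x)\<^sup>2) \<le> 2 * (indicator B x * ennreal ((g x - m)\<^sup>2)) + indicator B x * (2 * ennreal (m\<^sup>2))" for x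
  proof -
    have "(g x)\<^sup>2 \<le> 2 * (g x - m)\<^sup>2 + 2 * m\<^sup>2"
      using zero_le_power2[of "g x - 2 * m"] by (simp add: power2_eq_square algebra_simps)
    then have "ennreal ((g x)\<^sup>2) \<le> ennreal (2 * (g x - m)\<^sup>2 + 2 * m\<^sup>2)" by (rule ennreal_leI)
    then show ?thesis by (auto simp: indicator_def ennreal_plus ennreal_mult')
  qed
  have "(\<integral>\<^sup>+x. indicator B x * ennreal ((g x)\<^sup>2) \<partial>lborel) \<le>
    (\<integral>\<^sup>+x. 2 * (indicator B x * ennreal ((g x - m)\<^sup>2)) + indicator B x * (2 * ennreal (m\<^sup>2)) \<partial>lborel)"
    by (intro nn_integral_mono pw)
  also have "\<dots> = 2 * (\<integral>\<^sup>+x. indicator B x * ennreal ((g x - m)\<^sup>2) \<partial>lborel) + ennreal ((2 * R)\<^sup>2) * (2 * ennreal (m\<^sup>2))"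
    using R by (subst nn_integral_add) (auto simp: nn_integral_cmult nn_integral_multc B_def emeasure_sq)
  also have "\<dots> \<le> 2 * (ennreal (64 * R\<^sup>2) * D) + ennreal ((2 * R)\<^sup>2) * (2 * (ennreal (64 * R\<^sup>2) * D))"
    by (intro add_mono mult_left_mono E m) auto
  also have "\<dots> = (2 * ennreal (64 * R\<^sup>2) + ennreal ((2 * R)\<^sup>2) * (2 * ennreal (64 * R\<^sup>2))) * D"
    by (simp add: distrib_right mult.assoc)
  also have "2 * ennreal (64 * R\<^sup>2) + ennreal ((2 * R)\<^sup>2) * (2 * ennreal (64 * R\<^sup>2)) = ennreal (2 * (64 * R\<^sup>2) + (2 * R)\<^sup>2 * (2 * (64 * R\<^sup>2)))"
  proof -
    have 2: "2 * ennreal (64 * R\<^sup>2) = ennreal (2 * (64 * R\<^sup>2))" by (simp add: ennreal_mult')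
    show ?thesis unfolding 2 by (simp only: ennreal_mult'[symmetric] ennreal_plus[symmetric] zero_le_power2 mult_nonneg_nonneg zero_le_numeral)
  qed
  also have "2 * (64 * R\<^sup>2) + (2 * R)\<^sup>2 * (2 * (64 * R\<^sup>2)) = 128 * R\<^sup>2 + 512 * R ^ 4"
    by (simp add: power2_eq_square power4_eq_xxxx)
  finally show ?thesis unfolding D_def B_def .
qed

section \<open>Averages over grid cells\<close>

text \<open>Integer indices make membership a pair of floor equations, and the integral half-width
  of \<open>square\<close> makes its tiling by the cells in \<open>grid\<close> exact for every
  mesh.\<close>

definition cell :: "nat \<Rightarrow> int \<times> int \<Rightarrow> (real^2) set" where
  "cell k z = sq (real_of_int (fst z) / real (Suc k)) (real_of_int (snd z) / real (Suc k)) (1 / real (Suc k))"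

definition grid :: "nat \<Rightarrow> nat \<Rightarrow> (int \<times> int) set" where
  "grid N k = {- int (N * Suc k)..<int (N * Suc k)} \<times> {- int (N * Suc k)..<int (N * Suc k)}"

definition square :: "nat \<Rightarrow> (real^2) set" where
  "square N = sq (- real N) (- real N) (2 * real N)"

lemma finite_grid: "finite (grid N k)"
  by (simp add: grid_def)

lemma cell_borel [measurable]: "cell k z \<in> sets borel"
  unfolding cell_def by measurable

lemma square_borel [measurable]: "square N \<in> sets borel"
  unfolding square_def by measurable

lemma mem_cell: "x \<in> cell k z \<longleftrightarrow> z = (\<lfloor>real (Suc k) * x $ 1\<rfloor>, \<lfloor>real (Suc k) * x $ 2\<rfloor>)"
proof -
  have *: "(real_of_int i / s \<le> t \<and> t < real_of_int i / s + 1 / s) = (i = \<lfloor>s * t\<rfloor>)" if "s > 0" for i s t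
    using that floor_eq_iff[of "s * t" i] by (auto simp: field_simps)
  show ?thesis
    using *[of "real (Suc k)" "fst z" "x $ 1"] *[of "real (Suc k)" "snd z" "x $ 2"]
    by (auto simp: cell_def sq_def prod_eq_iff)
qed

lemma mem_square: "x \<in> square N \<longleftrightarrow> (\<lfloor>real (Suc k) * x $ 1\<rfloor>, \<lfloor>real (Suc k) * x $ 2\<rfloor>) \<in> grid N k"
proof -
  have "\<lfloor>real (Suc k) * t\<rfloor> \<in> {- int (N * Suc k)..<int (N * Suc k)} \<longleftrightarrow> - real N \<le> t \<and> t < - real N + 2 * real N" for t
  proof -
    define s where "s = real (Suc k)"
    have s: "s > 0" "real (N * Suc k) = real N * s" by (simp_all add: s_def algebra_simps)
    have "\<lfloor>s * t\<rfloor> \<in> {- int (N * Suc k)..<int (N * Suc k)} \<longleftrightarrow> s * (- real N) \<le> s * t \<and> s * t < s * real N"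
      by (simp only: atLeastLessThan_iff le_floor_iff floor_less_iff of_int_minus of_int_of_nat_eq s(2))
        (simp add: mult.commute)
    also have "\<dots> \<longleftrightarrow> - real N \<le> t \<and> t < real N" using s(1) by (simp only: mult_le_cancel_left_pos mult_less_cancel_left_pos)
    finally show ?thesis unfolding s_def by simp
  qed
  from this[of "x $ 1"] this[of "x $ 2"] show ?thesis
    unfolding square_def sq_def grid_def by auto
qed

lemma nn_integral_square_cells:
  fixes F :: "real^2 \<Rightarrow> ennreal"
  assumes [measurable]: "F \<in> borel_measurable borel"
  shows "(\<integral>\<^sup>+x. indicator (square N) x * F x \<partial>lborel) = (\<Sum>z\<in>grid N k. \<integral>\<^sup>+x. indicator (cell k z) x * F x \<partial>lborel)"
proof -
  have "indicator (square N) x = (\<Sum>z\<in>grid N k. indicator (cell k z) x :: ennreal)" for x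
  proof -
    define z0 where "z0 = (\<lfloor>real (Suc k) * x $ 1\<rfloor>, \<lfloor>real (Suc k) * x $ 2\<rfloor>)"
    have "(\<Sum>z\<in>grid N k. indicator (cell k z) x :: ennreal) = (\<Sum>z\<in>grid N k. if z = z0 then 1 else 0)"
      by (intro sum.cong) (auto simp: indicator_def mem_cell z0_def)
    also have "\<dots> = indicator (square N) x"
      using finite_grid[of N k] mem_square[of x N k, folded z0_def] by (simp add: indicator_def)
    finally show ?thesis ..
  qed
  then show ?thesis
    by (simp add: sum_distrib_right nn_integral_sum)
qed

text \<open>The mechanism of compactness: the gradient term carries the square of the mesh size, so
  on a fine mesh the L^2 norm is governed by finitely many linear functionals, the cell integrals.
  Their weight is 2 / L^2 for the side L of a cell.\<close>

lemma grid_estimate: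
  assumes w1: "wpd 1 g h1" and w2: "wpd 2 g h2"
  shows "(\<integral>\<^sup>+x. indicator (square N) x * ennreal ((g x)\<^sup>2) \<partial>lborel)
    \<le> ennreal (16 / (real (Suc k))\<^sup>2) * (\<integral>\<^sup>+x. indicator (square N) x * ennreal ((h1 x)\<^sup>2 + (h2 x)\<^sup>2) \<partial>lborel)
      + ennreal (\<Sum>z\<in>grid N k. 2 * (real (Suc k))\<^sup>2 * (\<integral>x. indicator (cell k z) x * g x \<partial>lborel)\<^sup>2)"
proof -
  have [measurable]: "g \<in> borel_measurable borel" "h1 \<in> borel_measurable borel" "h2 \<in> borel_measurable borel"
    using wpdD(1,2)[OF w1] wpdD(1,2)[OF w2] by measurable
  have c: "(\<integral>\<^sup>+x. indicator (cell k z) x * ennreal ((g x)\<^sup>2) \<partial>lborel)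
    \<le> ennreal (16 / (real (Suc k))\<^sup>2) * (\<integral>\<^sup>+x. indicator (cell k z) x * ennreal ((h1 x)\<^sup>2 + (h2 x)\<^sup>2) \<partial>lborel)
      + ennreal (2 * (real (Suc k))\<^sup>2 * (\<integral>x. indicator (cell k z) x * g x \<partial>lborel)\<^sup>2)" for z
    using cell_estimate[OF assms, of "1 / real (Suc k)" "real_of_int (fst z) / real (Suc k)" "real_of_int (snd z) / real (Suc k)"]
    unfolding cell_def[symmetric] by (simp add: power_divide mult_ac)
  have "(\<Sum>z\<in>grid N k. \<integral>\<^sup>+x. indicator (cell k z) x * ennreal ((g x)\<^sup>2) \<partial>lborel)
    \<le> (\<Sum>z\<in>grid N k. ennreal (16 / (real (Suc k))\<^sup>2) * (\<integral>\<^sup>+x. indicator (cell k z) x * ennreal ((h1 x)\<^sup>2 + (h2 x)\<^sup>2) \<partial>lborel)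
      + ennreal (2 * (real (Suc k))\<^sup>2 * (\<integral>x. indicator (cell k z) x * g x \<partial>lborel)\<^sup>2))"
    by (intro sum_mono c)
  also have "\<dots> = ennreal (16 / (real (Suc k))\<^sup>2) * (\<Sum>z\<in>grid N k. \<integral>\<^sup>+x. indicator (cell k z) x * ennreal ((h1 x)\<^sup>2 + (h2 x)\<^sup>2) \<partial>lborel)
     + ennreal (\<Sum>z\<in>grid N k. 2 * (real (Suc k))\<^sup>2 * (\<integral>x. indicator (cell k z) x * g x \<partial>lborel)\<^sup>2)"
    unfolding sum.distrib sum_distrib_left by (subst sum_ennreal) auto
  finally show ?thesis
    unfolding nn_integral_square_cells[where k=k, of "\<lambda>x. ennreal ((g x)\<^sup>2)", measurable]
    by (subst (1 2) nn_integral_square_cells[where k=k]) measurable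
qed

text \<open>A bound that does not depend on the mesh, to feed a diagonal extraction. Cells have
  measure at most 1, so Cauchy-Schwarz bounds the squared integral t^2; the estimate of t by 1 + t^2
  avoids a root.\<close>

lemma cell_integral_bound:
  assumes "wpd 1 g h1" "wpd 2 g h2"
    and mean: "(\<integral>x. indicator (sq 0 0 1) x * g x \<partial>lborel) = 0"
    and N: "N \<ge> 1" "z \<in> grid N k"
    and M: "(\<integral>\<^sup>+x. indicator (square N) x * ennreal ((h1 x)\<^sup>2 + (h2 x)\<^sup>2) \<partial>lborel) \<le> ennreal M" "0 \<le> M"
  shows "\<bar>\<integral>x. indicator (cell k z) x * g x \<partial>lborel\<bar> \<le> 1 + (128 * (real N)\<^sup>2 + 512 * real N ^ 4) * M"
proof -
  have [measurable]: "g \<in> borel_measurable borel" using wpdD(1)[OF assms(1)] by measurable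
  define t where "t = (\<integral>x. indicator (cell k z) x * g x \<partial>lborel)"
  define K where "K = (128 * (real N)\<^sup>2 + 512 * real N ^ 4) * M"
  have K: "K \<ge> 0" using M unfolding K_def by simp
  have sub: "cell k z \<subseteq> square N" using N(2) by (auto simp: mem_cell mem_square[of _ N k])
  have em: "emeasure lborel (cell k z) = ennreal ((1 / real (Suc k))\<^sup>2)" unfolding cell_def by (simp add: emeasure_sq)
  have "(1 / real (Suc k))\<^sup>2 \<le> 1\<^sup>2" by (intro power_mono) auto
  then have em1: "emeasure lborel (cell k z) \<le> 1" unfolding em using ennreal_leI by fastforce
  have "ennreal (t\<^sup>2) \<le> emeasure lborel (cell k z) * (\<integral>\<^sup>+x. indicator (cell k z) x * ennreal ((g x)\<^sup>2) \<partial>lborel)"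
    unfolding t_def using em by (intro set_jensen) auto
  also have "\<dots> \<le> 1 * (\<integral>\<^sup>+x. indicator (square N) x * ennreal ((g x)\<^sup>2) \<partial>lborel)"
    using sub em1 by (intro mult_mono nn_integral_mono) (auto simp: indicator_def)
  also have "\<dots> \<le> ennreal (128 * (real N)\<^sup>2 + 512 * real N ^ 4) * (\<integral>\<^sup>+x. indicator (square N) x * ennreal ((h1 x)\<^sup>2 + (h2 x)\<^sup>2) \<partial>lborel)"
    using mean_zero_estimate[OF assms(1,2) _ mean, of "real N"] N(1) unfolding square_def by simp
  also have "\<dots> \<le> ennreal (128 * (real N)\<^sup>2 + 512 * real N ^ 4) * ennreal M"
    by (intro mult_left_mono M) auto
  also have "\<dots> = ennreal K" unfolding K_def using M by (simp add: ennreal_mult'')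
  finally have "t\<^sup>2 \<le> K" using K by simp
  moreover have "\<bar>t\<bar> \<le> 1 + t\<^sup>2" using sum_squares_bound[of 1 "\<bar>t\<bar>"] by (simp add: power2_eq_square)
  ultimately show ?thesis unfolding K_def t_def by linarith
qed

section \<open>Completeness of L^q and Rellich compactness\<close>

text \<open>Riesz-Fischer relative to an exhaustion. It is applied to local L^2 with the squares as
  exhaustion, and to global L^q with every set of the exhaustion equal to the plane; the almost
  everywhere convergent subsequence serves Fatou's lemma in the second case.\<close>

lemma Lq_complete:
  fixes G :: "nat \<Rightarrow> real^2 \<Rightarrow> 'b::euclidean_space" and S :: "nat \<Rightarrow> (real^2) set" and q :: real
  assumes q: "q > 0" and G [measurable]: "\<And>n. G n \<in> borel_measurable borel"
    and S [measurable]: "\<And>R. S R \<in> sets borel" and US: "(\<Union>R. S R) = UNIV"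
    and Cauchy: "\<And>R e. e > 0 \<Longrightarrow> \<exists>N. \<forall>n\<ge>N. \<forall>m\<ge>N.
      (\<integral>\<^sup>+x. indicator (S R) x * ennreal (norm (G n x - G m x) powr q) \<partial>lborel) \<le> ennreal e"
  obtains g s where "g \<in> borel_measurable borel" "strict_mono s"
    "AE x in lborel. (\<lambda>k. G (s k) x) \<longlonglongrightarrow> g x"
    "\<And>R e. e > 0 \<Longrightarrow> \<exists>N. \<forall>n\<ge>N. (\<integral>\<^sup>+x. indicator (S R) x * ennreal (norm (G n x - g x) powr q) \<partial>lborel) \<le> ennreal e"
proof -
  \<comment> \<open>The first factor is the q-th power of the intended pointwise jump 2^-k, the
    second makes the weighted errors summable.\<close>
  define e where "e k = (1 / 2 ^ k) powr q * (1 / 2) ^ k" for k :: nat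
  have e: "e k > 0" for k by (simp add: e_def)
  define NN where "NN R e = (SOME N. \<forall>n\<ge>N. \<forall>m\<ge>N.
      (\<integral>\<^sup>+x. indicator (S R) x * ennreal (norm (G n x - G m x) powr q) \<partial>lborel) \<le> ennreal e)" for R e
  have NN: "(\<integral>\<^sup>+x. indicator (S R) x * ennreal (norm (G n x - G m x) powr q) \<partial>lborel) \<le> ennreal e"
    if "e > 0" "n \<ge> NN R e" "m \<ge> NN R e" for R e n m
    using someI_ex[OF Cauchy[OF that(1), of R], folded NN_def] that by blast
  \<comment> \<open>Adding all thresholds with both indices up to k dominates each of them at once,
    and the successor makes the sequence strictly increasing.\<close>
  define s where "s k = (\<Sum>i\<le>k. \<Sum>R\<le>k. Suc (NN R (e i)))" for k
  have s_less: "s k < s (Suc k)" for k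
  proof -
    have "s k \<le> (\<Sum>i\<le>k. \<Sum>R\<le>Suc k. Suc (NN R (e i)))"
      unfolding s_def by (intro sum_mono) simp
    also have "\<dots> < s (Suc k)" unfolding s_def by simp
    finally show ?thesis .
  qed
  then have s: "strict_mono s" by (simp add: strict_mono_Suc_iff)
  have s_ge: "NN R (e k) \<le> s m" if "R \<le> k" "k \<le> m" for R k m
  proof -
    have "NN R (e k) \<le> Suc (NN R (e k))" by simp
    also have "\<dots> \<le> (\<Sum>R\<le>m. Suc (NN R (e k)))" using that by (intro member_le_sum) auto
    also have "\<dots> \<le> s m" unfolding s_def
      using that by (intro member_le_sum[of k "{..m}" "\<lambda>i. \<Sum>R\<le>m. Suc (NN R (e i))"]) auto
    finally show ?thesis .
  qed
  have conv_S: "AE x in lborel. x \<in> S R \<longrightarrow> convergent (\<lambda>k. G (s k) x)" for R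
  proof -
    \<comment> \<open>The shift by R is essential: the threshold for the set \<open>S R\<close> is
      respected only from index R on. The weight rescales the allowed jump to size 1, so c tending
      to zero gives a geometric bound on the jumps.\<close>
    define c where "c k x = (2 ^ (k + R)) powr q * norm (G (s (Suc (k + R))) x - G (s (k + R)) x) powr q" for k x
    have [measurable]: "c k \<in> borel_measurable borel" for k unfolding c_def by measurable
    have ck: "(\<integral>\<^sup>+x. indicator (S R) x * ennreal (c k x) \<partial>lborel) \<le> ennreal ((1 / 2) ^ (k + R))" for k
    proof -
      have "(\<integral>\<^sup>+x. indicator (S R) x * ennreal (c k x) \<partial>lborel) =
        ennreal ((2 ^ (k + R)) powr q) * (\<integral>\<^sup>+x. indicator (S R) x * ennreal (norm (G (s (Suc (k + R))) x - G (s (k + R)) x) powr q) \<partial>lborel)"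
        by (subst nn_integral_cmult[symmetric]) (auto simp: c_def ennreal_mult' mult_ac)
      also have "\<dots> \<le> ennreal ((2 ^ (k + R)) powr q) * ennreal (e (k + R))"
        by (intro mult_left_mono NN e s_ge) auto
      also have "\<dots> = ennreal ((1 / 2) ^ (k + R))"
        by (simp add: e_def ennreal_mult'[symmetric] mult.assoc[symmetric] powr_mult[symmetric])
      finally show ?thesis .
    qed
    have "(\<integral>\<^sup>+x. (\<Sum>k. indicator (S R) x * ennreal (c k x)) \<partial>lborel) = (\<Sum>k. \<integral>\<^sup>+x. indicator (S R) x * ennreal (c k x) \<partial>lborel)"
      by (intro nn_integral_suminf) measurable
    also have "\<dots> \<le> (\<Sum>k. ennreal ((1 / 2) ^ (k + R)))"
      by (intro suminf_le ck) auto
    also have "\<dots> = ennreal (\<Sum>k. (1 / 2) ^ (k + R))"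
      by (intro suminf_ennreal2) (auto simp: summable_iff_shift)
    finally have "(\<integral>\<^sup>+x. (\<Sum>k. indicator (S R) x * ennreal (c k x)) \<partial>lborel) \<noteq> \<infinity>"
      by (auto simp: top_unique)
    then have "AE x in lborel. (\<Sum>k. indicator (S R) x * ennreal (c k x)) \<noteq> \<infinity>"
      by (intro nn_integral_noteq_infinite) auto
    then show ?thesis
    proof eventually_elim
      case (elim x)
      show ?case
      proof
        assume "x \<in> S R"
        then have "summable (\<lambda>k. c k x)"
          using elim by (intro summable_suminf_not_top) (auto simp: c_def)
        then have "(\<lambda>k. c k x) \<longlonglongrightarrow> 0" by (rule summable_LIMSEQ_zero)
        then have "eventually (\<lambda>k. c k x < 1) sequentially" by (rule order_tendstoD) simp
        then have ev: "eventually (\<lambda>k. norm (G (s (Suc (k + R))) x - G (s (k + R)) x) \<le> (1 / 2) ^ (k + R)) sequentially"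
        proof eventually_elim
          case (elim k)
          define y where "y = norm (G (s (Suc (k + R))) x - G (s (k + R)) x)"
          have "(2 ^ (k + R) * y) powr q < 1" using elim by (simp add: c_def y_def powr_mult)
          then have "2 ^ (k + R) * y < 1"
            using ge_one_powr_ge_zero[of "2 ^ (k + R) * y" q] q by linarith
          then show ?case unfolding y_def[symmetric] by (simp add: field_simps)
        qed
        have "summable (\<lambda>k. G (s (Suc (k + R))) x - G (s (k + R)) x)"
          by (rule summable_comparison_test_ev[OF ev]) (auto simp: summable_iff_shift)
        then have "summable (\<lambda>k. G (s (Suc k)) x - G (s k) x)"
          using summable_iff_shift[of "\<lambda>k. G (s (Suc k)) x - G (s k) x" R] by simp
        then have "convergent (\<lambda>n. G (s 0) x + (\<Sum>k<n. G (s (Suc k)) x - G (s k) x))"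
          by (intro convergent_add convergent_const) (simp add: summable_iff_convergent)
        moreover have "G (s 0) x + (\<Sum>k<n. G (s (Suc k)) x - G (s k) x) = G (s n) x" for n
          by (simp add: sum_lessThan_telescope[of "\<lambda>k. G (s k) x"])
        ultimately show "convergent (\<lambda>k. G (s k) x)" by simp
      qed
    qed
  qed
  define g where "g x = lim (\<lambda>k. G (s k) x)" for x
  have [measurable]: "g \<in> borel_measurable borel" unfolding g_def by measurable
  have "AE x in lborel. \<forall>R. x \<in> S R \<longrightarrow> convergent (\<lambda>k. G (s k) x)"
    using conv_S by (subst AE_all_countable) blast
  then have lim: "AE x in lborel. (\<lambda>k. G (s k) x) \<longlonglongrightarrow> g x"
  proof eventually_elim
    case (elim x)
    obtain R where "x \<in> S R" using US by blast
    then show ?case using elim unfolding g_def convergent_LIMSEQ_iff by blast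
  qed
  show thesis
  proof (rule that[OF _ s lim])
    fix R :: nat and e' :: real assume e': "e' > 0"
    show "\<exists>N. \<forall>n\<ge>N. (\<integral>\<^sup>+x. indicator (S R) x * ennreal (norm (G n x - g x) powr q) \<partial>lborel) \<le> ennreal e'"
    proof (intro exI allI impI)
      fix n assume n: "NN R e' \<le> n"
      have "(\<integral>\<^sup>+x. indicator (S R) x * ennreal (norm (G n x - g x) powr q) \<partial>lborel) =
         (\<integral>\<^sup>+x. liminf (\<lambda>k. indicator (S R) x * ennreal (norm (G n x - G (s k) x) powr q)) \<partial>lborel)"
      proof (rule nn_integral_cong_AE)
        show "AE x in lborel. indicator (S R) x * ennreal (norm (G n x - g x) powr q) =
          liminf (\<lambda>k. indicator (S R) x * ennreal (norm (G n x - G (s k) x) powr q))"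
          using lim
        proof eventually_elim
          case (elim x)
          have "(\<lambda>k. norm (G n x - G (s k) x) powr q) \<longlonglongrightarrow> norm (G n x - g x) powr q"
            using q by (intro tendsto_powr' tendsto_intros elim) auto
          then have "(\<lambda>k. ennreal (norm (G n x - G (s k) x) powr q)) \<longlonglongrightarrow> ennreal (norm (G n x - g x) powr q)"
            by (rule tendsto_ennrealI)
          then have "(\<lambda>k. indicator (S R) x * ennreal (norm (G n x - G (s k) x) powr q)) \<longlonglongrightarrow> indicator (S R) x * ennreal (norm (G n x - g x) powr q)"
            by (auto simp: indicator_def)
          from lim_imp_Liminf[OF _ this] show ?case by simp
        qed
      qed
      also have "\<dots> \<le> liminf (\<lambda>k. \<integral>\<^sup>+x. indicator (S R) x * ennreal (norm (G n x - G (s k) x) powr q) \<partial>lborel)"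
        by (rule nn_integral_liminf) measurable
      also have "\<dots> \<le> liminf (\<lambda>k::nat. ennreal e')"
      proof (rule Liminf_mono)
        have "eventually (\<lambda>k. NN R e' \<le> s k) sequentially"
          using eventually_ge_at_top[of "NN R e'"]
          by eventually_elim (use seq_suble[OF s] order_trans in blast)
        then show "eventually (\<lambda>k. (\<integral>\<^sup>+x. indicator (S R) x * ennreal (norm (G n x - G (s k) x) powr q) \<partial>lborel) \<le> ennreal e') sequentially"
          by eventually_elim (use NN[OF e' n] in blast)
      qed
      also have "\<dots> = ennreal e'" by (simp add: Liminf_const)
      finally show "(\<integral>\<^sup>+x. indicator (S R) x * ennreal (norm (G n x - g x) powr q) \<partial>lborel) \<le> ennreal e'" .
    qed
  qed measurable
qed

lemma sq_diff_le: "(c - d)\<^sup>2 \<le> 2 * c\<^sup>2 + 2 * (d::real)\<^sup>2"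
  using zero_le_power2[of "c + d"] by (simp add: power2_eq_square algebra_simps)

lemma ennreal_le_double_sum:
  assumes "c \<le> 2 * a + 2 * b" "0 \<le> a" "0 \<le> b"
  shows "ennreal c \<le> 2 * ennreal a + 2 * ennreal b"
proof -
  have "2 * ennreal a + 2 * ennreal b = ennreal (2 * a + 2 * b)"
    using assms by (simp add: ennreal_plus ennreal_mult')
  then show ?thesis using ennreal_leI[OF assms(1)] by simp
qed

lemma cball_subset_square: "r < real N \<Longrightarrow> cball 0 r \<subseteq> square N"
  unfolding square_def by (rule cball_subset_sq)

lemma UN_square: "(\<Union>N. square N) = UNIV"
proof -
  have "x \<in> (\<Union>N. square N)" for x
  proof -
    obtain N where "norm x < real N" using reals_Archimedean2 by blast
    then have "x \<in> square N" using cball_subset_square[of "norm x" N] by auto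
    then show ?thesis by blast
  qed
  then show ?thesis by blast
qed

text \<open>One subsequence makes all cell integrals, over all meshes and cells, converge. Then
  \<open>grid_estimate\<close> applied to differences gives the Cauchy property on each square: the
  mesh is chosen from the gradient bound, and the finitely many remaining cell integrals are
  Cauchy.\<close>

lemma rellich:
  fixes g h1 h2 :: "nat \<Rightarrow> real^2 \<Rightarrow> real"
  assumes w1: "\<And>n. wpd 1 (g n) (h1 n)" and w2: "\<And>n. wpd 2 (g n) (h2 n)"
    and mean: "\<And>n. (\<integral>x. indicator (sq 0 0 1) x * g n x \<partial>lborel) = 0"
    and bound: "\<And>N. \<exists>M. \<forall>n. (\<integral>\<^sup>+x. indicator (square N) x * ennreal ((h1 n x)\<^sup>2 + (h2 n x)\<^sup>2) \<partial>lborel) \<le> ennreal M"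
  obtains r u where "strict_mono (r :: nat \<Rightarrow> nat)" "u \<in> borel_measurable borel"
    "\<And>N e. e > 0 \<Longrightarrow> \<exists>n0. \<forall>n\<ge>n0. (\<integral>\<^sup>+x. indicator (square N) x * ennreal ((g (r n) x - u x)\<^sup>2) \<partial>lborel) \<le> ennreal e"
proof -
  have [measurable]: "g n \<in> borel_measurable borel" "h1 n \<in> borel_measurable borel" "h2 n \<in> borel_measurable borel" for n
    using wpdD(1,2)[OF w1] wpdD(1,2)[OF w2] by measurable
  define A where "A N n = (\<integral>\<^sup>+x. indicator (square N) x * ennreal ((h1 n x)\<^sup>2 + (h2 n x)\<^sup>2) \<partial>lborel)" for N n
  have "\<forall>N. \<exists>M. \<forall>n. A N n \<le> ennreal M" using bound by (simp add: A_def)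
  from choice[OF this] obtain M' where M': "\<And>N n. A N n \<le> ennreal (M' N)" by blast
  define M where "M N = max 0 (M' N)" for N
  have M: "A N n \<le> ennreal (M N)" "0 \<le> M N" for N n
    using M'[of N n] by (auto simp: M_def max_def ennreal_neg intro: order_trans)
  \<comment> \<open>The index z alone determines a square containing the cell of index z for every
    mesh, since refining the mesh moves that cell towards the origin. Hence the bound
    \<open>B z\<close> is the same for all k.\<close>
  define NZ where "NZ z = nat (\<bar>fst z\<bar> + \<bar>snd z\<bar>) + 1" for z :: "int \<times> int"
  have NZ: "NZ z \<ge> 1" "z \<in> grid (NZ z) k" for z k
  proof -
    have 1: "int (NZ z) = \<bar>fst z\<bar> + \<bar>snd z\<bar> + 1" by (simp add: NZ_def)
    have 2: "int (NZ z) \<le> int (NZ z * Suc k)" by simp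
    show "NZ z \<ge> 1" by (simp add: NZ_def)
    have "- int (NZ z * Suc k) \<le> fst z \<and> fst z < int (NZ z * Suc k)
        \<and> - int (NZ z * Suc k) \<le> snd z \<and> snd z < int (NZ z * Suc k)"
      using 1 2 by linarith
    then show "z \<in> grid (NZ z) k"
      unfolding grid_def mem_Times_iff atLeastLessThan_iff by blast
  qed
  define B where "B z = 1 + (128 * (real (NZ z))\<^sup>2 + 512 * real (NZ z) ^ 4) * M (NZ z)" for z
  have B: "B z > 0" for z unfolding B_def using M(2)[of "NZ z"] by (intro add_pos_nonneg) auto
  define t where "t n w = (\<integral>x. indicator (cell (fst w) (snd w)) x * g n x \<partial>lborel)" for n w
  have tB: "\<bar>t n w\<bar> \<le> B (snd w)" for n w
    unfolding t_def B_def
    by (rule cell_integral_bound[OF w1 w2 mean NZ M(1)[unfolded A_def] M(2)])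
  have ct: "countable (UNIV :: (nat \<times> int \<times> int) set)" by simp
  \<comment> \<open>The extraction asks for one bound for all indices, so each functional is divided
    by its own bound.\<close>
  have nb: "norm (t n w / B (snd w)) \<le> 1" for n w
    using tB[of n w] B[of "snd w"] by (simp add: abs_mult field_simps)
  obtain r where r: "strict_mono (r :: nat \<Rightarrow> nat)" "\<And>w. \<exists>l. (\<lambda>n. t (r n) w / B (snd w)) \<longlonglongrightarrow> l"
    by (rule function_convergent_subsequence[OF ct, where f="\<lambda>n w. t n w / B (snd w)", OF nb]) blast
  have "\<exists>l. (\<lambda>n. t (r n) w) \<longlonglongrightarrow> l" for w
  proof -
    obtain l where "(\<lambda>n. t (r n) w / B (snd w)) \<longlonglongrightarrow> l" using r(2) by blast
    then have "(\<lambda>n. t (r n) w / B (snd w) * B (snd w)) \<longlonglongrightarrow> l * B (snd w)" by (intro tendsto_intros)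
    then show ?thesis using B[of "snd w"] by auto
  qed
  then obtain T where T: "\<And>w. (\<lambda>n. t (r n) w) \<longlonglongrightarrow> T w" by metis
  have Cauchy: "\<exists>n0. \<forall>n\<ge>n0. \<forall>m\<ge>n0. (\<integral>\<^sup>+x. indicator (square N) x * ennreal (norm (g (r n) x - g (r m) x) powr 2) \<partial>lborel) \<le> ennreal e"
    if e: "e > 0" for N e
  proof -
    \<comment> \<open>Gradients of differences have squared norm at most \<open>4 * M N\<close>, so
      16 / s^2 times this is at most e / 2 as soon as s^2 is at least
      \<open>128 * M N / e\<close>.\<close>
    obtain k where k: "128 * M N / e < real k" using reals_Archimedean2 by blast
    define s where "s = real (Suc k)"
    have "0 \<le> 128 * M N / e" using M(2)[of N] e by simp
    then have s: "s \<ge> 1" "128 * M N / e \<le> s" using k by (auto simp: s_def)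
    have "s * 1 \<le> s * s" using s(1) by (intro mult_left_mono) auto
    then have "128 * M N / e \<le> s\<^sup>2"
      using s(2) unfolding power2_eq_square by linarith
    then have s2: "16 / s\<^sup>2 * (4 * M N) \<le> e / 2" using e s(1) by (simp add: field_simps)
    define a where "a n = (\<Sum>z\<in>grid N k. 2 * s\<^sup>2 * (t (r n) (k, z) - T (k, z))\<^sup>2)" for n
    have "a \<longlonglongrightarrow> (\<Sum>z\<in>grid N k. 2 * s\<^sup>2 * (T (k, z) - T (k, z))\<^sup>2)"
      unfolding a_def by (intro tendsto_intros T)
    then have "a \<longlonglongrightarrow> 0" by simp
    from LIMSEQ_D[OF this, of "e / 8"] e obtain n0 where n0: "\<And>n. n \<ge> n0 \<Longrightarrow> \<bar>a n\<bar> < e / 8" by auto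
    show ?thesis
    proof (intro exI allI impI)
      fix n m assume nm: "n0 \<le> n" "n0 \<le> m"
      define d where "d x = g (r n) x - g (r m) x" for x
      have w: "wpd 1 d (\<lambda>x. h1 (r n) x - h1 (r m) x)" "wpd 2 d (\<lambda>x. h2 (r n) x - h2 (r m) x)"
        unfolding d_def using wpd_linear[OF w1[of "r n"] w1[of "r m"], of 1 "-1"]
          wpd_linear[OF w2[of "r n"] w2[of "r m"], of 1 "-1"] by auto
      have "(\<integral>\<^sup>+x. indicator (square N) x * ennreal ((h1 (r n) x - h1 (r m) x)\<^sup>2 + (h2 (r n) x - h2 (r m) x)\<^sup>2) \<partial>lborel)
        \<le> (\<integral>\<^sup>+x. 2 * (indicator (square N) x * ennreal ((h1 (r n) x)\<^sup>2 + (h2 (r n) x)\<^sup>2))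
          + 2 * (indicator (square N) x * ennreal ((h1 (r m) x)\<^sup>2 + (h2 (r m) x)\<^sup>2)) \<partial>lborel)"
      proof (intro nn_integral_mono)
        fix x
        have "(h1 (r n) x - h1 (r m) x)\<^sup>2 + (h2 (r n) x - h2 (r m) x)\<^sup>2 \<le>
          2 * ((h1 (r n) x)\<^sup>2 + (h2 (r n) x)\<^sup>2) + 2 * ((h1 (r m) x)\<^sup>2 + (h2 (r m) x)\<^sup>2)"
          using sq_diff_le[of "h1 (r n) x" "h1 (r m) x"] sq_diff_le[of "h2 (r n) x" "h2 (r m) x"] by simp
        from ennreal_le_double_sum[OF this]
        show "indicator (square N) x * ennreal ((h1 (r n) x - h1 (r m) x)\<^sup>2 + (h2 (r n) x - h2 (r m) x)\<^sup>2)
          \<le> 2 * (indicator (square N) x * ennreal ((h1 (r n) x)\<^sup>2 + (h2 (r n) x)\<^sup>2))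
          + 2 * (indicator (square N) x * ennreal ((h1 (r m) x)\<^sup>2 + (h2 (r m) x)\<^sup>2))"
          by (cases "x \<in> square N") (simp_all del: ennreal_plus)
      qed
      also have "\<dots> = 2 * A N (r n) + 2 * A N (r m)"
        unfolding A_def by (subst nn_integral_add) (auto simp: nn_integral_cmult)
      also have "\<dots> \<le> 2 * ennreal (M N) + 2 * ennreal (M N)" by (intro add_mono mult_left_mono M) auto
      also have "\<dots> = ennreal (4 * M N)" using M(2)[of N] by (simp add: ennreal_mult' mult_2_right flip: distrib_right)
      finally have A: "(\<integral>\<^sup>+x. indicator (square N) x * ennreal ((h1 (r n) x - h1 (r m) x)\<^sup>2 + (h2 (r n) x - h2 (r m) x)\<^sup>2) \<partial>lborel) \<le> ennreal (4 * M N)" .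
      have "(\<integral>x. indicator (cell k z) x * d x \<partial>lborel) = t (r n) (k, z) - t (r m) (k, z)" for z
      proof -
        have "integrable lborel (\<lambda>x. indicator (cell k z) x * g l x)" for l
          unfolding cell_def by (intro locL1_sq_integrable wpdD(1)[OF w1])
        then show ?thesis unfolding d_def right_diff_distrib t_def by simp
      qed
      then have "(\<Sum>z\<in>grid N k. 2 * s\<^sup>2 * (\<integral>x. indicator (cell k z) x * d x \<partial>lborel)\<^sup>2)
         = (\<Sum>z\<in>grid N k. 2 * s\<^sup>2 * (t (r n) (k, z) - t (r m) (k, z))\<^sup>2)" by simp
      also have "\<dots> \<le> (\<Sum>z\<in>grid N k. 2 * (2 * s\<^sup>2 * (t (r n) (k, z) - T (k, z))\<^sup>2) + 2 * (2 * s\<^sup>2 * (t (r m) (k, z) - T (k, z))\<^sup>2))"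
      proof (intro sum_mono)
        fix z
        show "2 * s\<^sup>2 * (t (r n) (k, z) - t (r m) (k, z))\<^sup>2 \<le> 2 * (2 * s\<^sup>2 * (t (r n) (k, z) - T (k, z))\<^sup>2) + 2 * (2 * s\<^sup>2 * (t (r m) (k, z) - T (k, z))\<^sup>2)"
          using mult_left_mono[OF sq_diff_le[of "t (r n) (k, z) - T (k, z)" "t (r m) (k, z) - T (k, z)"], of "2 * s\<^sup>2"]
          by (simp add: distrib_left mult.assoc mult.left_commute)
      qed
      also have "\<dots> = 2 * a n + 2 * a m" unfolding a_def by (simp add: sum.distrib sum_distrib_left)
      also have "\<dots> \<le> e / 2" using n0[OF nm(1)] n0[OF nm(2)] by linarith
      finally have E: "(\<Sum>z\<in>grid N k. 2 * s\<^sup>2 * (\<integral>x. indicator (cell k z) x * d x \<partial>lborel)\<^sup>2) \<le> e / 2" .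
      have "(\<integral>\<^sup>+x. indicator (square N) x * ennreal ((d x)\<^sup>2) \<partial>lborel) \<le> ennreal (16 / s\<^sup>2) * ennreal (4 * M N) + ennreal (e / 2)"
        by (rule order_trans[OF grid_estimate[OF w, of N k, folded s_def]])
          (intro add_mono mult_left_mono A ennreal_leI E, auto)
      also have "\<dots> \<le> ennreal (e / 2) + ennreal (e / 2)"
        using ennreal_leI[OF s2] M(2)[of N] by (intro add_mono) (auto simp: ennreal_mult'[symmetric])
      also have "\<dots> = ennreal e" using e by (simp flip: ennreal_plus)
      finally show "(\<integral>\<^sup>+x. indicator (square N) x * ennreal (norm (g (r n) x - g (r m) x) powr 2) \<partial>lborel) \<le> ennreal e"
        by (simp add: d_def powr_numeral)
    qed
  qed
  obtain u where u: "u \<in> borel_measurable borel"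
    "\<And>N e. e > 0 \<Longrightarrow> \<exists>n0. \<forall>n\<ge>n0. (\<integral>\<^sup>+x. indicator (square N) x * ennreal (norm (g (r n) x - u x) powr 2) \<partial>lborel) \<le> ennreal e"
    by (rule Lq_complete[of 2 "\<lambda>n. g (r n)" square, OF _ _ _ UN_square Cauchy]) auto
  show thesis
    by (rule that[OF r(1) u(1)]) (use u(2) in \<open>simp add: powr_numeral\<close>)
qed

section \<open>Sobolev maps and uniform convexity\<close>

lemma nth_borel_measurable [measurable]: "(\<lambda>x::'a::real_normed_vector^'n. x $ i) \<in> borel_measurable borel"
  by (intro borel_measurable_continuous_onI continuous_intros)

text \<open>The working form of a Sobolev map: Borel representatives on \<open>lborel\<close>,
  componentwise weak derivatives, and gradients locally in L^2, which is the integrability that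
  \<open>weak_jacobian\<close> asks for. No global integrability is included, so that the definition
  does not depend on the exponent.\<close>

definition sob :: "(real^2 \<Rightarrow> real^2) \<Rightarrow> (real^2 \<Rightarrow> real^2^2) \<Rightarrow> bool" where
  "sob u G \<longleftrightarrow> u \<in> borel_measurable borel \<and> G \<in> borel_measurable borel \<and>
     (\<forall>i j. wpd j (\<lambda>x. u x $ i) (\<lambda>x. G x $ i $ j) \<and> locL2 (\<lambda>x. G x $ i $ j))"

lemma sobD:
  assumes "sob u G"
  shows "u \<in> borel_measurable borel" "G \<in> borel_measurable borel"
    "wpd j (\<lambda>x. u x $ i) (\<lambda>x. G x $ i $ j)" "locL2 (\<lambda>x. G x $ i $ j)" "locL2 (\<lambda>x. u x $ i)"
proof -
  show *: "u \<in> borel_measurable borel" "G \<in> borel_measurable borel"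
    "wpd j (\<lambda>x. u x $ i) (\<lambda>x. G x $ i $ j)" "locL2 (\<lambda>x. G x $ i $ j)" for i j
    using assms by (auto simp: sob_def)
  show "locL2 (\<lambda>x. u x $ i)"
    by (rule wpd_locL2[OF *(3)[where j=1] *(3)[where j=2] *(4) *(4)])
qed

lemma energy_lborel: "energy q G = (\<integral>\<^sup>+x. ennreal (norm (G x) powr q) \<partial>lborel)"
  by (simp add: energy_def nn_integral_completion)

lemma component_le_norm_matrix: "\<bar>(A::real^2^2) $ i $ j\<bar> \<le> norm A"
proof -
  have "norm (A $ i) \<le> norm A" unfolding norm_vec_def[of A] by (intro member_le_L2_set) auto
  then show ?thesis using component_le_norm_cart[of "A $ i" j] by linarith
qed

lemma norm_matrix_le: "norm (A::real^2^2) \<le> \<bar>A $ 1 $ 1\<bar> + \<bar>A $ 1 $ 2\<bar> + (\<bar>A $ 2 $ 1\<bar> + \<bar>A $ 2 $ 2\<bar>)"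
proof -
  have "norm A \<le> norm (A $ 1) + norm (A $ 2)"
    unfolding norm_vec_def[of A] using L2_set_le_sum[of UNIV "\<lambda>i. norm (A $ i)"] by (simp add: sum_2)
  then show ?thesis using norm_le_l1_cart[of "A $ 1"] norm_le_l1_cart[of "A $ 2"] by (simp add: sum_2)
qed

lemma power2_le_powr: "(y::real) \<ge> 0 \<Longrightarrow> q \<ge> 2 \<Longrightarrow> y\<^sup>2 \<le> 1 + y powr q"
proof (cases "y \<le> 1")
  case True
  assume "y \<ge> 0"
  then have "y\<^sup>2 \<le> 1" using True by (simp add: power_le_one)
  then show ?thesis using powr_ge_zero[of y q] by linarith
next
  case False
  assume "q \<ge> 2"
  then have "y powr 2 \<le> y powr q" using False by (intro powr_mono) auto
  then show ?thesis using False by simp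
qed

lemma energy_cball:
  assumes q: "q \<ge> 2" and [measurable]: "G \<in> borel_measurable borel" "S \<in> sets borel"
  shows "(\<integral>\<^sup>+x. indicator S x * ennreal ((norm (G x :: real^2^2))\<^sup>2) \<partial>lborel) \<le> emeasure lborel S + energy q G"
proof -
  have "(\<integral>\<^sup>+x. indicator S x * ennreal ((norm (G x))\<^sup>2) \<partial>lborel)
    \<le> (\<integral>\<^sup>+x. indicator S x + ennreal (norm (G x) powr q) \<partial>lborel)"
  proof (intro nn_integral_mono)
    fix x
    have "ennreal ((norm (G x))\<^sup>2) \<le> 1 + ennreal (norm (G x) powr q)"
      using ennreal_leI[OF power2_le_powr[of "norm (G x)" q]] q by (simp add: ennreal_plus)
    then show "indicator S x * ennreal ((norm (G x))\<^sup>2) \<le> indicator S x + ennreal (norm (G x) powr q)"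
      by (auto simp: indicator_def)
  qed
  also have "\<dots> = emeasure lborel S + energy q G"
    by (subst nn_integral_add) (auto simp: energy_lborel)
  finally show ?thesis .
qed

text \<open>This is where p \<ge> 1 enters: for q = 2 p \<ge> 2 the square of a number is at most 1
  plus its q-th power, so finite energy gives local square integrability.\<close>

lemma locL2_energy:
  assumes q: "q \<ge> 2" and [measurable]: "G \<in> borel_measurable borel" and fin: "energy q G < \<infinity>"
  shows "locL2 (\<lambda>x. G x $ i $ j)"
  unfolding locL2_def
proof (intro conjI allI)
  show [measurable]: "(\<lambda>x. G x $ i $ j) \<in> borel_measurable borel" by measurable
  fix R
  show "integrable lborel (\<lambda>x. indicator (cball 0 R) x * (G x $ i $ j)\<^sup>2)"
  proof (rule integrableI_nonneg)
    have "(\<integral>\<^sup>+x. ennreal (indicator (cball 0 R) x * (G x $ i $ j)\<^sup>2) \<partial>lborel)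
      \<le> (\<integral>\<^sup>+x. indicator (cball 0 R) x * ennreal ((norm (G x))\<^sup>2) \<partial>lborel)"
      using component_le_norm_matrix[of "G _" i j]
      by (intro nn_integral_mono) (auto simp: indicator_def abs_le_square_iff[symmetric] intro!: ennreal_leI)
    also have "\<dots> \<le> emeasure lborel (cball (0::real^2) R) + energy q G" by (intro energy_cball q) auto
    also have "\<dots> < \<infinity>" using fin emeasure_bounded_finite[OF bounded_cball, of "0::real^2" R] by simp
    finally show "(\<integral>\<^sup>+x. ennreal (indicator (cball 0 R) x * (G x $ i $ j)\<^sup>2) \<partial>lborel) < \<infinity>" .
  qed auto
qed

lemma locally_integrable_locL1:
  assumes "\<And>x. norm (g x) \<le> F x" "locL1 F" and [measurable]: "g \<in> borel_measurable borel"
  shows "locally_integrable (g :: real^2 \<Rightarrow> 'b::euclidean_space)"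
  unfolding locally_integrable_def
proof (intro allI impI)
  fix K :: "(real^2) set" assume K: "compact K"
  obtain R where R: "K \<subseteq> cball 0 R"
    using compact_imp_bounded[OF K] by (auto simp: bounded_iff subset_iff)
  have [measurable]: "K \<in> sets borel" using K by (simp add: borel_compact)
  have "integrable lborel (\<lambda>x. indicator K x *\<^sub>R g x)"
  proof (rule Bochner_Integration.integrable_bound[OF locL1_integrable[OF assms(2), of R]])
    show "AE x in lborel. norm (indicat_real K x *\<^sub>R g x) \<le> norm (indicat_real (cball 0 R) x * F x)"
      using R order_trans[OF assms(1) abs_ge_self] by (intro AE_I2) (auto simp: indicator_def)
  qed measurable
  then show "g absolutely_integrable_on K"
    unfolding set_integrable_def by (subst integrable_completion) auto
qed

lemma sob_admissible:
  assumes s: "sob u G" and fin: "energy (2 * p) G < \<infinity>" and det: "AE x in lborel. det (G x) = f x"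
  shows "admissible p f u G"
proof -
  note [measurable] = sobD(1,2)[OF s]
  have "locL1 (\<lambda>x. \<bar>u x $ 1\<bar> + \<bar>u x $ 2\<bar>)"
    by (intro locL1_add locL1_abs locL2_imp_locL1 sobD[OF s])
  then have 1: "locally_integrable u"
    using norm_le_l1_cart[of "u _"] by (intro locally_integrable_locL1[of u]) (auto simp: sum_2)
  have "locL1 (\<lambda>x. \<bar>G x $ 1 $ 1\<bar> + \<bar>G x $ 1 $ 2\<bar> + (\<bar>G x $ 2 $ 1\<bar> + \<bar>G x $ 2 $ 2\<bar>))"
    by (intro locL1_add locL1_abs locL2_imp_locL1 sobD[OF s])
  then have 2: "locally_integrable G"
    using norm_matrix_le[of "G _"] by (intro locally_integrable_locL1[of G]) auto
  have 3: "(\<integral>x. u x $ i * partial_deriv j \<phi> x \<partial>lebesgue) = - (\<integral>x. G x $ i $ j * \<phi> x \<partial>lebesgue)"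
    if t: "test_function \<phi>" for \<phi> i j
  proof -
    have [measurable]: "\<phi> \<in> borel_measurable borel" "partial_deriv j \<phi> \<in> borel_measurable borel"
      using t test_function_partial[OF t] by measurable
    show ?thesis
      using wpdD(3)[OF sobD(3)[OF s] t] by (simp add: integral_completion)
  qed
  have "in_Lp (2 * p) G"
    unfolding in_Lp_def
  proof
    show "G \<in> borel_measurable lebesgue" by (simp add: measurable_completion)
    have "integrable lborel (\<lambda>x. norm (G x) powr (2 * p))"
      using fin unfolding energy_lborel by (intro integrableI_nonneg) auto
    then show "integrable lebesgue (\<lambda>x. norm (G x) powr (2 * p))" by (subst integrable_completion) auto
  qed
  then show ?thesis unfolding admissible_def has_weak_gradient_def
    using 1 2 3 det by (simp add: AE_completion_iff)
qed

lemma lebesgue_borel_rep: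
  fixes g :: "real^2 \<Rightarrow> real"
  assumes "g \<in> borel_measurable lebesgue"
  obtains g' where "g' \<in> borel_measurable borel" "AE x in lborel. g x = g' x"
  using completion_ex_borel_measurable_real[OF assms] by auto

lemma locL1_rep:
  fixes g :: "real^2 \<Rightarrow> real"
  assumes g: "\<And>R. g absolutely_integrable_on cball 0 R"
    and [measurable]: "g' \<in> borel_measurable borel" and ae: "AE x in lborel. g x = g' x"
  shows "locL1 g'"
  unfolding locL1_def
proof (intro conjI allI)
  fix R
  have "integrable lebesgue (\<lambda>x. indicator (cball 0 R) x *\<^sub>R g x)"
    using g[of R] unfolding set_integrable_def .
  moreover have "AE x in lebesgue. indicator (cball 0 R) x *\<^sub>R g x = indicator (cball 0 R) x * g' x"
    using ae unfolding AE_completion_iff by eventually_elim simp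
  moreover have "(\<lambda>x. indicator (cball 0 R) x * g' x) \<in> borel_measurable lebesgue"
    by (intro measurable_completion) measurable
  ultimately have "integrable lebesgue (\<lambda>x. indicator (cball 0 R) x * g' x)"
    using integrable_cong_AE_imp by blast
  then show "integrable lborel (\<lambda>x. indicator (cball 0 R) x * g' x)"
    by (subst (asm) integrable_completion) auto
qed simp

text \<open>Borel representatives are chosen for the scalar components and reassembled along the
  coordinate matrices. The weak derivative identity survives because it involves the functions only
  under integrals.\<close>

lemma admissible_sob:
  assumes a: "admissible p f v H" and p: "p \<ge> 1"
  obtains u G where "sob u G" "energy (2 * p) G = energy (2 * p) H" "energy (2 * p) G < \<infinity>"
    "AE x in lborel. v x = u x" "AE x in lborel. det (G x) = f x"
proof -
  have li: "locally_integrable v" "locally_integrable H" and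
    wg: "\<And>\<phi> i j. test_function \<phi> \<Longrightarrow> (\<integral>x. v x $ i * partial_deriv j \<phi> x \<partial>lebesgue) = - (\<integral>x. H x $ i $ j * \<phi> x \<partial>lebesgue)"
    and Lp: "in_Lp (2 * p) H" and det: "AE x in lborel. det (H x) = f x"
    using a unfolding admissible_def has_weak_gradient_def by (auto simp: AE_completion_iff)
  have vi: "(\<lambda>x. v x $ i) absolutely_integrable_on cball 0 R" for i R
  proof -
    have "v absolutely_integrable_on cball 0 R" using li(1) by (simp add: locally_integrable_def)
    from absolutely_integrable_component[OF this, where b="axis i 1"] show ?thesis by (simp add: inner_axis)
  qed
  have Hi: "(\<lambda>x. H x $ i $ j) absolutely_integrable_on cball 0 R" for i j R
  proof -
    have "H absolutely_integrable_on cball 0 R" using li(2) by (simp add: locally_integrable_def)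
    from absolutely_integrable_component[OF this, where b="axis i (axis j 1)"] show ?thesis by (simp add: inner_axis)
  qed
  \<comment> \<open>Integrability on balls gives measurability of the cut functions, and the
    function is their pointwise limit.\<close>
  have lm: "g \<in> borel_measurable lebesgue" if "\<And>R. g absolutely_integrable_on cball 0 R" for g :: "real^2 \<Rightarrow> real"
  proof (rule borel_measurable_LIMSEQ_real)
    show "(\<lambda>n. indicator (cball 0 (real n)) x * g x) \<longlonglongrightarrow> g x" for x
    proof (rule Lim_transform_eventually[OF tendsto_const])
      obtain N where N: "norm x \<le> real N" using real_arch_simple by blast
      show "eventually (\<lambda>n. g x = indicator (cball 0 (real n)) x * g x) sequentially"
        using eventually_ge_at_top[of N] by eventually_elim (use N in auto)
    qed
    show "(\<lambda>x. indicator (cball 0 (real n)) x * g x) \<in> borel_measurable lebesgue" for n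
      using that[of "real n"] unfolding set_integrable_def by (auto dest: borel_measurable_integrable)
  qed
  have "\<forall>i. \<exists>g'. g' \<in> borel_measurable borel \<and> (AE x in lborel. v x $ i = g' x)"
    using lebesgue_borel_rep[OF lm[OF vi]] by blast
  from choice[OF this] obtain U where U [measurable]: "\<And>i. U i \<in> borel_measurable borel"
    and Uv: "\<And>i. AE x in lborel. v x $ i = U i x"
    by blast
  have "\<forall>z. \<exists>g'. g' \<in> borel_measurable borel \<and> (AE x in lborel. H x $ fst z $ snd z = g' x)"
    using lebesgue_borel_rep[OF lm[OF Hi]] by blast
  from choice[OF this] obtain K' where K': "\<And>z. K' z \<in> borel_measurable borel"
      "\<And>z. AE x in lborel. H x $ fst z $ snd z = K' z x"
    by blast
  define K where "K i j = K' (i, j)" for i j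
  have K [measurable]: "\<And>i j. K i j \<in> borel_measurable borel" and KH: "\<And>i j. AE x in lborel. H x $ i $ j = K i j x"
    unfolding K_def using K'(1) K'(2)[of "(_, _)"] by auto
  define u where "u x = U 1 x *\<^sub>R axis 1 1 + U 2 x *\<^sub>R (axis 2 1 :: real^2)" for x
  define G where "G x = K 1 1 x *\<^sub>R axis 1 (axis 1 1) + K 1 2 x *\<^sub>R axis 1 (axis 2 1)
     + (K 2 1 x *\<^sub>R axis 2 (axis 1 1) + K 2 2 x *\<^sub>R (axis 2 (axis 2 1) :: real^2^2))" for x
  have [measurable]: "u \<in> borel_measurable borel" "G \<in> borel_measurable borel"
    unfolding u_def G_def by measurable
  have ui: "u x $ i = U i x" for x i
    using exhaust_2[of i] by (auto simp: u_def axis_def)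
  have Gij: "G x $ i $ j = K i j x" for x i j
    using exhaust_2[of i] exhaust_2[of j] by (auto simp: G_def axis_def)
  have vu: "AE x in lborel. v x = u x"
    using Uv[of 1] Uv[of 2] by eventually_elim (simp add: vec_eq_iff ui forall_2)
  have HG: "AE x in lborel. H x = G x"
    using KH[of 1 1] KH[of 1 2] KH[of 2 1] KH[of 2 2] by eventually_elim (simp add: vec_eq_iff Gij forall_2)
  have en: "energy (2 * p) G = energy (2 * p) H"
    unfolding energy_lborel by (intro nn_integral_cong_AE) (use HG in \<open>eventually_elim, simp\<close>)
  have fin: "energy (2 * p) G < \<infinity>"
    unfolding en using Lp unfolding in_Lp_def energy_def by (simp add: integrable_iff_bounded)
  have w: "wpd j (\<lambda>x. u x $ i) (\<lambda>x. G x $ i $ j)" for i j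
    unfolding wpd_def ui Gij
  proof (intro conjI allI impI)
    show "locL1 (U i)" by (rule locL1_rep[OF vi U Uv])
    show "locL1 (K i j)" by (rule locL1_rep[OF Hi K KH])
    fix \<phi> assume t: "test_function \<phi>"
    have [measurable]: "\<phi> \<in> borel_measurable borel" "partial_deriv j \<phi> \<in> borel_measurable borel"
      using t test_function_partial[OF t] by measurable
    have c: "(\<integral>x. g x * \<psi> x \<partial>lebesgue) = (\<integral>x. g' x * \<psi> x \<partial>lborel)"
      if "g \<in> borel_measurable lebesgue" and [measurable]: "g' \<in> borel_measurable borel" "\<psi> \<in> borel_measurable borel"
        and "AE x in lborel. g x = g' x" for g g' \<psi> :: "real^2 \<Rightarrow> real"
    proof -
      have "(\<integral>x. g x * \<psi> x \<partial>lebesgue) = (\<integral>x. g' x * \<psi> x \<partial>lebesgue)"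
      proof (rule integral_cong_AE)
        show "(\<lambda>x. g x * \<psi> x) \<in> borel_measurable lebesgue"
          by (rule borel_measurable_times[OF that(1)]) (intro measurable_completion, measurable)
        show "(\<lambda>x. g' x * \<psi> x) \<in> borel_measurable lebesgue"
          by (intro measurable_completion) measurable
        show "AE x in lebesgue. g x * \<psi> x = g' x * \<psi> x"
          using that(4) unfolding AE_completion_iff by eventually_elim simp
      qed
      then show ?thesis by (simp add: integral_completion)
    qed
    show "(\<integral>x. U i x * partial_deriv j \<phi> x \<partial>lborel) = - (\<integral>x. K i j x * \<phi> x \<partial>lborel)"
      using wg[OF t, of i j] c[OF lm[OF vi] U _ Uv, of "partial_deriv j \<phi>" i] c[OF lm[OF Hi] K _ KH, of \<phi> i j] by simp
  qed
  have "sob u G"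
    unfolding sob_def using w locL2_energy[OF _ _ fin] p by auto
  moreover have "AE x in lborel. det (G x) = f x" using det HG by eventually_elim simp
  ultimately show thesis using that en fin vu by blast
qed

section \<open>Clarkson's inequality\<close>

lemma powr_superadditive:
  fixes X Y :: real assumes "X \<ge> 0" "Y \<ge> 0" "p \<ge> 1" shows "X powr p + Y powr p \<le> (X + Y) powr p"
proof -
  have *: "X powr p = X * X powr (p - 1)" if "X \<ge> 0" for X :: real using powr_mult_base[OF that, of "p - 1"] by simp
  have "X * X powr (p - 1) \<le> X * (X + Y) powr (p - 1)" "Y * Y powr (p - 1) \<le> Y * (X + Y) powr (p - 1)"
    using assms by (auto intro!: mult_left_mono powr_mono2)
  then show ?thesis using assms *[of X] *[of Y] *[of "X + Y"] by (simp add: distrib_right)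
qed

lemma powr_midpoint_convex:
  fixes s t :: real assumes "s \<ge> 0" "t \<ge> 0" "p \<ge> 1" shows "((s + t) / 2) powr p \<le> (s powr p + t powr p) / 2"
proof -
  \<comment> \<open>An endpoint at zero: halving t divides the power by 2^p, which is at least
    2.\<close>
  have z: "(t / 2) powr p \<le> t powr p / 2" if "t \<ge> 0" for t :: real
  proof -
    have "2 powr 1 \<le> 2 powr p" using assms by (intro powr_mono) auto
    then have "t powr p * 2 \<le> t powr p * 2 powr p" by (intro mult_left_mono) auto
    then show ?thesis using that by (simp add: powr_divide field_simps)
  qed
  show ?thesis
  proof (cases "s = 0 \<or> t = 0")
    case True
    then show ?thesis using z[of s] z[of t] assms by auto
  next
    case False
    then have "s > 0" "t > 0" using assms by auto
    then show ?thesis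
      using convex_onD[OF powr_convex[OF assms(3)], of "1/2" s t] by (simp add: field_simps)
  qed
qed

text \<open>With p = q / 2 \<ge> 1 both sides are p-th powers of squared norms. Superadditivity of
  the power joins the left-hand side into one power, the parallelogram law evaluates its base, and
  convexity splits it again.\<close>

lemma clarkson_pointwise:
  fixes a b :: "'a::real_inner" assumes "q \<ge> 2"
  shows "norm ((1/2) *\<^sub>R (a - b)) powr q + norm ((1/2) *\<^sub>R (a + b)) powr q \<le> (norm a powr q + norm b powr q) / 2"
proof -
  define p where "p = q / 2"
  have p: "p \<ge> 1" using assms by (simp add: p_def)
  have e: "norm x powr q = ((norm x)\<^sup>2) powr p" for x :: 'a
  proof -
    have "((norm x) powr 2) powr p = norm x powr (2 * p)" by (rule powr_powr)
    then show ?thesis by (simp add: p_def)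
  qed
  have par: "(norm ((1/2) *\<^sub>R (a - b)))\<^sup>2 + (norm ((1/2) *\<^sub>R (a + b)))\<^sup>2 = ((norm a)\<^sup>2 + (norm b)\<^sup>2) / 2"
    by (simp add: power2_norm_eq_inner inner_simps inner_commute field_simps)
  have "norm ((1/2) *\<^sub>R (a - b)) powr q + norm ((1/2) *\<^sub>R (a + b)) powr q
     \<le> ((norm ((1/2) *\<^sub>R (a - b)))\<^sup>2 + (norm ((1/2) *\<^sub>R (a + b)))\<^sup>2) powr p"
    unfolding e by (intro powr_superadditive p) auto
  also have "\<dots> \<le> (((norm a)\<^sup>2) powr p + ((norm b)\<^sup>2) powr p) / 2"
    unfolding par by (intro powr_midpoint_convex p) auto
  finally show ?thesis unfolding e .
qed

definition mid :: "('a \<Rightarrow> 'b::real_vector) \<Rightarrow> ('a \<Rightarrow> 'b) \<Rightarrow> 'a \<Rightarrow> 'b" where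
  "mid u v x = (1/2) *\<^sub>R (u x + v x)"

text \<open>Stated with factors 2 on the left instead of halves on the right, which avoids division
  in \<open>ennreal\<close>.\<close>

lemma clarkson:
  assumes q: "q \<ge> 2" and [measurable]: "G \<in> borel_measurable borel" "H \<in> borel_measurable borel"
  shows "2 * energy q (\<lambda>x. (1/2) *\<^sub>R (G x - H x)) + 2 * energy q (mid G H) \<le> energy q G + energy q H"
proof -
  have "2 * energy q (\<lambda>x. (1/2) *\<^sub>R (G x - H x)) + 2 * energy q (mid G H) =
    (\<integral>\<^sup>+x. 2 * ennreal (norm ((1/2) *\<^sub>R (G x - H x)) powr q) + 2 * ennreal (norm ((1/2) *\<^sub>R (G x + H x)) powr q) \<partial>lborel)"
    unfolding energy_lborel mid_def by (subst nn_integral_add) (auto simp: nn_integral_cmult)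
  also have "\<dots> \<le> (\<integral>\<^sup>+x. ennreal (norm (G x) powr q) + ennreal (norm (H x) powr q) \<partial>lborel)"
  proof (intro nn_integral_mono)
    fix x
    have "2 * norm ((1/2) *\<^sub>R (G x - H x)) powr q + 2 * norm ((1/2) *\<^sub>R (G x + H x)) powr q \<le> norm (G x) powr q + norm (H x) powr q"
    proof -
      have "x + y \<le> (a + b) / 2 \<Longrightarrow> 2 * x + 2 * y \<le> a + b" for x y a b :: real by simp
      then show ?thesis using clarkson_pointwise[OF q, of "G x" "H x"] by blast
    qed
    from ennreal_leI[OF this]
    show "2 * ennreal (norm ((1/2) *\<^sub>R (G x - H x)) powr q) + 2 * ennreal (norm ((1/2) *\<^sub>R (G x + H x)) powr q)
      \<le> ennreal (norm (G x) powr q) + ennreal (norm (H x) powr q)"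
      by (subst (asm) (1 2) ennreal_plus) (auto simp only: ennreal_mult' ennreal_numeral powr_ge_zero mult_nonneg_nonneg zero_le_numeral)
  qed
  also have "\<dots> = energy q G + energy q H"
    unfolding energy_lborel by (subst nn_integral_add) auto
  finally show ?thesis .
qed

section \<open>The direct method\<close>

text \<open>Local L^2 convergence on growing squares, written with nonnegative integrals so that no
  integrability of the functions has to be presupposed.\<close>

definition L2_tendsto :: "(nat \<Rightarrow> real^2 \<Rightarrow> real) \<Rightarrow> (real^2 \<Rightarrow> real) \<Rightarrow> bool" where
  "L2_tendsto g u \<longleftrightarrow> (\<forall>N. \<forall>e>0. \<exists>n0. \<forall>n\<ge>n0.
     (\<integral>\<^sup>+x. indicator (square N) x * ennreal ((g n x - u x)\<^sup>2) \<partial>lborel) \<le> ennreal e)"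

lemma L2_tendstoD:
  assumes "L2_tendsto g u" "e > 0"
  obtains n0 where "\<And>n. n \<ge> n0 \<Longrightarrow>
     (\<integral>\<^sup>+x. indicator (square N) x * ennreal ((g n x - u x)\<^sup>2) \<partial>lborel) \<le> ennreal e"
  using assms unfolding L2_tendsto_def by meson

lemma locL2_square_finite: "locL2 g \<Longrightarrow> (\<integral>\<^sup>+x. indicator (square N) x * ennreal ((g x)\<^sup>2) \<partial>lborel) < \<infinity>"
  unfolding square_def by (rule locL2_sq_finite)

lemma locL2_squareI:
  assumes [measurable]: "g \<in> borel_measurable borel"
    and fin: "\<And>N. (\<integral>\<^sup>+x. indicator (square N) x * ennreal ((g x)\<^sup>2) \<partial>lborel) < \<infinity>"
  shows "locL2 g"
  unfolding locL2_def
proof (intro conjI allI)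
  fix R
  obtain N where "R < real N" using reals_Archimedean2 by blast
  then have sub: "cball 0 R \<subseteq> square N" by (rule cball_subset_square)
  show "integrable lborel (\<lambda>x. indicator (cball 0 R) x * (g x)\<^sup>2)"
  proof (rule integrableI_nonneg)
    have "(\<integral>\<^sup>+x. ennreal (indicator (cball 0 R) x * (g x)\<^sup>2) \<partial>lborel)
      \<le> (\<integral>\<^sup>+x. indicator (square N) x * ennreal ((g x)\<^sup>2) \<partial>lborel)"
      using sub by (intro nn_integral_mono) (auto simp: indicator_def)
    then show "(\<integral>\<^sup>+x. ennreal (indicator (cball 0 R) x * (g x)\<^sup>2) \<partial>lborel) < \<infinity>"
      using fin[of N] by (rule le_less_trans)
  qed auto
qed measurable

lemma L2_tendsto_locL2:
  assumes "\<And>n. locL2 (g n)" and [measurable]: "u \<in> borel_measurable borel" and t: "L2_tendsto g u"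
  shows "locL2 u"
proof (rule locL2_squareI)
  fix N
  obtain n where n: "(\<integral>\<^sup>+x. indicator (square N) x * ennreal ((g n x - u x)\<^sup>2) \<partial>lborel) \<le> ennreal 1"
    using L2_tendstoD[OF t, of 1 N] by (metis order_refl zero_less_one)
  have [measurable]: "g n \<in> borel_measurable borel" using assms(1) by measurable
  have "(\<integral>\<^sup>+x. indicator (square N) x * ennreal ((u x)\<^sup>2) \<partial>lborel)
    \<le> (\<integral>\<^sup>+x. 2 * (indicator (square N) x * ennreal ((g n x)\<^sup>2)) + 2 * (indicator (square N) x * ennreal ((g n x - u x)\<^sup>2)) \<partial>lborel)"
  proof (intro nn_integral_mono)
    fix x
    have "(u x)\<^sup>2 \<le> 2 * (g n x)\<^sup>2 + 2 * (g n x - u x)\<^sup>2" using sq_diff_le[of "g n x" "g n x - u x"] by simp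
    from ennreal_le_double_sum[OF this]
    show "indicator (square N) x * ennreal ((u x)\<^sup>2) \<le>
      2 * (indicator (square N) x * ennreal ((g n x)\<^sup>2)) + 2 * (indicator (square N) x * ennreal ((g n x - u x)\<^sup>2))"
      by (auto simp: indicator_def)
  qed
  also have "\<dots> = 2 * (\<integral>\<^sup>+x. indicator (square N) x * ennreal ((g n x)\<^sup>2) \<partial>lborel)
     + 2 * (\<integral>\<^sup>+x. indicator (square N) x * ennreal ((g n x - u x)\<^sup>2) \<partial>lborel)"
    by (subst nn_integral_add) (auto simp: nn_integral_cmult)
  also have "\<dots> < \<infinity>"
    using locL2_square_finite[OF assms(1), of N n] le_less_trans[OF n ennreal_less_top] by (simp add: ennreal_mult_less_top)
  finally show "(\<integral>\<^sup>+x. indicator (square N) x * ennreal ((u x)\<^sup>2) \<partial>lborel) < \<infinity>" .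
qed measurable

text \<open>Young's inequality integrated over the square; the weight l stays free so that either
  factor can be made cheap.\<close>

lemma pairing_bound:
  assumes [measurable]: "k \<in> borel_measurable borel" "d \<in> borel_measurable borel"
    and supp: "\<And>x. x \<notin> square N \<Longrightarrow> k x = 0" and l: "l > 0" and CD: "C \<ge> 0" "D \<ge> 0"
    and C: "(\<integral>\<^sup>+x. indicator (square N) x * ennreal ((k x)\<^sup>2) \<partial>lborel) \<le> ennreal C"
    and D: "(\<integral>\<^sup>+x. indicator (square N) x * ennreal ((d x)\<^sup>2) \<partial>lborel) \<le> ennreal D"
  shows "\<bar>\<integral>x. k x * d x \<partial>lborel\<bar> \<le> l / 2 * C + 1 / (2 * l) * D"
proof (cases "integrable lborel (\<lambda>x. k x * d x)")
  case False
  \<comment> \<open>Without integrability the Bochner integral is 0 by convention, and the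
    right-hand side is nonnegative.\<close>
  then show ?thesis using l CD by (simp add: not_integrable_integral_eq)
next
  case True
  have "ennreal \<bar>\<integral>x. k x * d x \<partial>lborel\<bar> \<le> (\<integral>\<^sup>+x. ennreal \<bar>k x * d x\<bar> \<partial>lborel)"
    using integral_norm_bound_ennreal[OF True] by simp
  also have "\<dots> \<le> (\<integral>\<^sup>+x. ennreal (l / 2) * (indicator (square N) x * ennreal ((k x)\<^sup>2))
     + ennreal (1 / (2 * l)) * (indicator (square N) x * ennreal ((d x)\<^sup>2)) \<partial>lborel)"
  proof (intro nn_integral_mono)
    fix x
    have "0 \<le> (l * \<bar>k x\<bar> - \<bar>d x\<bar>)\<^sup>2 / (2 * l)" using l by simp
    also have "(l * \<bar>k x\<bar> - \<bar>d x\<bar>)\<^sup>2 = l\<^sup>2 * (k x)\<^sup>2 - 2 * l * \<bar>k x * d x\<bar> + (d x)\<^sup>2"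
      by (simp add: power2_diff power_mult_distrib abs_mult)
    also have "\<dots> / (2 * l) = l / 2 * (k x)\<^sup>2 - \<bar>k x * d x\<bar> + 1 / (2 * l) * (d x)\<^sup>2"
      using l by (simp add: power2_eq_square field_simps)
    finally have "\<bar>k x * d x\<bar> \<le> l / 2 * (k x)\<^sup>2 + 1 / (2 * l) * (d x)\<^sup>2" by linarith
    from ennreal_leI[OF this] have "ennreal \<bar>k x * d x\<bar> \<le> ennreal (l / 2) * ennreal ((k x)\<^sup>2) + ennreal (1 / (2 * l)) * ennreal ((d x)\<^sup>2)"
      using l by (subst (asm) ennreal_plus) (auto simp only: ennreal_mult'' zero_le_power2 intro!: mult_nonneg_nonneg divide_nonneg_nonneg)
    then show "ennreal \<bar>k x * d x\<bar> \<le> ennreal (l / 2) * (indicator (square N) x * ennreal ((k x)\<^sup>2))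
     + ennreal (1 / (2 * l)) * (indicator (square N) x * ennreal ((d x)\<^sup>2))"
      using supp[of x] by (cases "x \<in> square N") auto
  qed
  also have "\<dots> = ennreal (l / 2) * (\<integral>\<^sup>+x. indicator (square N) x * ennreal ((k x)\<^sup>2) \<partial>lborel)
     + ennreal (1 / (2 * l)) * (\<integral>\<^sup>+x. indicator (square N) x * ennreal ((d x)\<^sup>2) \<partial>lborel)"
    by (subst nn_integral_add) (auto simp: nn_integral_cmult)
  also have "\<dots> \<le> ennreal (l / 2) * ennreal C + ennreal (1 / (2 * l)) * ennreal D"
    by (intro add_mono mult_left_mono C D) auto
  also have "\<dots> = ennreal (l / 2 * C + 1 / (2 * l) * D)"
    using l CD by (subst ennreal_plus) (auto simp only: ennreal_mult'' intro!: mult_nonneg_nonneg divide_nonneg_nonneg)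
  finally show ?thesis
    by (subst (asm) ennreal_le_iff) (use l CD in \<open>auto intro!: add_nonneg_nonneg\<close>)
qed

text \<open>The weak-strong principle: one factor only stays bounded in L^2, the other tends to zero
  strongly.\<close>

lemma pairing_tendsto_0:
  assumes k: "\<And>n. k n \<in> borel_measurable borel" and d: "\<And>n. d n \<in> borel_measurable borel"
    and supp: "\<And>n x. x \<notin> square N \<Longrightarrow> k n x = 0" and C0: "C \<ge> 0"
    and C: "\<And>n. (\<integral>\<^sup>+x. indicator (square N) x * ennreal ((k n x)\<^sup>2) \<partial>lborel) \<le> ennreal C"
    and D: "L2_tendsto d (\<lambda>x. 0)"
  shows "(\<lambda>n. \<integral>x. k n x * d n x \<partial>lborel) \<longlonglongrightarrow> 0"
proof (rule LIMSEQ_I)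
  fix e :: real assume e: "e > 0"
  \<comment> \<open>The weight brings the bounded factor below e / 2, and the threshold
    \<open>e * l\<close> for the vanishing factor makes its contribution exactly e / 2.\<close>
  define l where "l = e / (2 * (C + 1))"
  have l: "l > 0" using e C0 by (simp add: l_def)
  have lC: "l / 2 * C < e / 2"
  proof -
    have "l * (C + 1) = e / 2" using C0 by (simp add: l_def field_simps)
    then have "l * C < e / 2" using l by (simp add: distrib_left)
    moreover have "0 \<le> l * C" using l C0 by simp
    ultimately show ?thesis by simp
  qed
  obtain n0 where n0: "\<And>n. n \<ge> n0 \<Longrightarrow> (\<integral>\<^sup>+x. indicator (square N) x * ennreal ((d n x - 0)\<^sup>2) \<partial>lborel) \<le> ennreal (e * l)"
    using L2_tendstoD[OF D, of "e * l" N] e l by auto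
  show "\<exists>no. \<forall>n\<ge>no. norm ((\<integral>x. k n x * d n x \<partial>lborel) - 0) < e"
  proof (intro exI allI impI)
    fix n assume n: "n0 \<le> n"
    have "\<bar>\<integral>x. k n x * d n x \<partial>lborel\<bar> \<le> l / 2 * C + 1 / (2 * l) * (e * l)"
      using n0[OF n] e l C0 by (intro pairing_bound[OF k d supp _ _ _ C]) auto
    also have "1 / (2 * l) * (e * l) = e / 2" using l by simp
    finally show "norm ((\<integral>x. k n x * d n x \<partial>lborel) - 0) < e" using lC by simp
  qed
qed

lemma integrable_pairing:
  assumes "locL2 k" "locL2 f" "\<And>x. x \<notin> square N \<Longrightarrow> k x = 0"
  shows "integrable lborel (\<lambda>x. k x * f x)"
proof -
  have "square N \<subseteq> cball 0 (\<bar>- real N\<bar> + \<bar>- real N\<bar> + 2 * \<bar>2 * real N\<bar>)"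
    unfolding square_def by (rule sq_subset_cball)
  then have "k x = 0" if "\<bar>- real N\<bar> + \<bar>- real N\<bar> + 2 * \<bar>2 * real N\<bar> < norm x" for x
    using that assms(3)[of x] by force
  then show ?thesis
    by (intro locL1_support_integrable[OF locL1_mult_L2[OF assms(1,2)]]) auto
qed

lemma pairing_tendsto:
  assumes k: "locL2 k" "\<And>x. x \<notin> square N \<Longrightarrow> k x = 0" and f: "\<And>n. locL2 (f n)" "locL2 g"
    and t: "L2_tendsto f g"
  shows "(\<lambda>n. \<integral>x. k x * f n x \<partial>lborel) \<longlonglongrightarrow> (\<integral>x. k x * g x \<partial>lborel)"
proof -
  have [measurable]: "k \<in> borel_measurable borel" "f n \<in> borel_measurable borel" "g \<in> borel_measurable borel" for n
    using k f by measurable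
  define C where "C = enn2real (\<integral>\<^sup>+x. indicator (square N) x * ennreal ((k x)\<^sup>2) \<partial>lborel)"
  have C: "(\<integral>\<^sup>+x. indicator (square N) x * ennreal ((k x)\<^sup>2) \<partial>lborel) \<le> ennreal C" "C \<ge> 0"
    unfolding C_def using locL2_square_finite[OF k(1), of N] by auto
  have "L2_tendsto (\<lambda>n x. f n x - g x) (\<lambda>x. 0)" using t by (simp add: L2_tendsto_def)
  then have "(\<lambda>n. \<integral>x. k x * (f n x - g x) \<partial>lborel) \<longlonglongrightarrow> 0"
    by (intro pairing_tendsto_0[where N=N and C=C] k(2) C) auto
  moreover have "(\<integral>x. k x * (f n x - g x) \<partial>lborel) = (\<integral>x. k x * f n x \<partial>lborel) - (\<integral>x. k x * g x \<partial>lborel)" for n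
    unfolding right_diff_distrib
    by (intro Bochner_Integration.integral_diff integrable_pairing[where N=N] k f)
  ultimately show ?thesis by (simp add: LIM_zero_iff)
qed

lemma test_function_square:
  assumes "test_function \<phi>"
  obtains N where "\<And>x. x \<notin> square N \<Longrightarrow> \<phi> x = 0" "\<And>j x. x \<notin> square N \<Longrightarrow> partial_deriv j \<phi> x = 0"
proof -
  obtain R where R: "\<And>x. R < norm x \<Longrightarrow> \<phi> x = 0" using test_function_support[OF assms] by blast
  obtain N where "R < real N" using reals_Archimedean2 by blast
  then have "cball 0 R \<subseteq> square N" by (rule cball_subset_square)
  then have out: "R < norm x" if "x \<notin> square N" for x using that by (force simp: subset_iff)
  show thesis by (rule that[OF R[OF out] partial_deriv_support[OF R out]])
qed

lemma wpd_limit: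
  assumes w: "\<And>n. wpd j (g n) (h n)" and L: "\<And>n. locL2 (g n)" "\<And>n. locL2 (h n)" "locL2 u" "locL2 v"
    and t: "L2_tendsto g u" "L2_tendsto h v"
  shows "wpd j u v"
  unfolding wpd_def
proof (intro conjI allI impI)
  show "locL1 u" "locL1 v" using L locL2_imp_locL1 by auto
  fix \<phi> assume \<phi>: "test_function \<phi>"
  obtain N where N: "\<And>x. x \<notin> square N \<Longrightarrow> \<phi> x = 0" "\<And>j x. x \<notin> square N \<Longrightarrow> partial_deriv j \<phi> x = 0"
    using test_function_square[OF \<phi>] by blast
  have c: "locL2 \<phi>" "locL2 (partial_deriv j \<phi>)"
    using test_function_continuous[OF \<phi>] test_function_continuous[OF test_function_partial[OF \<phi>]] by auto
  have "(\<lambda>n. \<integral>x. partial_deriv j \<phi> x * g n x \<partial>lborel) \<longlonglongrightarrow> (\<integral>x. partial_deriv j \<phi> x * u x \<partial>lborel)"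
    by (intro pairing_tendsto[OF c(2) N(2)] L t)
  moreover have "(\<lambda>n. - (\<integral>x. \<phi> x * h n x \<partial>lborel)) \<longlonglongrightarrow> - (\<integral>x. \<phi> x * v x \<partial>lborel)"
    by (intro tendsto_minus pairing_tendsto[OF c(1) N(1)] L t)
  moreover have "(\<integral>x. partial_deriv j \<phi> x * g n x \<partial>lborel) = - (\<integral>x. \<phi> x * h n x \<partial>lborel)" for n
    using wpdD(3)[OF w \<phi>] by (simp add: mult.commute)
  ultimately show "(\<integral>x. u x * partial_deriv j \<phi> x \<partial>lborel) = - (\<integral>x. v x * \<phi> x \<partial>lborel)"
    using LIMSEQ_unique by (force simp: mult.commute)
qed

lemma sob_mid:
  assumes "sob u G" "sob v H" shows "sob (mid u v) (mid G H)"
  unfolding sob_def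
proof (intro conjI allI)
  note [measurable] = sobD(1,2)[OF assms(1)] sobD(1,2)[OF assms(2)]
  show "mid u v \<in> borel_measurable borel" "mid G H \<in> borel_measurable borel"
    unfolding mid_def by measurable
  fix i j
  show "wpd j (\<lambda>x. mid u v x $ i) (\<lambda>x. mid G H x $ i $ j)"
    using wpd_linear[OF sobD(3)[OF assms(1)] sobD(3)[OF assms(2)], where a="1/2" and b="1/2"]
    by (simp add: mid_def distrib_left)
  show "locL2 (\<lambda>x. mid G H x $ i $ j)"
    using locL2_cmult[OF locL2_add[OF sobD(4)[OF assms(1)] sobD(4)[OF assms(2)]], where c="1/2"]
    by (simp add: mid_def)
qed

text \<open>In the uniformly convex space \<open>L\<^sup>2\<^sup>p\<close>, iterated midpoints of a bounded sequence suffice to make it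
  converge strongly, so this replaces the convex hull of a tail.\<close>

inductive mid_hull :: "(nat \<Rightarrow> real^2 \<Rightarrow> real^2) \<Rightarrow> (nat \<Rightarrow> real^2 \<Rightarrow> real^2^2) \<Rightarrow> nat \<Rightarrow>
    (real^2 \<Rightarrow> real^2) \<Rightarrow> (real^2 \<Rightarrow> real^2^2) \<Rightarrow> bool" for U H N where
  mid_hull_base: "n \<ge> N \<Longrightarrow> mid_hull U H N (U n) (H n)"
| mid_hull_mid: "mid_hull U H N u G \<Longrightarrow> mid_hull U H N v K \<Longrightarrow> mid_hull U H N (mid u v) (mid G K)"

lemma mid_hull_mono: "mid_hull U H M u G \<Longrightarrow> N \<le> M \<Longrightarrow> mid_hull U H N u G"
  by (induction rule: mid_hull.induct) (auto intro: mid_hull.intros)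

lemma mid_hull_sob: "mid_hull U H N u G \<Longrightarrow> (\<And>n. sob (U n) (H n)) \<Longrightarrow> sob u G"
  by (induction rule: mid_hull.induct) (auto intro: sob_mid)

lemma mid_hull_energy:
  assumes "mid_hull U H N u G" "\<And>n. sob (U n) (H n)" "\<And>n. n \<ge> N \<Longrightarrow> energy q (H n) \<le> ennreal K" "q \<ge> 2"
  shows "energy q G \<le> ennreal K"
  using assms
proof (induction rule: mid_hull.induct)
  case (mid_hull_mid u G v K')
  have m: "G \<in> borel_measurable borel" "K' \<in> borel_measurable borel"
    using mid_hull_sob[OF mid_hull_mid(1)] mid_hull_sob[OF mid_hull_mid(2)] mid_hull_mid.prems sobD(2) by blast+
  have "2 * energy q (mid G K') \<le> 2 * energy q (\<lambda>x. (1/2) *\<^sub>R (G x - K' x)) + 2 * energy q (mid G K')"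
    by simp
  also have "\<dots> \<le> energy q G + energy q K'" by (rule clarkson[OF \<open>q \<ge> 2\<close> m])
  also have "\<dots> \<le> ennreal K + ennreal K" using mid_hull_mid by (intro add_mono) auto
  finally have "2 * energy q (mid G K') \<le> 2 * ennreal K" by (simp add: mult_2)
  then show ?case by (simp add: ennreal_mult_le_mult_iff)
qed auto

lemma mid_hull_L2:
  assumes "mid_hull U H N u G" "\<And>n. sob (U n) (H n)" and [measurable]: "w \<in> borel_measurable borel"
    and "\<And>n. n \<ge> N \<Longrightarrow> (\<integral>\<^sup>+x. indicator (square M) x * ennreal ((U n x $ i - w x)\<^sup>2) \<partial>lborel) \<le> ennreal e"
  shows "(\<integral>\<^sup>+x. indicator (square M) x * ennreal ((u x $ i - w x)\<^sup>2) \<partial>lborel) \<le> ennreal e"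
  using assms(1,2,4)
proof (induction rule: mid_hull.induct)
  case (mid_hull_mid u G v K)
  have [measurable]: "u \<in> borel_measurable borel" "v \<in> borel_measurable borel"
    using mid_hull_sob[OF mid_hull_mid(1)] mid_hull_sob[OF mid_hull_mid(2)] mid_hull_mid.prems sobD(1) by blast+
  have "2 * (\<integral>\<^sup>+x. indicator (square M) x * ennreal ((mid u v x $ i - w x)\<^sup>2) \<partial>lborel) =
     (\<integral>\<^sup>+x. 2 * (indicator (square M) x * ennreal ((mid u v x $ i - w x)\<^sup>2)) \<partial>lborel)"
    unfolding mid_def by (rule nn_integral_cmult[symmetric]) measurable
  also have "\<dots> \<le> (\<integral>\<^sup>+x. indicator (square M) x * ennreal ((u x $ i - w x)\<^sup>2) + indicator (square M) x * ennreal ((v x $ i - w x)\<^sup>2) \<partial>lborel)"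
  proof (intro nn_integral_mono)
    fix x
    define a b where "a = u x $ i - w x" and "b = v x $ i - w x"
    have "mid u v x $ i - w x = (a + b) / 2" by (simp add: mid_def a_def b_def field_simps)
    moreover have "2 * ((a + b) / 2)\<^sup>2 \<le> a\<^sup>2 + b\<^sup>2"
      using zero_le_power2[of "a - b"] by (simp add: power2_eq_square field_simps)
    ultimately have "2 * (mid u v x $ i - w x)\<^sup>2 \<le> a\<^sup>2 + b\<^sup>2" by (simp only:)
    from ennreal_leI[OF this] have "2 * ennreal ((mid u v x $ i - w x)\<^sup>2) \<le> ennreal (a\<^sup>2) + ennreal (b\<^sup>2)"
      by (simp add: ennreal_mult' ennreal_plus)
    then show "2 * (indicator (square M) x * ennreal ((mid u v x $ i - w x)\<^sup>2)) \<le>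
      indicator (square M) x * ennreal ((u x $ i - w x)\<^sup>2) + indicator (square M) x * ennreal ((v x $ i - w x)\<^sup>2)"
      unfolding a_def b_def by (cases "x \<in> square M") auto
  qed
  also have "\<dots> = (\<integral>\<^sup>+x. indicator (square M) x * ennreal ((u x $ i - w x)\<^sup>2) \<partial>lborel) + (\<integral>\<^sup>+x. indicator (square M) x * ennreal ((v x $ i - w x)\<^sup>2) \<partial>lborel)"
    by (rule nn_integral_add) measurable
  also have "\<dots> \<le> ennreal e + ennreal e" using mid_hull_mid by (intro add_mono) auto
  finally have "2 * (\<integral>\<^sup>+x. indicator (square M) x * ennreal ((mid u v x $ i - w x)\<^sup>2) \<partial>lborel) \<le> 2 * ennreal e"
    by (simp add: mult_2)
  then show ?case by (simp add: ennreal_mult_le_mult_iff)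
qed auto

text \<open>Meant for a functional that is affine along midpoints, such as the Jacobian integral
  with its first component frozen. The determinant has no such property, and this lemma is how its
  constraint reaches averaged gradients.\<close>

lemma mid_hull_functional:
  assumes "mid_hull U H N u G" "\<And>n. sob (U n) (H n)"
    and mid: "\<And>u G v K. sob u G \<Longrightarrow> sob v K \<Longrightarrow> F (mid G K) = (F G + F K) / (2::real)"
    and "\<And>n. n \<ge> N \<Longrightarrow> \<bar>F (H n) - c\<bar> \<le> e"
  shows "\<bar>F G - c\<bar> \<le> e"
  using assms(1,2,4)
proof (induction rule: mid_hull.induct)
  case (mid_hull_mid u G v K)
  have "F (mid G K) = (F G + F K) / 2"
    by (rule mid[OF mid_hull_sob[OF mid_hull_mid(1)] mid_hull_sob[OF mid_hull_mid(2)]]) (use mid_hull_mid in auto)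
  moreover have "\<bar>F G - c\<bar> \<le> e" "\<bar>F K - c\<bar> \<le> e" using mid_hull_mid by auto
  ultimately show ?case by (auto simp: abs_le_iff)
qed auto

text \<open>Differences of norm at most s contribute at most s^2 times the area of the square. For a
  larger one, the square is at most s^(2 - q) times the q-th power, because 2 - q \<le> 0.\<close>

lemma Lq_imp_L2_tendsto:
  fixes g :: "nat \<Rightarrow> real^2 \<Rightarrow> real^2^2"
  assumes q: "q \<ge> 2" and [measurable]: "\<And>n. g n \<in> borel_measurable borel" "G \<in> borel_measurable borel"
    and t: "\<And>e. e > 0 \<Longrightarrow> \<exists>n0. \<forall>n\<ge>n0. energy q (\<lambda>x. g n x - G x) \<le> ennreal e"
  shows "L2_tendsto (\<lambda>n x. g n x $ i $ j) (\<lambda>x. G x $ i $ j)"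
  unfolding L2_tendsto_def
proof (intro allI impI)
  fix N :: nat and e :: real assume e: "e > 0"
  \<comment> \<open>Chosen so that s^2 times the area (2 N)^2 stays below e / 2; the summand 8
    covers N = 0.\<close>
  define s where "s = sqrt (e / (8 * (real N)\<^sup>2 + 8))"
  have s: "s > 0" using e by (simp add: s_def add_nonneg_pos)
  have s2: "s\<^sup>2 * (2 * real N)\<^sup>2 \<le> e / 2"
  proof -
    have "8 * (s\<^sup>2 * (real N)\<^sup>2) + 8 * s\<^sup>2 = s\<^sup>2 * (8 * (real N)\<^sup>2 + 8)" by (simp add: distrib_left)
    also have "\<dots> = e" using e by (simp add: s_def add_nonneg_pos add_pos_nonneg less_imp_neq[THEN not_sym])
    finally have "8 * (s\<^sup>2 * (real N)\<^sup>2) + 8 * s\<^sup>2 = e" .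
    moreover have "0 \<le> s\<^sup>2" by simp
    moreover have "s\<^sup>2 * (2 * real N)\<^sup>2 = 4 * (s\<^sup>2 * (real N)\<^sup>2)" by (simp add: power_mult_distrib)
    ultimately show ?thesis by linarith
  qed
  define c where "c = s powr (2 - q)"
  have c: "c > 0" using s by (simp add: c_def)
  obtain n0 where n0: "\<And>n. n \<ge> n0 \<Longrightarrow> energy q (\<lambda>x. g n x - G x) \<le> ennreal (e / (2 * c))"
    using t[of "e / (2 * c)"] e c by auto
  show "\<exists>n0. \<forall>n\<ge>n0. (\<integral>\<^sup>+x. indicator (square N) x * ennreal ((g n x $ i $ j - G x $ i $ j)\<^sup>2) \<partial>lborel) \<le> ennreal e"
  proof (intro exI allI impI)
    fix n assume n: "n0 \<le> n"
    have "(\<integral>\<^sup>+x. indicator (square N) x * ennreal ((g n x $ i $ j - G x $ i $ j)\<^sup>2) \<partial>lborel)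
      \<le> (\<integral>\<^sup>+x. ennreal (s\<^sup>2) * indicator (square N) x + ennreal c * ennreal (norm (g n x - G x) powr q) \<partial>lborel)"
    proof (intro nn_integral_mono)
      fix x
      define a where "a = norm (g n x - G x)"
      have "a\<^sup>2 \<le> s\<^sup>2 + c * a powr q"
      proof (cases "a \<le> s")
        case True
        then have "a\<^sup>2 \<le> s\<^sup>2" by (intro power_mono) (auto simp: a_def)
        moreover have "0 \<le> c * a powr q" using c by simp
        ultimately show ?thesis by linarith
      next
        case False
        then have a: "a > 0" "s \<le> a" using s by auto
        have "a\<^sup>2 = a powr (2 - q) * a powr q" using a by (simp add: powr_add[symmetric])
        also have "\<dots> \<le> c * a powr q"
          unfolding c_def using a s q by (intro mult_right_mono powr_mono2') auto
        finally show ?thesis using zero_le_power2[of s] by linarith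
      qed
      moreover have "(g n x $ i $ j - G x $ i $ j)\<^sup>2 \<le> a\<^sup>2"
        using component_le_norm_matrix[of "g n x - G x" i j] by (simp add: a_def abs_le_square_iff[symmetric])
      ultimately have "(g n x $ i $ j - G x $ i $ j)\<^sup>2 \<le> s\<^sup>2 + c * a powr q" by linarith
      from ennreal_leI[OF this] have "ennreal ((g n x $ i $ j - G x $ i $ j)\<^sup>2) \<le> ennreal (s\<^sup>2) + ennreal c * ennreal (a powr q)"
        using c by (simp add: ennreal_plus ennreal_mult')
      then show "indicator (square N) x * ennreal ((g n x $ i $ j - G x $ i $ j)\<^sup>2) \<le>
        ennreal (s\<^sup>2) * indicator (square N) x + ennreal c * ennreal (norm (g n x - G x) powr q)"
        unfolding a_def by (cases "x \<in> square N") auto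
    qed
    also have "\<dots> = ennreal (s\<^sup>2) * ennreal ((2 * real N)\<^sup>2) + ennreal c * energy q (\<lambda>x. g n x - G x)"
      unfolding energy_lborel
      by (subst nn_integral_add) (auto simp: nn_integral_cmult square_def emeasure_sq)
    also have "\<dots> \<le> ennreal (s\<^sup>2) * ennreal ((2 * real N)\<^sup>2) + ennreal c * ennreal (e / (2 * c))"
      by (intro add_mono mult_left_mono n0 n) auto
    also have "\<dots> = ennreal (s\<^sup>2 * (2 * real N)\<^sup>2 + e / 2)"
      using c e by (simp add: ennreal_mult'[symmetric] ennreal_plus[symmetric] del: ennreal_plus)
    also have "\<dots> \<le> ennreal e" using s2 by (intro ennreal_leI) simp
    finally show "(\<integral>\<^sup>+x. indicator (square N) x * ennreal ((g n x $ i $ j - G x $ i $ j)\<^sup>2) \<partial>lborel) \<le> ennreal e" .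
  qed
qed

lemma det_matrix_2: "det (A :: real^2^2) = A $ 1 $ 1 * A $ 2 $ 2 - A $ 1 $ 2 * A $ 2 $ 1"
  by (rule det_2)

lemma sob_translate:
  assumes "sob u G" shows "sob (\<lambda>x. u x - c) G"
proof -
  note [measurable] = sobD(1)[OF assms]
  have "(\<lambda>x. u x - c) \<in> borel_measurable borel" by measurable
  then show ?thesis
    using sobD[OF assms] wpd_add_const[OF sobD(3)[OF assms]] by (simp add: sob_def)
qed

lemma gradient_square_bound:
  assumes q: "q \<ge> 2" and s: "sob u G" and en: "energy q G \<le> ennreal K" "K \<ge> 0"
  shows "(\<integral>\<^sup>+x. indicator (square N) x * ennreal ((G x $ i $ 1)\<^sup>2 + (G x $ i $ 2)\<^sup>2) \<partial>lborel) \<le> ennreal (2 * ((2 * real N)\<^sup>2 + K))"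
proof -
  note [measurable] = sobD(2)[OF s]
  have "(\<integral>\<^sup>+x. indicator (square N) x * ennreal ((G x $ i $ 1)\<^sup>2 + (G x $ i $ 2)\<^sup>2) \<partial>lborel)
    \<le> (\<integral>\<^sup>+x. 2 * (indicator (square N) x * ennreal ((norm (G x))\<^sup>2)) \<partial>lborel)"
  proof (intro nn_integral_mono)
    fix x
    have "(G x $ i $ j)\<^sup>2 \<le> (norm (G x))\<^sup>2" for j
      using component_le_norm_matrix[of "G x" i j] by (simp add: abs_le_square_iff[symmetric])
    from this[of 1] this[of 2] have "(G x $ i $ 1)\<^sup>2 + (G x $ i $ 2)\<^sup>2 \<le> 2 * (norm (G x))\<^sup>2" by simp
    from ennreal_leI[OF this] show "indicator (square N) x * ennreal ((G x $ i $ 1)\<^sup>2 + (G x $ i $ 2)\<^sup>2) \<le>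
      2 * (indicator (square N) x * ennreal ((norm (G x))\<^sup>2))"
      by (cases "x \<in> square N") (auto simp: ennreal_mult')
  qed
  also have "\<dots> = 2 * (\<integral>\<^sup>+x. indicator (square N) x * ennreal ((norm (G x))\<^sup>2) \<partial>lborel)"
    by (rule nn_integral_cmult) measurable
  also have "\<dots> \<le> 2 * (ennreal ((2 * real N)\<^sup>2) + ennreal K)"
    using energy_cball[OF q, of G "square N"] en(1)
    by (intro mult_left_mono) (auto simp: square_def emeasure_sq intro: order_trans add_left_mono)
  also have "\<dots> = ennreal (2 * ((2 * real N)\<^sup>2 + K))"
    using en(2) by (simp add: ennreal_mult' ennreal_plus)
  finally show ?thesis .
qed

lemma L2_tendsto_subseq:
  assumes "L2_tendsto g u" "strict_mono r" shows "L2_tendsto (\<lambda>n. g (r n)) u"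
  unfolding L2_tendsto_def
proof (intro allI impI)
  fix N :: nat and e :: real assume "e > 0"
  then obtain n0 where n0: "\<And>n. n \<ge> n0 \<Longrightarrow> (\<integral>\<^sup>+x. indicator (square N) x * ennreal ((g n x - u x)\<^sup>2) \<partial>lborel) \<le> ennreal e"
    using L2_tendstoD[OF assms(1)] by blast
  then show "\<exists>n0. \<forall>n\<ge>n0. (\<integral>\<^sup>+x. indicator (square N) x * ennreal ((g (r n) x - u x)\<^sup>2) \<partial>lborel) \<le> ennreal e"
    using seq_suble[OF assms(2)] by (intro exI[of _ n0]) (meson order_trans)
qed

text \<open>Energy does not see additive constants, so the means over the unit square are subtracted
  before \<open>rellich\<close> is used. The two components are treated in turn, the second along
  the subsequence of the first.\<close>

lemma sob_rellich:
  fixes U :: "nat \<Rightarrow> real^2 \<Rightarrow> real^2"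
  assumes q: "q \<ge> 2" and s: "\<And>n. sob (U n) (H n)" and en: "\<And>n. energy q (H n) \<le> ennreal K" "K \<ge> 0"
  obtains r V w where "strict_mono (r :: nat \<Rightarrow> nat)" "\<And>n. sob (V n) (H (r n))" "w \<in> borel_measurable borel"
    "\<And>i. L2_tendsto (\<lambda>n x. V n x $ i) (\<lambda>x. w x $ i)"
proof -
  define c where "c n = (\<chi> i. \<integral>x. indicator (sq 0 0 1) x * U n x $ i \<partial>lborel)" for n
  define W where "W n x = U n x - c n" for n x
  have sW: "sob (W n) (H n)" for n unfolding W_def by (rule sob_translate[OF s])
  have mean: "(\<integral>x. indicator (sq 0 0 1) x * W n x $ i \<partial>lborel) = 0" for n i
  proof -
    have "integrable lborel (\<lambda>x. indicator (sq 0 0 1) x * U n x $ i)"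
      by (intro locL1_sq_integrable locL2_imp_locL1 sobD(5)[OF s])
    moreover have "integrable lborel (indicat_real (sq 0 0 1))" "(\<integral>x. indicat_real (sq 0 0 1) x \<partial>lborel) = 1"
      by (intro integrable_indicator_sq, simp) (subst integral_indicator_sq, auto)
    ultimately show ?thesis unfolding W_def c_def by (simp add: right_diff_distrib)
  qed
  have bd: "\<exists>M. \<forall>n. (\<integral>\<^sup>+x. indicator (square N) x * ennreal ((H (r n) x $ i $ 1)\<^sup>2 + (H (r n) x $ i $ 2)\<^sup>2) \<partial>lborel) \<le> ennreal M"
    for N i and r :: "nat \<Rightarrow> nat"
    using gradient_square_bound[OF q s en] by blast
  obtain r1 w1 where 1: "strict_mono r1" "w1 \<in> borel_measurable borel" "L2_tendsto (\<lambda>n x. W (r1 n) x $ 1) w1"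
    unfolding L2_tendsto_def
    using rellich[of "\<lambda>n x. W n x $ 1", OF sobD(3)[OF sW] sobD(3)[OF sW] mean bd[where r="\<lambda>n. n"]] by blast
  obtain r2 w2 where 2: "strict_mono r2" "w2 \<in> borel_measurable borel" "L2_tendsto (\<lambda>n x. W (r1 (r2 n)) x $ 2) w2"
    unfolding L2_tendsto_def
    using rellich[of "\<lambda>n x. W (r1 n) x $ 2", OF sobD(3)[OF sW] sobD(3)[OF sW] mean bd[where r=r1]] by blast
  have 3: "L2_tendsto (\<lambda>n x. W (r1 (r2 n)) x $ 1) w1" by (rule L2_tendsto_subseq[OF 1(3) 2(1)])
  define w where "w x = w1 x *\<^sub>R axis 1 1 + w2 x *\<^sub>R (axis 2 1 :: real^2)" for x
  have wi: "w x $ 1 = w1 x" "w x $ 2 = w2 x" for x by (auto simp: w_def axis_def)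
  have wm: "w \<in> borel_measurable borel" unfolding w_def using 1(2) 2(2) by measurable
  show thesis
  proof (rule that[of "\<lambda>n. r1 (r2 n)" "\<lambda>n. W (r1 (r2 n))" w])
    show "strict_mono (\<lambda>n. r1 (r2 n))" using strict_mono_o[OF 1(1) 2(1)] by (simp add: comp_def)
    show "L2_tendsto (\<lambda>n x. W (r1 (r2 n)) x $ i) (\<lambda>x. w x $ i)" for i
      using exhaust_2[of i] 2(3) 3 wi by auto
  qed (use sW wm in auto)
qed

lemma energy_diff_scale:
  assumes [measurable]: "G \<in> borel_measurable borel" "H \<in> borel_measurable borel"
  shows "energy q (\<lambda>x. G x - H x) = ennreal (2 powr q) * energy q (\<lambda>x. (1/2) *\<^sub>R (G x - H x))"
  unfolding energy_lborel
  by (subst nn_integral_cmult[symmetric])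
    (auto simp: ennreal_mult'[symmetric] powr_mult[symmetric] simp flip: scaleR_right_diff_distrib)

text \<open>The argument for projections in uniformly convex spaces, applied to the hulls of the
  tails. Near-minimisers of the energy in these hulls form a Cauchy sequence, because a large
  distance would by Clarkson push the midpoint below the infimum. Comparison with
  \<open>F N\<close>, itself a member of the hull, keeps their energy from exceeding that of the
  sequence.\<close>

lemma mid_hull_minimising:
  assumes q: "q \<ge> 2" and s: "\<And>n. sob (V n) (F n)" and en: "\<And>n. energy q (F n) \<le> ennreal K" "K \<ge> 0"
  obtains v g where "\<And>N. mid_hull V F N (v N) (g N)"
    "\<And>e. e > 0 \<Longrightarrow> \<exists>n0. \<forall>n\<ge>n0. \<forall>m\<ge>n0. energy q (\<lambda>x. g n x - g m x) \<le> ennreal e"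
    "\<And>N. energy q (g N) \<le> energy q (F N) + ennreal (1 / real (Suc N))"
proof -
  define S where "S N = {enn2real (energy q G) |u G. mid_hull V F N u G}" for N
  have enK: "energy q G \<le> ennreal K" if "mid_hull V F N u G" for N u G
    by (rule mid_hull_energy[OF that s en(1) q])
  have real: "energy q G = ennreal (enn2real (energy q G))" if "mid_hull V F N u G" for N u G
    using le_less_trans[OF enK[OF that] ennreal_less_top] by simp
  have Sne: "enn2real (energy q (F N)) \<in> S N" for N unfolding S_def using mid_hull_base[of N N V F] by blast
  have Sbd: "bdd_below (S N)" for N unfolding S_def by (intro bdd_belowI[of _ 0]) auto
  define d where "d N = Inf (S N)" for N
  have d_le: "d N \<le> enn2real (energy q G)" if "mid_hull V F N u G" for N u G
    unfolding d_def using that by (intro cInf_lower Sbd) (auto simp: S_def)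
  have d_mono: "d N \<le> d M" if "N \<le> M" for N M
  proof -
    have "S M \<subseteq> S N" unfolding S_def using mid_hull_mono[OF _ that] by blast
    then show ?thesis unfolding d_def using Sne by (intro cInf_superset_mono Sbd) auto
  qed
  have dK: "d N \<le> K" for N
  proof -
    have "d N \<le> enn2real (energy q (F N))" by (intro d_le[of N "V N"] mid_hull_base) simp
    also have "\<dots> \<le> K" using en by (intro enn2real_leI) auto
    finally show ?thesis .
  qed
  have "\<exists>v g. mid_hull V F N v g \<and> enn2real (energy q g) < d N + 1 / real (Suc N)" for N
  proof -
    have "\<exists>x\<in>S N. x < d N + 1 / real (Suc N)"
      unfolding d_def using Sne by (intro cInf_lessD) auto
    then show ?thesis unfolding S_def by blast
  qed
  then obtain v g where vg: "\<And>N. mid_hull V F N (v N) (g N)"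
      "\<And>N. enn2real (energy q (g N)) < d N + 1 / real (Suc N)"
    by metis
  have sg: "sob (v N) (g N)" for N by (rule mid_hull_sob[OF vg(1) s])
  note [measurable] = sobD(2)[OF sg]
  have diff: "energy q (\<lambda>x. g n x - g m x) \<le> ennreal (2 powr q * ((d m - d n) / 2 + 1 / real (Suc n)))" if nm: "n \<le> m" for n m
  proof -
    define a where "a = energy q (\<lambda>x. (1/2) *\<^sub>R (g n x - g m x))"
    \<comment> \<open>For n \<le> m the hull of the m-th tail lies in that of the n-th, so the
      midpoint competes for \<open>d n\<close>.\<close>
    have hm: "mid_hull V F n (mid (v n) (v m)) (mid (g n) (g m))"
      by (intro mid_hull_mid vg mid_hull_mono[OF _ nm])
    have le: "2 * a + 2 * energy q (mid (g n) (g m)) \<le> energy q (g n) + energy q (g m)"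
      unfolding a_def by (intro clarkson q) measurable
    also have "\<dots> \<le> ennreal K + ennreal K" by (intro add_mono enK[OF vg(1)])
    also have "\<dots> < \<infinity>" by simp
    finally have "2 * a < \<infinity>"
      by (rule le_less_trans[rotated]) simp
    then have "a < \<infinity>" by (auto simp: ennreal_mult_less_top)
    then have a: "a = ennreal (enn2real a)" by simp
    have "ennreal (2 * enn2real a + 2 * enn2real (energy q (mid (g n) (g m)))) \<le> ennreal (enn2real (energy q (g n)) + enn2real (energy q (g m)))"
    proof -
      have "ennreal (2 * enn2real a + 2 * enn2real (energy q (mid (g n) (g m)))) = 2 * a + 2 * energy q (mid (g n) (g m))"
        using a real[OF hm] by (simp add: ennreal_plus ennreal_mult')
      also have "\<dots> \<le> ennreal (enn2real (energy q (g n))) + ennreal (enn2real (energy q (g m)))"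
        using le real[OF vg(1)[of n]] real[OF vg(1)[of m]] by simp
      finally show ?thesis by simp
    qed
    then have "2 * enn2real a + 2 * enn2real (energy q (mid (g n) (g m))) \<le> enn2real (energy q (g n)) + enn2real (energy q (g m))"
      by (subst (asm) ennreal_le_iff) auto
    moreover have "d n \<le> enn2real (energy q (mid (g n) (g m)))" by (rule d_le[OF hm])
    moreover have "1 / real (Suc m) \<le> 1 / real (Suc n)" using nm by (intro divide_left_mono) auto
    ultimately have "2 * enn2real a \<le> (d m - d n) + 2 * (1 / real (Suc n))"
      using vg(2)[of n] vg(2)[of m] by linarith
    moreover have "2 * x \<le> y + 2 * z \<Longrightarrow> x \<le> y / 2 + z" for x y z :: real by simp
    ultimately have "enn2real a \<le> (d m - d n) / 2 + 1 / real (Suc n)" by blast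
    then have "2 powr q * enn2real a \<le> 2 powr q * ((d m - d n) / 2 + 1 / real (Suc n))" by (intro mult_left_mono) auto
    moreover have "energy q (\<lambda>x. g n x - g m x) = ennreal (2 powr q) * a"
      unfolding a_def by (rule energy_diff_scale) measurable
    then have "energy q (\<lambda>x. g n x - g m x) = ennreal (2 powr q * enn2real a)" using a by (metis ennreal_mult' powr_ge_zero)
    ultimately show ?thesis by (simp add: ennreal_leI)
  qed
  \<comment> \<open>Shrinking tails give increasing infima, bounded by K; their convergence makes
    the bound on distances small.\<close>
  have "incseq d" using d_mono by (simp add: incseq_def)
  then obtain l where "d \<longlonglongrightarrow> l" using incseq_convergent[of d K] dK by blast
  then have dC: "Cauchy d" by (rule LIMSEQ_imp_Cauchy)
  show thesis
  proof (rule that[OF vg(1)])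
    fix e :: real assume e: "e > 0"
    define e' where "e' = e / 2 powr q"
    have e': "e' > 0" "2 powr q * e' = e" using e by (auto simp: e'_def)
    obtain n1 where n1: "\<And>n m. n \<ge> n1 \<Longrightarrow> m \<ge> n1 \<Longrightarrow> \<bar>d m - d n\<bar> < e'"
      using dC e'(1) unfolding Cauchy_iff by fastforce
    obtain n2 where n2: "1 / real (Suc n2) < e' / 2" using e'(1) nat_approx_posE[of "e' / 2"] by auto
    have *: "energy q (\<lambda>x. g n x - g m x) \<le> ennreal e" if "n \<ge> max n1 n2" "m \<ge> max n1 n2" "n \<le> m" for n m
    proof -
      have "1 / real (Suc n) \<le> 1 / real (Suc n2)" using that by (intro divide_left_mono) auto
      moreover have "d m - d n < e'" using n1[of n m] that by (auto simp: abs_less_iff)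
      moreover have "x < c \<Longrightarrow> y \<le> z \<Longrightarrow> z < c / 2 \<Longrightarrow> x / 2 + y \<le> c" for x y z c :: real by simp
      ultimately have "(d m - d n) / 2 + 1 / real (Suc n) \<le> e'" using n2 by blast
      then have "2 powr q * ((d m - d n) / 2 + 1 / real (Suc n)) \<le> 2 powr q * e'" by (intro mult_left_mono) auto
      then show ?thesis using diff[OF that(3)] e'(2) by (auto intro: order_trans ennreal_leI)
    qed
    have sym: "energy q (\<lambda>x. g n x - g m x) = energy q (\<lambda>x. g m x - g n x)" for n m
      unfolding energy_lborel by (simp add: norm_minus_commute)
    show "\<exists>n0. \<forall>n\<ge>n0. \<forall>m\<ge>n0. energy q (\<lambda>x. g n x - g m x) \<le> ennreal e"
    proof (intro exI allI impI)
      fix n m assume "max n1 n2 \<le> n" "max n1 n2 \<le> m"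
      then show "energy q (\<lambda>x. g n x - g m x) \<le> ennreal e"
        using *[of n m] *[of m n] sym[of n m] by (cases "n \<le> m") auto
    qed
  next
    fix N
    have "enn2real (energy q (g N)) \<le> enn2real (energy q (F N)) + 1 / real (Suc N)"
      using vg(2)[of N] d_le[OF mid_hull_base[OF order_refl], of N] by linarith
    then have "ennreal (enn2real (energy q (g N))) \<le> ennreal (enn2real (energy q (F N))) + ennreal (1 / real (Suc N))"
      by (simp add: ennreal_leI flip: ennreal_plus)
    then show "energy q (g N) \<le> energy q (F N) + ennreal (1 / real (Suc N))"
      using real[OF vg(1)[of N]] real[OF mid_hull_base[OF order_refl], of N] by simp
  qed
qed

lemma mid_components: "mid G K x $ i $ j = (G x $ i $ j + K x $ i $ j) / 2" for G K :: "real^2 \<Rightarrow> real^2^2"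
  by (simp add: mid_def field_simps)

text \<open>Replaces weak compactness of the energy space. The translated maps converge strongly in
  local L^2 and so do all midpoints of their tails, while selected midpoints of the gradients
  converge strongly in L^q. The energy conclusion is phrased for an arbitrary eventual bound E,
  which a minimising sequence can bring arbitrarily near to the infimum.\<close>

theorem sob_compactness:
  fixes U :: "nat \<Rightarrow> real^2 \<Rightarrow> real^2"
  assumes q: "q \<ge> 2" and s: "\<And>n. sob (U n) (H n)" and en: "\<And>n. energy q (H n) \<le> ennreal K" "K \<ge> 0"
    and f: "locL1 f" and det: "\<And>n. AE x in lborel. det (H n x) = f x"
  obtains u G where "sob u G" "AE x in lborel. det (G x) = f x"
    "\<And>E n0. (\<And>n. n \<ge> n0 \<Longrightarrow> energy q (H n) \<le> E) \<Longrightarrow> energy q G \<le> E"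
proof -
  obtain r V w where r: "strict_mono (r :: nat \<Rightarrow> nat)" and sV: "\<And>n. sob (V n) (H (r n))"
    and [measurable]: "w \<in> borel_measurable borel"
    and V: "\<And>i. L2_tendsto (\<lambda>n x. V n x $ i) (\<lambda>x. w x $ i)"
    by (rule sob_rellich[OF q s en]) (rule that, assumption+)
  define F where "F n = H (r n)" for n
  have sF: "sob (V n) (F n)" and enF: "energy q (F n) \<le> ennreal K" for n
    unfolding F_def using sV en by auto
  have w2: "locL2 (\<lambda>x. w x $ i)" for i
    by (rule L2_tendsto_locL2[OF sobD(5)[OF sF] _ V]) measurable
  obtain v g where h: "\<And>N. mid_hull V F N (v N) (g N)"
    and gC: "\<And>e. e > 0 \<Longrightarrow> \<exists>n0. \<forall>n\<ge>n0. \<forall>m\<ge>n0. energy q (\<lambda>x. g n x - g m x) \<le> ennreal e"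
    and ge: "\<And>N. energy q (g N) \<le> energy q (F N) + ennreal (1 / real (Suc N))"
    by (rule mid_hull_minimising[OF q sF enF en(2)]) (rule that, assumption+)
  have sg: "sob (v N) (g N)" for N by (rule mid_hull_sob[OF h sF])
  have gm [measurable]: "g N \<in> borel_measurable borel" for N by (rule sobD(2)[OF sg])
  obtain G t where Gm [measurable]: "G \<in> borel_measurable borel" and t: "strict_mono (t :: nat \<Rightarrow> nat)"
    and Gt: "AE x in lborel. (\<lambda>k. g (t k) x) \<longlonglongrightarrow> G x"
    and GL: "\<And>e. e > 0 \<Longrightarrow> \<exists>N. \<forall>n\<ge>N. energy q (\<lambda>x. g n x - G x) \<le> ennreal e"
  proof (rule Lq_complete[of q g "\<lambda>R. UNIV"])
    show "\<exists>N. \<forall>n\<ge>N. \<forall>m\<ge>N. (\<integral>\<^sup>+x. indicator UNIV x * ennreal (norm (g n x - g m x) powr q) \<partial>lborel) \<le> ennreal e"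
      if "e > 0" for e
      using gC[OF that] by (simp add: energy_lborel)
  qed (use q in \<open>auto simp: energy_lborel\<close>)
  \<comment> \<open>Fatou's lemma along the almost everywhere convergent subsequence. Bounds on a
    tail suffice because the index \<open>r (t k)\<close> is at least k, and the errors 1 / (t k +
    1) vanish in the limit.\<close>
  have Gen: "energy q G \<le> E" if E: "\<And>n. n \<ge> n0 \<Longrightarrow> energy q (H n) \<le> E" for E n0
  proof -
    have "energy q G = (\<integral>\<^sup>+x. liminf (\<lambda>k. ennreal (norm (g (t k) x) powr q)) \<partial>lborel)"
      unfolding energy_lborel
    proof (rule nn_integral_cong_AE)
      show "AE x in lborel. ennreal (norm (G x) powr q) = liminf (\<lambda>k. ennreal (norm (g (t k) x) powr q))"
        using Gt
      proof eventually_elim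
        case (elim x)
        have "(\<lambda>k. norm (g (t k) x) powr q) \<longlonglongrightarrow> norm (G x) powr q"
          using q by (intro tendsto_powr' tendsto_intros elim) auto
        then have "(\<lambda>k. ennreal (norm (g (t k) x) powr q)) \<longlonglongrightarrow> ennreal (norm (G x) powr q)"
          by (rule tendsto_ennrealI)
        from lim_imp_Liminf[OF _ this] show ?case by simp
      qed
    qed
    also have "\<dots> \<le> liminf (\<lambda>k. energy q (g (t k)))"
      unfolding energy_lborel by (rule nn_integral_liminf) measurable
    also have "\<dots> \<le> liminf (\<lambda>k. E + ennreal (1 / real (Suc (t k))))"
    proof (rule Liminf_mono)
      show "eventually (\<lambda>k. energy q (g (t k)) \<le> E + ennreal (1 / real (Suc (t k)))) sequentially"
        using eventually_ge_at_top[of n0]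
      proof eventually_elim
        case (elim k)
        have "n0 \<le> r (t k)" using elim seq_suble[OF t, of k] seq_suble[OF r, of "t k"] by linarith
        then show ?case using ge[of "t k"] E[of "r (t k)"] unfolding F_def by (auto intro: order_trans add_right_mono)
      qed
    qed
    also have "\<dots> = E"
    proof -
      have "(\<lambda>k. 1 / real (Suc (t k))) \<longlonglongrightarrow> 0"
        using LIMSEQ_subseq_LIMSEQ[OF lim_1_over_n[THEN LIMSEQ_Suc] t] by (simp add: comp_def)
      then have "(\<lambda>k. ennreal (1 / real (Suc (t k)))) \<longlonglongrightarrow> ennreal 0" by (rule tendsto_ennrealI)
      then have "(\<lambda>k. E + ennreal (1 / real (Suc (t k)))) \<longlonglongrightarrow> E + ennreal 0" by (intro tendsto_add tendsto_const)
      from lim_imp_Liminf[OF _ this] show ?thesis by simp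
    qed
    finally show ?thesis .
  qed
  have fin: "energy q G < \<infinity>"
    using Gen[of 0 "ennreal K"] en(1) by (auto intro: le_less_trans[OF _ ennreal_less_top])
  have G2: "locL2 (\<lambda>x. G x $ i $ j)" for i j by (rule locL2_energy[OF q Gm fin])
  have gt: "L2_tendsto (\<lambda>n x. g n x $ i $ j) (\<lambda>x. G x $ i $ j)" for i j
    by (rule Lq_imp_L2_tendsto[OF q gm Gm GL])
  have vt: "L2_tendsto (\<lambda>n x. v n x $ i) (\<lambda>x. w x $ i)" for i
    unfolding L2_tendsto_def
  proof (intro allI impI)
    fix N :: nat and e :: real assume "e > 0"
    then obtain n0 where n0: "\<And>n. n \<ge> n0 \<Longrightarrow> (\<integral>\<^sup>+x. indicator (square N) x * ennreal ((V n x $ i - w x $ i)\<^sup>2) \<partial>lborel) \<le> ennreal e"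
      using L2_tendstoD[OF V] by blast
    show "\<exists>n0. \<forall>n\<ge>n0. (\<integral>\<^sup>+x. indicator (square N) x * ennreal ((v n x $ i - w x $ i)\<^sup>2) \<partial>lborel) \<le> ennreal e"
    proof (intro exI allI impI)
      fix n assume n: "n0 \<le> n"
      show "(\<integral>\<^sup>+x. indicator (square N) x * ennreal ((v n x $ i - w x $ i)\<^sup>2) \<partial>lborel) \<le> ennreal e"
        by (rule mid_hull_L2[OF h sF]) (use n0 n in \<open>auto intro: order_trans\<close>)
    qed
  qed
  have sob: "sob w G"
    unfolding sob_def
    using wpd_limit[OF sobD(3)[OF sg] sobD(5)[OF sg] sobD(4)[OF sg] w2 G2 vt gt] G2 Gm by auto
  have "AE x in lborel. det (G x) - f x = 0"
  proof (rule locL1_AE_0)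
    have dG: "locL1 (\<lambda>x. det (G x))" unfolding det_matrix_2 by (intro locL1_diff locL1_mult_L2 G2)
    then show "locL1 (\<lambda>x. det (G x) - f x)" using f by (intro locL1_diff)
    fix \<psi> assume \<psi>: "test_function \<psi>"
    obtain N where N: "\<And>x. x \<notin> square N \<Longrightarrow> \<psi> x = 0" "\<And>j x. x \<notin> square N \<Longrightarrow> partial_deriv j \<psi> x = 0"
      using test_function_square[OF \<psi>] by blast
    define p where "p j = partial_deriv j \<psi>" for j
    have pc: "continuous_on UNIV (p j)" for j unfolding p_def by (rule test_function_continuous[OF test_function_partial[OF \<psi>]])
    have [measurable]: "p j \<in> borel_measurable borel" for j using borel_measurable_continuous_onI[OF pc] .
    have p0: "x \<notin> square N \<Longrightarrow> p j x = 0" for j x unfolding p_def by (rule N(2))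
    have k2: "locL2 (\<lambda>x. w x $ 1 * p j x)" for j by (rule locL2_mult_continuous[OF w2 pc])
    \<comment> \<open>The divergence form of the Jacobian tested with \<psi>, with the first
      component of the map replaced by the limit w. It depends only on the second row of the
      gradient, and linearly.\<close>
    define L where "L A = (\<integral>x. (w x $ 1 * p 1 x) * A x $ 2 $ 2 \<partial>lborel) - (\<integral>x. (w x $ 1 * p 2 x) * A x $ 2 $ 1 \<partial>lborel)"
      for A :: "real^2 \<Rightarrow> real^2^2"
    have iw: "integrable lborel (\<lambda>x. (w x $ 1 * p j x) * A x)" if "locL2 A" for j A
      by (rule integrable_pairing[OF k2 that, of N]) (simp add: p0)
    have L_mid: "L (mid A B) = (L A + L B) / 2" if "sob a A" "sob b B" for a b A B
    proof -
      have "(w x $ 1 * p j x) * mid A B x $ 2 $ i = ((w x $ 1 * p j x) * A x $ 2 $ i + (w x $ 1 * p j x) * B x $ 2 $ i) / 2" for x j i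
        by (simp add: mid_components distrib_left)
      then have "(\<integral>x. (w x $ 1 * p j x) * mid A B x $ 2 $ i \<partial>lborel) =
          (\<integral>x. ((w x $ 1 * p j x) * A x $ 2 $ i + (w x $ 1 * p j x) * B x $ 2 $ i) / 2 \<partial>lborel)" for j i
        by (simp only:)
      moreover have "(\<integral>x. ((w x $ 1 * p j x) * A x $ 2 $ i + (w x $ 1 * p j x) * B x $ 2 $ i) / 2 \<partial>lborel) =
          ((\<integral>x. (w x $ 1 * p j x) * A x $ 2 $ i \<partial>lborel) + (\<integral>x. (w x $ 1 * p j x) * B x $ 2 $ i \<partial>lborel)) / 2" for j i
        using iw[OF sobD(4)[OF that(1)]] iw[OF sobD(4)[OF that(2)]] by simp
      ultimately show ?thesis unfolding L_def by (simp add: add_divide_distrib diff_divide_distrib)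
    qed
    define c where "c = - (\<integral>x. f x * \<psi> x \<partial>lborel)"
    have wj: "(\<integral>x. det (A x) * \<psi> x \<partial>lborel) = - (\<integral>x. a x $ 1 * (p 1 x * A x $ 2 $ 2 - p 2 x * A x $ 2 $ 1) \<partial>lborel)"
      if "sob a A" for a A
      unfolding det_matrix_2 p_def
      by (rule weak_jacobian[OF sobD(3)[OF that] sobD(3)[OF that] sobD(3)[OF that] sobD(3)[OF that] sobD(4)[OF that] sobD(4)[OF that] sobD(4)[OF that] sobD(4)[OF that] \<psi>])
    have Lw: "L A = (\<integral>x. w x $ 1 * (p 1 x * A x $ 2 $ 2 - p 2 x * A x $ 2 $ 1) \<partial>lborel)" if "sob a A" for a A
    proof -
      have "w x $ 1 * (p 1 x * A x $ 2 $ 2 - p 2 x * A x $ 2 $ 1) = (w x $ 1 * p 1 x) * A x $ 2 $ 2 - (w x $ 1 * p 2 x) * A x $ 2 $ 1" for x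
        by (simp add: algebra_simps)
      then show ?thesis
        unfolding L_def using Bochner_Integration.integral_diff[OF iw[OF sobD(4)[OF that]] iw[OF sobD(4)[OF that]]] by simp
    qed
    have LF: "(\<lambda>n. L (F n)) \<longlonglongrightarrow> c"
    proof -
      define k where "k n x = p 1 x * F n x $ 2 $ 2 - p 2 x * F n x $ 2 $ 1" for n x
      have [measurable]: "F n \<in> borel_measurable borel" "V n \<in> borel_measurable borel" for n using sobD(1,2)[OF sF] by auto
      have kL2: "locL2 (k n)" for n
        unfolding k_def using locL2_mult_continuous[OF sobD(4)[OF sF] pc] by (intro locL2_diff) (simp_all add: mult.commute)
      have k0: "x \<notin> square N \<Longrightarrow> k n x = 0" for n x unfolding k_def by (simp add: p0)
      obtain B where B: "B > 0" "\<And>j x. \<bar>p j x\<bar> \<le> B"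
      proof -
        obtain B1 where B1: "B1 > 0" "\<And>x. \<bar>p 1 x\<bar> \<le> B1"
          unfolding p_def by (rule test_function_bounded[OF test_function_partial[OF \<psi>, of 1]]) blast
        obtain B2 where B2: "B2 > 0" "\<And>x. \<bar>p 2 x\<bar> \<le> B2"
          unfolding p_def by (rule test_function_bounded[OF test_function_partial[OF \<psi>, of 2]]) blast
        have "\<bar>p j x\<bar> \<le> B1 + B2" for j x
          using exhaust_2[of j] B1(1) B2(1) B1(2)[of x] B2(2)[of x] by auto
        then show thesis using that[of "B1 + B2"] B1(1) B2(1) by simp
      qed
      have kb: "(\<integral>\<^sup>+x. indicator (square N) x * ennreal ((k n x)\<^sup>2) \<partial>lborel) \<le> ennreal (2 * B\<^sup>2 * (2 * ((2 * real N)\<^sup>2 + K)))" for n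
      proof -
        have "(\<integral>\<^sup>+x. indicator (square N) x * ennreal ((k n x)\<^sup>2) \<partial>lborel) \<le>
          (\<integral>\<^sup>+x. ennreal (2 * B\<^sup>2) * (indicator (square N) x * ennreal ((F n x $ 2 $ 1)\<^sup>2 + (F n x $ 2 $ 2)\<^sup>2)) \<partial>lborel)"
        proof (intro nn_integral_mono)
          fix x
          have pB: "(p j x)\<^sup>2 \<le> B\<^sup>2" for j using power_mono[OF B(2)[of j x], of 2] by simp
          have "(k n x)\<^sup>2 \<le> 2 * (p 1 x * F n x $ 2 $ 2)\<^sup>2 + 2 * (p 2 x * F n x $ 2 $ 1)\<^sup>2"
            unfolding k_def by (rule sq_diff_le)
          also have "\<dots> \<le> 2 * (B\<^sup>2 * (F n x $ 2 $ 2)\<^sup>2) + 2 * (B\<^sup>2 * (F n x $ 2 $ 1)\<^sup>2)"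
            unfolding power_mult_distrib by (intro add_mono mult_left_mono mult_right_mono pB) auto
          also have "\<dots> = 2 * B\<^sup>2 * ((F n x $ 2 $ 1)\<^sup>2 + (F n x $ 2 $ 2)\<^sup>2)" by (simp add: algebra_simps)
          finally have "ennreal ((k n x)\<^sup>2) \<le> ennreal (2 * B\<^sup>2) * ennreal ((F n x $ 2 $ 1)\<^sup>2 + (F n x $ 2 $ 2)\<^sup>2)"
            by (subst ennreal_mult'[symmetric]) (auto intro: ennreal_leI)
          then show "indicator (square N) x * ennreal ((k n x)\<^sup>2) \<le> ennreal (2 * B\<^sup>2) * (indicator (square N) x * ennreal ((F n x $ 2 $ 1)\<^sup>2 + (F n x $ 2 $ 2)\<^sup>2))"
            by (cases "x \<in> square N") (auto simp del: ennreal_plus)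
        qed
        also have "\<dots> = ennreal (2 * B\<^sup>2) * (\<integral>\<^sup>+x. indicator (square N) x * ennreal ((F n x $ 2 $ 1)\<^sup>2 + (F n x $ 2 $ 2)\<^sup>2) \<partial>lborel)"
          by (rule nn_integral_cmult) measurable
        also have "\<dots> \<le> ennreal (2 * B\<^sup>2) * ennreal (2 * ((2 * real N)\<^sup>2 + K))"
          by (intro mult_left_mono gradient_square_bound[OF q sF enF en(2)]) auto
        also have "\<dots> = ennreal (2 * B\<^sup>2 * (2 * ((2 * real N)\<^sup>2 + K)))"
          by (simp add: ennreal_mult')
        finally show ?thesis .
      qed
      \<comment> \<open>By the weak Jacobian identity for \<open>V n\<close> the value c results if
        w is replaced by \<open>V n\<close>. The difference \<open>L (F n) - c\<close> is therefore
        a pairing of the bounded gradients with a strongly vanishing factor.\<close>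
      have "L2_tendsto (\<lambda>n x. w x $ 1 - V n x $ 1) (\<lambda>x. 0)"
        using V[of 1] by (simp add: L2_tendsto_def power2_commute)
      then have "(\<lambda>n. \<integral>x. k n x * (w x $ 1 - V n x $ 1) \<partial>lborel) \<longlonglongrightarrow> 0"
        using kL2 kb en(2) by (intro pairing_tendsto_0[where N=N and C="2 * B\<^sup>2 * (2 * ((2 * real N)\<^sup>2 + K))"] k0) (auto simp: locL2_measurable)
      moreover have "(\<integral>x. k n x * (w x $ 1 - V n x $ 1) \<partial>lborel) = L (F n) - c" for n
      proof -
        have "(\<integral>x. det (F n x) * \<psi> x \<partial>lborel) = (\<integral>x. f x * \<psi> x \<partial>lborel)"
          using det[of "r n"] test_function_measurable[OF \<psi>] locL1_measurable[OF f]
          by (intro integral_cong_AE) (auto simp: F_def[symmetric] det_matrix_2)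
        then have "(\<integral>x. V n x $ 1 * k n x \<partial>lborel) = c" using wj[OF sF, of n] unfolding c_def k_def by simp
        moreover have "(\<integral>x. w x $ 1 * k n x \<partial>lborel) = L (F n)" using Lw[OF sF, of n] unfolding k_def by simp
        moreover have "integrable lborel (\<lambda>x. k n x * w x $ 1)" "integrable lborel (\<lambda>x. k n x * V n x $ 1)"
          by (intro integrable_pairing[where N=N] kL2 w2 sobD(5)[OF sF] k0, assumption)+
        ultimately show ?thesis by (simp add: right_diff_distrib mult.commute)
      qed
      ultimately show ?thesis by (simp add: LIM_zero_iff)
    qed
    have "(\<lambda>n. L (g n)) \<longlonglongrightarrow> c"
    proof (rule LIMSEQ_I)
      fix e :: real assume e: "e > 0"
      obtain n0 where n0: "\<And>n. n \<ge> n0 \<Longrightarrow> norm (L (F n) - c) < e / 2" using LIMSEQ_D[OF LF, of "e / 2"] e by auto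
      show "\<exists>no. \<forall>n\<ge>no. norm (L (g n) - c) < e"
      proof (intro exI allI impI)
        fix n assume n: "n0 \<le> n"
        \<comment> \<open>The hull used for \<open>g n\<close> is built from indices at least n
          only, so closeness on the tail is all that is required.\<close>
        have b: "\<bar>L (F m) - c\<bar> \<le> e / 2" if "n \<le> m" for m using n0[of m] n that by simp
        have "\<bar>L (g n) - c\<bar> \<le> e / 2"
          by (rule mid_hull_functional[OF h sF L_mid b])
        then show "norm (L (g n) - c) < e" using e by simp
      qed
    qed
    moreover have "(\<lambda>n. L (g n)) \<longlonglongrightarrow> L G"
      unfolding L_def
      by (intro tendsto_diff pairing_tendsto[where N=N] k2 sobD(4)[OF sg] G2 gt) (simp_all add: p0)
    ultimately have "L G = c" using LIMSEQ_unique by blast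
    then have "(\<integral>x. det (G x) * \<psi> x \<partial>lborel) = (\<integral>x. f x * \<psi> x \<partial>lborel)"
      using wj[OF sob] Lw[OF sob] by (simp add: c_def)
    then show "(\<integral>x. (det (G x) - f x) * \<psi> x \<partial>lborel) = 0"
      using integrable_locL1_test[OF dG \<psi>] integrable_locL1_test[OF f \<psi>] by (simp add: left_diff_distrib)
  qed
  then have "AE x in lborel. det (G x) = f x" by simp
  then show thesis by (rule that[OF sob _ Gen])
qed

theorem minimiser_exists:
  assumes p: "p \<ge> 1" and f: "locL1 f" and ex: "admissible p f v0 H0"
  obtains u G where "sob u G" "AE x in lborel. det (G x) = f x"
    "energy (2 * p) G = Inf {energy (2 * p) H |v H. admissible p f v H}" "energy (2 * p) G < \<infinity>"
proof -
  define I where "I = Inf {energy (2 * p) H |v H. admissible p f v H}"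
  have q: "2 * p \<ge> 2" using p by simp
  have "I \<le> energy (2 * p) H0" unfolding I_def using ex by (intro Inf_lower) auto
  also have "\<dots> < \<infinity>"
    using ex unfolding admissible_def in_Lp_def energy_def by (simp add: integrable_iff_bounded)
  finally have I: "I < \<infinity>" .
  have "\<forall>n. \<exists>z. sob (fst z) (snd z) \<and> (AE x in lborel. det (snd z x) = f x) \<and> energy (2 * p) (snd z) \<le> I + ennreal (1 / real (Suc n))"
  proof
    fix n
    \<comment> \<open>Strict because I is finite, which the given admissible map ensures.\<close>
    have "I < I + ennreal (1 / real (Suc n))" using I by (simp add: ennreal_zero_less_divide)
    then obtain v H where vH: "admissible p f v H" "energy (2 * p) H < I + ennreal (1 / real (Suc n))"
      unfolding I_def Inf_less_iff by auto
    obtain u G where "sob u G" "energy (2 * p) G = energy (2 * p) H" "AE x in lborel. det (G x) = f x"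
      by (rule admissible_sob[OF vH(1) p]) (rule that, assumption+)
    then show "\<exists>z. sob (fst z) (snd z) \<and> (AE x in lborel. det (snd z x) = f x) \<and> energy (2 * p) (snd z) \<le> I + ennreal (1 / real (Suc n))"
      using vH(2) by (intro exI[of _ "(u, G)"]) auto
  qed
  from choice[OF this] obtain Z where Z: "\<And>n. sob (fst (Z n)) (snd (Z n))" "\<And>n. AE x in lborel. det (snd (Z n) x) = f x"
    "\<And>n. energy (2 * p) (snd (Z n)) \<le> I + ennreal (1 / real (Suc n))"
    by blast
  define U H where "U n = fst (Z n)" and "H n = snd (Z n)" for n
  have s: "sob (U n) (H n)" and det: "AE x in lborel. det (H n x) = f x"
    and en: "energy (2 * p) (H n) \<le> I + ennreal (1 / real (Suc n))" for n
    unfolding U_def H_def using Z by auto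
  define K where "K = enn2real I + 1"
  have K0: "K \<ge> 0" by (simp add: K_def)
  have enK: "energy (2 * p) (H n) \<le> ennreal K" for n
  proof -
    have "energy (2 * p) (H n) \<le> I + ennreal (1 / real (Suc n))" by (rule en)
    also have "\<dots> \<le> ennreal (enn2real I) + ennreal 1" using I by (intro add_mono ennreal_leI) auto
    also have "\<dots> = ennreal K" unfolding K_def by (simp add: ennreal_plus)
    finally show ?thesis .
  qed
  obtain u G where uG: "sob u G" "AE x in lborel. det (G x) = f x"
    "\<And>E n0. (\<And>n. n \<ge> n0 \<Longrightarrow> energy (2 * p) (H n) \<le> E) \<Longrightarrow> energy (2 * p) G \<le> E"
  proof (rule sob_compactness[where U=U and H=H, OF q s enK K0 f det])
    fix u G
    assume a: "sob u G" "AE x in lborel. det (G x) = f x"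
      "\<And>E n0. (\<And>n. n \<ge> n0 \<Longrightarrow> energy (2 * p) (H n) \<le> E) \<Longrightarrow> energy (2 * p) G \<le> E"
    show ?thesis by (rule that[OF a])
  qed
  have "energy (2 * p) G \<le> I"
  proof (rule ennreal_le_epsilon)
    fix e :: real assume e: "e > 0"
    obtain n0 where n0: "1 / real (Suc n0) < e" using e nat_approx_posE by blast
    show "energy (2 * p) G \<le> I + ennreal e"
    proof (rule uG(3)[of n0])
      fix n assume "n0 \<le> n"
      then have "1 / real (Suc n) \<le> 1 / real (Suc n0)" by (intro divide_left_mono) auto
      then have "I + ennreal (1 / real (Suc n)) \<le> I + ennreal e" using n0 by (intro add_left_mono ennreal_leI) linarith
      then show "energy (2 * p) (H n) \<le> I + ennreal e" using en[of n] by (rule order_trans[rotated])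
    qed
  qed
  moreover from this have fin: "energy (2 * p) G < \<infinity>" using I by (rule le_less_trans)
  moreover have "I \<le> energy (2 * p) G"
    unfolding I_def using sob_admissible[OF uG(1) fin uG(2)] by (intro Inf_lower) auto
  ultimately show thesis using that[OF uG(1,2)] unfolding I_def by (simp add: antisym)
qed

section \<open>The radial datum\<close>

text \<open>Integration by parts puts the derivatives on the radial cutoff, and its gradient is -2 x
  times a radial weight. The derivatives of the second component then occur only in the combination
  \<open>x $ 1 * b2 x - x $ 2 * b1 x\<close>, its angular derivative, for which the hypothesis is
  substituted. Subtracting c from the first component leaves its gradient unchanged.\<close>

lemma jacobian_circulation:
  assumes u: "wpd 1 u1 a1" "wpd 2 u1 a2" and v: "wpd 1 u2 b1" "wpd 2 u2 b2"
    and a: "locL2 a1" "locL2 a2" and b: "locL2 b1" "locL2 b2"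
    and rot: "AE x in lborel. x $ 1 * b2 x - x $ 2 * b1 x = \<kappa> * (u1 x - c)"
  shows "(\<integral>x. (a1 x * b2 x - a2 x * b1 x) * rbump 1 R x \<partial>lborel)
     = 2 * \<kappa> * (\<integral>x. rbump (flat_deriv 1) R x * (u1 x - c)\<^sup>2 \<partial>lborel)"
proof -
  define B where "B = rbump (flat_deriv 1) R"
  have [measurable]: "u1 \<in> borel_measurable borel" "b1 \<in> borel_measurable borel" "b2 \<in> borel_measurable borel"
    using wpdD(1)[OF u(1)] b by measurable
  have [measurable]: "B \<in> borel_measurable borel" unfolding B_def
    using test_function_rbump by measurable
  have "(\<integral>x. (a1 x * b2 x - a2 x * b1 x) * rbump 1 R x \<partial>lborel)
     = - (\<integral>x. (u1 x - c) * (partial_deriv 1 (rbump 1 R) x * b2 x - partial_deriv 2 (rbump 1 R) x * b1 x) \<partial>lborel)"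
    by (rule weak_jacobian[OF wpd_add_const[OF u(1)] wpd_add_const[OF u(2)] v a b test_function_rbump])
  also have "\<dots> = - (\<integral>x. - 2 * \<kappa> * (B x * (u1 x - c)\<^sup>2) \<partial>lborel)"
  proof (intro arg_cong[where f=uminus] integral_cong_AE)
    show "AE x in lborel. (u1 x - c) * (partial_deriv 1 (rbump 1 R) x * b2 x - partial_deriv 2 (rbump 1 R) x * b1 x)
      = - 2 * \<kappa> * (B x * (u1 x - c)\<^sup>2)"
      using rot
    proof eventually_elim
      case (elim x)
      have "(u1 x - c) * (partial_deriv 1 (rbump 1 R) x * b2 x - partial_deriv 2 (rbump 1 R) x * b1 x)
        = - 2 * B x * (u1 x - c) * (x $ 1 * b2 x - x $ 2 * b1 x)"
        unfolding partial_deriv_rbump B_def by (simp add: algebra_simps)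
      then show ?case unfolding elim by (simp add: power2_eq_square)
    qed
  next
    show "(\<lambda>x. (u1 x - c) * (partial_deriv 1 (rbump 1 R) x * b2 x - partial_deriv 2 (rbump 1 R) x * b1 x)) \<in> borel_measurable lborel"
      unfolding partial_deriv_rbump B_def[symmetric] by measurable
  qed measurable
  finally show ?thesis unfolding B_def by simp
qed

text \<open>The previous lemma is used for the map and for the map with its components exchanged;
  the exchange reverses the sign of both the Jacobian and \<kappa>. The average of the two resulting
  formulas is symmetric in the components.\<close>

lemma jacobian_rotational:
  assumes u: "wpd 1 u1 a1" "wpd 2 u1 a2" and v: "wpd 1 u2 b1" "wpd 2 u2 b2"
    and a: "locL2 a1" "locL2 a2" and b: "locL2 b1" "locL2 b2"
    and rot: "AE x in lborel. x $ 1 * a2 x - x $ 2 * a1 x = - \<kappa> * (u2 x - c2)"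
      "AE x in lborel. x $ 1 * b2 x - x $ 2 * b1 x = \<kappa> * (u1 x - c1)"
  shows "(\<integral>x. (a1 x * b2 x - a2 x * b1 x) * rbump 1 R x \<partial>lborel)
     = \<kappa> * (\<integral>x. rbump (flat_deriv 1) R x * ((u1 x - c1)\<^sup>2 + (u2 x - c2)\<^sup>2) \<partial>lborel)"
proof -
  define B where "B = rbump (flat_deriv 1) R"
  define J where "J = (\<integral>x. (a1 x * b2 x - a2 x * b1 x) * rbump 1 R x \<partial>lborel)"
  have u2: "locL2 (\<lambda>x. u1 x - c1)" "locL2 (\<lambda>x. u2 x - c2)"
    using wpd_locL2[OF u a] wpd_locL2[OF v b] by auto
  have I: "integrable lborel (\<lambda>x. B x * (g x)\<^sup>2)" if "locL2 g" for g
    using integrable_locL1_test[of "\<lambda>x. (g x)\<^sup>2" B] that test_function_rbump unfolding B_def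
    by (simp add: locL2_iff mult.commute)
  have 1: "J = 2 * \<kappa> * (\<integral>x. B x * (u1 x - c1)\<^sup>2 \<partial>lborel)"
    unfolding J_def B_def by (rule jacobian_circulation[OF u v a b rot(2)])
  have "(\<integral>x. (b1 x * a2 x - b2 x * a1 x) * rbump 1 R x \<partial>lborel) = 2 * - \<kappa> * (\<integral>x. B x * (u2 x - c2)\<^sup>2 \<partial>lborel)"
    unfolding B_def by (rule jacobian_circulation[OF v u b a rot(1)])
  moreover have "(\<integral>x. (b1 x * a2 x - b2 x * a1 x) * rbump 1 R x \<partial>lborel) = - J"
    unfolding J_def by (subst Bochner_Integration.integral_minus[symmetric]) (simp add: algebra_simps)
  ultimately have 2: "J = 2 * \<kappa> * (\<integral>x. B x * (u2 x - c2)\<^sup>2 \<partial>lborel)" by simp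
  have "(\<integral>x. B x * ((u1 x - c1)\<^sup>2 + (u2 x - c2)\<^sup>2) \<partial>lborel) = (\<integral>x. B x * (u1 x - c1)\<^sup>2 \<partial>lborel) + (\<integral>x. B x * (u2 x - c2)\<^sup>2 \<partial>lborel)"
    using I[OF u2(1)] I[OF u2(2)] by (simp add: distrib_left)
  then have "2 * (\<kappa> * (\<integral>x. B x * ((u1 x - c1)\<^sup>2 + (u2 x - c2)\<^sup>2) \<partial>lborel)) =
      2 * \<kappa> * (\<integral>x. B x * (u1 x - c1)\<^sup>2 \<partial>lborel) + 2 * \<kappa> * (\<integral>x. B x * (u2 x - c2)\<^sup>2 \<partial>lborel)"
    by (simp only: distrib_left mult.assoc)
  also have "\<dots> = 2 * J" using 1 2 by (simp only: mult_2)
  finally have "2 * (\<kappa> * (\<integral>x. B x * ((u1 x - c1)\<^sup>2 + (u2 x - c2)\<^sup>2) \<partial>lborel)) = 2 * J" .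
  then show ?thesis unfolding J_def B_def by simp
qed

lemma flat_deriv_one: "flat (flat_deriv 1) x = (if x > 0 then (1 / x)\<^sup>2 * exp (- (1 / x)) else 0)"
  by (simp add: flat_def flat_deriv_def power2_eq_square)

text \<open>This sign makes the right-hand side of \<open>jacobian_rotational\<close> a multiple of
  \<kappa> by a nonnegative number.\<close>

lemma rbump_deriv_nonneg: "0 \<le> rbump (flat_deriv 1) R x"
  by (simp add: rbump_def flat_deriv_one)

section \<open>The radial stretching, its complex square and the competitor\<close>

definition bump :: "real^2 \<Rightarrow> real" where "bump = rbump 1 1"
definition bump' :: "real^2 \<Rightarrow> real" where "bump' = rbump (flat_deriv 1) 1"

definition w1 :: "real^2 \<Rightarrow> real" where "w1 x = x $ 1 * bump x"
definition w2 :: "real^2 \<Rightarrow> real" where "w2 x = x $ 2 * bump x"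
text \<open>\<open>k1\<close> and \<open>k2\<close> are the real and imaginary parts of the complex
  square of \<open>w1\<close> + i \<open>w2\<close>. Rotating the domain turns this square at twice
  the speed.\<close>

definition k1 :: "real^2 \<Rightarrow> real" where "k1 x = (w1 x)\<^sup>2 - (w2 x)\<^sup>2"
definition k2 :: "real^2 \<Rightarrow> real" where "k2 x = 2 * w1 x * w2 x"

lemma smooth_bump [intro]: "smooth_fun bump" "smooth_fun bump'"
  unfolding bump_def bump'_def by auto

lemma test_function_bump: "test_function bump" "test_function bump'"
  unfolding bump_def bump'_def by auto

lemma partial_deriv_bump: "partial_deriv j bump x = - 2 * x $ j * bump' x"
  unfolding bump_def bump'_def by (simp add: partial_deriv_rbump)

lemma smooth_w [intro]: "smooth_fun w1" "smooth_fun w2"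
  unfolding w1_def w2_def by (intro smooth_mult smooth_coord smooth_bump)+

lemma smooth_k [intro]: "smooth_fun k1" "smooth_fun k2"
  unfolding k1_def k2_def by (intro smooth_mult smooth_diff smooth_power smooth_const smooth_w)+

lemma smooth_mult_test_function: "smooth_fun f \<Longrightarrow> test_function g \<Longrightarrow> test_function (\<lambda>x. f x * g x)"
  using test_function_mult[of g f] by (simp add: mult.commute)

lemma test_function_w: "test_function w1" "test_function w2"
  unfolding w1_def w2_def by (intro smooth_mult_test_function smooth_coord test_function_bump)+

lemma test_function_diff: "test_function f \<Longrightarrow> test_function g \<Longrightarrow> test_function (\<lambda>x. f x - g x)"
  using test_function_add[of f "\<lambda>x. (-1) * g x"] smooth_mult_test_function[of "\<lambda>x. -1" g] by simp

lemma test_function_k: "test_function k1" "test_function k2"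
proof -
  show "test_function k1"
    unfolding k1_def power2_eq_square by (intro test_function_diff smooth_mult_test_function smooth_w test_function_w)
  show "test_function k2"
    unfolding k2_def by (intro smooth_mult_test_function smooth_mult smooth_const smooth_w test_function_w)
qed

lemma partial_w1: "partial_deriv j w1 x = axis j 1 $ 1 * bump x - 2 * x $ 1 * x $ j * bump' x"
proof -
  have "partial_deriv j (\<lambda>x. x $ 1 * bump x) x = partial_deriv j (\<lambda>x. x $ 1) x * bump x + x $ 1 * partial_deriv j bump x"
    by (intro partial_deriv_mult smooth_fun_differentiable smooth_coord smooth_bump)
  then show ?thesis unfolding w1_def by (simp add: partial_deriv_bump)
qed

lemma partial_w2: "partial_deriv j w2 x = axis j 1 $ 2 * bump x - 2 * x $ 2 * x $ j * bump' x"
proof -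
  have "partial_deriv j (\<lambda>x. x $ 2 * bump x) x = partial_deriv j (\<lambda>x. x $ 2) x * bump x + x $ 2 * partial_deriv j bump x"
    by (intro partial_deriv_mult smooth_fun_differentiable smooth_coord smooth_bump)
  then show ?thesis unfolding w2_def by (simp add: partial_deriv_bump)
qed

lemma partial_deriv_diff:
  assumes "smooth_fun f" "smooth_fun g"
  shows "partial_deriv j (\<lambda>x. f x - g x) x = partial_deriv j f x - partial_deriv j g x"
proof -
  have "partial_deriv j (\<lambda>x. f x + (- 1) * g x) x = partial_deriv j f x + partial_deriv j (\<lambda>x. (- 1) * g x) x"
    using assms by (intro partial_deriv_add smooth_fun_differentiable smooth_mult smooth_const)
  then show ?thesis using fun_cong[OF partial_deriv_cmult[OF assms(2), of j "-1"], of x] by simp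
qed

lemma partial_k1: "partial_deriv j k1 x = 2 * w1 x * partial_deriv j w1 x - 2 * w2 x * partial_deriv j w2 x"
proof -
  have "partial_deriv j k1 x = partial_deriv j (\<lambda>x. w1 x * w1 x) x - partial_deriv j (\<lambda>x. w2 x * w2 x) x"
    unfolding k1_def power2_eq_square by (intro partial_deriv_diff smooth_mult smooth_w)
  then show ?thesis by (simp add: partial_deriv_mult smooth_fun_differentiable smooth_w)
qed

lemma partial_k2: "partial_deriv j k2 x = 2 * (partial_deriv j w1 x * w2 x + w1 x * partial_deriv j w2 x)"
proof -
  have "partial_deriv j k2 x = 2 * partial_deriv j (\<lambda>x. w1 x * w2 x) x"
    unfolding k2_def mult.assoc by (simp add: partial_deriv_cmult smooth_mult smooth_w)
  then show ?thesis by (simp add: partial_deriv_mult smooth_fun_differentiable smooth_w)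
qed

definition Jw :: "real^2 \<Rightarrow> real" where
  "Jw x = partial_deriv 1 w1 x * partial_deriv 2 w2 x - partial_deriv 2 w1 x * partial_deriv 1 w2 x"

lemma Jw_eq: "Jw x = (bump x)\<^sup>2 - 2 * (norm x)\<^sup>2 * bump x * bump' x"
  unfolding Jw_def partial_w1 partial_w2 norm_sq_2 axis_nth_2 by (simp add: power2_eq_square algebra_simps)

lemma w_norm: "(w1 x)\<^sup>2 + (w2 x)\<^sup>2 = (norm x)\<^sup>2 * (bump x)\<^sup>2"
  unfolding w1_def w2_def norm_sq_2 by (simp add: power_mult_distrib distrib_right)

lemma k_norm: "(k1 x)\<^sup>2 + (k2 x)\<^sup>2 = ((w1 x)\<^sup>2 + (w2 x)\<^sup>2)\<^sup>2"
  unfolding k1_def k2_def by (simp add: power2_eq_square algebra_simps)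

text \<open>Complex squaring is holomorphic with derivative 2 z, hence has Jacobian 4 times the
  squared modulus; the rest is the chain rule.\<close>

lemma Jk_eq: "partial_deriv 1 k1 x * partial_deriv 2 k2 x - partial_deriv 2 k1 x * partial_deriv 1 k2 x
    = 4 * ((w1 x)\<^sup>2 + (w2 x)\<^sup>2) * Jw x"
  unfolding partial_k1 partial_k2 Jw_def by (simp add: power2_eq_square algebra_simps)

text \<open>The Jacobian of \<open>w + C * cnj (w\<^sup>2)\<close> is radial because this is the radial stretching \<open>w\<close> followed by a
  harmonic map, whose Jacobian \<open>1 - 4 C\<^sup>2 \<bar>w\<bar>\<^sup>2\<close> is radial.\<close>

definition datum :: "real \<Rightarrow> real^2 \<Rightarrow> real" where
  "datum C x = Jw x * (1 - 4 * C\<^sup>2 * ((w1 x)\<^sup>2 + (w2 x)\<^sup>2))"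

definition competitor :: "real \<Rightarrow> real^2 \<Rightarrow> real^2" where
  "competitor C x = (w1 x + C * k1 x) *\<^sub>R axis 1 1 + (w2 x - C * k2 x) *\<^sub>R axis 2 1"

definition competitor_grad :: "real \<Rightarrow> real^2 \<Rightarrow> real^2^2" where
  "competitor_grad C x =
     (partial_deriv 1 w1 x + C * partial_deriv 1 k1 x) *\<^sub>R axis 1 (axis 1 1)
   + (partial_deriv 2 w1 x + C * partial_deriv 2 k1 x) *\<^sub>R axis 1 (axis 2 1)
   + ((partial_deriv 1 w2 x - C * partial_deriv 1 k2 x) *\<^sub>R axis 2 (axis 1 1)
   + (partial_deriv 2 w2 x - C * partial_deriv 2 k2 x) *\<^sub>R axis 2 (axis 2 1))"

lemma competitor_nth: "competitor C x $ 1 = w1 x + C * k1 x" "competitor C x $ 2 = w2 x - C * k2 x"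
  by (auto simp: competitor_def axis_def)

lemma competitor_grad_nth:
  "competitor_grad C x $ 1 $ j = partial_deriv j w1 x + C * partial_deriv j k1 x"
  "competitor_grad C x $ 2 $ j = partial_deriv j w2 x - C * partial_deriv j k2 x"
  using exhaust_2[of j] by (auto simp: competitor_grad_def axis_def)

text \<open>For the map z + C cnj(z^2) the two Wirtinger derivatives are 1 and 2 C cnj z, so its
  Jacobian is the difference of their squared moduli, 1 - 4 C^2 \<open>\<bar>z\<bar>\<close>^2.
  Composition with the stretching multiplies by \<open>Jw\<close>.\<close>

lemma det_competitor: "det (competitor_grad C x) = datum C x"
  unfolding det_matrix_2 competitor_grad_nth partial_k1 partial_k2 datum_def Jw_def
  by (simp add: power2_eq_square algebra_simps)

lemma datum_radial: "radially_symmetric (datum C)"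
  unfolding radially_symmetric_def
proof (intro allI impI)
  fix x y :: "real^2" assume n: "norm x = norm y"
  have "bump x = bump y" "bump' x = bump' y"
    using arg_cong[OF n, of "\<lambda>t. t\<^sup>2"] unfolding bump_def bump'_def rbump_def norm_sq_2 by auto
  then show "datum C x = datum C y" unfolding datum_def Jw_eq w_norm n by simp
qed

lemma smooth_Jw: "smooth_fun Jw"
  unfolding Jw_def by (intro smooth_mult smooth_diff smooth_fun_partial smooth_w)

lemma test_function_Jw: "test_function Jw"
  unfolding Jw_def by (intro test_function_diff smooth_mult_test_function smooth_fun_partial smooth_w test_function_partial test_function_w)

lemma test_function_datum: "test_function (datum C)"
  unfolding datum_def
  by (intro test_function_mult[OF test_function_Jw] smooth_diff smooth_const smooth_mult smooth_add smooth_power smooth_w)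

lemma locL2_smooth: "smooth_fun f \<Longrightarrow> locL2 f"
  by (intro locL2_continuous smooth_continuous)

lemma Jw_rbump: "(\<integral>x. Jw x * rbump 1 R x \<partial>lborel) = (\<integral>x. rbump (flat_deriv 1) R x * ((w1 x)\<^sup>2 + (w2 x)\<^sup>2) \<partial>lborel)"
proof -
  have "(\<integral>x. Jw x * rbump 1 R x \<partial>lborel) = 1 * (\<integral>x. rbump (flat_deriv 1) R x * ((w1 x - 0)\<^sup>2 + (w2 x - 0)\<^sup>2) \<partial>lborel)"
    unfolding Jw_def
  proof (rule jacobian_rotational)
    show "AE x in lborel. x $ 1 * partial_deriv 2 w1 x - x $ 2 * partial_deriv 1 w1 x = - 1 * (w2 x - 0)"
      unfolding partial_w1 axis_nth_2 w2_def by (simp add: algebra_simps)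
    show "AE x in lborel. x $ 1 * partial_deriv 2 w2 x - x $ 2 * partial_deriv 1 w2 x = 1 * (w1 x - 0)"
      unfolding partial_w2 axis_nth_2 w1_def by (simp add: algebra_simps)
  qed (intro wpd_smooth locL2_smooth smooth_fun_partial smooth_w)+
  then show ?thesis by simp
qed

text \<open>The complex square satisfies the rotational relation with speed 2, inherited from the
  relation with speed 1 for the stretching through the product rule.\<close>

lemma Jk_rbump: "(\<integral>x. (4 * ((w1 x)\<^sup>2 + (w2 x)\<^sup>2) * Jw x) * rbump 1 R x \<partial>lborel)
   = 2 * (\<integral>x. rbump (flat_deriv 1) R x * ((w1 x)\<^sup>2 + (w2 x)\<^sup>2)\<^sup>2 \<partial>lborel)"
proof -
  have rw: "x $ 1 * partial_deriv 2 w1 x - x $ 2 * partial_deriv 1 w1 x = - w2 x"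
    "x $ 1 * partial_deriv 2 w2 x - x $ 2 * partial_deriv 1 w2 x = w1 x" for x
    unfolding partial_w1 partial_w2 axis_nth_2 w1_def w2_def by (simp_all add: algebra_simps)
  have "(\<integral>x. (partial_deriv 1 k1 x * partial_deriv 2 k2 x - partial_deriv 2 k1 x * partial_deriv 1 k2 x) * rbump 1 R x \<partial>lborel)
    = 2 * (\<integral>x. rbump (flat_deriv 1) R x * ((k1 x - 0)\<^sup>2 + (k2 x - 0)\<^sup>2) \<partial>lborel)"
  proof (rule jacobian_rotational)
    have "x $ 1 * partial_deriv 2 k1 x - x $ 2 * partial_deriv 1 k1 x = - 2 * (k2 x - 0)" for x
    proof -
      have "x $ 1 * partial_deriv 2 k1 x - x $ 2 * partial_deriv 1 k1 x
        = 2 * w1 x * (x $ 1 * partial_deriv 2 w1 x - x $ 2 * partial_deriv 1 w1 x)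
        - 2 * w2 x * (x $ 1 * partial_deriv 2 w2 x - x $ 2 * partial_deriv 1 w2 x)"
        unfolding partial_k1 by (simp add: algebra_simps)
      then show ?thesis unfolding rw by (simp add: k2_def)
    qed
    then show "AE x in lborel. x $ 1 * partial_deriv 2 k1 x - x $ 2 * partial_deriv 1 k1 x = - 2 * (k2 x - 0)" by simp
    have "x $ 1 * partial_deriv 2 k2 x - x $ 2 * partial_deriv 1 k2 x = 2 * (k1 x - 0)" for x
    proof -
      have "x $ 1 * partial_deriv 2 k2 x - x $ 2 * partial_deriv 1 k2 x
        = 2 * w2 x * (x $ 1 * partial_deriv 2 w1 x - x $ 2 * partial_deriv 1 w1 x)
        + 2 * w1 x * (x $ 1 * partial_deriv 2 w2 x - x $ 2 * partial_deriv 1 w2 x)"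
        unfolding partial_k2 by (simp add: algebra_simps)
      then show ?thesis unfolding rw by (simp add: k1_def power2_eq_square)
    qed
    then show "AE x in lborel. x $ 1 * partial_deriv 2 k2 x - x $ 2 * partial_deriv 1 k2 x = 2 * (k1 x - 0)" by simp
  qed (intro wpd_smooth locL2_smooth smooth_fun_partial smooth_k)+
  then show ?thesis unfolding Jk_eq by (simp add: k_norm)
qed

lemma integrable_rbump_smooth: "smooth_fun g \<Longrightarrow> integrable lborel (\<lambda>x. rbump q R x * g x)"
  by (intro integrable_test test_function_mult test_function_rbump)

lemma smooth_w_norm: "smooth_fun (\<lambda>x. (w1 x)\<^sup>2 + (w2 x)\<^sup>2)" "smooth_fun (\<lambda>x. ((w1 x)\<^sup>2 + (w2 x)\<^sup>2)\<^sup>2)"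
  by (intro smooth_power smooth_add smooth_w)+

text \<open>The datum is \<open>Jw\<close> minus C^2 times the Jacobian of the complex square,
  because conjugation reverses orientation. The speeds 1 and 2 then give two positive quantities
  with opposite signs and different orders in \<open>\<bar>w\<bar>\<close>, which is what makes both
  signs attainable.\<close>

lemma datum_rbump: "(\<integral>x. datum C x * rbump 1 R x \<partial>lborel)
  = (\<integral>x. rbump (flat_deriv 1) R x * ((w1 x)\<^sup>2 + (w2 x)\<^sup>2) \<partial>lborel)
    - 2 * C\<^sup>2 * (\<integral>x. rbump (flat_deriv 1) R x * ((w1 x)\<^sup>2 + (w2 x)\<^sup>2)\<^sup>2 \<partial>lborel)"
proof -
  have i: "integrable lborel (\<lambda>x. Jw x * rbump 1 R x)"
    "integrable lborel (\<lambda>x. (4 * ((w1 x)\<^sup>2 + (w2 x)\<^sup>2) * Jw x) * rbump 1 R x)"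
    by (intro integrable_test smooth_mult_test_function test_function_rbump smooth_mult smooth_const smooth_Jw smooth_w_norm)+
  have "(\<integral>x. datum C x * rbump 1 R x \<partial>lborel) = (\<integral>x. Jw x * rbump 1 R x - C\<^sup>2 * ((4 * ((w1 x)\<^sup>2 + (w2 x)\<^sup>2) * Jw x) * rbump 1 R x) \<partial>lborel)"
    unfolding datum_def by (intro Bochner_Integration.integral_cong) (auto simp: algebra_simps)
  also have "\<dots> = (\<integral>x. Jw x * rbump 1 R x \<partial>lborel) - C\<^sup>2 * (\<integral>x. (4 * ((w1 x)\<^sup>2 + (w2 x)\<^sup>2) * Jw x) * rbump 1 R x \<partial>lborel)"
    using i by simp
  finally show ?thesis unfolding Jw_rbump Jk_rbump by simp
qed

lemma w_norm_pos: "0 < norm x \<Longrightarrow> norm x < 1 \<Longrightarrow> 0 < (w1 x)\<^sup>2 + (w2 x)\<^sup>2"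
proof -
  assume x: "0 < norm x" "norm x < 1"
  then have "(norm x)\<^sup>2 < 1" by (simp add: power_less_one_iff)
  then have "bump x > 0" unfolding bump_def rbump_def norm_sq_2[symmetric] by (simp add: flat_one)
  then show ?thesis unfolding w_norm using x by simp
qed

lemma rbump_deriv_w_pos:
  assumes R: "0 < R" "R \<le> 1" and n: "n \<in> {1, 2::nat}"
  shows "0 < (\<integral>x. rbump (flat_deriv 1) R x * ((w1 x)\<^sup>2 + (w2 x)\<^sup>2) ^ n \<partial>lborel)"
\<comment> \<open>This ball lies inside the disc of squared radius R and has the origin on its
  boundary sphere, so the stretching vanishes nowhere on it.\<close>
proof (rule integral_pos_ball[where c="(sqrt R / 2) *\<^sub>R axis 1 1" and r="sqrt R / 2"])
  show "integrable lborel (\<lambda>x. rbump (flat_deriv 1) R x * ((w1 x)\<^sup>2 + (w2 x)\<^sup>2) ^ n)"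
    by (intro integrable_rbump_smooth smooth_power smooth_w_norm)
  show "0 < rbump (flat_deriv 1) R x * ((w1 x)\<^sup>2 + (w2 x)\<^sup>2) ^ n" if "x \<in> ball ((sqrt R / 2) *\<^sub>R axis 1 1) (sqrt R / 2)" for x
  proof -
    define c where "c = ((sqrt R / 2) *\<^sub>R axis 1 1 :: real^2)"
    have nc: "norm c = sqrt R / 2" unfolding c_def using R by simp
    have d: "norm (c - x) < sqrt R / 2" using that unfolding c_def[symmetric] by (simp add: dist_norm)
    then have "x \<noteq> 0" using nc by auto
    have "norm x < sqrt R" using norm_triangle_ineq4[of c "c - x"] d nc by simp
    moreover have "sqrt R \<le> 1" using R by simp
    ultimately have "0 < (w1 x)\<^sup>2 + (w2 x)\<^sup>2" using w_norm_pos[of x] \<open>x \<noteq> 0\<close> by (metis order_less_le_trans zero_less_norm_iff)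
    moreover have "(norm x)\<^sup>2 < R" using \<open>norm x < sqrt R\<close> R power_strict_mono[of "norm x" "sqrt R" 2] by simp
    ultimately show ?thesis
      unfolding rbump_def norm_sq_2[symmetric] flat_deriv_one by simp
  qed
qed (use R in \<open>auto intro!: mult_nonneg_nonneg rbump_deriv_nonneg\<close>)

text \<open>On the unit disc the constant C is tuned to let the quartic term win. On small discs the
  quadratic term wins whatever C is, since the squared modulus of the stretching is at most R
  there.\<close>

lemma datum_sign_change:
  obtains C R where "0 < (\<integral>x. datum C x * rbump 1 R x \<partial>lborel)" "(\<integral>x. datum C x * rbump 1 1 x \<partial>lborel) < 0"
proof -
  define X where "X R = (\<integral>x. rbump (flat_deriv 1) R x * ((w1 x)\<^sup>2 + (w2 x)\<^sup>2) \<partial>lborel)" for R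
  define Y where "Y R = (\<integral>x. rbump (flat_deriv 1) R x * ((w1 x)\<^sup>2 + (w2 x)\<^sup>2)\<^sup>2 \<partial>lborel)" for R
  have X: "X R > 0" and Y: "Y R > 0" if "0 < R" "R \<le> 1" for R
    using rbump_deriv_w_pos[OF that, of 1] rbump_deriv_w_pos[OF that, of 2] unfolding X_def Y_def by auto
  \<comment> \<open>With this choice the subtracted term at radius 1 is exactly twice the first
    one.\<close>
  define C where "C = sqrt (X 1 / Y 1)"
  have C: "C\<^sup>2 = X 1 / Y 1" "C\<^sup>2 > 0" unfolding C_def using X[of 1] Y[of 1] by auto
  \<comment> \<open>The quartic integral is at most R times the quadratic one, so R \<le> 1 / (4
    C^2) reduces the subtracted term to at most half of the first.\<close>
  define R where "R = min 1 (1 / (4 * C\<^sup>2))"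
  have R: "0 < R" "R \<le> 1" "4 * C\<^sup>2 * R \<le> 1"
    unfolding R_def using C(2) by (auto simp: min_def field_simps)
  have "Y R \<le> R * X R"
  proof -
    have "rbump (flat_deriv 1) R x * ((w1 x)\<^sup>2 + (w2 x)\<^sup>2)\<^sup>2 \<le> R * (rbump (flat_deriv 1) R x * ((w1 x)\<^sup>2 + (w2 x)\<^sup>2))" for x
    proof (cases "(norm x)\<^sup>2 < R")
      case True
      have "0 \<le> bump x" "bump x \<le> 1" unfolding bump_def rbump_def by (auto simp: flat_one_bounds)
      then have "(norm x)\<^sup>2 * (bump x)\<^sup>2 \<le> (norm x)\<^sup>2 * 1" by (intro mult_left_mono) (auto simp: power_le_one)
      then have w: "(w1 x)\<^sup>2 + (w2 x)\<^sup>2 \<le> R" unfolding w_norm using True by simp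
      define W where "W = (w1 x)\<^sup>2 + (w2 x)\<^sup>2"
      have "W * (rbump (flat_deriv 1) R x * W) \<le> R * (rbump (flat_deriv 1) R x * W)"
        using w rbump_deriv_nonneg[of R x] unfolding W_def by (intro mult_right_mono) auto
      then show ?thesis unfolding W_def[symmetric] by (simp add: power2_eq_square mult_ac)
    next
      case False
      then have "rbump (flat_deriv 1) R x = 0" unfolding rbump_def norm_sq_2[symmetric] by (simp add: flat_deriv_one)
      then show ?thesis by simp
    qed
    then have "Y R \<le> (\<integral>x. R * (rbump (flat_deriv 1) R x * ((w1 x)\<^sup>2 + (w2 x)\<^sup>2)) \<partial>lborel)"
      unfolding Y_def by (intro integral_mono Bochner_Integration.integrable_mult_right integrable_rbump_smooth smooth_w_norm)
    then show ?thesis unfolding X_def by simp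
  qed
  then have "4 * C\<^sup>2 * Y R \<le> 4 * C\<^sup>2 * R * X R" using C(2) by simp
  also have "\<dots> \<le> 1 * X R" using R X[of R] by (intro mult_right_mono) auto
  finally have "2 * C\<^sup>2 * Y R < X R" using X[of R] R by linarith
  then have "0 < (\<integral>x. datum C x * rbump 1 R x \<partial>lborel)" unfolding datum_rbump X_def Y_def by simp
  moreover have "2 * C\<^sup>2 * Y 1 = 2 * X 1" using C(1) Y[of 1] by simp
  then have "(\<integral>x. datum C x * rbump 1 1 x \<partial>lborel) < 0"
    using X[of 1] unfolding datum_rbump X_def Y_def by simp
  ultimately show thesis using that by blast
qed

lemma sob_competitor: "sob (competitor C) (competitor_grad C)"
  unfolding sob_def
proof (intro conjI allI)
  have sm: "smooth_fun (\<lambda>x. competitor C x $ i)" for i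
    using exhaust_2[of i] by (auto simp: competitor_nth intro!: smooth_add smooth_diff smooth_mult smooth_const smooth_w smooth_k)
  have pd: "competitor_grad C x $ i $ j = partial_deriv j (\<lambda>x. competitor C x $ i) x" for x i j
  proof -
    have "partial_deriv j (\<lambda>x. w1 x + C * k1 x) x = partial_deriv j w1 x + C * partial_deriv j k1 x"
      by (subst partial_deriv_add)
        (auto simp: partial_deriv_cmult smooth_k intro!: smooth_fun_differentiable smooth_mult smooth_const smooth_k smooth_w)
    moreover have "partial_deriv j (\<lambda>x. w2 x - C * k2 x) x = partial_deriv j w2 x - C * partial_deriv j k2 x"
      by (subst partial_deriv_diff)
        (auto simp: partial_deriv_cmult smooth_k intro!: smooth_mult smooth_const smooth_k smooth_w)
    ultimately show ?thesis using exhaust_2[of i] by (auto simp: competitor_nth competitor_grad_nth)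
  qed
  show "wpd j (\<lambda>x. competitor C x $ i) (\<lambda>x. competitor_grad C x $ i $ j)" for i j
    unfolding pd by (rule wpd_smooth[OF sm])
  show "locL2 (\<lambda>x. competitor_grad C x $ i $ j)" for i j
    unfolding pd by (intro locL2_smooth smooth_fun_partial sm)
  have [measurable]: "g \<in> borel_measurable borel" if "smooth_fun g" for g
    using that smooth_continuous by (intro borel_measurable_continuous_onI)
  show "competitor C \<in> borel_measurable borel"
    unfolding competitor_def[abs_def] using smooth_w smooth_k by measurable
  show "competitor_grad C \<in> borel_measurable borel"
    unfolding competitor_grad_def[abs_def] using smooth_w smooth_k smooth_fun_partial by measurable
qed

lemma bounded_support_finite:
  assumes "\<And>x. \<bar>g x\<bar> \<le> M" "\<And>x. R < norm x \<Longrightarrow> g x = 0" "0 < q"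
  shows "(\<integral>\<^sup>+x. ennreal (\<bar>g (x :: real^2) :: real\<bar> powr q) \<partial>lborel) < \<infinity>"
proof -
  have "(\<integral>\<^sup>+x. ennreal (\<bar>g x\<bar> powr q) \<partial>lborel) \<le> (\<integral>\<^sup>+x. ennreal (M powr q) * indicator (cball (0::real^2) R) x \<partial>lborel)"
  proof (intro nn_integral_mono)
    fix x show "ennreal (\<bar>g x\<bar> powr q) \<le> ennreal (M powr q) * indicator (cball (0::real^2) R) x"
      using assms(1)[of x] assms(2)[of x] assms(3)
      by (cases "norm x \<le> R") (auto intro!: ennreal_leI powr_mono2)
  qed
  also have "\<dots> = ennreal (M powr q) * emeasure lborel (cball (0::real^2) R)" by (rule nn_integral_cmult_indicator) simp
  also have "\<dots> < \<infinity>"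
    using emeasure_bounded_finite[OF bounded_cball, of "0::real^2" R] by (simp add: ennreal_mult_less_top)
  finally show ?thesis .
qed

lemma competitor_energy:
  assumes p: "p \<ge> 1" shows "energy (2 * p) (competitor_grad C) < \<infinity>"
proof -
  define N where "N x = \<bar>competitor_grad C x $ 1 $ 1\<bar> + \<bar>competitor_grad C x $ 1 $ 2\<bar> + (\<bar>competitor_grad C x $ 2 $ 1\<bar> + \<bar>competitor_grad C x $ 2 $ 2\<bar>)" for x
  have t: "test_function (\<lambda>x. competitor_grad C x $ i $ j)" for i j
    using exhaust_2[of i]
    by (auto simp: competitor_grad_nth
        intro!: test_function_add test_function_diff smooth_mult_test_function smooth_const test_function_partial test_function_w test_function_k)
  have "\<exists>M R. \<forall>x. \<bar>competitor_grad C x $ i $ j\<bar> \<le> M \<and> (R < norm x \<longrightarrow> competitor_grad C x $ i $ j = 0)" for i j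
  proof -
    obtain M where M: "\<And>x. \<bar>competitor_grad C x $ i $ j\<bar> \<le> M" by (rule test_function_bounded[OF t[of i j]]) blast
    obtain R where R: "\<And>x. R < norm x \<Longrightarrow> competitor_grad C x $ i $ j = 0" by (rule test_function_support[OF t[of i j]]) blast
    show ?thesis using M R by blast
  qed
  then have "\<forall>z. \<exists>M R. \<forall>x. \<bar>competitor_grad C x $ fst z $ snd z\<bar> \<le> M \<and> (R < norm x \<longrightarrow> competitor_grad C x $ fst z $ snd z = 0)" by blast
  from choice[OF this] obtain M where "\<forall>z. \<exists>R. \<forall>x. \<bar>competitor_grad C x $ fst z $ snd z\<bar> \<le> M z \<and> (R < norm x \<longrightarrow> competitor_grad C x $ fst z $ snd z = 0)" by blast
  from choice[OF this] obtain R where MR: "\<And>z x. \<bar>competitor_grad C x $ fst z $ snd z\<bar> \<le> M z"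
    "\<And>z x. R z < norm x \<Longrightarrow> competitor_grad C x $ fst z $ snd z = 0" by blast
  have "energy (2 * p) (competitor_grad C) \<le> (\<integral>\<^sup>+x. ennreal (\<bar>N x\<bar> powr (2 * p)) \<partial>lborel)"
    unfolding energy_lborel N_def using p norm_matrix_le[of "competitor_grad C _"]
    by (intro nn_integral_mono ennreal_leI powr_mono2) auto
  also have "\<dots> < \<infinity>"
  proof (rule bounded_support_finite)
    show "\<bar>N x\<bar> \<le> M (1, 1) + M (1, 2) + (M (2, 1) + M (2, 2))" for x
      using MR(1)[of x "(1, 1)"] MR(1)[of x "(1, 2)"] MR(1)[of x "(2, 1)"] MR(1)[of x "(2, 2)"] unfolding N_def by simp
    show "N x = 0" if "max (max (R (1, 1)) (R (1, 2))) (max (R (2, 1)) (R (2, 2))) < norm x" for x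
      using that MR(2)[of "(1, 1)" x] MR(2)[of "(1, 2)" x] MR(2)[of "(2, 1)" x] MR(2)[of "(2, 2)" x] unfolding N_def by simp
  qed (use p in auto)
  finally show ?thesis .
qed

lemma competitor_admissible: "p \<ge> 1 \<Longrightarrow> admissible p (datum C) (competitor C) (competitor_grad C)"
  by (rule sob_admissible[OF sob_competitor competitor_energy]) (simp_all add: det_competitor)

text \<open>As the support grows, the cutoff tends to 1 while the radial weight in its gradient
  decays like the inverse square of the parameter; together they compute the integral of the
  datum.\<close>

lemma rbump_tendsto_1: "(\<lambda>n. rbump 1 (real n) x) \<longlonglongrightarrow> 1" and rbump_deriv_tendsto_0: "(\<lambda>n. rbump (flat_deriv 1) (real n) x) \<longlonglongrightarrow> 0"
proof -
  define c where "c = (x $ 1)\<^sup>2 + (x $ 2)\<^sup>2"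
  have "filterlim (\<lambda>n. - c + real n) at_top sequentially"
    by (intro filterlim_tendsto_add_at_top[OF tendsto_const filterlim_real_sequentially])
  then have f: "filterlim (\<lambda>n. real n - c) at_top sequentially" by (simp add: add.commute)
  then have i: "(\<lambda>n. 1 / (real n - c)) \<longlonglongrightarrow> 0"
    using tendsto_inverse_0_at_top by (auto simp: divide_inverse)
  have ev: "eventually (\<lambda>n. real n - c > 0) sequentially" using f[unfolded filterlim_at_top_dense, rule_format, of 0] .
  have "(\<lambda>n. exp (- (1 / (real n - c)))) \<longlonglongrightarrow> exp (- 0)" by (intro tendsto_intros i)
  then have e: "(\<lambda>n. exp (- (1 / (real n - c)))) \<longlonglongrightarrow> 1" by simp
  show "(\<lambda>n. rbump 1 (real n) x) \<longlonglongrightarrow> 1"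
    by (rule Lim_transform_eventually[OF e]) (use ev in \<open>eventually_elim, simp add: rbump_def c_def[symmetric] flat_one\<close>)
  have "(\<lambda>n. (1 / (real n - c))\<^sup>2 * exp (- (1 / (real n - c)))) \<longlonglongrightarrow> 0\<^sup>2 * 1" by (intro tendsto_intros i e)
  then have "(\<lambda>n. (1 / (real n - c))\<^sup>2 * exp (- (1 / (real n - c)))) \<longlonglongrightarrow> 0" by simp
  then show "(\<lambda>n. rbump (flat_deriv 1) (real n) x) \<longlonglongrightarrow> 0"
    by (rule Lim_transform_eventually) (use ev in \<open>eventually_elim, simp add: rbump_def c_def[symmetric] flat_deriv_one\<close>)
qed

lemma rbump_deriv_integral_tendsto_0:
  assumes g: "test_function g" "\<And>x. 1 < norm x \<Longrightarrow> g x = 0"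
  shows "(\<lambda>n. \<integral>x. rbump (flat_deriv 1) (real (n + 2)) x * g x \<partial>lborel) \<longlonglongrightarrow> 0"
proof -
  have [measurable]: "g \<in> borel_measurable borel" "rbump (flat_deriv 1) R \<in> borel_measurable borel" for R
    using g test_function_rbump by measurable
  have "(\<lambda>n. \<integral>x. rbump (flat_deriv 1) (real (n + 2)) x * g x \<partial>lborel) \<longlonglongrightarrow> (\<integral>x. 0 * g x \<partial>lborel)"
  proof (rule integral_dominated_convergence)
    show "integrable lborel (\<lambda>x. \<bar>g x\<bar>)" using integrable_test[OF g(1)] by simp
    show "AE x in lborel. (\<lambda>n. rbump (flat_deriv 1) (real (n + 2)) x * g x) \<longlonglongrightarrow> 0 * g x"
      by (intro AE_I2 tendsto_mult tendsto_const LIMSEQ_ignore_initial_segment[OF rbump_deriv_tendsto_0, where k=2])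
    show "AE x in lborel. norm (rbump (flat_deriv 1) (real (n + 2)) x * g x) \<le> \<bar>g x\<bar>" for n
    proof (rule AE_I2)
      fix x
      show "norm (rbump (flat_deriv 1) (real (n + 2)) x * g x) \<le> \<bar>g x\<bar>"
      proof (cases "norm x \<le> 1")
        case True
        then have "(norm x)\<^sup>2 \<le> 1" by (simp add: power_le_one)
        \<comment> \<open>The shift by 2 keeps this quantity at least 1 on the unit disc, so the
          weight is bounded by 1 and dominated convergence applies.\<close>
        then have y: "real (n + 2) - (norm x)\<^sup>2 \<ge> 1" by simp
        define y where "y = real (n + 2) - (norm x)\<^sup>2"
        have "(1 / y)\<^sup>2 \<le> 1" "exp (- (1 / y)) \<le> 1" using y unfolding y_def[symmetric] by (auto simp: power_le_one)
        then have "(1 / y)\<^sup>2 * exp (- (1 / y)) \<le> 1" by (intro mult_le_one) auto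
        then have "rbump (flat_deriv 1) (real (n + 2)) x \<le> 1"
          using y unfolding rbump_def norm_sq_2[symmetric] y_def[symmetric] flat_deriv_one by simp
        then show ?thesis using rbump_deriv_nonneg[of "real (n + 2)" x]
          by (simp add: abs_mult mult_left_le_one_le del: of_nat_add)
      qed (use g in auto)
    qed
  qed measurable
  then show ?thesis by simp
qed

lemma w_support: "1 < norm x \<Longrightarrow> w1 x = 0" "1 < norm x \<Longrightarrow> w2 x = 0"
  by (auto simp: w1_def w2_def bump_def rbump_support[of 1 1])

text \<open>The cancellation needed for the Hardy space at p = 1. The cutoff integrals of the datum
  converge to its full integral, and by \<open>datum_rbump\<close> they are expressed through
  weights that tend to zero on the support of the stretching.\<close>

lemma integral_datum: "(\<integral>x. datum C x \<partial>lborel) = 0"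
proof -
  have t: "test_function (\<lambda>x. (w1 x)\<^sup>2 + (w2 x)\<^sup>2)" "test_function (\<lambda>x. ((w1 x)\<^sup>2 + (w2 x)\<^sup>2)\<^sup>2)"
    by (rule test_functionI[of _ 1], intro smooth_w_norm, simp add: w_support)+
  have d: "(\<lambda>n. datum C x * rbump 1 (real n) x) \<longlonglongrightarrow> datum C x * 1" for x
    by (intro tendsto_intros rbump_tendsto_1)
  have [measurable]: "datum C \<in> borel_measurable borel" "rbump 1 R \<in> borel_measurable borel" for R
    using test_function_datum test_function_rbump by measurable
  have "(\<lambda>n. \<integral>x. datum C x * rbump 1 (real (n + 2)) x \<partial>lborel) \<longlonglongrightarrow> (\<integral>x. datum C x \<partial>lborel)"
  proof (rule integral_dominated_convergence)
    show "integrable lborel (\<lambda>x. \<bar>datum C x\<bar>)" using integrable_test[OF test_function_datum] by simp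
    show "AE x in lborel. (\<lambda>n. datum C x * rbump 1 (real (n + 2)) x) \<longlonglongrightarrow> datum C x"
      using LIMSEQ_ignore_initial_segment[OF d, where k=2] by (intro AE_I2) (simp only: mult_1_right)
    show "AE x in lborel. norm (datum C x * rbump 1 (real (n + 2)) x) \<le> \<bar>datum C x\<bar>" for n
      by (intro AE_I2) (simp add: abs_mult rbump_def flat_one_bounds mult_left_le)
  qed measurable
  moreover have "(\<lambda>n. \<integral>x. datum C x * rbump 1 (real (n + 2)) x \<partial>lborel) \<longlonglongrightarrow> 0 - 2 * C\<^sup>2 * 0"
    unfolding datum_rbump
    by (intro tendsto_intros rbump_deriv_integral_tendsto_0 t) (simp_all add: w_support)
  ultimately show ?thesis using LIMSEQ_unique by fastforce
qed

section \<open>Test functions in the Hardy space\<close>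

lemma test_function_iterated: "test_function f \<Longrightarrow> test_function (iterated_partial js f)"
  by (induction js) (auto simp: iterated_partial_def intro: test_function_partial)

lemma test_function_schwartz: assumes "test_function f" shows "schwartz_function f"
  unfolding schwartz_function_def
proof (intro conjI allI)
  show "smooth_fun f" by (rule test_function_smooth[OF assms])
  fix k js
  note t = test_function_iterated[OF assms, of js]
  obtain R where R: "R > 0" "\<And>x. R < norm x \<Longrightarrow> iterated_partial js f x = 0" by (rule test_function_support[OF t]) blast
  obtain B where B: "B > 0" "\<And>x. \<bar>iterated_partial js f x\<bar> \<le> B" by (rule test_function_bounded[OF t]) blast
  have "norm x ^ k * \<bar>iterated_partial js f x\<bar> \<le> R ^ k * B" for x
  proof (cases "norm x \<le> R")
    case True
    then show ?thesis using B R(1) by (intro mult_mono power_mono) auto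
  qed (use R B in auto)
  then show "\<exists>C. \<forall>x. norm x ^ k * \<bar>iterated_partial js f x\<bar> \<le> C" by blast
qed

text \<open>Two points are joined by two axis-parallel segments, each controlled by a bound on a
  partial derivative; hence the factor 2.\<close>

lemma test_function_lipschitz:
  assumes t: "test_function \<phi>"
  obtains L where "L > 0" "\<And>x y. \<bar>\<phi> x - \<phi> y\<bar> \<le> L * norm (x - y)"
proof -
  obtain B1 where B1: "B1 > 0" "\<And>x. \<bar>partial_deriv 1 \<phi> x\<bar> \<le> B1"
    by (rule test_function_bounded[OF test_function_partial[OF t, of 1]]) blast
  obtain B2 where B2: "B2 > 0" "\<And>x. \<bar>partial_deriv 2 \<phi> x\<bar> \<le> B2"
    by (rule test_function_bounded[OF test_function_partial[OF t, of 2]]) blast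
  define B where "B = B1 + B2"
  have B: "B > 0" "\<bar>partial_deriv j \<phi> x\<bar> \<le> B" for j x
    using exhaust_2[of j] B1(1) B2(1) B1(2)[of x] B2(2)[of x] unfolding B_def by auto
  have step: "\<bar>\<phi> (x + c *\<^sub>R axis j 1) - \<phi> x\<bar> \<le> B * \<bar>c\<bar>" for x c j
  proof -
    have c: "continuous_on {0..1} (\<lambda>t. c * partial_deriv j \<phi> (x + (t * c) *\<^sub>R axis j 1))"
      by (intro continuous_intros continuous_on_compose2[OF test_function_continuous[OF test_function_partial[OF t], of UNIV]]) auto
    have "\<bar>\<phi> (x + c *\<^sub>R axis j 1) - \<phi> x\<bar> \<le> (\<integral>s. \<bar>indicator {0..1} s * (c * partial_deriv j \<phi> (x + (s * c) *\<^sub>R axis j 1))\<bar> \<partial>lborel)"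
      unfolding test_function_difference[OF t, of x c j] real_norm_def[symmetric] by (rule integral_norm_bound)
    also have "\<dots> \<le> (\<integral>s. indicator {0..1::real} s * (B * \<bar>c\<bar>) \<partial>lborel)"
    proof (intro integral_mono)
      show "integrable lborel (\<lambda>s. \<bar>indicator {0..1} s * (c * partial_deriv j \<phi> (x + (s * c) *\<^sub>R axis j 1))\<bar>)"
        using borel_integrable_atLeastAtMost'[OF c] unfolding set_integrable_def by simp
      show "integrable lborel (\<lambda>s. indicator {0..1::real} s * (B * \<bar>c\<bar>))"
        by (intro Bochner_Integration.integrable_mult_left integrable_real_indicator) auto
      show "\<bar>indicator {0..1} s * (c * partial_deriv j \<phi> (x + (s * c) *\<^sub>R axis j 1))\<bar> \<le> indicator {0..1} s * (B * \<bar>c\<bar>)" for s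
        using mult_right_mono[OF B(2)[of j "x + (s * c) *\<^sub>R axis j 1"], of "\<bar>c\<bar>"]
        by (auto simp: indicator_def abs_mult mult.commute)
    qed
    also have "\<dots> = B * \<bar>c\<bar>" by simp
    finally show ?thesis .
  qed
  have "\<bar>\<phi> x - \<phi> y\<bar> \<le> (2 * B) * norm (x - y)" for x y
  proof -
    define z where "z = x - y"
    have x: "x = (y + z $ 1 *\<^sub>R axis 1 1) + z $ 2 *\<^sub>R axis 2 1"
    proof -
      have "x = y + z" by (simp add: z_def)
      also have "\<dots> = (y + z $ 1 *\<^sub>R axis 1 1) + z $ 2 *\<^sub>R axis 2 1"
        by (subst vec2_eq_axis[of z]) (simp only: add.assoc)
      finally show ?thesis .
    qed
    have "\<bar>\<phi> x - \<phi> y\<bar> \<le> B * \<bar>z $ 2\<bar> + B * \<bar>z $ 1\<bar>"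
      using step[of "y + z $ 1 *\<^sub>R axis 1 1" "z $ 2" 2] step[of y "z $ 1" 1] unfolding x[symmetric] by linarith
    also have "\<dots> \<le> B * norm z + B * norm z"
      using B(1) component_le_norm_cart[of z] by (intro add_mono mult_left_mono) auto
    finally show ?thesis by (simp add: z_def)
  qed
  then show thesis using that[of "2 * B"] B(1) by simp
qed

lemma emeasure_cball_le: "t > 0 \<Longrightarrow> emeasure lborel (cball (x::real^2) t) \<le> ennreal (16 * t\<^sup>2)"
  using pi_less_4 by (simp add: emeasure_cball unit_ball_vol_2 ennreal_leI mult_right_mono)

lemma measure_cball_le: "t > 0 \<Longrightarrow> measure lborel (cball (x::real^2) t) \<le> 16 * t\<^sup>2"
  using emeasure_cball_le[of t x] by (simp add: measure_def enn2real_leI)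

text \<open>Dyadic annuli: the integrand is at most 8^-k on the k-th annulus, whose enclosing disc
  has area at most 64 * 4^k, so the sum is geometric with ratio 1/2.\<close>

lemma inverse_cube_integral:
  "(\<integral>\<^sup>+x. indicator {x::real^2. 1 \<le> norm x} x * ennreal (1 / norm x ^ 3) \<partial>lborel) < \<infinity>"
proof -
  have "(\<integral>\<^sup>+x. indicator {x::real^2. 1 \<le> norm x} x * ennreal (1 / norm x ^ 3) \<partial>lborel)
    \<le> (\<integral>\<^sup>+x. (\<Sum>k. ennreal ((1 / 8) ^ k) * indicator (cball (0::real^2) (2 ^ Suc k)) x) \<partial>lborel)"
  proof (intro nn_integral_mono)
    fix x :: "real^2"
    show "indicator {x. 1 \<le> norm x} x * ennreal (1 / norm x ^ 3) \<le> (\<Sum>k. ennreal ((1 / 8) ^ k) * indicator (cball (0::real^2) (2 ^ Suc k)) x)"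
    proof (cases "1 \<le> norm x")
      case True
      have "\<exists>k. norm x < 2 ^ Suc k"
      proof -
        obtain k where "norm x < 2 ^ k" using real_arch_pow[of 2 "norm x"] by auto
        then have "norm x < 2 ^ Suc k" by (rule less_le_trans) simp
        then show ?thesis by blast
      qed
      \<comment> \<open>Minimality gives the lower bound 2^k on the norm; for k = 0 it is the
        assumption that the norm is at least 1.\<close>
      define k where "k = (LEAST k. norm x < 2 ^ Suc k)"
      have k: "norm x < 2 ^ Suc k" unfolding k_def by (rule LeastI_ex) fact
      have "2 ^ k \<le> norm x"
      proof (cases k)
        case (Suc m)
        then have "\<not> norm x < 2 ^ Suc m" unfolding k_def using not_less_Least[of m "\<lambda>k. norm x < 2 ^ Suc k"] by simp
        then show ?thesis using Suc by simp
      qed (use True in simp)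
      then have "(2 ^ k) ^ 3 \<le> norm x ^ 3" by (intro power_mono) auto
      moreover have "((2::real) ^ k) ^ 3 = 8 ^ k" by (simp add: power_commutes flip: power_mult) (simp add: mult.commute[of k] power_mult)
      ultimately have "1 / norm x ^ 3 \<le> 1 / 8 ^ k" by (intro frac_le) auto
      then have "indicator {x. 1 \<le> norm x} x * ennreal (1 / norm x ^ 3) \<le> ennreal ((1 / 8) ^ k) * indicator (cball (0::real^2) (2 ^ Suc k)) x"
        using True k by (simp add: power_one_over ennreal_leI)
      also have "\<dots> \<le> (\<Sum>k. ennreal ((1 / 8) ^ k) * indicator (cball (0::real^2) (2 ^ Suc k)) x)"
      proof -
        define F where "F k = ennreal ((1 / 8) ^ k) * indicator (cball (0::real^2) (2 ^ Suc k)) x" for k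
        have "(\<Sum>j\<in>{k}. F j) \<le> (\<Sum>j. F j)" by (intro sum_le_suminf) auto
        then show ?thesis unfolding F_def[symmetric] by simp
      qed
      finally show ?thesis .
    qed simp
  qed
  also have "\<dots> = (\<Sum>k. \<integral>\<^sup>+x. ennreal ((1 / 8) ^ k) * indicator (cball (0::real^2) (2 ^ Suc k)) x \<partial>lborel)"
    by (intro nn_integral_suminf) measurable
  also have "\<dots> \<le> (\<Sum>k. ennreal (64 * (1 / 2) ^ k))"
  proof (intro suminf_le)
    fix k
    have "(\<integral>\<^sup>+x. ennreal ((1 / 8) ^ k) * indicator (cball (0::real^2) (2 ^ Suc k)) x \<partial>lborel) = ennreal ((1 / 8) ^ k) * emeasure lborel (cball (0::real^2) (2 ^ Suc k))"
      by (rule nn_integral_cmult_indicator) simp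
    also have "\<dots> \<le> ennreal ((1 / 8) ^ k) * ennreal (16 * (2 ^ Suc k)\<^sup>2)"
      by (intro mult_left_mono emeasure_cball_le) auto
    also have "\<dots> = ennreal ((1 / 8) ^ k * (16 * (2 ^ Suc k)\<^sup>2))" by (simp add: ennreal_mult'[symmetric])
    also have "(1 / 8) ^ k * (16 * (2 ^ Suc k)\<^sup>2) = 64 * ((1 / 8) ^ k * (4 ^ k) :: real)"
    proof -
      have "((2::real) ^ Suc k)\<^sup>2 = 4 * 4 ^ k" by (simp add: power_mult_distrib power2_eq_square power_mult_distrib[symmetric])
      then show ?thesis by simp
    qed
    also have "(1 / 8) ^ k * 4 ^ k = ((1 / 2) ^ k :: real)" by (simp add: power_mult_distrib[symmetric])
    finally show "(\<integral>\<^sup>+x. ennreal ((1 / 8) ^ k) * indicator (cball (0::real^2) (2 ^ Suc k)) x \<partial>lborel) \<le> ennreal (64 * (1 / 2) ^ k)" .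
  qed auto
  also have "\<dots> = ennreal (\<Sum>k. 64 * (1 / 2) ^ k)" by (intro suminf_ennreal2) (auto intro: summable_mult)
  also have "\<dots> < \<infinity>" by simp
  finally show ?thesis .
qed

lemma dilated_conv_lborel:
  assumes "test_function \<Phi>" "test_function f"
  shows "dilated_conv \<Phi> t f x = (\<integral>y. \<Phi> ((x - y) /\<^sub>R t) / t\<^sup>2 * f y \<partial>lborel)"
proof -
  have [measurable]: "\<Phi> \<in> borel_measurable borel" "f \<in> borel_measurable borel" using assms by measurable
  show ?thesis unfolding dilated_conv_def by (rule integral_completion) measurable
qed

text \<open>The maximal function is bounded everywhere, and outside a large ball it decays like the
  inverse cube of the norm. The decay comes from the zero mean: a constant value of the kernel may
  be subtracted, and the Lipschitz bound on the difference gains one power of the dilation over the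
  size t^-2 of the kernel.\<close>

lemma test_function_hardy:
  assumes f: "test_function f" and mean: "(\<integral>x. f x \<partial>lborel) = 0" and p: "p \<ge> 1"
  shows "f \<in> hardy_space p"
proof -
  have [measurable]: "f \<in> borel_measurable borel" using f by measurable
  obtain R0 where R0: "R0 > 0" "\<And>x. R0 < norm x \<Longrightarrow> f x = 0" by (rule test_function_support[OF f]) blast
  \<comment> \<open>A radius of at least 1 places the far region, where the norm exceeds 2 R, inside
    the domain of the inverse cube integral.\<close>
  define R where "R = R0 + 1"
  have R: "R \<ge> 1" "\<And>x. R < norm x \<Longrightarrow> f x = 0" using R0 unfolding R_def by auto
  obtain M where M: "M > 0" "\<And>x. \<bar>f x\<bar> \<le> M" by (rule test_function_bounded[OF f]) blast
  define \<Phi> where "\<Phi> = rbump 1 1"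
  have \<Phi>: "test_function \<Phi>" unfolding \<Phi>_def by (rule test_function_rbump)
  have [measurable]: "\<Phi> \<in> borel_measurable borel" using \<Phi> by measurable
  have \<Phi>b: "0 \<le> \<Phi> x" "\<Phi> x \<le> 1" "1 \<le> norm x \<Longrightarrow> \<Phi> x = 0" for x
    unfolding \<Phi>_def using rbump_support[of 1 1 x] by (auto simp: rbump_def flat_one_bounds)
  obtain L where L: "L > 0" "\<And>x y. \<bar>\<Phi> x - \<Phi> y\<bar> \<le> L * norm (x - y)" by (rule test_function_lipschitz[OF \<Phi>]) blast
  have \<Phi>t: "test_function (\<lambda>y. \<Phi> ((x - y) /\<^sub>R t) / t\<^sup>2 * f y)" for x t
  proof -
    have "smooth_fun (\<lambda>y. \<Phi> (inverse t *\<^sub>R (- y) + inverse t *\<^sub>R x))"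
      using smooth_affine[OF test_function_smooth[OF \<Phi>], of "\<lambda>y. inverse t *\<^sub>R (- y)" "inverse t *\<^sub>R x"]
      by (simp add: linear_iff scaleR_add_right)
    then have "smooth_fun (\<lambda>y. (1 / t\<^sup>2) * \<Phi> ((x - y) /\<^sub>R t))"
      by (intro smooth_mult smooth_const) (simp add: scaleR_diff_right)
    from smooth_mult_test_function[OF this f] show ?thesis by simp
  qed
  have ns: "norm (z /\<^sub>R t) = norm z / t" if "t > 0" for z :: "real^2" and t :: real
    using that by (simp add: divide_inverse mult.commute)
  have b1: "\<bar>dilated_conv \<Phi> t f x\<bar> \<le> 16 * M" if t: "t > 0" for t x
  proof -
    have "\<bar>dilated_conv \<Phi> t f x\<bar> \<le> (\<integral>y. \<bar>\<Phi> ((x - y) /\<^sub>R t) / t\<^sup>2 * f y\<bar> \<partial>lborel)"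
      unfolding dilated_conv_lborel[OF \<Phi> f] real_norm_def[symmetric] by (rule integral_norm_bound)
    also have "\<dots> \<le> (\<integral>y. (M / t\<^sup>2) * indicator (cball x t) y \<partial>lborel)"
    proof (intro integral_mono)
      show "integrable lborel (\<lambda>y. \<bar>\<Phi> ((x - y) /\<^sub>R t) / t\<^sup>2 * f y\<bar>)" by (intro integrable_abs integrable_test \<Phi>t)
      show "integrable lborel (\<lambda>y. (M / t\<^sup>2) * indicator (cball x t) y)"
        by (intro Bochner_Integration.integrable_mult_right integrable_indicator_cball)
      fix y
      show "\<bar>\<Phi> ((x - y) /\<^sub>R t) / t\<^sup>2 * f y\<bar> \<le> (M / t\<^sup>2) * indicator (cball x t) y"
      proof (cases "y \<in> cball x t")
        case True
        have "\<Phi> ((x - y) /\<^sub>R t) * \<bar>f y\<bar> \<le> 1 * M" using \<Phi>b M by (intro mult_mono) auto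
        then show ?thesis using True \<Phi>b(1)[of "(x - y) /\<^sub>R t"] t by (simp add: abs_mult divide_right_mono)
      next
        case False
        then have "1 \<le> norm ((x - y) /\<^sub>R t)" unfolding ns[OF t] using t by (simp add: dist_norm)
        then show ?thesis using \<Phi>b(3) M by simp
      qed
    qed
    also have "\<dots> = (M / t\<^sup>2) * measure lborel (cball x t)" by simp
    also have "\<dots> \<le> (M / t\<^sup>2) * (16 * t\<^sup>2)" using M by (intro mult_left_mono measure_cball_le t) auto
    also have "\<dots> = 16 * M" using t by simp
    finally show ?thesis .
  qed
  define K where "K = 8 * L * R * M * (16 * R\<^sup>2)"
  have K: "K > 0" unfolding K_def using L R M by simp
  have b2: "\<bar>dilated_conv \<Phi> t f x\<bar> \<le> K / norm x ^ 3" if t: "t > 0" and x: "2 * R \<le> norm x" for t x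
  proof -
    have x0: "norm x > 0" using x R by linarith
    have tx: "test_function (\<lambda>y. \<Phi> (x /\<^sub>R t) / t\<^sup>2 * f y)"
      by (intro smooth_mult_test_function smooth_const f)
    have "dilated_conv \<Phi> t f x = (\<integral>y. \<Phi> ((x - y) /\<^sub>R t) / t\<^sup>2 * f y \<partial>lborel) - (\<integral>y. \<Phi> (x /\<^sub>R t) / t\<^sup>2 * f y \<partial>lborel)"
      unfolding dilated_conv_lborel[OF \<Phi> f] using mean by simp
    also have "\<dots> = (\<integral>y. \<Phi> ((x - y) /\<^sub>R t) / t\<^sup>2 * f y - \<Phi> (x /\<^sub>R t) / t\<^sup>2 * f y \<partial>lborel)"
      by (intro Bochner_Integration.integral_diff[symmetric] integrable_test \<Phi>t tx)
    finally have "dilated_conv \<Phi> t f x = (\<integral>y. \<Phi> ((x - y) /\<^sub>R t) / t\<^sup>2 * f y - \<Phi> (x /\<^sub>R t) / t\<^sup>2 * f y \<partial>lborel)" .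
    then have "\<bar>dilated_conv \<Phi> t f x\<bar> \<le> (\<integral>y. \<bar>\<Phi> ((x - y) /\<^sub>R t) / t\<^sup>2 * f y - \<Phi> (x /\<^sub>R t) / t\<^sup>2 * f y\<bar> \<partial>lborel)"
      unfolding real_norm_def[symmetric] by (simp only: integral_norm_bound)
    also have "\<dots> \<le> (\<integral>y. (8 * L * R * M / norm x ^ 3) * indicator (cball (0::real^2) R) y \<partial>lborel)"
    proof (intro integral_mono)
      show "integrable lborel (\<lambda>y. \<bar>\<Phi> ((x - y) /\<^sub>R t) / t\<^sup>2 * f y - \<Phi> (x /\<^sub>R t) / t\<^sup>2 * f y\<bar>)"
        by (intro integrable_abs Bochner_Integration.integrable_diff integrable_test \<Phi>t tx)
      show "integrable lborel (\<lambda>y. (8 * L * R * M / norm x ^ 3) * indicator (cball (0::real^2) R) y)"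
        by (intro Bochner_Integration.integrable_mult_right integrable_indicator_cball)
      fix y
      show "\<bar>\<Phi> ((x - y) /\<^sub>R t) / t\<^sup>2 * f y - \<Phi> (x /\<^sub>R t) / t\<^sup>2 * f y\<bar> \<le> (8 * L * R * M / norm x ^ 3) * indicator (cball (0::real^2) R) y"
      proof (cases "norm y \<le> R")
        case y: True
        have e: "\<Phi> ((x - y) /\<^sub>R t) / t\<^sup>2 * f y - \<Phi> (x /\<^sub>R t) / t\<^sup>2 * f y = (\<Phi> ((x - y) /\<^sub>R t) - \<Phi> (x /\<^sub>R t)) / t\<^sup>2 * f y"
          by (simp add: left_diff_distrib diff_divide_distrib)
        show ?thesis
        proof (cases "2 * t < norm x")
          case True
          \<comment> \<open>Here y has at most half the norm of x, so both x and x - y are longer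
            than t and the two kernel values vanish.\<close>
          have "norm x - norm y \<le> norm (x - y)" by (rule norm_triangle_ineq2)
          then have "t \<le> norm (x - y)" "t \<le> norm x" using True x y t by linarith+
          then have "\<Phi> ((x - y) /\<^sub>R t) = 0" "\<Phi> (x /\<^sub>R t) = 0" using t by (auto intro!: \<Phi>b(3) simp only: ns[OF t] le_divide_eq_1_pos)
          then show ?thesis using L R M x0 by simp
        next
          case False
          \<comment> \<open>Only dilations at least half the norm of x remain. The Lipschitz bound L
            R / t^3 then becomes 8 L R divided by the cube of that norm.\<close>
          then have tx: "norm x \<le> 2 * t" by simp
          have "\<bar>\<Phi> ((x - y) /\<^sub>R t) - \<Phi> (x /\<^sub>R t)\<bar> \<le> L * norm ((x - y) /\<^sub>R t - x /\<^sub>R t)" by (rule L(2))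
          also have "(x - y) /\<^sub>R t - x /\<^sub>R t = - (y /\<^sub>R t)" by (simp add: scaleR_diff_right)
          also have "L * norm (- (y /\<^sub>R t)) \<le> L * (R / t)"
            unfolding norm_minus_cancel ns[OF t] using L y t by (intro mult_left_mono divide_right_mono) auto
          finally have 1: "\<bar>\<Phi> ((x - y) /\<^sub>R t) - \<Phi> (x /\<^sub>R t)\<bar> / t\<^sup>2 \<le> L * (R / t) / t\<^sup>2" by (intro divide_right_mono) auto
          have "norm x ^ 3 \<le> (2 * t) ^ 3" using tx by (intro power_mono) auto
          then have "1 / t ^ 3 \<le> 8 / norm x ^ 3" using t x0 by (simp add: power_mult_distrib field_simps)
          then have "L * R * (1 / t ^ 3) \<le> L * R * (8 / norm x ^ 3)" using L R by (intro mult_left_mono) auto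
          moreover have "L * (R / t) / t\<^sup>2 = L * R * (1 / t ^ 3)" by (simp add: power2_eq_square power3_eq_cube)
          ultimately have "\<bar>\<Phi> ((x - y) /\<^sub>R t) - \<Phi> (x /\<^sub>R t)\<bar> / t\<^sup>2 \<le> L * R * (8 / norm x ^ 3)" using 1 by linarith
          then have "\<bar>\<Phi> ((x - y) /\<^sub>R t) - \<Phi> (x /\<^sub>R t)\<bar> / t\<^sup>2 * \<bar>f y\<bar> \<le> L * R * (8 / norm x ^ 3) * M"
            using M L R x0 by (intro mult_mono) auto
          then show ?thesis unfolding e using y by (simp add: abs_mult mult_ac)
        qed
      next
        case False
        then show ?thesis using R(2)[of y] by simp
      qed
    qed
    also have "\<dots> = (8 * L * R * M / norm x ^ 3) * measure lborel (cball (0::real^2) R)" by simp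
    also have "\<dots> \<le> (8 * L * R * M / norm x ^ 3) * (16 * R\<^sup>2)"
      using L R M x0 by (intro mult_left_mono measure_cball_le) auto
    also have "\<dots> = K / norm x ^ 3" unfolding K_def by simp
    finally show ?thesis .
  qed
  have "in_Lp p f"
    unfolding in_Lp_def
  proof
    show "f \<in> borel_measurable lebesgue" by (simp add: measurable_completion)
    have "integrable lborel (\<lambda>x. norm (f x) powr p)"
      using bounded_support_finite[of f M R p, OF M(2) R(2)] p by (intro integrableI_nonneg) auto
    then show "integrable lebesgue (\<lambda>x. norm (f x) powr p)" by (subst integrable_completion) auto
  qed
  moreover have "schwartz_function \<Phi>" by (rule test_function_schwartz[OF \<Phi>])
  moreover have "(\<integral>x. \<Phi> x \<partial>lebesgue) \<noteq> 0"
    using rbump_integral_pos[of 1] unfolding \<Phi>_def[symmetric] by (simp add: integral_completion)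
  moreover have "(\<integral>\<^sup>+x. (SUP t\<in>{0<..}. ennreal (\<bar>dilated_conv \<Phi> t f x\<bar> powr p)) \<partial>lebesgue) < \<infinity>"
  proof -
    have pw: "(SUP t\<in>{0<..}. ennreal (\<bar>dilated_conv \<Phi> t f x\<bar> powr p)) \<le>
      ennreal ((16 * M) powr p) * indicator (cball 0 (2 * R)) x + ennreal (K powr p) * (indicator {x. 1 \<le> norm x} x * ennreal (1 / norm x ^ 3))" for x :: "real^2"
    proof (rule SUP_least)
      fix t :: real assume "t \<in> {0<..}"
      then have t: "t > 0" by simp
      show "ennreal (\<bar>dilated_conv \<Phi> t f x\<bar> powr p) \<le>
        ennreal ((16 * M) powr p) * indicator (cball 0 (2 * R)) x + ennreal (K powr p) * (indicator {x. 1 \<le> norm x} x * ennreal (1 / norm x ^ 3))"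
      proof (cases "norm x \<le> 2 * R")
        case True
        have "ennreal (\<bar>dilated_conv \<Phi> t f x\<bar> powr p) \<le> ennreal ((16 * M) powr p)"
          using b1[OF t, of x] p by (intro ennreal_leI powr_mono2) auto
        then show ?thesis using True by (simp add: add_increasing2)
      next
        case False
        have n: "norm x \<ge> 1" using False R by linarith
        have "\<bar>dilated_conv \<Phi> t f x\<bar> powr p \<le> (K / norm x ^ 3) powr p"
          using b2[OF t, of x] False p by (intro powr_mono2) auto
        also have "\<dots> = K powr p * (1 / norm x ^ 3) powr p"
          using K n by (subst powr_mult[symmetric]) auto
        \<comment> \<open>The base is at most 1 and p is at least 1, so the first power dominates
          and one integral serves every p.\<close>
        also have "\<dots> \<le> K powr p * (1 / norm x ^ 3) powr 1"
        proof (intro mult_left_mono powr_mono')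
          have "1 \<le> norm x ^ 3" using n by (rule one_le_power)
          then show "1 / norm x ^ 3 \<le> 1" by (intro divide_le_eq_1_pos[THEN iffD2]) linarith+
        qed (use p in auto)
        also have "\<dots> = K powr p * (1 / norm x ^ 3)" using n by simp
        finally have "ennreal (\<bar>dilated_conv \<Phi> t f x\<bar> powr p) \<le> ennreal (K powr p) * ennreal (1 / norm x ^ 3)"
          by (subst ennreal_mult'[symmetric]) (auto intro: ennreal_leI)
        then show ?thesis using n by (simp add: add_increasing)
      qed
    qed
    have "(\<integral>\<^sup>+x. (SUP t\<in>{0<..}. ennreal (\<bar>dilated_conv \<Phi> t f x\<bar> powr p)) \<partial>lebesgue) \<le>
      (\<integral>\<^sup>+x. ennreal ((16 * M) powr p) * indicator (cball (0::real^2) (2 * R)) x + ennreal (K powr p) * (indicator {x. 1 \<le> norm x} x * ennreal (1 / norm x ^ 3)) \<partial>lborel)"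
      unfolding nn_integral_completion by (intro nn_integral_mono pw)
    also have "\<dots> = ennreal ((16 * M) powr p) * emeasure lborel (cball (0::real^2) (2 * R))
       + ennreal (K powr p) * (\<integral>\<^sup>+x. indicator {x::real^2. 1 \<le> norm x} x * ennreal (1 / norm x ^ 3) \<partial>lborel)"
      by (subst nn_integral_add) (auto simp: nn_integral_cmult)
    also have "\<dots> < \<infinity>"
      using inverse_cube_integral emeasure_bounded_finite[OF bounded_cball, of "0::real^2" "2 * R"]
      by (simp add: ennreal_mult_less_top)
    finally show ?thesis .
  qed
  ultimately show ?thesis unfolding hardy_space_def by blast
qed

section \<open>Rotations of the domain\<close>

definition rot :: "real \<Rightarrow> real^2 \<Rightarrow> real^2" where
  "rot \<alpha> x = (cos \<alpha> * x $ 1 - sin \<alpha> * x $ 2) *\<^sub>R axis 1 1 + (sin \<alpha> * x $ 1 + cos \<alpha> * x $ 2) *\<^sub>R axis 2 1"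

lemma rot_nth [simp]: "rot \<alpha> x $ 1 = cos \<alpha> * x $ 1 - sin \<alpha> * x $ 2" "rot \<alpha> x $ 2 = sin \<alpha> * x $ 1 + cos \<alpha> * x $ 2"
  by (auto simp: rot_def axis_def)

lemma linear_rot: "linear (rot \<alpha>)"
  by (rule linearI) (simp_all add: vec_eq_iff forall_2 algebra_simps)

lemma norm_rot [simp]: "norm (rot \<alpha> x) = norm x"
proof -
  have "(norm (rot \<alpha> x))\<^sup>2 = ((sin \<alpha>)\<^sup>2 + (cos \<alpha>)\<^sup>2) * (norm x)\<^sup>2"
    unfolding norm_sq_2 rot_nth by algebra
  then show ?thesis by simp
qed

lemma rot_rot: "rot \<alpha> (rot \<beta> x) = rot (\<alpha> + \<beta>) x"
  by (simp add: vec_eq_iff forall_2 cos_add sin_add algebra_simps)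

lemma rot_0 [simp]: "rot 0 x = x"
  by (simp add: vec_eq_iff forall_2)

lemma rot_measurable [measurable]: "rot \<alpha> \<in> borel_measurable borel"
  unfolding rot_def[abs_def] by measurable

text \<open>Lebesgue-Borel measure is determined by its values on boxes, and the preimage of a box
  is its image under the inverse rotation, whose volume is that of the box.\<close>

lemma distr_rot: "distr lborel borel (rot \<alpha>) = lborel"
proof (rule lborel_eqI[symmetric])
  fix l u :: "real^2" assume le: "\<And>b. b \<in> Basis \<Longrightarrow> l \<bullet> b \<le> u \<bullet> b"
  have ot: "orthogonal_transformation (rot (- \<alpha>))"
    by (simp add: orthogonal_transformation linear_rot)
  have im: "rot \<alpha> -` box l u = rot (- \<alpha>) ` box l u"
  proof (intro equalityI subsetI)
    fix x assume "x \<in> rot \<alpha> -` box l u"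
    then have "x = rot (- \<alpha>) (rot \<alpha> x)" "rot \<alpha> x \<in> box l u" by (simp_all add: rot_rot)
    then show "x \<in> rot (- \<alpha>) ` box l u" by blast
  qed (auto simp: rot_rot)
  have B: "box l u \<in> lmeasurable" by (rule lmeasurable_box)
  have "rot \<alpha> -` box l u \<in> sets borel"
    using measurable_sets[OF rot_measurable, of "box l u" \<alpha>] by simp
  then have "emeasure lborel (rot \<alpha> -` box l u) = emeasure lebesgue (rot (- \<alpha>) ` box l u)"
    unfolding im by simp
  also have "\<dots> = ennreal (measure lebesgue (rot (- \<alpha>) ` box l u))"
    using measurable_orthogonal_image[OF ot B] by (intro emeasure_eq_measure2)
  also have "measure lebesgue (rot (- \<alpha>) ` box l u) = measure lebesgue (box l u)"
    by (rule measure_orthogonal_image[OF ot B])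
  also have "ennreal (measure lebesgue (box l u)) = emeasure lborel (box l u)"
    using emeasure_eq_measure2[OF B] by simp
  finally show "emeasure (distr lborel borel (rot \<alpha>)) (box l u) = (\<Prod>b\<in>Basis. (u - l) \<bullet> b)"
    using emeasure_lborel_box[OF le] by (simp add: emeasure_distr)
qed simp

lemma nn_integral_rot:
  assumes [measurable]: "f \<in> borel_measurable borel"
  shows "(\<integral>\<^sup>+x. f (rot \<alpha> x) \<partial>lborel) = (\<integral>\<^sup>+x. f x \<partial>lborel)"
proof -
  have "(\<integral>\<^sup>+x. f x \<partial>distr lborel borel (rot \<alpha>)) = (\<integral>\<^sup>+x. f (rot \<alpha> x) \<partial>lborel)"
    by (subst nn_integral_distr) auto
  then show ?thesis by (simp add: distr_rot)
qed

lemma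
  fixes f :: "real^2 \<Rightarrow> real"
  assumes [measurable]: "f \<in> borel_measurable borel"
  shows integral_rot: "(\<integral>x. f (rot \<alpha> x) \<partial>lborel) = (\<integral>x. f x \<partial>lborel)"
    and integrable_rot: "integrable lborel (\<lambda>x. f (rot \<alpha> x)) \<longleftrightarrow> integrable lborel f"
proof -
  have "(\<integral>x. f x \<partial>distr lborel borel (rot \<alpha>)) = (\<integral>x. f (rot \<alpha> x) \<partial>lborel)"
    by (subst integral_distr) auto
  then show "(\<integral>x. f (rot \<alpha> x) \<partial>lborel) = (\<integral>x. f x \<partial>lborel)" by (simp add: distr_rot)
  have "integrable (distr lborel borel (rot \<alpha>)) f \<longleftrightarrow> integrable lborel (\<lambda>x. f (rot \<alpha> x))"
    by (subst integrable_distr_eq) auto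
  then show "integrable lborel (\<lambda>x. f (rot \<alpha> x)) \<longleftrightarrow> integrable lborel f" by (simp add: distr_rot)
qed

lemma AE_rot:
  assumes "AE x in lborel. P x" shows "AE x in lborel. P (rot \<alpha> x)"
proof -
  obtain N where N: "{x. \<not> P x} \<subseteq> N" "N \<in> null_sets lborel"
    using assms by (auto elim!: AE_E simp: null_sets_def)
  have [measurable]: "N \<in> sets borel" using N by auto
  have "AE x in distr lborel borel (rot \<alpha>). x \<notin> N"
    using N by (simp add: distr_rot AE_not_in)
  then have "AE x in lborel. rot \<alpha> x \<notin> N"
    by (subst (asm) AE_distr_iff) auto
  then show ?thesis by eventually_elim (use N in auto)
qed

lemma locL1_rot: assumes "locL1 g" shows "locL1 (\<lambda>x. g (rot \<alpha> x))"
  unfolding locL1_def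
proof (intro conjI allI)
  have [measurable]: "g \<in> borel_measurable borel" using assms by measurable
  show "(\<lambda>x. g (rot \<alpha> x)) \<in> borel_measurable borel" by measurable
  fix R
  have "integrable lborel (\<lambda>x. indicator (cball 0 R) (rot \<alpha> x) * g (rot \<alpha> x))"
    using integrable_rot[of "\<lambda>x. indicator (cball 0 R) x * g x" \<alpha>] locL1_integrable[OF assms] by simp
  moreover have "indicator (cball 0 R) (rot \<alpha> x) = (indicator (cball 0 R) x :: real)" for x
    by (auto simp: indicator_def)
  ultimately show "integrable lborel (\<lambda>x. indicator (cball 0 R) x * g (rot \<alpha> x))" by simp
qed

lemma locL2_rot: assumes "locL2 g" shows "locL2 (\<lambda>x. g (rot \<alpha> x))"
proof -
  have [measurable]: "g \<in> borel_measurable borel" using assms by measurable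
  have "(\<lambda>x. g (rot \<alpha> x)) \<in> borel_measurable borel" by measurable
  then show ?thesis using assms locL1_rot[of "\<lambda>x. (g x)\<^sup>2" \<alpha>] by (simp add: locL2_iff)
qed

lemma test_function_rot: "test_function \<phi> \<Longrightarrow> test_function (\<lambda>x. \<phi> (rot \<alpha> x))"
  using test_function_affine[of \<phi> "rot \<alpha>" 0] linear_rot by simp

lemma partial_rot:
  assumes "smooth_fun \<phi>"
  shows "partial_deriv 1 (\<lambda>x. \<phi> (rot \<alpha> x)) x = cos \<alpha> * partial_deriv 1 \<phi> (rot \<alpha> x) + sin \<alpha> * partial_deriv 2 \<phi> (rot \<alpha> x)"
    "partial_deriv 2 (\<lambda>x. \<phi> (rot \<alpha> x)) x = - sin \<alpha> * partial_deriv 1 \<phi> (rot \<alpha> x) + cos \<alpha> * partial_deriv 2 \<phi> (rot \<alpha> x)"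
  using partial_deriv_affine_comp[OF smooth_fun_differentiable[OF assms], where A="rot \<alpha>" and x=x and b=0] linear_rot
  by (simp_all add: axis_nth_2)

text \<open>The test function is written as \<psi> composed with the rotation, so that a change of
  variables leaves g undisturbed. The hypothesis \<open>pd\<close> undoes and redoes the rotation so
  that \<open>partial_rot\<close> instantiates it literally; a and b are the coefficients of the
  chain rule.\<close>

lemma wpd_rot_aux:
  assumes w1: "wpd 1 g h1" and w2: "wpd 2 g h2" and \<phi>: "test_function \<phi>"
    and pd: "\<And>x. partial_deriv j (\<lambda>x. \<phi> (rot (- \<alpha>) (rot \<alpha> x))) x =
       a * partial_deriv 1 (\<lambda>x. \<phi> (rot (- \<alpha>) x)) (rot \<alpha> x) + b * partial_deriv 2 (\<lambda>x. \<phi> (rot (- \<alpha>) x)) (rot \<alpha> x)"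
  shows "(\<integral>x. g (rot \<alpha> x) * partial_deriv j \<phi> x \<partial>lborel) = - (\<integral>x. (a * h1 (rot \<alpha> x) + b * h2 (rot \<alpha> x)) * \<phi> x \<partial>lborel)"
proof -
  define \<psi> where "\<psi> x = \<phi> (rot (- \<alpha>) x)" for x
  have \<psi>: "test_function \<psi>" unfolding \<psi>_def by (rule test_function_rot[OF \<phi>])
  have [measurable]: "g \<in> borel_measurable borel" "h1 \<in> borel_measurable borel" "h2 \<in> borel_measurable borel"
      "\<psi> \<in> borel_measurable borel" "partial_deriv 1 \<psi> \<in> borel_measurable borel" "partial_deriv 2 \<psi> \<in> borel_measurable borel"
    using wpdD(1,2)[OF w1] wpdD(1,2)[OF w2] \<psi> test_function_partial[OF \<psi>] by measurable
  have \<phi>\<psi>: "\<phi> x = \<psi> (rot \<alpha> x)" for x unfolding \<psi>_def by (simp add: rot_rot)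
  have pd': "partial_deriv j \<phi> x = a * partial_deriv 1 \<psi> (rot \<alpha> x) + b * partial_deriv 2 \<psi> (rot \<alpha> x)" for x
    using pd[of x] unfolding \<psi>_def by (simp add: rot_rot)
  have I: "integrable lborel (\<lambda>x. g x * partial_deriv i \<psi> x)" for i
    by (intro integrable_locL1_test wpdD(1)[OF w1] test_function_partial \<psi>)
  have I': "integrable lborel (\<lambda>x. h1 x * \<psi> x)" "integrable lborel (\<lambda>x. h2 x * \<psi> x)"
    by (intro integrable_locL1_test wpdD(2)[OF w1] wpdD(2)[OF w2] \<psi>)+
  have "(\<integral>x. g (rot \<alpha> x) * partial_deriv j \<phi> x \<partial>lborel) = (\<integral>x. g x * (a * partial_deriv 1 \<psi> x + b * partial_deriv 2 \<psi> x) \<partial>lborel)"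
    unfolding pd' by (rule integral_rot[of "\<lambda>x. g x * (a * partial_deriv 1 \<psi> x + b * partial_deriv 2 \<psi> x)"]) measurable
  also have "\<dots> = (\<integral>x. a * (g x * partial_deriv 1 \<psi> x) + b * (g x * partial_deriv 2 \<psi> x) \<partial>lborel)"
    by (simp add: algebra_simps)
  also have "\<dots> = a * (\<integral>x. g x * partial_deriv 1 \<psi> x \<partial>lborel) + b * (\<integral>x. g x * partial_deriv 2 \<psi> x \<partial>lborel)"
    using I by simp
  also have "\<dots> = - (a * (\<integral>x. h1 x * \<psi> x \<partial>lborel) + b * (\<integral>x. h2 x * \<psi> x \<partial>lborel))"
    using wpdD(3)[OF w1 \<psi>] wpdD(3)[OF w2 \<psi>] by simp
  also have "a * (\<integral>x. h1 x * \<psi> x \<partial>lborel) + b * (\<integral>x. h2 x * \<psi> x \<partial>lborel) = (\<integral>x. a * (h1 x * \<psi> x) + b * (h2 x * \<psi> x) \<partial>lborel)"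
    using I' by simp
  also have "\<dots> = (\<integral>x. (a * h1 x + b * h2 x) * \<psi> x \<partial>lborel)"
    by (simp add: algebra_simps)
  also have "\<dots> = (\<integral>x. (a * h1 (rot \<alpha> x) + b * h2 (rot \<alpha> x)) * \<psi> (rot \<alpha> x) \<partial>lborel)"
    by (rule integral_rot[of "\<lambda>x. (a * h1 x + b * h2 x) * \<psi> x", symmetric]) measurable
  finally show ?thesis unfolding \<phi>\<psi> .
qed

lemma wpd_rot:
  assumes w1: "wpd 1 g h1" and w2: "wpd 2 g h2"
  shows "wpd 1 (\<lambda>x. g (rot \<alpha> x)) (\<lambda>x. cos \<alpha> * h1 (rot \<alpha> x) + sin \<alpha> * h2 (rot \<alpha> x))"
    "wpd 2 (\<lambda>x. g (rot \<alpha> x)) (\<lambda>x. - sin \<alpha> * h1 (rot \<alpha> x) + cos \<alpha> * h2 (rot \<alpha> x))"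
proof -
  have L: "locL1 (\<lambda>x. g (rot \<alpha> x))" "locL1 (\<lambda>x. a * h1 (rot \<alpha> x) + b * h2 (rot \<alpha> x))" for a b
    by (intro locL1_add locL1_cmult locL1_rot wpdD(1)[OF w1] wpdD(2)[OF w1] wpdD(2)[OF w2])+
  have sm: "smooth_fun (\<lambda>x. \<phi> (rot (- \<alpha>) x))" if "test_function \<phi>" for \<phi>
    by (rule test_function_smooth[OF test_function_rot[OF that]])
  show "wpd 1 (\<lambda>x. g (rot \<alpha> x)) (\<lambda>x. cos \<alpha> * h1 (rot \<alpha> x) + sin \<alpha> * h2 (rot \<alpha> x))"
    unfolding wpd_def by (intro conjI allI impI L wpd_rot_aux[OF w1 w2] partial_rot(1)[OF sm])
  show "wpd 2 (\<lambda>x. g (rot \<alpha> x)) (\<lambda>x. - sin \<alpha> * h1 (rot \<alpha> x) + cos \<alpha> * h2 (rot \<alpha> x))"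
    unfolding wpd_def by (intro conjI allI impI L wpd_rot_aux[OF w1 w2] partial_rot(2)[OF sm])
qed

definition grad_rot :: "real \<Rightarrow> (real^2 \<Rightarrow> real^2^2) \<Rightarrow> real^2 \<Rightarrow> real^2^2" where
  "grad_rot \<alpha> G x = G (rot \<alpha> x) ** matrix (rot \<alpha>)"

lemma grad_rot_nth:
  "grad_rot \<alpha> G x $ i $ 1 = cos \<alpha> * G (rot \<alpha> x) $ i $ 1 + sin \<alpha> * G (rot \<alpha> x) $ i $ 2"
  "grad_rot \<alpha> G x $ i $ 2 = - sin \<alpha> * G (rot \<alpha> x) $ i $ 1 + cos \<alpha> * G (rot \<alpha> x) $ i $ 2"
  by (simp_all add: grad_rot_def matrix_matrix_mult_def matrix_def sum_2 axis_nth_2 mult.commute)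

lemma norm_matrix_sq: "(norm (A :: real^2^2))\<^sup>2 = (A $ 1 $ 1)\<^sup>2 + (A $ 1 $ 2)\<^sup>2 + ((A $ 2 $ 1)\<^sup>2 + (A $ 2 $ 2)\<^sup>2)"
  by (simp add: norm_vec_def L2_set_def sum_2)

lemma rotate_sq_sum: "(cos \<alpha> * a + sin \<alpha> * b)\<^sup>2 + (- sin \<alpha> * a + cos \<alpha> * b)\<^sup>2 = a\<^sup>2 + (b::real)\<^sup>2"
proof -
  have "(cos \<alpha> * a + sin \<alpha> * b)\<^sup>2 + (- sin \<alpha> * a + cos \<alpha> * b)\<^sup>2 = ((sin \<alpha>)\<^sup>2 + (cos \<alpha>)\<^sup>2) * (a\<^sup>2 + b\<^sup>2)"
    by algebra
  then show ?thesis by simp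
qed

lemma norm_grad_rot: "norm (grad_rot \<alpha> G x) = norm (G (rot \<alpha> x))"
proof -
  have "(norm (grad_rot \<alpha> G x))\<^sup>2 = (norm (G (rot \<alpha> x)))\<^sup>2"
    unfolding norm_matrix_sq grad_rot_nth rotate_sq_sum ..
  then show ?thesis by simp
qed

lemma det_grad_rot: "det (grad_rot \<alpha> G x) = det (G (rot \<alpha> x))"
proof -
  have "det (grad_rot \<alpha> G x) = ((sin \<alpha>)\<^sup>2 + (cos \<alpha>)\<^sup>2) * det (G (rot \<alpha> x))"
    unfolding det_matrix_2 grad_rot_nth by algebra
  then show ?thesis by simp
qed

lemma sob_rot:
  assumes s: "sob u G" shows "sob (\<lambda>x. u (rot \<alpha> x)) (grad_rot \<alpha> G)"
  unfolding sob_def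
proof (intro conjI allI)
  note [measurable] = sobD(1,2)[OF s]
  show "(\<lambda>x. u (rot \<alpha> x)) \<in> borel_measurable borel" by measurable
  have "grad_rot \<alpha> G = (\<lambda>x. (cos \<alpha> * G (rot \<alpha> x) $ 1 $ 1 + sin \<alpha> * G (rot \<alpha> x) $ 1 $ 2) *\<^sub>R axis 1 (axis 1 1)
     + (- sin \<alpha> * G (rot \<alpha> x) $ 1 $ 1 + cos \<alpha> * G (rot \<alpha> x) $ 1 $ 2) *\<^sub>R axis 1 (axis 2 1)
     + ((cos \<alpha> * G (rot \<alpha> x) $ 2 $ 1 + sin \<alpha> * G (rot \<alpha> x) $ 2 $ 2) *\<^sub>R axis 2 (axis 1 1)
     + (- sin \<alpha> * G (rot \<alpha> x) $ 2 $ 1 + cos \<alpha> * G (rot \<alpha> x) $ 2 $ 2) *\<^sub>R axis 2 (axis 2 1)))"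
    by (simp add: fun_eq_iff vec_eq_iff forall_2 grad_rot_nth axis_def)
  also have "\<dots> \<in> borel_measurable borel" by measurable
  finally show "grad_rot \<alpha> G \<in> borel_measurable borel" .
  fix i j
  show "wpd j (\<lambda>x. u (rot \<alpha> x) $ i) (\<lambda>x. grad_rot \<alpha> G x $ i $ j)"
    using wpd_rot[OF sobD(3)[OF s, where i=i and j=1] sobD(3)[OF s, where i=i and j=2], where \<alpha>=\<alpha>] exhaust_2[of j] by (auto simp only: grad_rot_nth)
  show "locL2 (\<lambda>x. grad_rot \<alpha> G x $ i $ j)"
    using exhaust_2[of j] by (auto simp only: grad_rot_nth intro!: locL2_add locL2_cmult locL2_rot sobD(4)[OF s])
qed

lemma energy_rot:
  assumes [measurable]: "G \<in> borel_measurable borel" shows "energy q (grad_rot \<alpha> G) = energy q G"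
  unfolding energy_lborel norm_grad_rot
  by (rule nn_integral_rot[of "\<lambda>x. ennreal (norm (G x) powr q)"]) measurable

lemma minimiser_rot:
  assumes s: "sob u G" and det: "AE x in lborel. det (G x) = f x" and f: "radially_symmetric f"
    and en: "energy (2 * p) G = Inf {energy (2 * p) H |v H. admissible p f v H}" and fin: "energy (2 * p) G < \<infinity>"
  shows "energy_minimiser p f (\<lambda>x. u (rot \<alpha> x))"
proof -
  have e: "energy (2 * p) (grad_rot \<alpha> G) = energy (2 * p) G" by (rule energy_rot[OF sobD(2)[OF s]])
  have fr: "f (rot \<alpha> x) = f x" for x using f unfolding radially_symmetric_def by (metis norm_rot)
  have "AE x in lborel. det (grad_rot \<alpha> G x) = f x"
    using AE_rot[OF det, of \<alpha>] by (simp add: det_grad_rot fr)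
  then have "admissible p f (\<lambda>x. u (rot \<alpha> x)) (grad_rot \<alpha> G)"
    using sob_admissible[OF sob_rot[OF s], of p \<alpha> f] e fin by simp
  then show ?thesis unfolding energy_minimiser_def using e en fin by (intro exI[of _ "grad_rot \<alpha> G"]) simp
qed

section \<open>Infinitesimal form of equivalence under small rotations\<close>

text \<open>The squared lengths of the two columns minus twice the determinant, 1 + 1 - 2 = 0, is a
  sum of two squares, whose vanishing gives the shape of the matrix.\<close>

lemma rotation_matrix_2:
  fixes Q :: "real^2^2"
  assumes "rotation_matrix Q"
  shows "Q $ 2 $ 2 = Q $ 1 $ 1" "Q $ 1 $ 2 = - Q $ 2 $ 1" "(Q $ 1 $ 1)\<^sup>2 + (Q $ 2 $ 1)\<^sup>2 = 1"
proof -
  have o: "transpose Q ** Q = mat 1" and d: "det Q = 1"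
    using assms by (auto simp: rotation_matrix_def orthogonal_matrix_def)
  have "(transpose Q ** Q) $ 1 $ 1 = 1" "(transpose Q ** Q) $ 2 $ 2 = 1" unfolding o by (auto simp: mat_def)
  then have 1: "(Q $ 1 $ 1)\<^sup>2 + (Q $ 2 $ 1)\<^sup>2 = 1" and 2: "(Q $ 1 $ 2)\<^sup>2 + (Q $ 2 $ 2)\<^sup>2 = 1"
    by (auto simp: matrix_matrix_mult_def transpose_def sum_2 power2_eq_square)
  have "(Q $ 1 $ 1 - Q $ 2 $ 2)\<^sup>2 + (Q $ 1 $ 2 + Q $ 2 $ 1)\<^sup>2 = 0"
    using 1 2 d unfolding det_matrix_2 by (simp add: power2_eq_square algebra_simps)
  then have "Q $ 1 $ 1 - Q $ 2 $ 2 = 0 \<and> Q $ 1 $ 2 + Q $ 2 $ 1 = 0" by (simp only: sum_power2_eq_zero_iff)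
  then show "Q $ 2 $ 2 = Q $ 1 $ 1" "Q $ 1 $ 2 = - Q $ 2 $ 1" by auto
  show "(Q $ 1 $ 1)\<^sup>2 + (Q $ 2 $ 1)\<^sup>2 = 1" by (rule 1)
qed

definition ang :: "(real^2 \<Rightarrow> real) \<Rightarrow> real^2 \<Rightarrow> real" where
  "ang \<phi> x = x $ 1 * partial_deriv 2 \<phi> x - x $ 2 * partial_deriv 1 \<phi> x"

lemma rot_DERIV:
  assumes "smooth_fun \<phi>"
  shows "((\<lambda>t. \<phi> (rot (- t) x)) has_real_derivative - ang \<phi> x) (at 0)"
proof -
  have r: "((\<lambda>t. rot (- t) x) has_derivative (\<lambda>h. h *\<^sub>R (x $ 2 *\<^sub>R axis 1 1 - x $ 1 *\<^sub>R axis 2 1))) (at 0)"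
    unfolding rot_def by (auto intro!: derivative_eq_intros simp: fun_eq_iff algebra_simps)
  have p: "(\<phi> has_derivative (\<lambda>v. v $ 1 * partial_deriv 1 \<phi> x + v $ 2 * partial_deriv 2 \<phi> x)) (at (rot (- 0) x))"
    using has_derivative_partial[OF smooth_fun_differentiable[OF assms], of x] by simp
  have l: "(\<lambda>h. (h *\<^sub>R (x $ 2 *\<^sub>R axis 1 1 - x $ 1 *\<^sub>R axis 2 1 :: real^2)) $ 1 * partial_deriv 1 \<phi> x
      + (h *\<^sub>R (x $ 2 *\<^sub>R axis 1 1 - x $ 1 *\<^sub>R axis 2 1 :: real^2)) $ 2 * partial_deriv 2 \<phi> x) = (*) (- ang \<phi> x)"
    by (simp add: fun_eq_iff ang_def axis_nth_2 algebra_simps)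
  from has_derivative_compose[OF r p] show ?thesis
    unfolding has_field_derivative_def l .
qed

lemma test_function_ang: "test_function \<phi> \<Longrightarrow> test_function (ang \<phi>)"
  unfolding ang_def by (intro test_function_diff smooth_mult_test_function smooth_coord test_function_partial)

lemma rot_minus_id: "norm (rot (- t) x - x) \<le> 4 * \<bar>t\<bar> * norm x"
proof -
  have s: "\<bar>sin t\<bar> \<le> \<bar>t\<bar>" by (rule abs_sin_x_le_abs_x)
  have c: "\<bar>cos t - 1\<bar> \<le> \<bar>t\<bar>"
  proof -
    have "cos t - 1 = - 2 * (sin (t / 2))\<^sup>2" using cos_double_sin[of "t / 2"] by simp
    then have "\<bar>cos t - 1\<bar> = 2 * (\<bar>sin (t / 2)\<bar> * \<bar>sin (t / 2)\<bar>)" by (simp add: power2_eq_square abs_mult)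
    also have "\<dots> \<le> 2 * (\<bar>t / 2\<bar> * 1)" by (intro mult_left_mono mult_mono abs_sin_x_le_abs_x) auto
    finally show ?thesis by simp
  qed
  have x: "\<bar>x $ 1\<bar> \<le> norm x" "\<bar>x $ 2\<bar> \<le> norm x" by (rule component_le_norm_cart)+
  have "norm (rot (- t) x - x) \<le> \<bar>(cos t - 1) * x $ 1 + sin t * x $ 2\<bar> + \<bar>- sin t * x $ 1 + (cos t - 1) * x $ 2\<bar>"
    using norm_le_l1_cart[of "rot (- t) x - x"] by (simp add: sum_2 algebra_simps)
  also have "\<dots> \<le> (\<bar>cos t - 1\<bar> * \<bar>x $ 1\<bar> + \<bar>sin t\<bar> * \<bar>x $ 2\<bar>) + (\<bar>sin t\<bar> * \<bar>x $ 1\<bar> + \<bar>cos t - 1\<bar> * \<bar>x $ 2\<bar>)"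
    by (intro add_mono order_trans[OF abs_triangle_ineq]) (simp_all add: abs_mult)
  also have "\<dots> \<le> (\<bar>t\<bar> * norm x + \<bar>t\<bar> * norm x) + (\<bar>t\<bar> * norm x + \<bar>t\<bar> * norm x)"
    by (intro add_mono mult_mono s c x) auto
  finally show ?thesis by simp
qed

text \<open>The map u cannot be differentiated along rotations pointwise, so the difference quotient
  is taken on the test function. Its Lipschitz constant dominates the quotients uniformly; rotations
  preserve the support ball, so one ball suffices.\<close>

lemma difference_quotient_tendsto:
  assumes u: "locL1 u" and \<phi>: "test_function \<phi>" and a: "\<alpha> \<longlonglongrightarrow> 0" "\<And>k. \<alpha> k \<noteq> 0"
  shows "(\<lambda>k. (\<integral>x. u x * (\<phi> (rot (- \<alpha> k) x) - \<phi> x) \<partial>lborel) / \<alpha> k) \<longlonglongrightarrow> - (\<integral>x. u x * ang \<phi> x \<partial>lborel)"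
proof -
  have [measurable]: "u \<in> borel_measurable borel" "\<phi> \<in> borel_measurable borel" "ang \<phi> \<in> borel_measurable borel"
    using u \<phi> test_function_ang[OF \<phi>] by measurable
  obtain R where R: "R > 0" "\<And>x. R < norm x \<Longrightarrow> \<phi> x = 0" by (rule test_function_support[OF \<phi>]) blast
  obtain L where L: "L > 0" "\<And>x y. \<bar>\<phi> x - \<phi> y\<bar> \<le> L * norm (x - y)" by (rule test_function_lipschitz[OF \<phi>]) blast
  have "(\<lambda>k. \<integral>x. u x * ((\<phi> (rot (- \<alpha> k) x) - \<phi> x) / \<alpha> k) \<partial>lborel) \<longlonglongrightarrow> (\<integral>x. u x * - ang \<phi> x \<partial>lborel)"
  proof (rule integral_dominated_convergence)
    show "integrable lborel (\<lambda>x. \<bar>(4 * L * R) * (indicator (cball 0 R) x * u x)\<bar>)"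
      using locL1_integrable[OF u] by (intro integrable_abs Bochner_Integration.integrable_mult_right) auto
    show "AE x in lborel. (\<lambda>k. u x * ((\<phi> (rot (- \<alpha> k) x) - \<phi> x) / \<alpha> k)) \<longlonglongrightarrow> u x * - ang \<phi> x"
    proof (intro AE_I2 tendsto_mult tendsto_const)
      fix x
      have "((\<lambda>h. (\<phi> (rot (- h) x) - \<phi> x) / h) \<longlongrightarrow> - ang \<phi> x) (at 0)"
        using rot_DERIV[OF test_function_smooth[OF \<phi>], of x] by (simp add: DERIV_def)
      moreover have "filterlim \<alpha> (at 0) sequentially" using a by (simp add: filterlim_at)
      ultimately show "(\<lambda>k. (\<phi> (rot (- \<alpha> k) x) - \<phi> x) / \<alpha> k) \<longlonglongrightarrow> - ang \<phi> x"
        by (rule filterlim_compose)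
    qed
    fix k
    show "AE x in lborel. norm (u x * ((\<phi> (rot (- \<alpha> k) x) - \<phi> x) / \<alpha> k)) \<le> \<bar>(4 * L * R) * (indicator (cball 0 R) x * u x)\<bar>"
    proof (rule AE_I2)
      fix x
      show "norm (u x * ((\<phi> (rot (- \<alpha> k) x) - \<phi> x) / \<alpha> k)) \<le> \<bar>(4 * L * R) * (indicator (cball 0 R) x * u x)\<bar>"
      proof (cases "norm x \<le> R")
        case True
        have "\<bar>\<phi> (rot (- \<alpha> k) x) - \<phi> x\<bar> \<le> L * norm (rot (- \<alpha> k) x - x)" by (rule L(2))
        also have "\<dots> \<le> L * (4 * \<bar>\<alpha> k\<bar> * R)"
          using L(1) order_trans[OF rot_minus_id[of "\<alpha> k" x] mult_left_mono[OF True, of "4 * \<bar>\<alpha> k\<bar>"]] by (intro mult_left_mono) auto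
        finally have "\<bar>\<phi> (rot (- \<alpha> k) x) - \<phi> x\<bar> / \<bar>\<alpha> k\<bar> \<le> 4 * L * R" using a(2)[of k] by (simp add: field_simps)
        from mult_left_mono[OF this, of "\<bar>u x\<bar>"] show ?thesis
          using True L(1) R(1) by (simp add: abs_mult mult_ac)
      qed (use R in simp)
    qed
  qed measurable
  then show ?thesis by simp
qed

text \<open>The rotation field has zero divergence, so the angular derivative can be written as
  \<open>\<partial>\<close>_2(x_1 \<phi>) - \<open>\<partial>\<close>_1(x_2 \<phi>), and the weak
  derivatives apply to these two test functions.\<close>

lemma integral_ang:
  assumes w: "wpd 1 u g1" "wpd 2 u g2" and \<phi>: "test_function \<phi>"
  shows "(\<integral>x. u x * ang \<phi> x \<partial>lborel) = - (\<integral>x. (x $ 1 * g2 x - x $ 2 * g1 x) * \<phi> x \<partial>lborel)"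
proof -
  have t: "test_function (\<lambda>x. x $ i * \<phi> x)" for i by (intro smooth_mult_test_function smooth_coord \<phi>)
  have pd: "partial_deriv j (\<lambda>x. x $ i * \<phi> x) x = axis j 1 $ i * \<phi> x + x $ i * partial_deriv j \<phi> x" for i j x
    by (subst partial_deriv_mult) (auto intro!: smooth_fun_differentiable smooth_coord test_function_smooth[OF \<phi>])
  have eq: "ang \<phi> x = partial_deriv 2 (\<lambda>x. x $ 1 * \<phi> x) x - partial_deriv 1 (\<lambda>x. x $ 2 * \<phi> x) x" for x
    unfolding pd ang_def axis_nth_2 by simp
  have "(\<integral>x. u x * ang \<phi> x \<partial>lborel) = (\<integral>x. u x * partial_deriv 2 (\<lambda>x. x $ 1 * \<phi> x) x \<partial>lborel) - (\<integral>x. u x * partial_deriv 1 (\<lambda>x. x $ 2 * \<phi> x) x \<partial>lborel)"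
    unfolding eq right_diff_distrib
    by (intro Bochner_Integration.integral_diff integrable_locL1_test wpdD(1)[OF w(1)] test_function_partial t)
  also have "\<dots> = - ((\<integral>x. g2 x * (x $ 1 * \<phi> x) \<partial>lborel) - (\<integral>x. g1 x * (x $ 2 * \<phi> x) \<partial>lborel))"
    using wpdD(3)[OF w(2) t] wpdD(3)[OF w(1) t] by simp
  also have "(\<integral>x. g2 x * (x $ 1 * \<phi> x) \<partial>lborel) - (\<integral>x. g1 x * (x $ 2 * \<phi> x) \<partial>lborel) = (\<integral>x. g2 x * (x $ 1 * \<phi> x) - g1 x * (x $ 2 * \<phi> x) \<partial>lborel)"
    by (intro Bochner_Integration.integral_diff[symmetric] integrable_locL1_test wpdD(2)[OF w(1)] wpdD(2)[OF w(2)] t)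
  also have "\<dots> = (\<integral>x. (x $ 1 * g2 x - x $ 2 * g1 x) * \<phi> x \<partial>lborel)"
    by (simp add: algebra_simps)
  finally show ?thesis .
qed

lemma integral_rot_difference:
  assumes u: "locL1 u" and v: "locL1 v" and \<phi>: "test_function \<phi>"
    and rel: "AE x in lborel. u (rot \<alpha> x) = a * u x + b * v x + c"
  shows "(\<integral>x. u x * (\<phi> (rot (- \<alpha>) x) - \<phi> x) \<partial>lborel)
    = (a - 1) * (\<integral>x. u x * \<phi> x \<partial>lborel) + b * (\<integral>x. v x * \<phi> x \<partial>lborel) + c * (\<integral>x. \<phi> x \<partial>lborel)"
proof -
  note \<phi>r = test_function_rot[OF \<phi>, of "- \<alpha>"]
  have [measurable]: "u \<in> borel_measurable borel" "v \<in> borel_measurable borel" "\<phi> \<in> borel_measurable borel"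
    using u v \<phi> by measurable
  have i: "integrable lborel (\<lambda>x. u x * \<phi> x)" "integrable lborel (\<lambda>x. v x * \<phi> x)" "integrable lborel (\<lambda>x. \<phi> x)"
    using integrable_locL1_test[OF u \<phi>] integrable_locL1_test[OF v \<phi>] integrable_test[OF \<phi>] by auto
  have "(\<integral>x. u x * \<phi> (rot (- \<alpha>) x) \<partial>lborel) = (\<integral>x. u (rot \<alpha> x) * \<phi> (rot (- \<alpha>) (rot \<alpha> x)) \<partial>lborel)"
    by (rule integral_rot[of "\<lambda>x. u x * \<phi> (rot (- \<alpha>) x)", symmetric]) measurable
  also have "\<dots> = (\<integral>x. a * (u x * \<phi> x) + b * (v x * \<phi> x) + c * \<phi> x \<partial>lborel)"
  proof (rule integral_cong_AE)
    show "AE x in lborel. u (rot \<alpha> x) * \<phi> (rot (- \<alpha>) (rot \<alpha> x)) = a * (u x * \<phi> x) + b * (v x * \<phi> x) + c * \<phi> x"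
      using rel by eventually_elim (simp add: rot_rot algebra_simps)
  qed measurable
  also have "\<dots> = a * (\<integral>x. u x * \<phi> x \<partial>lborel) + b * (\<integral>x. v x * \<phi> x \<partial>lborel) + c * (\<integral>x. \<phi> x \<partial>lborel)"
    using i by simp
  finally have "(\<integral>x. u x * \<phi> (rot (- \<alpha>) x) \<partial>lborel)
      = a * (\<integral>x. u x * \<phi> x \<partial>lborel) + b * (\<integral>x. v x * \<phi> x \<partial>lborel) + c * (\<integral>x. \<phi> x \<partial>lborel)" .
  moreover have "(\<integral>x. u x * (\<phi> (rot (- \<alpha>) x) - \<phi> x) \<partial>lborel) = (\<integral>x. u x * \<phi> (rot (- \<alpha>) x) \<partial>lborel) - (\<integral>x. u x * \<phi> x \<partial>lborel)"
    unfolding right_diff_distrib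
    by (rule Bochner_Integration.integral_diff[OF integrable_locL1_test[OF u \<phi>r] i(1)])
  ultimately show ?thesis by (simp add: algebra_simps)
qed

lemma rbump_rot: "rbump q r (rot \<alpha> x) = rbump q r x"
  using norm_rot[of \<alpha> x] unfolding rbump_def norm_sq_2[symmetric] by simp

text \<open>In complex notation (a - 1 + i b) / \<alpha> times U = U1 + i U2 converges, and dividing
  by the nonzero U gives convergence of the quotient. Its real part tends to zero because a + i b
  stays on the unit circle, whose tangent at 1 is imaginary.\<close>

lemma rotation_generator_limit:
  fixes \<alpha> a b c1 c2 :: "nat \<Rightarrow> real"
  assumes \<alpha>: "\<alpha> \<longlonglongrightarrow> 0" "\<And>k. \<alpha> k \<noteq> 0" and ab: "\<And>k. (a k)\<^sup>2 + (b k)\<^sup>2 = 1"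
    and T: "(\<lambda>k. ((a k - 1) * U1 + - b k * U2) / \<alpha> k) \<longlonglongrightarrow> T1" "(\<lambda>k. (b k * U1 + (a k - 1) * U2) / \<alpha> k) \<longlonglongrightarrow> T2"
    and U: "U1\<^sup>2 + U2\<^sup>2 \<noteq> 0"
  obtains \<kappa> where "(\<lambda>k. (a k - 1) / \<alpha> k) \<longlonglongrightarrow> 0" "(\<lambda>k. b k / \<alpha> k) \<longlonglongrightarrow> \<kappa>"
proof -
  define A where "A k = (a k - 1) / \<alpha> k" for k
  define B where "B k = b k / \<alpha> k" for k
  have s: "a k - 1 = \<alpha> k * A k" "b k = \<alpha> k * B k" for k using \<alpha>(2) by (simp_all add: A_def B_def)
  have T': "(\<lambda>k. A k * U1 - B k * U2) \<longlonglongrightarrow> T1" "(\<lambda>k. B k * U1 + A k * U2) \<longlonglongrightarrow> T2"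
  proof -
    have "((a k - 1) * U1 + - b k * U2) / \<alpha> k = A k * U1 - B k * U2" for k
      using \<alpha>(2)[of k] by (simp add: A_def B_def field_simps)
    then show "(\<lambda>k. A k * U1 - B k * U2) \<longlonglongrightarrow> T1" using T(1) by simp
    have "(b k * U1 + (a k - 1) * U2) / \<alpha> k = B k * U1 + A k * U2" for k
      using \<alpha>(2)[of k] by (simp add: A_def B_def field_simps)
    then show "(\<lambda>k. B k * U1 + A k * U2) \<longlonglongrightarrow> T2" using T(2) by simp
  qed
  \<comment> \<open>Multiplication by the conjugate of U over its squared modulus; this is the real
    part, the imaginary part follows below.\<close>
  have "(\<lambda>k. (U1 * (A k * U1 - B k * U2) + U2 * (B k * U1 + A k * U2)) / (U1\<^sup>2 + U2\<^sup>2)) \<longlonglongrightarrow> (U1 * T1 + U2 * T2) / (U1\<^sup>2 + U2\<^sup>2)"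
    by (intro tendsto_intros T' U)
  also have "(\<lambda>k. (U1 * (A k * U1 - B k * U2) + U2 * (B k * U1 + A k * U2)) / (U1\<^sup>2 + U2\<^sup>2)) = A"
    using U by (intro ext) (simp add: divide_eq_eq, algebra)
  finally have A: "A \<longlonglongrightarrow> (U1 * T1 + U2 * T2) / (U1\<^sup>2 + U2\<^sup>2)" .
  have "(\<lambda>k. (U1 * (B k * U1 + A k * U2) - U2 * (A k * U1 - B k * U2)) / (U1\<^sup>2 + U2\<^sup>2)) \<longlonglongrightarrow> (U1 * T2 - U2 * T1) / (U1\<^sup>2 + U2\<^sup>2)"
    by (intro tendsto_intros T' U)
  also have "(\<lambda>k. (U1 * (B k * U1 + A k * U2) - U2 * (A k * U1 - B k * U2)) / (U1\<^sup>2 + U2\<^sup>2)) = B"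
    using U by (intro ext) (simp add: divide_eq_eq, algebra)
  finally have B: "B \<longlonglongrightarrow> (U1 * T2 - U2 * T1) / (U1\<^sup>2 + U2\<^sup>2)" .
  \<comment> \<open>The circle equation for 1 + \<alpha> (A + i B), divided by \<alpha>, expresses A
    as \<alpha> times a bounded quantity.\<close>
  have "A k = - (\<alpha> k * ((A k)\<^sup>2 + (B k)\<^sup>2)) / 2" for k
  proof -
    have "(1 + \<alpha> k * A k)\<^sup>2 + (\<alpha> k * B k)\<^sup>2 = 1" using ab[of k] unfolding s(1)[symmetric] s(2)[symmetric] by simp
    then have "\<alpha> k * (2 * A k + \<alpha> k * ((A k)\<^sup>2 + (B k)\<^sup>2)) = 0" by algebra
    then show ?thesis using \<alpha>(2)[of k] by simp
  qed
  moreover have "(\<lambda>k. - (\<alpha> k * ((A k)\<^sup>2 + (B k)\<^sup>2)) / 2) \<longlonglongrightarrow> - (0 * (((U1 * T1 + U2 * T2) / (U1\<^sup>2 + U2\<^sup>2))\<^sup>2 + ((U1 * T2 - U2 * T1) / (U1\<^sup>2 + U2\<^sup>2))\<^sup>2)) / 2"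
    by (intro tendsto_intros A B \<alpha>(1)) simp
  ultimately have "A \<longlonglongrightarrow> 0" by (metis (no_types, lifting) ext mult_zero_left minus_zero div_0)
  then show ?thesis using B that unfolding A_def B_def by blast
qed

text \<open>Differentiates the relation at angle zero. If all integrals of \<open>u\<close> against test functions of
  mean zero vanish then \<open>u\<close> is constant; otherwise one such integral determines the angular speed \<open>\<kappa>\<close>,
  and a radial test function determines the centre.\<close>

lemma rotation_generator:
  assumes s: "sob u G" and \<alpha>: "\<alpha> \<longlonglongrightarrow> 0" "\<And>k. \<alpha> k \<noteq> 0" and Q: "\<And>k. rotation_matrix (Q k)"
    and rel: "\<And>k. AE x in lborel. u (rot (\<alpha> k) x) = Q k *v u x + c k"
  obtains \<kappa> m1 m2 where "AE x in lborel. x $ 1 * G x $ 1 $ 2 - x $ 2 * G x $ 1 $ 1 = - \<kappa> * (u x $ 2 - m2)"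
    "AE x in lborel. x $ 1 * G x $ 2 $ 2 - x $ 2 * G x $ 2 $ 1 = \<kappa> * (u x $ 1 - m1)"
proof -
  define a where "a k = Q k $ 1 $ 1" for k
  define b where "b k = Q k $ 2 $ 1" for k
  define U where "U i \<phi> = (\<integral>x. u x $ i * \<phi> x \<partial>lborel)" for i \<phi>
  define I where "I \<phi> = (\<integral>x. \<phi> x \<partial>lborel)" for \<phi> :: "real^2 \<Rightarrow> real"
  define T where "T i \<phi> = (\<integral>x. (x $ 1 * G x $ i $ 2 - x $ 2 * G x $ i $ 1) * \<phi> x \<partial>lborel)" for i \<phi>
  define D where "D i k \<phi> = (\<integral>x. u x $ i * (\<phi> (rot (- \<alpha> k) x) - \<phi> x) \<partial>lborel) / \<alpha> k" for i k \<phi>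
  note w = sobD(3)[OF s]
  have l: "locL1 (\<lambda>x. u x $ i)" for i by (rule wpdD(1)[OF w])
  have lG: "locL1 (\<lambda>x. x $ 1 * G x $ i $ 2 - x $ 2 * G x $ i $ 1)" for i
    using locL1_diff[OF locL1_mult_continuous[OF wpdD(2)[OF w[of 2 i]], of "\<lambda>x. x $ 1"] locL1_mult_continuous[OF wpdD(2)[OF w[of 1 i]], of "\<lambda>x. x $ 2"]]
    by (simp add: continuous_intros mult.commute)
  have ab: "(a k)\<^sup>2 + (b k)\<^sup>2 = 1" for k unfolding a_def b_def by (rule rotation_matrix_2(3)[OF Q])
  have rel1: "AE x in lborel. u (rot (\<alpha> k) x) $ 1 = a k * u x $ 1 + - b k * u x $ 2 + c k $ 1" for k
    using rel[of k] by eventually_elim (simp add: matrix_vector_mult_def sum_2 a_def b_def rotation_matrix_2(2)[OF Q])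
  have rel2: "AE x in lborel. u (rot (\<alpha> k) x) $ 2 = a k * u x $ 2 + b k * u x $ 1 + c k $ 2" for k
    using rel[of k] by eventually_elim (simp add: matrix_vector_mult_def sum_2 a_def b_def rotation_matrix_2(1)[OF Q])
  have D1: "D 1 k \<phi> = ((a k - 1) * U 1 \<phi> + - b k * U 2 \<phi> + c k $ 1 * I \<phi>) / \<alpha> k" if "test_function \<phi>" for k \<phi>
    unfolding D_def U_def I_def integral_rot_difference[OF l l that rel1] ..
  have D2: "D 2 k \<phi> = (b k * U 1 \<phi> + (a k - 1) * U 2 \<phi> + c k $ 2 * I \<phi>) / \<alpha> k" if "test_function \<phi>" for k \<phi>
    unfolding D_def U_def I_def integral_rot_difference[OF l l that rel2] by (simp add: add.commute)
  have DT: "(\<lambda>k. D i k \<phi>) \<longlonglongrightarrow> T i \<phi>" if "test_function \<phi>" for i \<phi>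
    using difference_quotient_tendsto[OF l that \<alpha>, of i] integral_ang[OF w[of 1 i] w[of 2 i] that]
    unfolding D_def T_def by simp
  show ?thesis
  proof (cases "\<exists>\<phi>. test_function \<phi> \<and> I \<phi> = 0 \<and> (U 1 \<phi>)\<^sup>2 + (U 2 \<phi>)\<^sup>2 \<noteq> 0")
    case True
    then obtain \<phi>0 where \<phi>0: "test_function \<phi>0" "I \<phi>0 = 0" "(U 1 \<phi>0)\<^sup>2 + (U 2 \<phi>0)\<^sup>2 \<noteq> 0" by blast
    have lim0: "(\<lambda>k. ((a k - 1) * U 1 \<phi>0 + - b k * U 2 \<phi>0) / \<alpha> k) \<longlonglongrightarrow> T 1 \<phi>0"
        "(\<lambda>k. (b k * U 1 \<phi>0 + (a k - 1) * U 2 \<phi>0) / \<alpha> k) \<longlonglongrightarrow> T 2 \<phi>0"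
      using DT[OF \<phi>0(1), of 1] DT[OF \<phi>0(1), of 2] unfolding D1[OF \<phi>0(1)] D2[OF \<phi>0(1)] \<phi>0(2) by simp_all
    obtain \<kappa> where A: "(\<lambda>k. (a k - 1) / \<alpha> k) \<longlonglongrightarrow> 0" and B: "(\<lambda>k. b k / \<alpha> k) \<longlonglongrightarrow> \<kappa>"
      by (rule rotation_generator_limit[OF \<alpha> ab lim0 \<phi>0(3)])
    define \<rho> where "\<rho> = rbump 1 1"
    have \<rho>: "test_function \<rho>" "I \<rho> > 0" unfolding \<rho>_def I_def
      by (rule test_function_rbump) (rule rbump_integral_pos, simp)
    \<comment> \<open>Invariance under rotations leaves a linear equation for the translation
      \<open>c k\<close>. Its solution says that m = (m1, m2) is a common fixed point of all the
      motions: u - m is multiplied by \<open>Q k\<close> with no translation left.\<close>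
    have D\<rho>: "D i k \<rho> = 0" for i k unfolding D_def \<rho>_def by (simp add: rbump_rot)
    define m1 where "m1 = U 1 \<rho> / I \<rho>"
    define m2 where "m2 = U 2 \<rho> / I \<rho>"
    have U\<rho>: "U 1 \<rho> = m1 * I \<rho>" "U 2 \<rho> = m2 * I \<rho>" using \<rho>(2) by (simp_all add: m1_def m2_def)
    have c1: "c k $ 1 = - ((a k - 1) * m1 + - b k * m2)" for k
    proof -
      have "((a k - 1) * m1 + - b k * m2 + c k $ 1) * I \<rho> = 0"
        using D\<rho>[of 1 k] \<alpha>(2)[of k] unfolding D1[OF \<rho>(1)] U\<rho> by (simp add: algebra_simps)
      then show ?thesis using \<rho>(2) by simp
    qed
    have c2: "c k $ 2 = - (b k * m1 + (a k - 1) * m2)" for k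
    proof -
      have "(b k * m1 + (a k - 1) * m2 + c k $ 2) * I \<rho> = 0"
        using D\<rho>[of 2 k] \<alpha>(2)[of k] unfolding D2[OF \<rho>(1)] U\<rho> by (simp add: algebra_simps)
      then show ?thesis using \<rho>(2) by simp
    qed
    have T1: "T 1 \<phi> = - \<kappa> * (U 2 \<phi> - m2 * I \<phi>)" if t: "test_function \<phi>" for \<phi>
    proof -
      have "(\<lambda>k. (a k - 1) / \<alpha> k * (U 1 \<phi> - m1 * I \<phi>) - b k / \<alpha> k * (U 2 \<phi> - m2 * I \<phi>))
          \<longlonglongrightarrow> 0 * (U 1 \<phi> - m1 * I \<phi>) - \<kappa> * (U 2 \<phi> - m2 * I \<phi>)"
        by (intro tendsto_intros A B)
      moreover have "(a k - 1) / \<alpha> k * (U 1 \<phi> - m1 * I \<phi>) - b k / \<alpha> k * (U 2 \<phi> - m2 * I \<phi>) = D 1 k \<phi>" for k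
        unfolding D1[OF t] c1 using \<alpha>(2)[of k] by (simp add: field_simps)
      ultimately have "(\<lambda>k. D 1 k \<phi>) \<longlonglongrightarrow> - \<kappa> * (U 2 \<phi> - m2 * I \<phi>)" by simp
      from LIMSEQ_unique[OF DT[OF t] this] show ?thesis .
    qed
    have T2: "T 2 \<phi> = \<kappa> * (U 1 \<phi> - m1 * I \<phi>)" if t: "test_function \<phi>" for \<phi>
    proof -
      have "(\<lambda>k. b k / \<alpha> k * (U 1 \<phi> - m1 * I \<phi>) + (a k - 1) / \<alpha> k * (U 2 \<phi> - m2 * I \<phi>))
          \<longlonglongrightarrow> \<kappa> * (U 1 \<phi> - m1 * I \<phi>) + 0 * (U 2 \<phi> - m2 * I \<phi>)"
        by (intro tendsto_intros A B)
      moreover have "b k / \<alpha> k * (U 1 \<phi> - m1 * I \<phi>) + (a k - 1) / \<alpha> k * (U 2 \<phi> - m2 * I \<phi>) = D 2 k \<phi>" for k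
        unfolding D2[OF t] c2 using \<alpha>(2)[of k] by (simp add: field_simps)
      ultimately have "(\<lambda>k. D 2 k \<phi>) \<longlonglongrightarrow> \<kappa> * (U 1 \<phi> - m1 * I \<phi>)" by simp
      from LIMSEQ_unique[OF DT[OF t] this] show ?thesis .
    qed
    have conclude: "AE x in lborel. x $ 1 * G x $ i $ 2 - x $ 2 * G x $ i $ 1 = l * (u x $ j - m)"
      if TU: "\<And>\<phi>. test_function \<phi> \<Longrightarrow> T i \<phi> = l * (U j \<phi> - m * I \<phi>)" for i j l m
    proof -
      have lum: "locL1 (\<lambda>x. l * (u x $ j - m))" by (intro locL1_cmult locL1_diff locL1_const l)
      have "AE x in lborel. (x $ 1 * G x $ i $ 2 - x $ 2 * G x $ i $ 1) - l * (u x $ j - m) = 0"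
      proof (rule locL1_AE_0)
        show "locL1 (\<lambda>x. (x $ 1 * G x $ i $ 2 - x $ 2 * G x $ i $ 1) - l * (u x $ j - m))"
          by (intro locL1_diff lG lum)
        fix \<phi> assume t: "test_function \<phi>"
        have e: "l * (u x $ j - m) * \<phi> x = l * (u x $ j * \<phi> x) - l * m * \<phi> x" for x by (simp add: algebra_simps)
        have "(\<integral>x. l * (u x $ j - m) * \<phi> x \<partial>lborel) = l * U j \<phi> - l * m * I \<phi>"
          unfolding e U_def I_def using integrable_locL1_test[OF l t] integrable_test[OF t] by simp
        then have "(\<integral>x. ((x $ 1 * G x $ i $ 2 - x $ 2 * G x $ i $ 1) - l * (u x $ j - m)) * \<phi> x \<partial>lborel) = T i \<phi> - (l * U j \<phi> - l * m * I \<phi>)"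
          unfolding T_def left_diff_distrib[of _ "l * (u _ $ j - m)"]
          using integrable_locL1_test[OF lG t] integrable_locL1_test[OF lum t] by simp
        then show "(\<integral>x. ((x $ 1 * G x $ i $ 2 - x $ 2 * G x $ i $ 1) - l * (u x $ j - m)) * \<phi> x \<partial>lborel) = 0"
          unfolding TU[OF t] by (simp add: right_diff_distrib)
      qed
      then show ?thesis by eventually_elim simp
    qed
    show ?thesis by (rule that[OF conclude[OF T1] conclude[OF T2]])
  next
    case False
    have G0: "AE x in lborel. G x $ i $ j = 0" for i j
    proof (rule locL1_AE_0[OF wpdD(2)[OF w]])
      fix \<phi> assume t: "test_function \<phi>"
      \<comment> \<open>Partial derivatives of test functions have mean zero, and integrals of u
        against them are, up to sign, integrals of the gradient. So the gradient vanishes and speed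
        0 with any centre works.\<close>
      have "I (partial_deriv j \<phi>) = 0" unfolding I_def by (rule integral_partial_test[OF t])
      then have "(U 1 (partial_deriv j \<phi>))\<^sup>2 + (U 2 (partial_deriv j \<phi>))\<^sup>2 = 0"
        using False test_function_partial[OF t] by blast
      then have "U i (partial_deriv j \<phi>) = 0" using exhaust_2[of i] by (auto simp: sum_power2_eq_zero_iff)
      then show "(\<integral>x. G x $ i $ j * \<phi> x \<partial>lborel) = 0" using wpdD(3)[OF w t, of i j] unfolding U_def by simp
    qed
    have "AE x in lborel. x $ 1 * G x $ i $ 2 - x $ 2 * G x $ i $ 1 = 0" for i
      using G0[of i 1] G0[of i 2] by eventually_elim simp
    then show ?thesis using that[of 0 0 0] by simp
  qed
qed

section \<open>Uncountably many classes\<close>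

lemma infinite_interval_close_points:
  fixes S :: "real set"
  assumes "infinite S" "S \<subseteq> {0..1}" "e > 0"
  obtains x y where "x \<in> S" "y \<in> S" "x \<noteq> y" "\<bar>x - y\<bar> < e"
proof -
  obtain l where l: "l islimpt S"
    using assms(1,2) compact_Icc[of 0 "1::real"] unfolding compact_eq_Bolzano_Weierstrass by blast
  obtain x where x: "x \<in> S" "x \<noteq> l" "dist x l < e / 2"
    using l assms(3) unfolding islimpt_approachable by (meson half_gt_zero)
  \<comment> \<open>Being strictly closer to the limit point than x makes y different from
    x.\<close>
  obtain y where y: "y \<in> S" "y \<noteq> l" "dist y l < dist x l"
    using l x(2) unfolding islimpt_approachable by (meson zero_less_dist_iff)
  have "x \<noteq> y" using y(3) by auto
  moreover have "\<bar>x - y\<bar> < e" using x(3) y(3) dist_triangle2[of x y l] by (simp add: dist_real_def)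
  ultimately show ?thesis by (rule that[OF x(1) y(1)])
qed

theorem theorem3:
  fixes p :: real
  assumes "1 \<le> p"
  shows "\<exists>f. f \<in> hardy_space p \<and> radially_symmetric f \<and>
           uncountable ({u. energy_minimiser p f u} // rotation_rel)"
proof -
  obtain C R where sign: "0 < (\<integral>x. datum C x * rbump 1 R x \<partial>lborel)" "(\<integral>x. datum C x * rbump 1 1 x \<partial>lborel) < 0"
    by (rule datum_sign_change)
  have l: "locL1 (datum C)" by (intro locL1_continuous smooth_continuous test_function_smooth test_function_datum)
  obtain u G where s: "sob u G" and det: "AE x in lborel. det (G x) = datum C x"
    and en: "energy (2 * p) G = Inf {energy (2 * p) H |v H. admissible p (datum C) v H}" and fin: "energy (2 * p) G < \<infinity>"
    by (rule minimiser_exists[OF assms l competitor_admissible[OF assms]])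
  define v where "v \<alpha> x = u (rot \<alpha> x)" for \<alpha> x
  have min: "energy_minimiser p (datum C) (v \<alpha>)" for \<alpha>
    using minimiser_rot[OF s det datum_radial en fin, of \<alpha>] unfolding v_def[abs_def] .
  have "uncountable ({u. energy_minimiser p (datum C) u} // rotation_rel)"
  proof
    assume cnt: "countable ({u. energy_minimiser p (datum C) u} // rotation_rel)" (is "countable ?X")
    \<comment> \<open>Pigeonhole: if each of the countably many classes held only finitely many
      angles, the unit interval would be countable. An infinite set of angles in one class is enough
      to find distinct angles arbitrarily close together.\<close>
    have "\<exists>Z \<in> ?X. infinite {\<alpha> \<in> {0..1}. rotation_rel `` {v \<alpha>} = Z}"
    proof (rule ccontr)
      assume "\<not> ?thesis"
      then have "countable (\<Union>Z\<in>?X. {\<alpha> \<in> {0..1}. rotation_rel `` {v \<alpha>} = Z})"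
        by (intro countable_UN cnt) (auto intro: countable_finite)
      moreover have "{0..1} \<subseteq> (\<Union>Z\<in>?X. {\<alpha> \<in> {0..1}. rotation_rel `` {v \<alpha>} = Z})"
        using min by (auto intro!: quotientI)
      ultimately show False using uncountable_closed_interval[of 0 1] countable_subset by auto
    qed
    then obtain Z where Z: "infinite {\<alpha> \<in> {0..1}. rotation_rel `` {v \<alpha>} = Z}" by blast
    have "\<exists>\<gamma> Q c. \<gamma> \<noteq> 0 \<and> \<bar>\<gamma>\<bar> < inverse (real (Suc k)) \<and> rotation_matrix Q \<and> (AE x in lborel. u (rot \<gamma> x) = Q *v u x + c)" for k
    proof -
      obtain \<alpha> \<beta> where \<alpha>\<beta>: "\<alpha> \<in> {\<alpha> \<in> {0..1}. rotation_rel `` {v \<alpha>} = Z}" "\<beta> \<in> {\<alpha> \<in> {0..1}. rotation_rel `` {v \<alpha>} = Z}"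
          "\<alpha> \<noteq> \<beta>" "\<bar>\<alpha> - \<beta>\<bar> < inverse (real (Suc k))"
        by (rule infinite_interval_close_points[OF Z, of "inverse (real (Suc k))"]) auto
      have "(v \<alpha>, v \<beta>) \<in> rotation_rel"
        using \<alpha>\<beta>(1,2) eq_equiv_class_iff[OF equiv_rotation_rel, of "v \<alpha>" "v \<beta>"] by simp
      then obtain Q c where Q: "rotation_matrix Q" and "AE x in lebesgue. v \<alpha> x = Q *v v \<beta> x + c"
        unfolding rotation_rel_def by blast
      then have "AE x in lborel. u (rot \<alpha> x) = Q *v u (rot \<beta> x) + c"
        unfolding v_def by (simp add: AE_completion_iff)
      \<comment> \<open>Composing with a rotation of the domain turns a relation between two angles
        into one between u and its rotation by their difference.\<close>
      from AE_rot[OF this, of "- \<beta>"] have "AE x in lborel. u (rot (\<alpha> - \<beta>) x) = Q *v u x + c"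
        by (simp add: rot_rot)
      then show ?thesis using \<alpha>\<beta>(3,4) Q by (intro exI[of _ "\<alpha> - \<beta>"] exI[of _ Q] exI[of _ c]) simp
    qed
    then have "\<forall>k. \<exists>z. fst z \<noteq> 0 \<and> \<bar>fst z\<bar> < inverse (real (Suc k)) \<and> rotation_matrix (fst (snd z))
        \<and> (AE x in lborel. u (rot (fst z) x) = fst (snd z) *v u x + snd (snd z))" by fastforce
    from choice[OF this] obtain \<zeta> where \<zeta>: "\<forall>k. fst (\<zeta> k) \<noteq> 0 \<and> \<bar>fst (\<zeta> k)\<bar> < inverse (real (Suc k))
        \<and> rotation_matrix (fst (snd (\<zeta> k))) \<and> (AE x in lborel. u (rot (fst (\<zeta> k)) x) = fst (snd (\<zeta> k)) *v u x + snd (snd (\<zeta> k)))" ..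
    obtain \<gamma> Q c where \<gamma>: "\<And>k. \<gamma> k \<noteq> 0" "\<And>k. \<bar>\<gamma> k\<bar> < inverse (real (Suc k))"
      and Q: "\<And>k. rotation_matrix (Q k)" and rel: "\<And>k. AE x in lborel. u (rot (\<gamma> k) x) = Q k *v u x + c k"
      by (rule that[of "\<lambda>k. fst (\<zeta> k)" "\<lambda>k. fst (snd (\<zeta> k))" "\<lambda>k. snd (snd (\<zeta> k))"]) (use \<zeta> in blast)+
    have "\<gamma> \<longlonglongrightarrow> 0"
      by (rule Lim_null_comparison[OF _ LIMSEQ_inverse_real_of_nat]) (use \<gamma>(2) in \<open>auto intro!: always_eventually less_imp_le simp del: of_nat_Suc\<close>)
    then obtain \<kappa> m1 m2 where gen: "AE x in lborel. x $ 1 * G x $ 1 $ 2 - x $ 2 * G x $ 1 $ 1 = - \<kappa> * (u x $ 2 - m2)"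
        "AE x in lborel. x $ 1 * G x $ 2 $ 2 - x $ 2 * G x $ 2 $ 1 = \<kappa> * (u x $ 1 - m1)"
      by (rule rotation_generator[OF s _ \<gamma>(1) Q rel])
    \<comment> \<open>The speed \<kappa> and the centre come from u alone and are the same for every
      radius, so the sign of the left-hand side cannot vary with r.\<close>
    have key: "(\<integral>x. datum C x * rbump 1 r x \<partial>lborel)
        = \<kappa> * (\<integral>x. rbump (flat_deriv 1) r x * ((u x $ 1 - m1)\<^sup>2 + (u x $ 2 - m2)\<^sup>2) \<partial>lborel)" for r
    proof -
      note [measurable] = sobD(2)[OF s]
      have [measurable]: "datum C \<in> borel_measurable borel" "rbump 1 r \<in> borel_measurable borel"
        using test_function_datum test_function_rbump by measurable
      have "(\<integral>x. datum C x * rbump 1 r x \<partial>lborel) = (\<integral>x. (G x $ 1 $ 1 * G x $ 2 $ 2 - G x $ 1 $ 2 * G x $ 2 $ 1) * rbump 1 r x \<partial>lborel)"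
        using det by (intro integral_cong_AE) (measurable, auto elim!: eventually_mono simp: det_matrix_2)
      also have "\<dots> = \<kappa> * (\<integral>x. rbump (flat_deriv 1) r x * ((u x $ 1 - m1)\<^sup>2 + (u x $ 2 - m2)\<^sup>2) \<partial>lborel)"
        by (rule jacobian_rotational[OF sobD(3)[OF s] sobD(3)[OF s] sobD(3)[OF s] sobD(3)[OF s]
              sobD(4)[OF s] sobD(4)[OF s] sobD(4)[OF s] sobD(4)[OF s] gen])
      finally show ?thesis .
    qed
    have nn: "0 \<le> (\<integral>x. rbump (flat_deriv 1) r x * ((u x $ 1 - m1)\<^sup>2 + (u x $ 2 - m2)\<^sup>2) \<partial>lborel)" for r
      by (intro Bochner_Integration.integral_nonneg mult_nonneg_nonneg rbump_deriv_nonneg) simp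
    have "\<kappa> > 0" using sign(1) nn[of R] unfolding key by (auto simp: zero_less_mult_iff)
    moreover have "\<kappa> < 0" using sign(2) nn[of 1] unfolding key by (auto simp: mult_less_0_iff)
    ultimately show False by simp
  qed
  moreover have "datum C \<in> hardy_space p"
    by (rule test_function_hardy[OF test_function_datum integral_datum assms])
  ultimately show ?thesis using datum_radial by blast
qed

end
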